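(* Let $N,n,m\ge 1$, let $\nu\in(0,1)$, let $w_1,\dots,w_N\in\mathcal A(A_\nu,\mathbb C^n)$ be such that the associated functionals $\Phi_1,\dots,\Phi_N$ are linearly independent (in the sense defined in the context), and let $a_1,\dots,a_N\in\mathbb R$. Assume that the problem $(\mathcal P)$ is of type $(\mathcal P_m)$, i.e. there is a polynomial $Q(\zeta)=\prod_{k=1}^m(\zeta-\sigma_k)$ with $\sigma_1,\dots,\sigma_m\in E$ such that each $Qw_j$ extends to a mapping of class $\mathcal A(E,\mathbb C^n)$, $j=1,\dots,N$. Let $D\subset\subset G\subset\subset\mathbb C^n$ be domains and let $u\in PSH(G)\cap\mathcal C(G)$ be such that $D=\{u<0\}$ and $\partial D=\{u=0\}$. Suppose that $f\in\mathcal O(E,D)$ is an extremal for this problem (for $D$, $\Phi_1,\dots,\Phi_N$, $a_1,\dots,a_N$). Assume that there exist a set $S\subset\partial E$, a mapping $s=(s_1,\dots,s_n)\in H^\infty(E,\mathbb C^n)$, a number $\varepsilon>0$, and a function $v:S\times\mathcal A(E,\mathbb C^n)\to\mathbb C$ such that: (a) $\partial E\setminus S$ has zero measure; (b) $f^*(\zeta)$, $\nabla u(f^*(\zeta))$, $s^*(\zeta)$ are defined for all $\zeta\in S$; (c) $s_k$ nowhere vanishes on $E$, $k=1,\dots,n$; (d) for all $\zeta\in S$ and all $h\in\mathcal A(E,\mathbb C^n)$ with $\|h\|_\infty\le\varepsilon$, $$u\big(f^*(\zeta)+s^*(\zeta)\cdot h(\zeta)\big)=u\big(f^*(\zeta)\big)+2\operatorname{Re}\Big(\nabla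 u(f^*(\zeta))\bullet\big(s^*(\zeta)\cdot h(\zeta)\big)\Big)+v(\zeta,h);$$ (e) $\displaystyle\lim_{h\to0}\frac{\sup\{|v(\zeta,h)|:\zeta\in S\}}{\|h\|_\infty}=0$. Then there exist $\varrho\in L^\infty(\partial E)$, $\varrho>0$, and $g\in H^\infty(E,\mathbb C^n)$ such that $$g^*(\zeta)=Q(\zeta)\varrho(\zeta)\,s^*(\zeta)\cdot\nabla u(f^*(\zeta))\quad\text{for a.a. }\zeta\in\partial E.$$
   Context: Notation. $E$ is the open unit disk in $\mathbb C$; $\mathcal O(\Omega,D)$ is the set of all holomorphic mappings $\Omega\to D$; $A_\nu=\{z\in\mathbb C:\nu<|z|<1\}$; $\mathcal A(\Omega,\mathbb C^n)=\mathcal C(\overline\Omega,\mathbb C^n)\cap\mathcal O(\Omega,\mathbb C^n)$; $H^\infty(\Omega,\mathbb C^n)$ is the space of bounded holomorphic mappings $\Omega\to\mathbb C^n$, with $\|f\|_\infty=\sup_{\Omega}\|f\|$ where $\|\cdot\|$ is the Euclidean norm; $f^*(\zeta)$ is the non-tangential boundary value of $f$ at $\zeta\in\partial E$; $PSH(G)$ is the set of plurisubharmonic functions on $G$. For $z,w\in\mathbb C^n$: $z\bullet w=\sum_{j=1}^nz_jw_j$ (no conjugation) and $z\cdot w=(z_1w_1,\dots,z_nw_n)$. $\nabla u=(\partial u/\partial z_1,\dots,\partial u/\partial z_n)$ is the complex gradient. $A\subset\subset B$ means $A$ is relatively compact in $B$. Functionals. For given $w_1,\dots,w_N\in\mathcal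 A(A_\nu,\mathbb C^n)$, $$\Phi_j(h)=\frac1{2\pi}\int_0^{2\pi}\operatorname{Re}\big(h^*(e^{i\theta})\bullet w_j(e^{i\theta})\big)\,d\theta,\quad h\in H^\infty(E,\mathbb C^n),\ j=1,\dots,N.$$ They are called linearly independent if for arbitrary $s=(s_1,\dots,s_n),g\in H^\infty(E,\mathbb C^n)$ and $\lambda_1,\dots,\lambda_N\in\mathbb R$ such that each $s_k$ nowhere vanishes on $E$ and $g(0)=0$, the following holds: if $\sum_{k=1}^N\lambda_kw_k\cdot s^*=g^*$ on a subset of $\partial E$ of positive measure, then $\lambda_1=\dots=\lambda_N=0$. Problem $(\mathcal P)$. Given a bounded domain $D\subset\mathbb C^n$ and $a_1,\dots,a_N\in\mathbb R$, find $f\in\mathcal O(E,D)$ such that $\Phi_j(f)=a_j$, $j=1,\dots,N$, and there is no $g\in\mathcal O(E,D)$ with $\Phi_j(g)=a_j$, $j=1,\dots,N$, and $g(E)\subset\subset D$. Any solution $f$ is called an extremal for $(\mathcal P)$. *)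

theory Defs
  imports
    "HOL-Complex_Analysis.Complex_Analysis"
    "HOL-Computational_Algebra.Polynomial"
begin

text \<open>
  The space \<open>\<complex>\<^sup>n\<close> is \<open>complex ^ 'n\<close> with its Euclidean norm.  The product
  \<open>z \<bullet> w = \<Sum> z\<^sub>j w\<^sub>j\<close> (without conjugation) is \<^const>\<open>scalar_product\<close>, and the componentwise
  product is the multiplication \<open>*\<close> of \<open>complex ^ 'n\<close>.  Maps are total functions
  \<open>complex \<Rightarrow> complex ^ 'n\<close>, of which only the values on the relevant domain matter.
\<close>

definition domain_set :: "'a::topological_space set \<Rightarrow> bool" where
  "domain_set D \<longleftrightarrow> open D \<and> connected D \<and> D \<noteq> {}"

definition rel_compact :: "'a::topological_space set \<Rightarrow> 'a set \<Rightarrow> bool" where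
  "rel_compact A B \<longleftrightarrow> compact (closure A) \<and> closure A \<subseteq> B"

definition annulus :: "real \<Rightarrow> complex set" where
  "annulus \<nu> = {z. \<nu> < cmod z \<and> cmod z < 1}"

definition hol_maps :: "complex set \<Rightarrow> (complex ^ 'n) set \<Rightarrow> (complex \<Rightarrow> complex ^ 'n) set" where
  "hol_maps \<Omega> D = {f. (\<forall>k. (\<lambda>z. f z $ k) holomorphic_on \<Omega>) \<and> f ` \<Omega> \<subseteq> D}"

definition A_maps :: "complex set \<Rightarrow> (complex \<Rightarrow> complex ^ 'n) set" where
  "A_maps \<Omega> = {f. continuous_on (closure \<Omega>) f \<and> f \<in> hol_maps \<Omega> UNIV}"

definition H_infty :: "complex set \<Rightarrow> (complex \<Rightarrow> complex ^ 'n) set" where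
  "H_infty \<Omega> = {f. f \<in> hol_maps \<Omega> UNIV \<and> bounded (f ` \<Omega>)}"

definition sup_norm :: "complex set \<Rightarrow> (complex \<Rightarrow> complex ^ 'n) \<Rightarrow> real" where
  "sup_norm \<Omega> f = (SUP z\<in>\<Omega>. norm (f z))"

definition stolz_region :: "complex \<Rightarrow> real \<Rightarrow> complex set" where
  "stolz_region \<zeta> \<alpha> = {z. cmod z < 1 \<and> cmod (z - \<zeta>) < \<alpha> * (1 - cmod z)}"

definition has_nt_limit :: "(complex \<Rightarrow> complex ^ 'n) \<Rightarrow> complex \<Rightarrow> complex ^ 'n \<Rightarrow> bool" where
  "has_nt_limit f \<zeta> l \<longleftrightarrow> (\<forall>\<alpha>>1. (f \<longlongrightarrow> l) (at \<zeta> within stolz_region \<zeta> \<alpha>))"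

definition nt_defined :: "(complex \<Rightarrow> complex ^ 'n) \<Rightarrow> complex \<Rightarrow> bool" where
  "nt_defined f \<zeta> \<longleftrightarrow> (\<exists>l. has_nt_limit f \<zeta> l)"

text \<open>The boundary value \<open>f\<^sup>*(\<zeta>)\<close>; it is unspecified unless \<open>nt_defined f \<zeta>\<close>.\<close>

definition nt_value :: "(complex \<Rightarrow> complex ^ 'n) \<Rightarrow> complex \<Rightarrow> complex ^ 'n" where
  "nt_value f \<zeta> = (THE l. has_nt_limit f \<zeta> l)"

text \<open>Arc length on the unit circle, on the Lebesgue measurable sets.\<close>

definition circle_measure :: "complex measure" where
  "circle_measure =
     completion (distr (restrict_space lborel {0..<2 * pi}) (restrict_space borel (sphere 0 1)) cis)"

definition L_infty_circle :: "(complex \<Rightarrow> real) set" where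
  "L_infty_circle =
     {\<rho>. \<rho> \<in> borel_measurable circle_measure \<and> (\<exists>C. AE \<zeta> in circle_measure. \<bar>\<rho> \<zeta>\<bar> \<le> C)}"

text \<open>
  Only real-valued functions occur below, so the value \<open>-\<infinity>\<close> is left out.  For such a function,
  integrability over circles is implied by the sub-mean value inequality read in \<open>[-\<infinity>, \<infinity>)\<close>;
  it is stated explicitly because the integral of a non-integrable function is \<open>0\<close> in the library.
\<close>

definition subharmonic_on :: "complex set \<Rightarrow> (complex \<Rightarrow> real) \<Rightarrow> bool" where
  "subharmonic_on U v \<longleftrightarrow>
     (\<forall>c. openin (top_of_set U) {z \<in> U. v z < c}) \<and>
     (\<forall>a r. 0 < r \<and> cball a r \<subseteq> U \<longrightarrow>
        set_integrable lebesgue {0..2 * pi} (\<lambda>\<theta>. v (a + of_real r * cis \<theta>)) \<and>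
        v a \<le> 1 / (2 * pi) * (LINT \<theta>:{0..2 * pi}|lebesgue. v (a + of_real r * cis \<theta>)))"

definition psh_on :: "(complex ^ 'n) set \<Rightarrow> (complex ^ 'n \<Rightarrow> real) \<Rightarrow> bool" where
  "psh_on G u \<longleftrightarrow>
     (\<forall>c. openin (top_of_set G) {z \<in> G. u z < c}) \<and>
     (\<forall>a b. subharmonic_on {t. a + t *s b \<in> G} (\<lambda>t. u (a + t *s b)))"

text \<open>
  The complex gradient, with \<open>\<partial>u/\<partial>z\<^sub>j = (\<partial>u/\<partial>x\<^sub>j - \<i> \<partial>u/\<partial>y\<^sub>j) / 2\<close>; it is defined where all
  real partial derivatives exist.
\<close>

definition cgrad_defined :: "(complex ^ 'n \<Rightarrow> real) \<Rightarrow> complex ^ 'n \<Rightarrow> bool" where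
  "cgrad_defined u z \<longleftrightarrow>
     (\<forall>j. (\<lambda>t::real. u (z + axis j (of_real t))) field_differentiable (at 0) \<and>
          (\<lambda>t::real. u (z + axis j (\<i> * of_real t))) field_differentiable (at 0))"

definition cgrad :: "(complex ^ 'n \<Rightarrow> real) \<Rightarrow> complex ^ 'n \<Rightarrow> complex ^ 'n" where
  "cgrad u z =
     (\<chi> j. (of_real (deriv (\<lambda>t::real. u (z + axis j (of_real t))) 0)
            - \<i> * of_real (deriv (\<lambda>t::real. u (z + axis j (\<i> * of_real t))) 0)) / 2)"

definition Phi :: "(complex \<Rightarrow> complex ^ 'n) \<Rightarrow> (complex \<Rightarrow> complex ^ 'n) \<Rightarrow> real" where
  "Phi w h =
     1 / (2 * pi) *
       (LINT \<theta>:{0..2 * pi}|lebesgue. Re (scalar_product (nt_value h (cis \<theta>)) (w (cis \<theta>))))"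

definition lin_indep_functionals :: "nat \<Rightarrow> (nat \<Rightarrow> complex \<Rightarrow> complex ^ 'n) \<Rightarrow> bool" where
  "lin_indep_functionals N w \<longleftrightarrow>
     (\<forall>s \<in> H_infty (ball 0 1). \<forall>g \<in> H_infty (ball 0 1). \<forall>lam :: nat \<Rightarrow> real.
        (\<forall>k. \<forall>z \<in> ball 0 1. s z $ k \<noteq> 0) \<and> g 0 = 0 \<and>
        (\<exists>A \<in> sets circle_measure. 0 < emeasure circle_measure A \<and>
           (\<forall>\<zeta>\<in>A. nt_defined s \<zeta> \<and> nt_defined g \<zeta> \<and>
              (\<Sum>k=1..N. lam k *\<^sub>R (w k \<zeta> * nt_value s \<zeta>)) = nt_value g \<zeta>))
        \<longrightarrow> (\<forall>k\<in>{1..N}. lam k = 0))"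

definition extremal ::
  "(complex ^ 'n) set \<Rightarrow> nat \<Rightarrow> (nat \<Rightarrow> complex \<Rightarrow> complex ^ 'n) \<Rightarrow> (nat \<Rightarrow> real) \<Rightarrow>
     (complex \<Rightarrow> complex ^ 'n) \<Rightarrow> bool" where
  "extremal D N w a f \<longleftrightarrow>
     f \<in> hol_maps (ball 0 1) D \<and> (\<forall>j\<in>{1..N}. Phi (w j) f = a j) \<and>
     \<not> (\<exists>g \<in> hol_maps (ball 0 1) D.
          (\<forall>j\<in>{1..N}. Phi (w j) g = a j) \<and> rel_compact (g ` ball 0 1) D)"

text \<open>Type \<open>(P\<^sub>m)\<close>; the witness \<open>Q\<close> is a parameter so that it can be referred to elsewhere.\<close>

definition problem_type ::
  "nat \<Rightarrow> real \<Rightarrow> nat \<Rightarrow> (nat \<Rightarrow> complex \<Rightarrow> complex ^ 'n) \<Rightarrow> complex poly \<Rightarrow> bool" where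
  "problem_type m \<nu> N w Q \<longleftrightarrow>
     (\<exists>\<sigma>. (\<forall>k\<in>{1..m}. \<sigma> k \<in> ball 0 1) \<and> Q = (\<Prod>k=1..m. [:- \<sigma> k, 1:])) \<and>
     (\<forall>j\<in>{1..N}. \<exists>F \<in> A_maps (ball 0 1). \<forall>z \<in> closure (annulus \<nu>). F z = poly Q z *s w j z)"

end

theory Submission
  imports Defs
begin

text \<open>
  Put \<open>p = s\<^sup>* \<cdot> \<nabla>u(f\<^sup>*)\<close> on the circle; this is bounded and measurable.
  For \<open>h\<close> of class \<open>\<A>(E)\<close> put \<open>r\<^sub>h = Re (p \<bullet> h)\<close> and \<open>L\<^sub>k(h) = \<Phi>\<^sub>k(s \<cdot> h)\<close>.  By hypotheses (d) and (e),
  \<open>2 r\<^sub>h\<close> is the first variation of \<open>u\<close> at the boundary when \<open>f\<close> is replaced by \<open>f + s \<cdot> h\<close>.  The proof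
  is a Lagrange multiplier argument: extremality of \<open>f\<close> yields a function \<open>0 \<le> \<rho> \<le> 1\<close> and real numbers
  \<open>\<lambda>\<^sub>k\<close>, not all zero, with \<open>\<integral> \<rho> r\<^sub>h = \<Sum> \<lambda>\<^sub>k L\<^sub>k(h)\<close> for every \<open>h\<close>.

  For \<open>e \<in> \<real>\<^sup>N\<close> consider \<open>J\<^sub>e(h) = \<integral> H(r\<^sub>h) + \<Sum> (L\<^sub>k(h) - e\<^sub>k)\<^sup>2 / 2\<close>, where \<open>H\<close> is a
  \<open>C\<^sup>1\<close> approximation of the positive part.  If some \<open>J\<^sub>e\<close> has a positive infimum, then the derivatives of
  \<open>J\<^sub>e\<close> along a minimising sequence converge, although the sequence itself need not, and their limit
  is the multiplier (\<open>bounded_multiplier_exists\<close>).  The map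
  \<open>X = \<Sum> \<lambda>\<^sub>k w\<^sub>k \<cdot> s\<^sup>* - 2 \<pi> \<rho> p\<close> then annihilates \<open>\<A>(E)\<close>, and the Poisson integral together
  with Fatou's theorem shows that it is the boundary function of some \<open>g \<in> H\<^sup>\<infinity>\<close> with \<open>g(0) = 0\<close>
  (\<open>annihilator_boundary_value\<close>).  On the set where \<open>\<rho> = 0\<close> this is the relation that linear
  independence forbids, so \<open>\<rho> > 0\<close> almost everywhere; multiplying by \<open>Q\<close> turns the \<open>w\<^sub>k\<close> into
  maps of class \<open>\<A>(E)\<close> and exhibits \<open>2 \<pi> Q \<rho> p\<close> as a boundary function
  (\<open>multiplier_gives_boundary_value\<close>).

  In the remaining case every \<open>J\<^sub>e\<close> has infimum \<open>0\<close>.  Then by scaling every \<open>e\<close> is approximated by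
  values \<open>L(h)\<close> for which \<open>\<integral> max 0 r\<^sub>h\<close> is arbitrarily small, and \<open>f\<close> is not extremal
  (\<open>improved_competitor\<close>).  The step \<open>g = f + t s \<cdot> h\<close> has, up to a correction, \<open>u(g\<^sup>*) \<le> 2 t \<beta> + t\<close> with \<open>\<beta> = max 0 r\<^sub>h\<close>
  small in the mean but not in the supremum.  Since \<open>u \<circ> f\<close> is negative on a smaller disc, the maximum
  principle bounds \<open>u \<circ> g\<close> by the Poisson integral of \<open>2 t \<beta> + t\<close> plus a multiple of \<open>ln |z|\<close>.
  Now reparametrise \<open>g\<close> by a map \<open>\<phi>\<close> of the disc into itself with
  \<open>ln |\<phi>| \<le> - \<tau> (P[\<beta>](\<phi>) + 1)\<close> for a suitable \<open>\<tau>\<close> proportional to \<open>t\<close>: points are pulled inward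
  in proportion to the Poisson integral of \<open>\<beta>\<close>, and the logarithm cancels it, so that
  \<open>u \<circ> g \<circ> \<phi>\<close> stays below a negative constant.  The effect of \<open>\<phi>\<close> on the functionals is controlled
  because they are means over an inner circle \<open>|z| = R\<close>, where only the mean of \<open>\<beta>\<close> matters; the main
  part of the change is cancelled by the choice of \<open>e\<close>, the rest by solving an \<open>N \<times> N\<close> system close to the
  identity.
\<close>

section \<open>Arc length on the unit circle\<close>

text \<open>
  Borel sets suffice for all constructions, so the circle measure is used before its completion.
\<close>

definition circ :: "complex measure" where
  "circ = distr (restrict_space lborel {0..<2 * pi}) (restrict_space borel (sphere 0 1)) cis"

lemma circle_measure_eq: "circle_measure = completion circ"
  by (simp add: circle_measure_def circ_def)

lemma space_circ [simp]: "space circ = sphere 0 1"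
  by (simp add: circ_def space_restrict_space)

lemma sets_circ: "sets circ = sets (restrict_space borel (sphere 0 1))"
  by (simp add: circ_def)

lemma measurable_cis_circ:
  "cis \<in> restrict_space lborel {0..<2 * pi} \<rightarrow>\<^sub>M restrict_space borel (sphere 0 1)"
proof (rule measurable_restrict_space3)
  show "cis \<in> lborel \<rightarrow>\<^sub>M borel"
    by (auto intro!: borel_measurable_continuous_onI continuous_on_cis continuous_on_id)
qed auto

lemma AE_circ_iff_completion: "(AE \<zeta> in circle_measure. P \<zeta>) \<longleftrightarrow> (AE \<zeta> in circ. P \<zeta>)"
  unfolding circle_measure_eq by (rule AE_completion_iff)

lemma AE_circD:
  assumes "AE \<zeta> in circ. P \<zeta>"
  shows "AE \<theta> in lborel. \<theta> \<in> {0..<2 * pi} \<longrightarrow> P (cis \<theta>)"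
proof -
  have "AE \<theta> in restrict_space lborel {0..<2 * pi}. P (cis \<theta>)"
    using AE_distrD[OF measurable_cis_circ] assms unfolding circ_def by blast
  then show ?thesis by (subst (asm) AE_restrict_space_iff) auto
qed

text \<open>
  The angle in \<open>[0, 2\<pi>)\<close> is a Borel function of the point of the circle, so a null set of angles gives
  a null set of points.  The angle \<open>0\<close> is counted among the exceptions.
\<close>

lemma AE_circI:
  assumes N: "negligible N"
    and P: "\<And>\<theta>. 0 < \<theta> \<Longrightarrow> \<theta> < 2 * pi \<Longrightarrow> \<theta> \<notin> N \<Longrightarrow> P (cis \<theta>)"
  shows "AE \<zeta> in circ. P \<zeta>"
proof -
  obtain N' where N': "N' \<in> null_sets lborel" "N \<union> {0} \<subseteq> N'"
  proof -
    have "negligible (N \<union> {0})" using N by auto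
    then have "N \<union> {0} \<in> null_sets (completion lborel)"
      by (simp add: negligible_iff_null_sets)
    then have "\<exists>N'\<in>null_sets lborel. N \<union> {0} \<subseteq> N'"
      unfolding null_sets_completion_iff2 .
    then show ?thesis using that by auto
  qed
  \<comment> \<open>the angle in \<open>[0, 2\<pi>)\<close>; the real part is clamped so that \<open>a\<close> is Borel on the whole plane\<close>
  define a where "a = (\<lambda>\<zeta>. if 0 \<le> Im \<zeta> then arccos (max (-1) (min 1 (Re \<zeta>)))
                            else 2 * pi - arccos (max (-1) (min 1 (Re \<zeta>))))"
  have "continuous_on UNIV (\<lambda>x::complex. arccos (max (-1) (min 1 (Re x))))"
  proof (rule continuous_on_arccos)
    show "continuous_on UNIV (\<lambda>x::complex. max (-1) (min 1 (Re x)))"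
      by (rule continuous_on_max[OF continuous_on_const
              continuous_on_min[OF continuous_on_const continuous_on_Re[OF continuous_on_id]]])
  qed simp
  then have [measurable]: "(\<lambda>x. arccos (max (-1) (min 1 (Re x)))) \<in> borel_measurable borel"
    by (rule borel_measurable_continuous_onI)
  have am [measurable]: "a \<in> borel_measurable borel" unfolding a_def by measurable
  have acis: "a (cis \<theta>) = \<theta>" if "0 \<le> \<theta>" "\<theta> < 2 * pi" for \<theta>
  proof (cases "\<theta> \<le> pi")
    case True
    then have "0 \<le> sin \<theta>" using that by (simp add: sin_ge_zero)
    then show ?thesis using that True by (simp add: a_def arccos_cos)
  next
    case False
    then have "sin \<theta> < 0" using that by (intro sin_lt_zero) auto
    moreover have "arccos (cos \<theta>) = 2 * pi - \<theta>"
    proof -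
      have "arccos (cos (2 * pi - \<theta>)) = 2 * pi - \<theta>"
        by (rule arccos_cos) (use that False in auto)
      then show ?thesis by (simp add: cos_diff)
    qed
    ultimately show ?thesis by (simp add: a_def)
  qed
  have [measurable]: "N' \<in> sets borel" using N' by auto
  have "{\<zeta> \<in> sphere 0 1. a \<zeta> \<in> N'} = (a -` N') \<inter> sphere 0 1" by auto
  also have "\<dots> \<in> sets circ"
    unfolding sets_circ sets_restrict_space using measurable_sets[OF am, of N'] by auto
  finally have B: "{\<zeta> \<in> sphere 0 1. a \<zeta> \<in> N'} \<in> sets circ" .
  have "AE \<zeta> in circ. a \<zeta> \<notin> N'"
    unfolding circ_def
  proof (subst AE_distr_iff[OF measurable_cis_circ])
    show "{x \<in> space (restrict_space borel (sphere 0 1)). a x \<notin> N'}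
            \<in> sets (restrict_space borel (sphere 0 1))"
    proof -
      have "{x \<in> space (restrict_space borel (sphere 0 1)). a x \<notin> N'}
              = space circ - {\<zeta> \<in> sphere 0 1. a \<zeta> \<in> N'}"
        by (auto simp: space_restrict_space)
      moreover have "space circ - {\<zeta> \<in> sphere 0 1. a \<zeta> \<in> N'} \<in> sets circ"
        using B by (rule sets.compl_sets)
      ultimately show ?thesis by (simp only: sets_circ)
    qed
    have "AE \<theta> in lborel. \<theta> \<notin> N'" using N' by (rule_tac AE_not_in)
    then have "AE \<theta> in lborel. \<theta> \<in> {0..<2 * pi} \<longrightarrow> a (cis \<theta>) \<notin> N'"
      by eventually_elim (use acis in auto)
    then show "AE x in restrict_space lborel {0..<2 * pi}. a (cis x) \<notin> N'"
      by (subst AE_restrict_space_iff) auto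
  qed
  then show ?thesis
  proof (rule AE_mp, intro AE_I2 impI)
    fix \<zeta> assume z: "\<zeta> \<in> space circ" "a \<zeta> \<notin> N'"
    then have "cmod \<zeta> = 1" by simp
    then obtain \<theta> where t: "\<zeta> = cis \<theta>" "0 \<le> \<theta>" "\<theta> < 2 * pi"
      using Arg2pi[of \<zeta>] that[of "Arg2pi \<zeta>"] by (simp add: is_Arg_def cis_conv_exp)
    then have "\<theta> \<notin> N'" using z acis by auto
    then have "\<theta> \<noteq> 0" "\<theta> \<notin> N" using N' by auto
    then show "P \<zeta>" using P t by auto
  qed
qed

lemma emeasure_circ: "emeasure circ (space circ) = ennreal (2 * pi)"
proof -
  have "cis -` sphere 0 1 \<inter> space (restrict_space lborel {0..<2 * pi}) = {0..<2*pi}"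
    by (auto simp: space_restrict_space)
  moreover have "emeasure circ (sphere 0 1) =
      emeasure (restrict_space lborel {0..<2 * pi}) (cis -` sphere 0 1 \<inter> space (restrict_space lborel {0..<2 * pi}))"
    unfolding circ_def
    by (rule emeasure_distr[OF measurable_cis_circ]) (auto simp: sets_restrict_space)
  ultimately show ?thesis by (simp add: emeasure_restrict_space)
qed

interpretation circ: finite_measure circ
  by standard (use emeasure_circ in auto)

lemma measure_circ: "measure circ (sphere 0 1) = 2 * pi"
  using emeasure_circ by (simp add: measure_def)

lemma integral_circ:
  fixes f :: "complex \<Rightarrow> 'b::{banach, second_countable_topology}"
  assumes f: "f \<in> borel_measurable circ"
  shows "integral\<^sup>L circ f = (LINT \<theta>:{0..<2 * pi}|lborel. f (cis \<theta>))"
proof -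
  have "f \<in> borel_measurable (restrict_space borel (sphere 0 1))"
    using f by (simp add: circ_def)
  then have "integral\<^sup>L circ f = (\<integral>\<theta>. f (cis \<theta>) \<partial>restrict_space lborel {0..<2 * pi})"
    unfolding circ_def by (intro integral_distr measurable_cis_circ)
  then show ?thesis by (simp add: integral_restrict_space set_lebesgue_integral_def)
qed

lemma borel_measurable_circ_cis:
  fixes f :: "complex \<Rightarrow> 'b::{real_normed_vector, second_countable_topology}"
  assumes "f \<in> borel_measurable circ"
  shows "(\<lambda>\<theta>. indicator {0..<2 * pi} \<theta> *\<^sub>R f (cis \<theta>)) \<in> borel_measurable lborel"
proof -
  have "f \<in> borel_measurable (restrict_space borel (sphere 0 1))"
    using assms by (simp add: circ_def)
  from measurable_compose[OF measurable_cis_circ this]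
  show ?thesis by (subst (asm) borel_measurable_restrict_space_iff) auto
qed

text \<open>
  The functionals integrate a boundary value, which is known only almost everywhere, over
  \<open>[0, 2\<pi>]\<close> with Lebesgue measure; this lets any Borel version on the circle compute them.
\<close>

lemma lebesgue_integral_cis_eq_circ:
  fixes f g :: "complex \<Rightarrow> real"
  assumes g: "g \<in> borel_measurable circ" and eq: "AE \<zeta> in circ. f \<zeta> = g \<zeta>"
  shows "(LINT \<theta>:{0..2 * pi}|lebesgue. f (cis \<theta>)) = integral\<^sup>L circ g"
proof -
  let ?g = "\<lambda>\<theta>. indicator {0..<2 * pi} \<theta> *\<^sub>R g (cis \<theta>)"
  let ?f = "\<lambda>\<theta>. indicator {0..2 * pi} \<theta> *\<^sub>R f (cis \<theta>)"
  have gm: "?g \<in> borel_measurable lborel" by (rule borel_measurable_circ_cis[OF g])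
  have "AE \<theta> in lborel. \<theta> \<noteq> 2 * pi" by (rule AE_lborel_singleton)
  with AE_circD[OF eq] have "AE \<theta> in lborel. ?g \<theta> = ?f \<theta>"
    by eventually_elim (auto simp: indicator_def)
  then have ae: "AE \<theta> in lebesgue. ?g \<theta> = ?f \<theta>" by (rule AE_completion)
  have gm': "?g \<in> borel_measurable lebesgue" using gm by (rule measurable_completion)
  have fm: "?f \<in> borel_measurable lebesgue"
  proof (rule measurableI)
    fix A :: "real set" assume A: "A \<in> sets borel"
    show "?f -` A \<inter> space lebesgue \<in> sets lebesgue"
    proof (rule completion.in_sets_AE)
      show "?g -` A \<inter> space lebesgue \<in> sets lebesgue" by (rule measurable_sets[OF gm' A])
      show "AE x in lebesgue. (x \<in> ?g -` A \<inter> space lebesgue) = (x \<in> ?f -` A \<inter> space lebesgue)"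
        using ae by eventually_elim auto
    qed auto
  qed auto
  have "integral\<^sup>L lebesgue ?f = integral\<^sup>L lebesgue ?g"
    by (rule integral_cong_AE[OF fm gm']) (use ae in \<open>eventually_elim, simp\<close>)
  also have "\<dots> = integral\<^sup>L lborel ?g" by (rule integral_completion[OF gm])
  finally show ?thesis using integral_circ[OF g] by (simp add: set_lebesgue_integral_def)
qed

lemma measurable_circ_continuous:
  fixes k :: "complex \<Rightarrow> 'b::{real_normed_vector, second_countable_topology}"
  assumes "continuous_on (sphere 0 1) k"
  shows "k \<in> borel_measurable circ"
proof -
  have "k \<in> borel_measurable (restrict_space borel (sphere 0 1))"
    by (rule borel_measurable_continuous_on_restrict[OF assms])
  then show ?thesis by (simp add: circ_def)
qed

lemma integrable_circ_bounded:
  fixes f :: "complex \<Rightarrow> 'b::{banach, second_countable_topology}"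
  assumes "f \<in> borel_measurable circ" "\<And>\<zeta>. cmod \<zeta> = 1 \<Longrightarrow> norm (f \<zeta>) \<le> B"
  shows "integrable circ f"
  by (rule circ.integrable_const_bound[where B = B]) (use assms in \<open>auto\<close>)

lemma integral_circ_continuous:
  fixes k :: "complex \<Rightarrow> 'b::euclidean_space"
  assumes k: "continuous_on (sphere 0 1) k"
  shows "integral\<^sup>L circ k = integral {0..2 * pi} (\<lambda>\<theta>. k (cis \<theta>))"
proof -
  have c: "continuous_on {0..2*pi} (\<lambda>\<theta>. k (cis \<theta>))"
    by (rule continuous_on_compose2[OF k]) (auto intro!: continuous_on_cis continuous_on_id)
  have "integral\<^sup>L circ k = (LINT \<theta>:{0..<2 * pi}|lborel. k (cis \<theta>))"
    by (rule integral_circ[OF measurable_circ_continuous[OF k]])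
  also have "\<dots> = (LINT \<theta>:{0..2 * pi}|lborel. k (cis \<theta>))"
  proof (rule set_integral_cong_set)
    show "set_borel_measurable lborel {0..<2*pi} (\<lambda>\<theta>. k (cis \<theta>))"
      unfolding set_borel_measurable_def
      by (rule borel_measurable_circ_cis[OF measurable_circ_continuous[OF k]])
    show "set_borel_measurable lborel {0..2*pi} (\<lambda>\<theta>. k (cis \<theta>))"
      using borel_integrable_compact[OF compact_Icc c]
      by (auto simp: set_borel_measurable_def set_integrable_def indicator_scaleR_eq_if if_distrib cong: if_cong)
    have "AE \<theta> in lborel. \<theta> \<noteq> 2 * pi" by (rule AE_lborel_singleton)
    then show "AE x in lborel. (x \<in> {0..2 * pi}) = (x \<in> {0..<2 * pi})"
      by eventually_elim auto
  qed
  also have "\<dots> = integral {0..2 * pi} (\<lambda>\<theta>. k (cis \<theta>))"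
    by (rule set_borel_integral_eq_integral(2)) (rule borel_integrable_atLeastAtMost', rule c)
  finally show ?thesis .
qed

section \<open>Cauchy and Poisson integrals of bounded functions\<close>

lemma holomorphic_mean_value:
  fixes k :: "complex \<Rightarrow> complex"
  assumes k: "k holomorphic_on ball z r0" and r: "0 < r" "r < r0"
  shows "integral\<^sup>L circ (\<lambda>\<zeta>. k (z + of_real r * \<zeta>)) = 2 * pi * k z"
proof -
  have kc: "k holomorphic_on cball z r" using k r by (auto intro: holomorphic_on_subset)
  have "((\<lambda>u. k u / (u - z)) has_contour_integral (2 * of_real pi * \<i> * k z)) (circlepath z r)"
    using Cauchy_integral_circlepath_simple[OF kc, of z] r by simp
  then have "((\<lambda>t. k (z + r * cis t) / (z + r * cis t - z) * r * \<i> * cis t) has_integral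
      (2 * of_real pi * \<i> * k z)) {0..2*pi}"
    unfolding circlepath_def by (subst (asm) has_contour_integral_part_circlepath_iff) auto
  then have "((\<lambda>t. \<i> * k (z + r * cis t)) has_integral (2 * of_real pi * \<i> * k z)) {0..2*pi}"
    by (rule has_integral_eq[rotated]) (use r in \<open>auto simp: field_simps\<close>)
  then have "((\<lambda>t. (-\<i>) * (\<i> * k (z + r * cis t))) has_integral ((-\<i>) * (2 * of_real pi * \<i> * k z))) {0..2*pi}"
    by (rule has_integral_mult_right)
  then have hi: "((\<lambda>t. k (z + r * cis t)) has_integral (2 * of_real pi * k z)) {0..2*pi}"
    by (simp add: algebra_simps)
  have "continuous_on (sphere 0 1) (\<lambda>\<zeta>. k (z + of_real r * \<zeta>))"
    by (rule continuous_on_compose2[OF holomorphic_on_imp_continuous_on[OF kc]])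
       (use r in \<open>auto intro!: continuous_intros simp: dist_norm norm_mult\<close>)
  from integral_circ_continuous[OF this] show ?thesis
    using integral_unique[OF hi] by simp
qed

lemma integral_circ_power:
  assumes "0 < k"
  shows "integral\<^sup>L circ (\<lambda>\<zeta>. \<zeta> ^ k) = 0"
proof -
  have "integral\<^sup>L circ (\<lambda>\<zeta>. (0 + of_real 1 * \<zeta>) ^ k) = 2 * of_real pi * 0 ^ k"
    using holomorphic_mean_value[of "\<lambda>z. z ^ k" 0 2 1] by (simp add: holomorphic_on_power)
  then show ?thesis using assms by simp
qed

text \<open>
  The bound holds at every point of the circle, so that no null sets appear when such functions are
  combined.
\<close>

definition bdd_circ :: "(complex \<Rightarrow> 'b::real_normed_vector) \<Rightarrow> bool" where
  "bdd_circ F \<longleftrightarrow> F \<in> borel_measurable circ \<and> (\<exists>B. \<forall>\<zeta>. cmod \<zeta> = 1 \<longrightarrow> norm (F \<zeta>) \<le> B)"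

lemma bdd_circ_integrable:
  fixes F :: "complex \<Rightarrow> 'b::{banach, second_countable_topology}"
  assumes "bdd_circ F" shows "integrable circ F"
  using assms integrable_circ_bounded unfolding bdd_circ_def by blast

lemma bdd_circ_measurable: "bdd_circ F \<Longrightarrow> F \<in> borel_measurable circ"
  by (simp add: bdd_circ_def)

lemma bdd_circ_bound:
  assumes "bdd_circ F" obtains B where "B \<ge> 0" "\<And>\<zeta>. cmod \<zeta> = 1 \<Longrightarrow> norm (F \<zeta>) \<le> B"
proof -
  obtain B where B: "\<And>\<zeta>. cmod \<zeta> = 1 \<Longrightarrow> norm (F \<zeta>) \<le> B" using assms by (auto simp: bdd_circ_def)
  have "norm (F 1) \<le> B" by (rule B) simp
  then have "B \<ge> 0" using norm_ge_zero order_trans by blast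
  with B that show ?thesis by blast
qed

lemma bdd_circ_continuous:
  fixes k :: "complex \<Rightarrow> 'b::{real_normed_vector, second_countable_topology}"
  assumes "continuous_on (sphere 0 1) k" shows "bdd_circ k"
proof -
  have "bounded (k ` sphere 0 1)" by (intro compact_imp_bounded compact_continuous_image assms) auto
  then show ?thesis using measurable_circ_continuous[OF assms]
    unfolding bdd_circ_def bounded_iff by (metis imageI mem_sphere_0)
qed

lemma bdd_circ_mult:
  fixes F G :: "complex \<Rightarrow> 'b::{real_normed_algebra, second_countable_topology}"
  assumes "bdd_circ F" "bdd_circ G" shows "bdd_circ (\<lambda>\<zeta>. F \<zeta> * G \<zeta>)"
proof -
  obtain A where A: "A \<ge> 0" "\<And>\<zeta>. cmod \<zeta> = 1 \<Longrightarrow> norm (F \<zeta>) \<le> A" using bdd_circ_bound assms by metis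
  obtain B where B: "B \<ge> 0" "\<And>\<zeta>. cmod \<zeta> = 1 \<Longrightarrow> norm (G \<zeta>) \<le> B" using bdd_circ_bound assms by metis
  have "norm (F \<zeta> * G \<zeta>) \<le> A * B" if "cmod \<zeta> = 1" for \<zeta>
    using order_trans[OF norm_mult_ineq mult_mono[OF A(2) B(2)]] A(1) that by auto
  moreover have "(\<lambda>\<zeta>. F \<zeta> * G \<zeta>) \<in> borel_measurable circ"
    using assms by (intro borel_measurable_times bdd_circ_measurable)
  ultimately show ?thesis unfolding bdd_circ_def by blast
qed

lemma bdd_circ_add:
  fixes F G :: "complex \<Rightarrow> 'b::{real_normed_vector, second_countable_topology}"
  assumes "bdd_circ F" "bdd_circ G" shows "bdd_circ (\<lambda>\<zeta>. F \<zeta> + G \<zeta>)"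
proof -
  obtain A where A: "A \<ge> 0" "\<And>\<zeta>. cmod \<zeta> = 1 \<Longrightarrow> norm (F \<zeta>) \<le> A" using bdd_circ_bound assms by metis
  obtain B where B: "B \<ge> 0" "\<And>\<zeta>. cmod \<zeta> = 1 \<Longrightarrow> norm (G \<zeta>) \<le> B" using bdd_circ_bound assms by metis
  have "norm (F \<zeta> + G \<zeta>) \<le> A + B" if "cmod \<zeta> = 1" for \<zeta>
    using norm_triangle_mono[OF A(2) B(2)] that by auto
  moreover have "(\<lambda>\<zeta>. F \<zeta> + G \<zeta>) \<in> borel_measurable circ"
    using assms by (intro borel_measurable_add bdd_circ_measurable)
  ultimately show ?thesis unfolding bdd_circ_def by blast
qed

lemma bdd_circ_compose:
  assumes F: "bdd_circ F" and g: "continuous_on UNIV g" and gb: "\<And>x. norm (g x) \<le> K * norm x + L" and K: "K \<ge> 0"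
  shows "bdd_circ (\<lambda>\<zeta>. g (F \<zeta>))"
proof -
  obtain A where A: "A \<ge> 0" "\<And>\<zeta>. cmod \<zeta> = 1 \<Longrightarrow> norm (F \<zeta>) \<le> A" using bdd_circ_bound F by metis
  have "norm (g (F \<zeta>)) \<le> K * A + L" if "cmod \<zeta> = 1" for \<zeta>
    using gb[of "F \<zeta>"] mult_left_mono[OF A(2)[OF that] K] by linarith
  moreover have "(\<lambda>\<zeta>. g (F \<zeta>)) \<in> borel_measurable circ"
    using F by (intro measurable_compose[OF bdd_circ_measurable borel_measurable_continuous_onI[OF g]])
  ultimately show ?thesis unfolding bdd_circ_def by blast
qed

lemma bdd_circ_cnj: "bdd_circ F \<Longrightarrow> bdd_circ (\<lambda>\<zeta>. cnj (F \<zeta>))"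
  by (rule bdd_circ_compose[where K = 1 and L = 0]) (auto intro!: continuous_intros)

lemma bdd_circ_of_real: "bdd_circ F \<Longrightarrow> bdd_circ (\<lambda>\<zeta>. of_real (F \<zeta>) :: complex)"
  by (rule bdd_circ_compose[where K = 1 and L = 0 and g = of_real]) (auto intro!: continuous_intros)

lemma bdd_circ_Re: "bdd_circ F \<Longrightarrow> bdd_circ (\<lambda>\<zeta>. Re (F \<zeta>))"
  by (rule bdd_circ_compose[where K = 1 and L = 0 and g = Re]) (auto intro!: continuous_intros abs_Re_le_cmod)

lemma bdd_circ_const: "bdd_circ (\<lambda>\<zeta>. c)"
  by (auto simp: bdd_circ_def)

text \<open>
  Expand \<open>\<zeta> / (\<zeta> - z)\<close> in the geometric series of \<open>cnj \<zeta> * z\<close>; it converges uniformly on the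
  circle.
\<close>

lemma sums_cauchy_transform:
  fixes F :: "complex \<Rightarrow> complex"
  assumes F: "bdd_circ F" and z: "cmod z < 1"
  shows "(\<lambda>k. integral\<^sup>L circ (\<lambda>\<zeta>. F \<zeta> * cnj \<zeta> ^ k) * z ^ k) sums integral\<^sup>L circ (\<lambda>\<zeta>. F \<zeta> * (\<zeta> / (\<zeta> - z)))"
proof -
  obtain B where B: "B \<ge> 0" "\<And>\<zeta>. cmod \<zeta> = 1 \<Longrightarrow> norm (F \<zeta>) \<le> B" using bdd_circ_bound F by metis
  have pw: "bdd_circ (\<lambda>\<zeta>. cnj \<zeta> ^ k)" for k
    by (rule bdd_circ_continuous) (auto intro!: continuous_intros)
  have int: "integrable circ (\<lambda>\<zeta>. F \<zeta> * cnj \<zeta> ^ k * z ^ k)" for k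
    by (intro bdd_circ_integrable bdd_circ_mult F pw bdd_circ_const)
  have nrm: "norm (F \<zeta> * cnj \<zeta> ^ k * z ^ k) \<le> B * cmod z ^ k" if "cmod \<zeta> = 1" for \<zeta> k
    using B(2)[OF that] that by (simp add: norm_mult norm_power mult_right_mono)
  have sm: "summable (\<lambda>k. B * cmod z ^ k)" using z by (intro summable_mult summable_geometric) auto
  have "(\<lambda>k. integral\<^sup>L circ (\<lambda>\<zeta>. F \<zeta> * cnj \<zeta> ^ k * z ^ k)) sums integral\<^sup>L circ (\<lambda>\<zeta>. \<Sum>k. F \<zeta> * cnj \<zeta> ^ k * z ^ k)"
  proof (rule sums_integral[OF int])
    show "AE \<zeta> in circ. summable (\<lambda>k. norm (F \<zeta> * cnj \<zeta> ^ k * z ^ k))"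
      by (rule AE_I2) (rule summable_comparison_test'[OF sm], use nrm in auto)
    show "summable (\<lambda>k. \<integral>\<zeta>. norm (F \<zeta> * cnj \<zeta> ^ k * z ^ k) \<partial>circ)"
    proof (rule summable_comparison_test')
      show "summable (\<lambda>k. 2 * pi * (B * cmod z ^ k))" by (rule summable_mult[OF sm])
      fix k
      have "(\<integral>\<zeta>. norm (F \<zeta> * cnj \<zeta> ^ k * z ^ k) \<partial>circ) \<le> (\<integral>\<zeta>. B * cmod z ^ k \<partial>circ)"
        by (rule integral_mono) (use int nrm in auto)
      also have "\<dots> = 2 * pi * (B * cmod z ^ k)" by (simp add: measure_circ)
      finally show "norm (\<integral>\<zeta>. norm (F \<zeta> * cnj \<zeta> ^ k * z ^ k) \<partial>circ) \<le> 2 * pi * (B * cmod z ^ k)"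
        by (simp add: integral_nonneg_AE)
    qed
  qed
  moreover have "integral\<^sup>L circ (\<lambda>\<zeta>. \<Sum>k. F \<zeta> * cnj \<zeta> ^ k * z ^ k) = integral\<^sup>L circ (\<lambda>\<zeta>. F \<zeta> * (\<zeta> / (\<zeta> - z)))"
  proof (rule Bochner_Integration.integral_cong[OF refl])
    fix \<zeta> assume "\<zeta> \<in> space circ"
    then have z1: "cmod \<zeta> = 1" by simp
    then have c: "cnj \<zeta> * \<zeta> = 1" by (simp add: complex_norm_square[symmetric] mult.commute)
    have n0: "\<zeta> \<noteq> z" using z z1 by auto
    have "cmod (cnj \<zeta> * z) < 1" using z z1 by (simp add: norm_mult)
    from geometric_sums[OF this] have "(\<lambda>k. F \<zeta> * (cnj \<zeta> * z) ^ k) sums (F \<zeta> * (1 / (1 - cnj \<zeta> * z)))"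
      by (rule sums_mult)
    then have "(\<Sum>k. F \<zeta> * cnj \<zeta> ^ k * z ^ k) = F \<zeta> * (1 / (1 - cnj \<zeta> * z))"
      by (simp add: sums_iff power_mult_distrib mult.assoc)
    also have "1 / (1 - cnj \<zeta> * z) = \<zeta> / (\<zeta> - z)"
    proof -
      have "\<zeta> * (1 - cnj \<zeta> * z) = \<zeta> - z"
      proof -
        have "\<zeta> * (1 - cnj \<zeta> * z) = \<zeta> - (cnj \<zeta> * \<zeta>) * z" by (simp add: algebra_simps)
        then show ?thesis by (simp only: c mult_1)
      qed
      moreover have "\<zeta> \<noteq> 0" using z1 by auto
      ultimately show ?thesis using n0 by (simp add: divide_simps) (metis mult_eq_0_iff right_minus_eq)
    qed
    finally show "(\<Sum>k. F \<zeta> * cnj \<zeta> ^ k * z ^ k) = F \<zeta> * (\<zeta> / (\<zeta> - z))" .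
  qed
  ultimately show ?thesis by simp
qed

text \<open>
  The kernel is \<open>\<zeta> / (\<zeta> - z)\<close>, because integration is with respect to arc length and not \<open>d\<zeta>\<close>.
\<close>

definition cauchy_transform :: "(complex \<Rightarrow> complex) \<Rightarrow> complex \<Rightarrow> complex" where
  "cauchy_transform F z = integral\<^sup>L circ (\<lambda>\<zeta>. F \<zeta> * (\<zeta> / (\<zeta> - z))) / (2 * pi)"

lemma holomorphic_cauchy_transform:
  assumes "bdd_circ F" shows "cauchy_transform F holomorphic_on ball 0 1"
proof -
  have "(\<lambda>z. integral\<^sup>L circ (\<lambda>\<zeta>. F \<zeta> * (\<zeta> / (\<zeta> - z)))) holomorphic_on ball 0 1"
    by (rule power_series_holomorphic[where a = "\<lambda>k. integral\<^sup>L circ (\<lambda>\<zeta>. F \<zeta> * cnj \<zeta> ^ k)"])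
       (use sums_cauchy_transform[OF assms] in auto)
  then show ?thesis unfolding cauchy_transform_def by (intro holomorphic_intros) auto
qed

lemma cauchy_transform_0: "cauchy_transform F 0 = integral\<^sup>L circ F / (2 * pi)"
proof -
  have "integral\<^sup>L circ (\<lambda>\<zeta>. F \<zeta> * (\<zeta> / (\<zeta> - 0))) = integral\<^sup>L circ F"
    by (rule Bochner_Integration.integral_cong) auto
  then show ?thesis by (simp add: cauchy_transform_def)
qed

definition poisson_kernel :: "complex \<Rightarrow> complex \<Rightarrow> real" where
  "poisson_kernel z \<zeta> = (1 - (cmod z)\<^sup>2) / (cmod (\<zeta> - z))\<^sup>2"

definition poisson :: "(complex \<Rightarrow> 'b) \<Rightarrow> complex \<Rightarrow> 'b::{banach, second_countable_topology}" where
  "poisson F z = (1 / (2 * pi)) *\<^sub>R integral\<^sup>L circ (\<lambda>\<zeta>. poisson_kernel z \<zeta> *\<^sub>R F \<zeta>)"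

lemma poisson_kernel_nonneg: "cmod z < 1 \<Longrightarrow> 0 \<le> poisson_kernel z \<zeta>"
  by (simp add: poisson_kernel_def power_le_one)

text \<open>
  Splits the kernel into a holomorphic and an antiholomorphic part in \<open>z\<close>.
\<close>

lemma poisson_kernel_decomp:
  assumes "cmod \<zeta> = 1" "cmod z < 1"
  shows "complex_of_real (poisson_kernel z \<zeta>) = \<zeta> / (\<zeta> - z) + cnj (\<zeta> / (\<zeta> - z)) - 1"
proof -
  have n: "\<zeta> - z \<noteq> 0" using assms by auto
  then have n': "cnj \<zeta> - cnj z \<noteq> 0" by (metis complex_cnj_diff complex_cnj_zero_iff)
  have c: "\<zeta> * cnj \<zeta> = 1" using assms by (simp add: complex_norm_square[symmetric])
  have "complex_of_real (poisson_kernel z \<zeta>) = (1 - z * cnj z) / ((\<zeta> - z) * (cnj \<zeta> - cnj z))"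
    unfolding poisson_kernel_def
    by (simp only: of_real_divide of_real_diff of_real_1 complex_norm_square complex_cnj_diff)
  also have "\<dots> = \<zeta> / (\<zeta> - z) + cnj (\<zeta> / (\<zeta> - z)) - 1"
  proof -
    have "\<zeta> * (cnj \<zeta> - cnj z) + cnj \<zeta> * (\<zeta> - z) - (\<zeta> - z) * (cnj \<zeta> - cnj z) = 1 - z * cnj z"
      using c by (simp add: algebra_simps)
    moreover have "\<zeta> / (\<zeta> - z) + cnj (\<zeta> / (\<zeta> - z)) - 1 =
        (\<zeta> * (cnj \<zeta> - cnj z) + cnj \<zeta> * (\<zeta> - z) - (\<zeta> - z) * (cnj \<zeta> - cnj z)) / ((\<zeta> - z) * (cnj \<zeta> - cnj z))"
    proof -
      have "a / p + b / q - 1 = (a * q + b * p - p * q) / (p * q)" if "p \<noteq> 0" "q \<noteq> 0" for a b p q :: complex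
        using that by (simp add: field_simps)
      from this[OF n n'] show ?thesis by simp
    qed
    ultimately show ?thesis by simp
  qed
  finally show ?thesis .
qed

lemma continuous_poisson_kernel: "cmod z < 1 \<Longrightarrow> continuous_on (sphere 0 1) (poisson_kernel z)"
  unfolding poisson_kernel_def by (intro continuous_intros) auto

lemma bdd_circ_scaleR:
  fixes G :: "complex \<Rightarrow> 'b::{real_normed_vector, second_countable_topology}"
  assumes "bdd_circ F" "bdd_circ G" shows "bdd_circ (\<lambda>\<zeta>. F \<zeta> *\<^sub>R G \<zeta>)"
proof -
  obtain A where A: "A \<ge> 0" "\<And>\<zeta>. cmod \<zeta> = 1 \<Longrightarrow> norm (F \<zeta>) \<le> A" using bdd_circ_bound assms by metis
  obtain B where B: "B \<ge> 0" "\<And>\<zeta>. cmod \<zeta> = 1 \<Longrightarrow> norm (G \<zeta>) \<le> B" using bdd_circ_bound assms by metis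
  have "norm (F \<zeta> *\<^sub>R G \<zeta>) \<le> A * B" if "cmod \<zeta> = 1" for \<zeta>
    using mult_mono[OF A(2) B(2)] A(1) that by simp
  moreover have "(\<lambda>\<zeta>. F \<zeta> *\<^sub>R G \<zeta>) \<in> borel_measurable circ"
    using assms by (intro borel_measurable_scaleR bdd_circ_measurable)
  ultimately show ?thesis unfolding bdd_circ_def by blast
qed

lemma poisson_integrable:
  fixes F :: "complex \<Rightarrow> 'b::{banach, second_countable_topology}"
  assumes "bdd_circ F" "cmod z < 1" shows "integrable circ (\<lambda>\<zeta>. poisson_kernel z \<zeta> *\<^sub>R F \<zeta>)"
  by (intro bdd_circ_integrable bdd_circ_scaleR assms bdd_circ_continuous continuous_poisson_kernel)

lemma bdd_circ_cauchy_kernel: "cmod z < 1 \<Longrightarrow> bdd_circ (\<lambda>\<zeta>. \<zeta> / (\<zeta> - z))"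
  by (intro bdd_circ_continuous continuous_intros) auto

lemma poisson_eq_cauchy:
  assumes F: "bdd_circ F" and z: "cmod z < 1"
  shows "poisson F z = cauchy_transform F z + cnj (cauchy_transform (\<lambda>\<zeta>. cnj (F \<zeta>)) z) - cauchy_transform F 0"
proof -
  have i1: "integrable circ (\<lambda>\<zeta>. F \<zeta> * (\<zeta> / (\<zeta> - z)))"
    by (intro bdd_circ_integrable bdd_circ_mult F bdd_circ_cauchy_kernel z)
  have i2: "integrable circ (\<lambda>\<zeta>. F \<zeta> * cnj (\<zeta> / (\<zeta> - z)))"
    by (intro bdd_circ_integrable bdd_circ_mult F bdd_circ_cnj bdd_circ_cauchy_kernel z)
  have "integral\<^sup>L circ (\<lambda>\<zeta>. poisson_kernel z \<zeta> *\<^sub>R F \<zeta>) =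
      integral\<^sup>L circ (\<lambda>\<zeta>. F \<zeta> * (\<zeta> / (\<zeta> - z)) + F \<zeta> * cnj (\<zeta> / (\<zeta> - z)) - F \<zeta>)"
    by (rule Bochner_Integration.integral_cong)
       (use z in \<open>auto simp: scaleR_conv_of_real poisson_kernel_decomp algebra_simps simp del: complex_cnj_divide\<close>)
  also have "\<dots> = integral\<^sup>L circ (\<lambda>\<zeta>. F \<zeta> * (\<zeta> / (\<zeta> - z))) + integral\<^sup>L circ (\<lambda>\<zeta>. F \<zeta> * cnj (\<zeta> / (\<zeta> - z))) - integral\<^sup>L circ F"
    using i1 i2 bdd_circ_integrable[OF F] by (simp del: complex_cnj_divide)
  also have "integral\<^sup>L circ (\<lambda>\<zeta>. F \<zeta> * cnj (\<zeta> / (\<zeta> - z))) = cnj (integral\<^sup>L circ (\<lambda>\<zeta>. cnj (F \<zeta>) * (\<zeta> / (\<zeta> - z))))"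
    using Bochner_Integration.integral_cnj[of circ "\<lambda>\<zeta>. cnj (F \<zeta>) * (\<zeta> / (\<zeta> - z))"] by simp
  finally show ?thesis unfolding poisson_def cauchy_transform_0
    unfolding cauchy_transform_def
    by (simp only: scaleR_conv_of_real add_divide_distrib diff_divide_distrib
          complex_cnj_divide complex_cnj_complex_of_real complex_cnj_mult) (simp add: add_divide_distrib diff_divide_distrib)
qed

lemma poisson_1:
  assumes z: "cmod z < 1" shows "poisson (\<lambda>_. 1::complex) z = 1"
proof -
  have C: "cauchy_transform (\<lambda>_. 1) z = 1" if "cmod z < 1" for z
  proof -
    have I: "integral\<^sup>L circ (\<lambda>\<zeta>. 1 * cnj \<zeta> ^ k) = (if k = 0 then 2 * pi else 0)" for k
    proof (cases "k = 0")
      case False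
      have "integral\<^sup>L circ (\<lambda>\<zeta>. cnj (\<zeta> ^ k)) = 0"
        using False integral_circ_power[of k] Bochner_Integration.integral_cnj[of circ "\<lambda>\<zeta>. \<zeta> ^ k"] by simp
      then show ?thesis using False by simp
    qed (simp add: measure_circ scaleR_conv_of_real)
    have "(\<lambda>k. (if k = 0 then 2 * pi else 0) * z ^ k) sums integral\<^sup>L circ (\<lambda>\<zeta>. 1 * (\<zeta> / (\<zeta> - z)))"
      using sums_cauchy_transform[OF bdd_circ_const that, of 1] unfolding I .
    moreover have "(\<lambda>k. (if k = 0 then 2 * pi else 0) * z ^ k) = (\<lambda>k. if k = 0 then complex_of_real (2 * pi) else 0)"
      by auto
    moreover have "(\<lambda>k. if k = 0 then complex_of_real (2 * pi) else 0) sums complex_of_real (2 * pi)"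
      using sums_single[of 0 "\<lambda>_. complex_of_real (2*pi)"] by simp
    ultimately show ?thesis unfolding cauchy_transform_def by (metis (no_types, lifting) divide_self_if of_real_eq_0_iff of_real_mult of_real_numeral pi_neq_zero sums_unique2 mult_eq_0_iff zero_neq_numeral)
  qed
  show ?thesis using poisson_eq_cauchy[OF bdd_circ_const z, of 1] C[OF z] C[of 0] by simp
qed

section \<open>Poisson integrals: boundary continuity and holomorphic completion\<close>

lemma poisson_of_real: "poisson (\<lambda>\<zeta>. complex_of_real (F \<zeta>)) z = of_real (poisson F z)"
proof -
  have "integral\<^sup>L circ (\<lambda>\<zeta>. poisson_kernel z \<zeta> *\<^sub>R complex_of_real (F \<zeta>))
      = integral\<^sup>L circ (\<lambda>\<zeta>. complex_of_real (poisson_kernel z \<zeta> *\<^sub>R F \<zeta>))"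
    by (rule Bochner_Integration.integral_cong) (auto simp: scaleR_conv_of_real)
  also have "\<dots> = of_real (integral\<^sup>L circ (\<lambda>\<zeta>. poisson_kernel z \<zeta> *\<^sub>R F \<zeta>))"
    by (rule integral_complex_of_real)
  finally show ?thesis by (simp add: poisson_def scaleR_conv_of_real)
qed

lemma poisson_real_1: "cmod z < 1 \<Longrightarrow> poisson (\<lambda>_. 1::real) z = 1"
  using poisson_1[of z] poisson_of_real[of "\<lambda>_. 1" z] by (metis of_real_1 of_real_eq_iff)

lemma poisson_const:
  fixes c :: "'b::{banach, second_countable_topology}"
  assumes z: "cmod z < 1" shows "poisson (\<lambda>_. c) z = c"
proof -
  have "integrable circ (\<lambda>\<zeta>. poisson_kernel z \<zeta>)"
    using poisson_integrable[OF bdd_circ_const z, of "1::real"] by simp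
  then have "poisson (\<lambda>_. c) z = poisson (\<lambda>_. 1::real) z *\<^sub>R c"
    unfolding poisson_def by simp
  then show ?thesis using poisson_real_1[OF z] by simp
qed

lemma poisson_mono:
  fixes F G :: "complex \<Rightarrow> real"
  assumes "bdd_circ F" "bdd_circ G" "cmod z < 1" "AE \<zeta> in circ. F \<zeta> \<le> G \<zeta>"
  shows "poisson F z \<le> poisson G z"
proof -
  have "integral\<^sup>L circ (\<lambda>\<zeta>. poisson_kernel z \<zeta> *\<^sub>R F \<zeta>) \<le> integral\<^sup>L circ (\<lambda>\<zeta>. poisson_kernel z \<zeta> *\<^sub>R G \<zeta>)"
  proof (rule integral_mono_AE)
    show "AE \<zeta> in circ. poisson_kernel z \<zeta> *\<^sub>R F \<zeta> \<le> poisson_kernel z \<zeta> *\<^sub>R G \<zeta>"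
      using assms(4) by eventually_elim (use poisson_kernel_nonneg[OF assms(3)] in \<open>auto intro: mult_left_mono\<close>)
  qed (rule poisson_integrable[OF assms(1,3)] poisson_integrable[OF assms(2,3)])+
  then show ?thesis by (simp add: poisson_def divide_right_mono)
qed

lemma poisson_add:
  fixes F G :: "complex \<Rightarrow> 'b::{banach, second_countable_topology}"
  assumes "bdd_circ F" "bdd_circ G" "cmod z < 1"
  shows "poisson (\<lambda>\<zeta>. F \<zeta> + G \<zeta>) z = poisson F z + poisson G z"
  using poisson_integrable[OF assms(1,3)] poisson_integrable[OF assms(2,3)]
  by (simp add: poisson_def scaleR_right_distrib)

lemma poisson_cmult:
  fixes F :: "complex \<Rightarrow> real"
  shows "poisson (\<lambda>\<zeta>. c * F \<zeta>) z = c * poisson F z"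
proof -
  have "(\<lambda>\<zeta>. poisson_kernel z \<zeta> *\<^sub>R (c * F \<zeta>)) = (\<lambda>\<zeta>. c * (poisson_kernel z \<zeta> *\<^sub>R F \<zeta>))" by auto
  then show ?thesis unfolding poisson_def by simp
qed

lemma poisson_nonneg:
  fixes F :: "complex \<Rightarrow> real"
  assumes "bdd_circ F" "cmod z < 1" "\<And>\<zeta>. cmod \<zeta> = 1 \<Longrightarrow> 0 \<le> F \<zeta>"
  shows "0 \<le> poisson F z"
proof -
  have "AE \<zeta> in circ. 0 \<le> F \<zeta>" using assms(3) by (intro AE_I2) auto
  then show ?thesis
    using poisson_mono[OF bdd_circ_const assms(1,2), of 0] poisson_const[OF assms(2), of "0::real"] by simp
qed

lemma bdd_circ_norm:
  fixes F :: "complex \<Rightarrow> 'b::{real_normed_vector, second_countable_topology}"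
  shows "bdd_circ F \<Longrightarrow> bdd_circ (\<lambda>\<zeta>. norm (F \<zeta>))"
  unfolding bdd_circ_def by auto

lemma norm_poisson_le:
  fixes F :: "complex \<Rightarrow> 'b::{banach, second_countable_topology}"
  assumes "bdd_circ F" "cmod z < 1"
  shows "norm (poisson F z) \<le> poisson (\<lambda>\<zeta>. norm (F \<zeta>)) z"
proof -
  have "norm (integral\<^sup>L circ (\<lambda>\<zeta>. poisson_kernel z \<zeta> *\<^sub>R F \<zeta>)) \<le> integral\<^sup>L circ (\<lambda>\<zeta>. norm (poisson_kernel z \<zeta> *\<^sub>R F \<zeta>))"
    by (rule integral_norm_bound)
  then show ?thesis using poisson_kernel_nonneg[OF assms(2)] by (simp add: poisson_def divide_right_mono)
qed

lemma norm_poisson_diff_le: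
  fixes F :: "complex \<Rightarrow> 'b::{banach, second_countable_topology}"
  assumes F: "bdd_circ F" and z: "cmod z < 1"
  shows "norm (poisson F z - c) \<le> poisson (\<lambda>\<zeta>. norm (F \<zeta> - c)) z"
proof -
  have "poisson F z - c = poisson (\<lambda>\<zeta>. F \<zeta> + (- c)) z"
    using poisson_add[OF F bdd_circ_const[of "- c"] z] poisson_const[OF z, of "- c"] by simp
  then show ?thesis using norm_poisson_le[OF bdd_circ_add[OF F bdd_circ_const[of "- c"]] z] by simp
qed

lemma bdd_circ_norm_diff:
  fixes F :: "complex \<Rightarrow> 'b::{real_normed_vector, second_countable_topology}"
  assumes F: "bdd_circ F"
  shows "bdd_circ (\<lambda>\<zeta>. norm (F \<zeta> - c))"
  using bdd_circ_norm[OF bdd_circ_add[OF F bdd_circ_const[of "- c"]]] by simp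

lemma poisson_kernel_far:
  assumes "cmod z < 1" "\<delta> > 0" "cmod (z - \<xi>) \<le> \<delta> / 2" "\<delta> \<le> cmod (\<zeta> - \<xi>)"
  shows "poisson_kernel z \<zeta> \<le> 4 * (1 - (cmod z)\<^sup>2) / \<delta>\<^sup>2"
proof -
  have "cmod (\<zeta> - \<xi>) \<le> cmod (\<zeta> - z) + cmod (z - \<xi>)" by (metis norm_triangle_ineq diff_add_cancel add_diff_eq)
  then have "\<delta> / 2 \<le> cmod (\<zeta> - z)" using assms by linarith
  then have "(\<delta> / 2)\<^sup>2 \<le> (cmod (\<zeta> - z))\<^sup>2" using assms by (intro power_mono) auto
  moreover have "0 \<le> 1 - (cmod z)\<^sup>2" using assms by (simp add: power_le_one)
  ultimately have "poisson_kernel z \<zeta> \<le> (1 - (cmod z)\<^sup>2) / (\<delta> / 2)\<^sup>2"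
    unfolding poisson_kernel_def using assms by (intro divide_left_mono mult_pos_pos) (auto intro: order_less_le_trans[rotated])
  then show ?thesis by (simp add: power_divide field_simps)
qed

lemma one_minus_norm_sq_le:
  assumes "cmod z \<le> 1" "cmod \<xi> = 1"
  shows "1 - (cmod z)\<^sup>2 \<le> 2 * cmod (z - \<xi>)"
proof -
  have "1 - cmod z \<le> cmod (z - \<xi>)" using norm_triangle_ineq3[of z \<xi>] assms by linarith
  moreover have "1 - (cmod z)\<^sup>2 = (1 - cmod z) * (1 + cmod z)" by (simp add: power2_eq_square algebra_simps)
  moreover have "(1 - cmod z) * (1 + cmod z) \<le> (1 - cmod z) * 2" using assms by (intro mult_left_mono) auto
  moreover have "(1 - cmod z) * 2 \<le> 2 * cmod (z - \<xi>)" using calculation(1) by simp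
  ultimately show ?thesis by (metis order_trans)
qed

text \<open>
  The Poisson kernel has mean \<open>1\<close>, and far from \<open>\<xi>\<close> it is bounded by \<open>4 (1 - |z|\<^sup>2) / \<delta>\<^sup>2\<close> for \<open>z\<close> near \<open>\<xi>\<close>.
\<close>

lemma poisson_localized_bound:
  fixes \<phi> :: "complex \<Rightarrow> real"
  assumes \<phi>: "bdd_circ \<phi>" "\<And>\<zeta>. cmod \<zeta> = 1 \<Longrightarrow> 0 \<le> \<phi> \<zeta>" "\<And>\<zeta>. cmod \<zeta> = 1 \<Longrightarrow> \<phi> \<zeta> \<le> B"
    and near: "\<And>\<zeta>. cmod \<zeta> = 1 \<Longrightarrow> cmod (\<zeta> - \<xi>) < \<delta> \<Longrightarrow> \<phi> \<zeta> \<le> e"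
    and z: "cmod z < 1" "\<delta> > 0" "cmod (z - \<xi>) \<le> \<delta> / 2" and e: "0 \<le> e"
  shows "poisson \<phi> z \<le> e + 4 * (1 - (cmod z)\<^sup>2) / \<delta>\<^sup>2 * B"
proof -
  let ?K = "4 * (1 - (cmod z)\<^sup>2) / \<delta>\<^sup>2"
  have K0: "0 \<le> ?K" using z by (simp add: power_le_one)
  have B0: "0 \<le> B" using \<phi>(2,3)[of 1] by simp
  have pt: "poisson_kernel z \<zeta> *\<^sub>R \<phi> \<zeta> \<le> poisson_kernel z \<zeta> *\<^sub>R e + ?K * B" if "cmod \<zeta> = 1" for \<zeta>
  proof (cases "cmod (\<zeta> - \<xi>) < \<delta>")
    case True
    have "poisson_kernel z \<zeta> * \<phi> \<zeta> \<le> poisson_kernel z \<zeta> * e"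
      by (intro mult_left_mono near that True poisson_kernel_nonneg z)
    then show ?thesis using mult_nonneg_nonneg[OF K0 B0] by simp
  next
    case False
    then have "poisson_kernel z \<zeta> * \<phi> \<zeta> \<le> ?K * B"
      by (intro mult_mono poisson_kernel_far[of z \<delta> \<xi>] \<phi> z K0 that) auto
    moreover have "0 \<le> poisson_kernel z \<zeta> * e" using poisson_kernel_nonneg[OF z(1)] e by simp
    ultimately show ?thesis by simp
  qed
  have i: "integrable circ (\<lambda>\<zeta>. poisson_kernel z \<zeta> *\<^sub>R e)"
    by (rule poisson_integrable[OF bdd_circ_const z(1)])
  have "integral\<^sup>L circ (\<lambda>\<zeta>. poisson_kernel z \<zeta> *\<^sub>R \<phi> \<zeta>) \<le> integral\<^sup>L circ (\<lambda>\<zeta>. poisson_kernel z \<zeta> *\<^sub>R e + ?K * B)"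
    by (rule integral_mono[OF poisson_integrable[OF \<phi>(1) z(1)]]) (use pt i in auto)
  also have "\<dots> = integral\<^sup>L circ (\<lambda>\<zeta>. poisson_kernel z \<zeta> *\<^sub>R e) + 2 * pi * (?K * B)"
    by (subst Bochner_Integration.integral_add[OF i]) (auto simp: measure_circ)
  finally have "poisson \<phi> z \<le> poisson (\<lambda>_. e) z + ?K * B"
    unfolding poisson_def by (simp add: field_simps)
  then show ?thesis using poisson_const[OF z(1), of e] by simp
qed

lemma continuous_poisson_interior:
  assumes "bdd_circ F" shows "continuous_on (ball 0 1) (poisson F :: complex \<Rightarrow> complex)"
proof -
  have "continuous_on (ball 0 1) (\<lambda>z. cauchy_transform F z + cnj (cauchy_transform (\<lambda>\<zeta>. cnj (F \<zeta>)) z) - cauchy_transform F 0)"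
    by (intro continuous_intros holomorphic_on_imp_continuous_on holomorphic_cauchy_transform assms bdd_circ_cnj)
  then show ?thesis
    by (rule continuous_on_eq) (use poisson_eq_cauchy[OF assms] in auto)
qed

text \<open>
  The Dirichlet problem: near \<open>\<xi>\<close> the Poisson integral of \<open>|F - F \<xi>|\<close> is small by
  \<open>poisson_localized_bound\<close>.
\<close>

lemma continuous_poisson_extension:
  fixes F :: "complex \<Rightarrow> real"
  assumes F: "continuous_on (sphere 0 1) F"
  shows "continuous_on (cball 0 1) (\<lambda>z. if cmod z < 1 then poisson F z else F z)"
    (is "continuous_on _ ?H")
proof -
  have Fb: "bdd_circ F" by (rule bdd_circ_continuous[OF F])
  obtain B where B: "B \<ge> 0" "\<And>\<zeta>. cmod \<zeta> = 1 \<Longrightarrow> norm (F \<zeta>) \<le> B" using bdd_circ_bound Fb by metis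
  have "continuous_on (ball 0 1) (\<lambda>z. Re (poisson (\<lambda>\<zeta>. complex_of_real (F \<zeta>)) z))"
    by (intro continuous_intros continuous_poisson_interior bdd_circ_of_real Fb)
  then have int: "continuous_on (ball 0 1) ?H"
    by (rule continuous_on_eq) (auto simp: poisson_of_real)
  show ?thesis unfolding continuous_on_eq_continuous_within
  proof
    fix \<xi> :: complex assume z0: "\<xi> \<in> cball 0 1"
    show "continuous (at \<xi> within cball 0 1) ?H"
    proof (cases "cmod \<xi> < 1")
      case True
      then have "isCont ?H \<xi>" using int by (simp add: continuous_on_eq_continuous_at)
      then show ?thesis by (rule continuous_at_imp_continuous_at_within)
    next
      case False
      then have z1: "cmod \<xi> = 1" using z0 by simp
      show ?thesis unfolding continuous_within_eps_delta
      proof (intro allI impI)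
        fix e :: real assume e: "0 < e"
        obtain \<delta> where \<delta>: "\<delta> > 0" "\<And>\<zeta>. cmod \<zeta> = 1 \<Longrightarrow> dist \<zeta> \<xi> < \<delta> \<Longrightarrow> dist (F \<zeta>) (F \<xi>) < e / 2"
          using F z1 e unfolding continuous_on_iff by (metis half_gt_zero mem_sphere_0)
        define K where "K = 4 * 2 / \<delta>\<^sup>2 * (2 * B) + 1"
        have K: "K > 0" unfolding K_def using B \<delta> by (intro add_nonneg_pos) auto
        define d where "d = min (\<delta> / 2) (e / (2 * K))"
        have d: "d > 0" unfolding d_def using \<delta> e K by auto
        show "\<exists>d>0. \<forall>x'\<in>cball 0 1. dist x' \<xi> < d \<longrightarrow> dist (?H x') (?H \<xi>) < e"
        proof (intro exI[of _ d] conjI ballI impI d)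
          fix z :: complex assume z: "z \<in> cball 0 1" "dist z \<xi> < d"
          show "dist (?H z) (?H \<xi>) < e"
          proof (cases "cmod z < 1")
            case True
            have "norm (poisson F z - F \<xi>) \<le> poisson (\<lambda>\<zeta>. norm (F \<zeta> - F \<xi>)) z"
              by (rule norm_poisson_diff_le[OF Fb True])
            also have "\<dots> \<le> e / 2 + 4 * (1 - (cmod z)\<^sup>2) / \<delta>\<^sup>2 * (2 * B)"
            proof (rule poisson_localized_bound[where \<xi> = \<xi>])
              show "bdd_circ (\<lambda>\<zeta>. norm (F \<zeta> - F \<xi>))" by (rule bdd_circ_norm_diff[OF Fb])
              show "norm (F \<zeta> - F \<xi>) \<le> 2 * B" if "cmod \<zeta> = 1" for \<zeta>
                using B(2)[OF that] B(2)[OF z1] by simp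
              show "norm (F \<zeta> - F \<xi>) \<le> e / 2" if "cmod \<zeta> = 1" "cmod (\<zeta> - \<xi>) < \<delta>" for \<zeta>
                using \<delta>(2)[OF that(1)] that(2) by (simp add: dist_norm)
            qed (use True e \<delta> z in \<open>auto simp: d_def dist_norm\<close>)
            also have "4 * (1 - (cmod z)\<^sup>2) / \<delta>\<^sup>2 * (2 * B) \<le> 4 * (2 * cmod (z - \<xi>)) / \<delta>\<^sup>2 * (2 * B)"
              by (intro mult_right_mono divide_right_mono mult_left_mono one_minus_norm_sq_le z1) (use True B in auto)
            also have "\<dots> \<le> K * cmod (z - \<xi>)" unfolding K_def by (simp add: algebra_simps)
            also have "\<dots> < K * (e / (2 * K))" using z K by (intro mult_strict_left_mono) (auto simp: d_def dist_norm)
            also have "\<dots> = e / 2" using K by simp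
            finally show ?thesis using True z1 by (simp add: dist_norm)
          next
            case False
            then have "cmod z = 1" using z by simp
            moreover have "dist z \<xi> < \<delta>" using z \<delta>(1) by (simp add: d_def)
            ultimately show ?thesis using \<delta>(2)[of z] z1 e by auto
          qed
        qed
      qed
    qed
  qed
qed

text \<open>
  The Schwarz (Herglotz) integral: the holomorphic function with real part \<open>poisson \<beta>\<close> that is real at \<open>0\<close>.
\<close>

definition schwarz :: "(complex \<Rightarrow> real) \<Rightarrow> complex \<Rightarrow> complex" where
  "schwarz \<beta> z = 2 * cauchy_transform (\<lambda>\<zeta>. of_real (\<beta> \<zeta>)) z - cauchy_transform (\<lambda>\<zeta>. of_real (\<beta> \<zeta>)) 0"

lemma holomorphic_schwarz: "bdd_circ \<beta> \<Longrightarrow> schwarz \<beta> holomorphic_on ball 0 1"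
  unfolding schwarz_def
  by (intro holomorphic_intros holomorphic_cauchy_transform bdd_circ_of_real) auto

lemma Re_schwarz:
  assumes "bdd_circ \<beta>" "cmod z < 1" shows "Re (schwarz \<beta> z) = poisson \<beta> z"
proof -
  have E: "cauchy_transform (\<lambda>\<zeta>. of_real (\<beta> \<zeta>)) z + cnj (cauchy_transform (\<lambda>\<zeta>. of_real (\<beta> \<zeta>)) z)
      - cauchy_transform (\<lambda>\<zeta>. of_real (\<beta> \<zeta>)) 0 = of_real (poisson \<beta> z)"
    using poisson_eq_cauchy[OF bdd_circ_of_real[OF assms(1)] assms(2)] poisson_of_real[of \<beta> z] by simp
  show ?thesis using arg_cong[OF E, of Re] by (simp add: schwarz_def)
qed

text \<open>
  On a smaller disc the kernel is bounded, so the mean of \<open>\<beta>\<close> alone controls the integral, however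
  large \<open>\<beta>\<close> is.
\<close>

lemma norm_schwarz_le:
  assumes \<beta>: "bdd_circ \<beta>" "\<And>\<zeta>. cmod \<zeta> = 1 \<Longrightarrow> 0 \<le> \<beta> \<zeta>" and z: "cmod z \<le> R" "R < 1"
  shows "cmod (schwarz \<beta> z) \<le> 3 / (1 - R) * (integral\<^sup>L circ \<beta> / (2 * pi))"
proof -
  let ?m = "integral\<^sup>L circ \<beta> / (2 * pi)"
  have m0: "0 \<le> integral\<^sup>L circ \<beta>" by (rule integral_nonneg_AE) (use \<beta>(2) in auto)
  have R0: "0 \<le> R" using z norm_ge_zero order_trans by blast
  have z1: "cmod z < 1" using z by simp
  have i: "integrable circ (\<lambda>\<zeta>. of_real (\<beta> \<zeta>) * (\<zeta> / (\<zeta> - z)))"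
    by (intro bdd_circ_integrable bdd_circ_mult bdd_circ_of_real \<beta> bdd_circ_cauchy_kernel z1)
  have "norm (integral\<^sup>L circ (\<lambda>\<zeta>. of_real (\<beta> \<zeta>) * (\<zeta> / (\<zeta> - z)))) \<le> integral\<^sup>L circ (\<lambda>\<zeta>. norm (of_real (\<beta> \<zeta>) * (\<zeta> / (\<zeta> - z))))"
    by (rule integral_norm_bound)
  also have "\<dots> \<le> integral\<^sup>L circ (\<lambda>\<zeta>. \<beta> \<zeta> * (1 / (1 - R)))"
  proof (rule integral_mono)
    show "integrable circ (\<lambda>\<zeta>. norm (of_real (\<beta> \<zeta>) * (\<zeta> / (\<zeta> - z))))" using i by (rule integrable_norm)
    show "integrable circ (\<lambda>\<zeta>. \<beta> \<zeta> * (1 / (1 - R)))" using bdd_circ_integrable[OF \<beta>(1)] by simp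
    fix \<zeta> assume "\<zeta> \<in> space circ"
    then have z1: "cmod \<zeta> = 1" by simp
    have "1 - R \<le> cmod (\<zeta> - z)" using norm_triangle_ineq2[of \<zeta> z] z z1 by linarith
    then have "1 / cmod (\<zeta> - z) \<le> 1 / (1 - R)" using z by (intro divide_left_mono mult_pos_pos) auto
    then have "\<beta> \<zeta> * (1 / cmod (\<zeta> - z)) \<le> \<beta> \<zeta> * (1 / (1 - R))" using \<beta>(2)[OF z1] by (rule mult_left_mono)
    then show "norm (of_real (\<beta> \<zeta>) * (\<zeta> / (\<zeta> - z))) \<le> \<beta> \<zeta> * (1 / (1 - R))"
      using \<beta>(2)[OF z1] z1 by (simp add: norm_mult norm_divide)
  qed
  also have "\<dots> = integral\<^sup>L circ \<beta> / (1 - R)" by simp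
  finally have 1: "cmod (cauchy_transform (\<lambda>\<zeta>. of_real (\<beta> \<zeta>)) z) \<le> ?m / (1 - R)"
    using divide_right_mono[of _ "integral\<^sup>L circ \<beta> / (1 - R)" "2 * pi"]
    by (simp add: cauchy_transform_def norm_divide mult.commute)
  have 2: "cmod (cauchy_transform (\<lambda>\<zeta>. of_real (\<beta> \<zeta>)) 0) = ?m"
    unfolding cauchy_transform_0 using m0 by (simp add: norm_divide)
  have 3: "cmod (schwarz \<beta> z) \<le> 2 * (?m / (1 - R)) + ?m"
  proof -
    have "cmod (schwarz \<beta> z) \<le> cmod (2 * cauchy_transform (\<lambda>\<zeta>. of_real (\<beta> \<zeta>)) z)
        + cmod (cauchy_transform (\<lambda>\<zeta>. of_real (\<beta> \<zeta>)) 0)"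
      unfolding schwarz_def by (rule norm_triangle_ineq4)
    also have "cmod (2 * cauchy_transform (\<lambda>\<zeta>. of_real (\<beta> \<zeta>)) z) \<le> 2 * (?m / (1 - R))"
      using 1 by (simp only: norm_mult norm_numeral)
    finally show ?thesis by (simp only: 2)
  qed
  have "?m * (1 - R) \<le> ?m * 1" using m0 R0 by (intro mult_left_mono) auto
  then have "?m \<le> ?m / (1 - R)" using z by (simp add: pos_le_divide_eq)
  moreover have "b \<le> a \<Longrightarrow> x \<le> 2 * a + b \<Longrightarrow> x \<le> 3 * a" for a b x :: real by linarith
  ultimately have "cmod (schwarz \<beta> z) \<le> 3 * (?m / (1 - R))" using 3 by blast
  also have "3 * (?m / (1 - R)) = 3 / (1 - R) * ?m"
  proof -
    have "a * (m / b) = a / b * m" for a b m :: real by simp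
    then show ?thesis .
  qed
  finally show ?thesis .
qed

text \<open>
  The coefficients of the antiholomorphic part of the Poisson integral are the moments of \<open>F\<close>, up to
  conjugation.
\<close>

lemma poisson_holomorphic_of_moments:
  assumes F: "bdd_circ F" and mom: "\<And>k. integral\<^sup>L circ (\<lambda>\<zeta>. F \<zeta> * \<zeta> ^ k) = 0"
  shows "(poisson F) holomorphic_on ball 0 1" "poisson F 0 = 0" "bounded (poisson F ` ball 0 1)"
proof -
  have F0: "cauchy_transform F 0 = 0" using mom[of 0] by (simp add: cauchy_transform_0)
  have eq: "poisson F z = cauchy_transform F z" if z: "cmod z < 1" for z
  proof -
    have "integral\<^sup>L circ (\<lambda>\<zeta>. cnj (F \<zeta>) * cnj \<zeta> ^ k) = 0" for k
    proof -
      have "integral\<^sup>L circ (\<lambda>\<zeta>. cnj (F \<zeta> * \<zeta> ^ k)) = 0"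
        using Bochner_Integration.integral_cnj[of circ "\<lambda>\<zeta>. F \<zeta> * \<zeta> ^ k"] mom[of k] by simp
      then show ?thesis by simp
    qed
    then have "(\<lambda>k. 0) sums integral\<^sup>L circ (\<lambda>\<zeta>. cnj (F \<zeta>) * (\<zeta> / (\<zeta> - z)))"
      using sums_cauchy_transform[OF bdd_circ_cnj[OF F] z] by simp
    then have "cauchy_transform (\<lambda>\<zeta>. cnj (F \<zeta>)) z = 0"
      unfolding cauchy_transform_def by (simp add: sums_iff)
    then show ?thesis using poisson_eq_cauchy[OF F z] F0 by simp
  qed
  show "(poisson F) holomorphic_on ball 0 1"
    by (rule holomorphic_transform[OF holomorphic_cauchy_transform[OF F]]) (use eq in auto)
  show "poisson F 0 = 0" using eq[of 0] F0 by simp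
  obtain B where B: "B \<ge> 0" "\<And>\<zeta>. cmod \<zeta> = 1 \<Longrightarrow> norm (F \<zeta>) \<le> B" using bdd_circ_bound F by metis
  have "norm (poisson F z) \<le> B" if "cmod z < 1" for z
  proof -
    have "norm (poisson F z) \<le> poisson (\<lambda>\<zeta>. norm (F \<zeta>)) z" by (rule norm_poisson_le[OF F that])
    also have "\<dots> \<le> poisson (\<lambda>_. B) z"
      by (rule poisson_mono[OF bdd_circ_norm[OF F] bdd_circ_const that]) (use B in auto)
    finally show ?thesis using poisson_const[OF that, of B] by simp
  qed
  then show "bounded (poisson F ` ball 0 1)" unfolding bounded_iff by (intro exI[of _ B]) auto
qed

section \<open>Fatou's theorem\<close>

text \<open>
  Lebesgue points, approached from one side.  The differentiation theorem for a single integrand is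
  applied to the countably many functions \<open>|G - c|\<close> with \<open>c\<close> in a dense set.
\<close>

lemma lebesgue_points_right:
  fixes G :: "real \<Rightarrow> complex"
  assumes Gm [measurable]: "G \<in> borel_measurable borel" and Gb: "\<And>x. cmod (G x) \<le> B"
  shows "\<exists>N. negligible N \<and> (\<forall>x. x \<notin> N \<longrightarrow> (\<forall>e>0. \<exists>\<delta>>0. \<forall>t. 0 < t \<and> t \<le> \<delta> \<longrightarrow>
           (\<integral>\<^sup>+\<tau>. ennreal (cmod (G (x + \<tau>) - G x)) * indicator {0<..t} \<tau> \<partial>lborel) \<le> ennreal (e * t)))"
proof -
  define f where "f = (\<lambda>c x. cmod (G x - c))"
  have fm [measurable]: "f c \<in> borel_measurable borel" for c unfolding f_def by measurable
  have fb: "norm (f c x) \<le> B + cmod c" for c x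
    unfolding f_def using norm_triangle_ineq4[of "G x" c] Gb[of x] by simp
  have si: "set_integrable lborel {a..b} (f c)" for a b c
    unfolding set_integrable_def
    by (rule integrableI_bounded_set_indicator[where B = "B + cmod c"]) (use fb in \<open>auto simp: emeasure_lborel_Icc_eq\<close>)
  have io: "f c integrable_on cbox a b" for a b c
    using set_borel_integral_eq_integral(1)[OF si[of a b c]] by simp
  have "\<exists>N. negligible N \<and> (\<forall>x e. x \<notin> N \<longrightarrow> 0 < e \<longrightarrow>
         (\<exists>d>0. \<forall>h. 0 < h \<and> h < d \<longrightarrow> \<bar>integral {x..x + h} (f c) / h - f c x\<bar> < e))" for c
  proof -
    obtain N where N: "negligible N" "\<And>x e. \<lbrakk>x \<notin> N; 0 < e\<rbrakk> \<Longrightarrow>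
         \<exists>d>0. \<forall>h. 0 < h \<and> h < d \<longrightarrow> norm (integral (cbox x (x + h *\<^sub>R One)) (f c) /\<^sub>R h ^ DIM(real) - f c x) < e"
      using integrable_ccontinuous_explicit[OF io[of c]] by metis
    have "\<forall>x e. x \<notin> N \<longrightarrow> 0 < e \<longrightarrow>
         (\<exists>d>0. \<forall>h. 0 < h \<and> h < d \<longrightarrow> \<bar>integral {x..x + h} (f c) / h - f c x\<bar> < e)"
      using N(2) by (simp add: divide_inverse mult.commute)
    with N(1) show ?thesis by blast
  qed
  then obtain N where N: "\<And>c. negligible (N c)" "\<And>c x e. x \<notin> N c \<Longrightarrow> 0 < e \<Longrightarrow>
         (\<exists>d>0. \<forall>h. 0 < h \<and> h < d \<longrightarrow> \<bar>integral {x..x + h} (f c) / h - f c x\<bar> < e)"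
    by metis
  obtain C :: "complex set" where C: "countable C" "\<And>X. open X \<Longrightarrow> X \<noteq> {} \<Longrightarrow> \<exists>c\<in>C. c \<in> X"
    using countable_dense_setE by blast
  have "negligible (\<Union>c\<in>C. N c)"
    by (rule negligible_countable_Union) (use C N in auto)
  moreover have "\<exists>\<delta>>0. \<forall>t. 0 < t \<and> t \<le> \<delta> \<longrightarrow>
           (\<integral>\<^sup>+\<tau>. ennreal (cmod (G (x + \<tau>) - G x)) * indicator {0<..t} \<tau> \<partial>lborel) \<le> ennreal (e * t)"
    if x: "x \<notin> (\<Union>c\<in>C. N c)" and e: "e > 0" for x e
  proof -
    obtain c where c: "c \<in> C" "c \<in> ball (G x) (e / 4)" using C(2)[of "ball (G x) (e/4)"] e by auto
    then obtain d where d: "d > 0" "\<And>h. 0 < h \<Longrightarrow> h < d \<Longrightarrow> \<bar>integral {x..x + h} (f c) / h - f c x\<bar> < e / 4"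
      using N(2)[of x c "e / 4"] x e by auto
    show ?thesis
    proof (intro exI[of _ "d / 2"] conjI allI impI)
      fix t assume t: "0 < t \<and> t \<le> d / 2"
      have fcx: "f c x < e / 4" using c by (simp add: f_def dist_norm)
      have "\<bar>integral {x..x + t} (f c) / t - f c x\<bar> < e / 4" by (rule d(2)) (use t d(1) in auto)
      then have "integral {x..x + t} (f c) / t < e / 2" using fcx by linarith
      then have I: "integral {x..x + t} (f c) \<le> e / 2 * t" using t by (simp add: field_simps)
      have si': "set_integrable lborel {x..x+t} (\<lambda>\<theta>. f c \<theta> + e / 4)"
        by (intro set_integral_add si)
           (auto simp: set_integrable_def emeasure_lborel_Icc_eq intro!: integrableI_bounded_set_indicator[where B = "\<bar>e / 4\<bar>", unfolded real_scaleR_def])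
      have "(\<integral>\<^sup>+\<tau>. ennreal (cmod (G (x + \<tau>) - G x)) * indicator {0<..t} \<tau> \<partial>lborel)
          = (\<integral>\<^sup>+\<theta>. ennreal (cmod (G \<theta> - G x)) * indicator {0<..t} (\<theta> - x) \<partial>lborel)"
        by (subst (2) nn_integral_real_affine[where c = 1 and t = x]) auto
      also have "\<dots> \<le> (\<integral>\<^sup>+\<theta>. ennreal (indicator {x..x+t} \<theta> *\<^sub>R (f c \<theta> + e / 4)) \<partial>lborel)"
      proof (rule nn_integral_mono)
        fix \<theta>
        have "cmod (G \<theta> - G x) \<le> f c \<theta> + e / 4"
          using norm_triangle_ineq4[of "G \<theta> - c" "G x - c"] fcx by (simp add: f_def)
        then show "ennreal (cmod (G \<theta> - G x)) * indicator {0<..t} (\<theta> - x)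
            \<le> ennreal (indicator {x..x+t} \<theta> *\<^sub>R (f c \<theta> + e / 4))"
          by (auto simp: indicator_def intro!: ennreal_leI)
      qed
      also have "\<dots> = ennreal (LINT \<theta>:{x..x+t}|lborel. f c \<theta> + e / 4)"
        unfolding set_lebesgue_integral_def
        by (rule nn_integral_eq_integral)
           (use si' e in \<open>auto simp: set_integrable_def f_def indicator_def\<close>)
      also have "(LINT \<theta>:{x..x+t}|lborel. f c \<theta> + e / 4) = (LINT \<theta>:{x..x+t}|lborel. f c \<theta>) + e / 4 * t"
      proof (subst set_integral_add(2)[OF si])
        show "set_integrable lborel {x..x + t} (\<lambda>\<theta>. e / 4)"
          unfolding set_integrable_def
          by (rule integrableI_bounded_set_indicator[where B = "\<bar>e / 4\<bar>"]) (auto simp: emeasure_lborel_Icc_eq)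
        have "(LINT \<theta>:{x..x + t}|lborel. e / 4) = e / 4 * t"
          using t by (simp add: set_lebesgue_integral_def)
        then show "(LINT \<theta>:{x..x + t}|lborel. f c \<theta>) + (LINT \<theta>:{x..x + t}|lborel. e / 4) =
            (LINT \<theta>:{x..x + t}|lborel. f c \<theta>) + e / 4 * t" by simp
      qed
      also have "(LINT \<theta>:{x..x+t}|lborel. f c \<theta>) = integral {x..x + t} (f c)"
        by (rule set_borel_integral_eq_integral(2)[OF si])
      also have "ennreal (integral {x..x + t} (f c) + e / 4 * t) \<le> ennreal (e * t)"
      proof (rule ennreal_leI)
        have "e / 2 * t + e / 4 * t \<le> e * t" using t e by (simp add: field_simps)
        then show "integral {x..x + t} (f c) + e / 4 * t \<le> e * t" using I by linarith
      qed
      finally show "(\<integral>\<^sup>+\<tau>. ennreal (cmod (G (x + \<tau>) - G x)) * indicator {0<..t} \<tau> \<partial>lborel) \<le> ennreal (e * t)" .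
    qed (use d in auto)
  qed
  ultimately show ?thesis by blast
qed

text \<open>
  The kernel is a superposition of indicators of initial intervals:
  \<open>d / (d\<^sup>2 + \<tau>\<^sup>2)\<close> is the integral of \<open>w(t) = 2 t d / (d\<^sup>2 + t\<^sup>2)\<^sup>2\<close> over \<open>t \<ge> \<tau>\<close>.  Hence bounds for averages over
  \<open>(0, t]\<close> pass to the kernel, and the constant is at most the integral of \<open>2 d / (d\<^sup>2 + t\<^sup>2)\<close>, which is \<open>\<pi>\<close>.
\<close>

lemma cauchy_kernel_average_bound:
  fixes \<phi> :: "real \<Rightarrow> real"
  assumes \<phi>m [measurable]: "\<phi> \<in> borel_measurable borel" and \<phi>0: "\<And>\<tau>. 0 \<le> \<phi> \<tau>" and d: "d > 0" and e: "e \<ge> 0"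
    and avg: "\<And>t. t > 0 \<Longrightarrow> (\<integral>\<^sup>+\<tau>. ennreal (\<phi> \<tau>) * indicator {0<..t} \<tau> \<partial>lborel) \<le> ennreal (e * t)"
  shows "(\<integral>\<^sup>+\<tau>. ennreal (d / (d\<^sup>2 + \<tau>\<^sup>2) * \<phi> \<tau>) * indicator {0<..} \<tau> \<partial>lborel) \<le> ennreal (e * pi)"
proof -
  define w where "w = (\<lambda>t::real. 2 * t * d / (d\<^sup>2 + t\<^sup>2)\<^sup>2)"
  have [measurable]: "w \<in> borel_measurable borel" unfolding w_def by measurable
  have pos: "d\<^sup>2 + t\<^sup>2 > 0" for t using d by (simp add: add_pos_nonneg)
  have k: "(\<integral>\<^sup>+t. ennreal (w t) * indicator {\<tau>..} t \<partial>lborel) = ennreal (d / (d\<^sup>2 + \<tau>\<^sup>2))" if "\<tau> > 0" for \<tau>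
  proof -
    have "((\<lambda>t. - d / (d\<^sup>2 + t\<^sup>2)) \<longlongrightarrow> 0) at_top"
      by (intro real_tendsto_divide_at_top[OF tendsto_const] filterlim_tendsto_add_at_top[OF tendsto_const]
            filterlim_pow_at_top filterlim_ident) auto
    then have "(\<integral>\<^sup>+t. ennreal (w t) * indicator {\<tau>..} t \<partial>lborel) = 0 - (- d / (d\<^sup>2 + \<tau>\<^sup>2))"
    proof (intro nn_integral_FTC_atLeast)
      fix t assume "\<tau> \<le> t"
      show "((\<lambda>t. - d / (d\<^sup>2 + t\<^sup>2)) has_real_derivative w t) (at t)"
        unfolding w_def using pos[of t]
        by (auto intro!: derivative_eq_intros simp: power2_eq_square)
      show "0 \<le> w t" using that \<open>\<tau> \<le> t\<close> d by (simp add: w_def)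
    qed auto
    then show ?thesis by simp
  qed
  have "(\<integral>\<^sup>+\<tau>. ennreal (d / (d\<^sup>2 + \<tau>\<^sup>2) * \<phi> \<tau>) * indicator {0<..} \<tau> \<partial>lborel)
      = (\<integral>\<^sup>+\<tau>. (\<integral>\<^sup>+t. ennreal (w t) * indicator {\<tau>..} t * (ennreal (\<phi> \<tau>) * indicator {0<..} \<tau>) \<partial>lborel) \<partial>lborel)"
  proof (rule nn_integral_cong)
    fix \<tau> :: real
    have "(\<integral>\<^sup>+t. ennreal (w t) * indicator {\<tau>..} t * (ennreal (\<phi> \<tau>) * indicator {0<..} \<tau>) \<partial>lborel)
        = (\<integral>\<^sup>+t. ennreal (w t) * indicator {\<tau>..} t \<partial>lborel) * (ennreal (\<phi> \<tau>) * indicator {0<..} \<tau>)"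
      by (rule nn_integral_multc) measurable
    also have "\<dots> = ennreal (d / (d\<^sup>2 + \<tau>\<^sup>2) * \<phi> \<tau>) * indicator {0<..} \<tau>"
    proof (cases "\<tau> > 0")
      case True
      have "ennreal (d / (d\<^sup>2 + \<tau>\<^sup>2) * \<phi> \<tau>) = ennreal (d / (d\<^sup>2 + \<tau>\<^sup>2)) * ennreal (\<phi> \<tau>)"
        using d pos[of \<tau>] by (intro ennreal_mult') auto
      moreover have "indicator {0<..} \<tau> = (1::ennreal)" using True by simp
      ultimately show ?thesis by (simp only: k[OF True] mult_1_right)
    qed simp
    finally show "ennreal (d / (d\<^sup>2 + \<tau>\<^sup>2) * \<phi> \<tau>) * indicator {0<..} \<tau>
        = (\<integral>\<^sup>+t. ennreal (w t) * indicator {\<tau>..} t * (ennreal (\<phi> \<tau>) * indicator {0<..} \<tau>) \<partial>lborel)" by simp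
  qed
  also have "\<dots> = (\<integral>\<^sup>+\<tau>. (\<integral>\<^sup>+t. (if \<tau> \<le> t then ennreal (w t) else 0) * (ennreal (\<phi> \<tau>) * indicator {0<..} \<tau>) \<partial>lborel) \<partial>lborel)"
    by (intro nn_integral_cong) (auto simp: indicator_def)
  also have "\<dots> = (\<integral>\<^sup>+t. (\<integral>\<^sup>+\<tau>. (if \<tau> \<le> t then ennreal (w t) else 0) * (ennreal (\<phi> \<tau>) * indicator {0<..} \<tau>) \<partial>lborel) \<partial>lborel)"
    by (rule lborel_pair.Fubini') measurable
  also have "\<dots> \<le> (\<integral>\<^sup>+t. ennreal e * (ennreal (2 * d / (d\<^sup>2 + t\<^sup>2)) * indicator {0..} t) \<partial>lborel)"
  proof (rule nn_integral_mono)
    fix t :: real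
    have eq: "(\<integral>\<^sup>+\<tau>. (if \<tau> \<le> t then ennreal (w t) else 0) * (ennreal (\<phi> \<tau>) * indicator {0<..} \<tau>) \<partial>lborel)
        = ennreal (w t) * (\<integral>\<^sup>+\<tau>. ennreal (\<phi> \<tau>) * indicator {0<..t} \<tau> \<partial>lborel)"
      by (subst nn_integral_cmult[symmetric]) (auto intro!: nn_integral_cong simp: indicator_def)
    show "(\<integral>\<^sup>+\<tau>. (if \<tau> \<le> t then ennreal (w t) else 0) * (ennreal (\<phi> \<tau>) * indicator {0<..} \<tau>) \<partial>lborel)
        \<le> ennreal e * (ennreal (2 * d / (d\<^sup>2 + t\<^sup>2)) * indicator {0..} t)"
    proof (cases "t > 0")
      case True
      have w0: "0 \<le> w t" using True d by (simp add: w_def)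
      have "w t * t \<le> 2 * d / (d\<^sup>2 + t\<^sup>2)"
      proof -
        have "w t * t = 2 * d / (d\<^sup>2 + t\<^sup>2) * (t\<^sup>2 / (d\<^sup>2 + t\<^sup>2))"
          by (simp add: w_def power2_eq_square)
        also have "\<dots> \<le> 2 * d / (d\<^sup>2 + t\<^sup>2) * 1"
          using pos[of t] d by (intro mult_left_mono) auto
        finally show ?thesis by simp
      qed
      from mult_left_mono[OF this e]
      have le: "w t * (e * t) \<le> e * (2 * d / (d\<^sup>2 + t\<^sup>2))" by (simp only: mult.left_commute)
      have "ennreal (w t) * (\<integral>\<^sup>+\<tau>. ennreal (\<phi> \<tau>) * indicator {0<..t} \<tau> \<partial>lborel) \<le> ennreal (w t) * ennreal (e * t)"
        by (intro mult_left_mono avg True) auto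
      also have "\<dots> = ennreal (w t * (e * t))" using w0 e True by (simp add: ennreal_mult')
      also have "\<dots> \<le> ennreal (e * (2 * d / (d\<^sup>2 + t\<^sup>2)))" by (rule ennreal_leI[OF le])
      also have "\<dots> = ennreal e * (ennreal (2 * d / (d\<^sup>2 + t\<^sup>2)) * indicator {0..} t)"
        using True ennreal_mult'[OF e, of "2 * d / (d\<^sup>2 + t\<^sup>2)"] by (simp only: indicator_simps atLeast_iff less_imp_le mult_1_right)
      finally show ?thesis unfolding eq .
    qed (simp add: eq)
  qed
  also have "\<dots> = ennreal e * (\<integral>\<^sup>+t. ennreal (2 * d / (d\<^sup>2 + t\<^sup>2)) * indicator {0..} t \<partial>lborel)"
    by (rule nn_integral_cmult) measurable
  also have "(\<integral>\<^sup>+t. ennreal (2 * d / (d\<^sup>2 + t\<^sup>2)) * indicator {0..} t \<partial>lborel) = ennreal (pi - 2 * arctan (0 / d))"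
  proof (rule nn_integral_FTC_atLeast)
    fix t :: real
    show "((\<lambda>t. 2 * arctan (t / d)) has_real_derivative 2 * d / (d\<^sup>2 + t\<^sup>2)) (at t)"
      using pos[of t] d by (auto intro!: derivative_eq_intros simp: field_simps power2_eq_square)
    show "0 \<le> 2 * d / (d\<^sup>2 + t\<^sup>2)" using d by simp
    have "filterlim (\<lambda>t. t / d) at_top at_top"
      using filterlim_tendsto_pos_mult_at_top[OF tendsto_const[of "1 / d"] _ filterlim_ident] d by simp
    then have "((\<lambda>t. arctan (t / d)) \<longlongrightarrow> pi / 2) at_top" by (rule filterlim_compose[OF tendsto_arctan_at_top])
    then show "((\<lambda>t. 2 * arctan (t / d)) \<longlongrightarrow> pi) at_top" using tendsto_mult[OF tendsto_const[of 2]] by fastforce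
  qed measurable
  finally show ?thesis using e by (simp add: ennreal_mult')
qed

lemma cauchy_kernel_local_bound:
  fixes H :: "real \<Rightarrow> complex"
  assumes Hm [measurable]: "H \<in> borel_measurable borel" and d: "d > 0" and e: "e \<ge> 0" and \<delta>: "\<delta> > 0"
    and avg: "\<And>t. 0 < t \<Longrightarrow> t \<le> \<delta> \<Longrightarrow>
      (\<integral>\<^sup>+\<tau>. ennreal (cmod (H (x + \<tau>) - H x)) * indicator {0<..t} \<tau> \<partial>lborel) \<le> ennreal (e * t)"
  shows "(\<integral>\<^sup>+\<tau>. ennreal (d / (d\<^sup>2 + \<tau>\<^sup>2) * cmod (H (x + \<tau>) - H x)) * indicator {0<..\<delta>} \<tau> \<partial>lborel) \<le> ennreal (e * pi)"
proof -
  define \<phi> where "\<phi> = (\<lambda>\<tau>. cmod (H (x + \<tau>) - H x) * indicator {0<..\<delta>} \<tau>)"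
  have "(\<integral>\<^sup>+\<tau>. ennreal (d / (d\<^sup>2 + \<tau>\<^sup>2) * cmod (H (x + \<tau>) - H x)) * indicator {0<..\<delta>} \<tau> \<partial>lborel)
      = (\<integral>\<^sup>+\<tau>. ennreal (d / (d\<^sup>2 + \<tau>\<^sup>2) * \<phi> \<tau>) * indicator {0<..} \<tau> \<partial>lborel)"
    by (intro nn_integral_cong) (auto simp: \<phi>_def indicator_def)
  also have "\<dots> \<le> ennreal (e * pi)"
  proof (rule cauchy_kernel_average_bound[OF _ _ d e])
    fix t :: real assume t: "t > 0"
    define t' where "t' = min t \<delta>"
    have "(\<integral>\<^sup>+\<tau>. ennreal (\<phi> \<tau>) * indicator {0<..t} \<tau> \<partial>lborel)
        = (\<integral>\<^sup>+\<tau>. ennreal (cmod (H (x + \<tau>) - H x)) * indicator {0<..t'} \<tau> \<partial>lborel)"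
      by (intro nn_integral_cong) (auto simp: \<phi>_def indicator_def t'_def)
    also have "\<dots> \<le> ennreal (e * t')" by (rule avg) (use t \<delta> in \<open>auto simp: t'_def\<close>)
    also have "\<dots> \<le> ennreal (e * t)" using e by (intro ennreal_leI mult_left_mono) (auto simp: t'_def)
    finally show "(\<integral>\<^sup>+\<tau>. ennreal (\<phi> \<tau>) * indicator {0<..t} \<tau> \<partial>lborel) \<le> ennreal (e * t)" .
  qed (auto simp: \<phi>_def)
  finally show ?thesis .
qed

lemma sin_ge_half:
  assumes "0 \<le> \<tau>" "\<tau> \<le> (1::real)" shows "\<tau> / 2 \<le> sin \<tau>"
proof -
  have "sin 0 - 0 / 2 \<le> sin \<tau> - \<tau> / 2"
  proof (rule DERIV_nonneg_imp_nondecreasing[OF assms(1), of "\<lambda>t. sin t - t / 2"])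
    fix x assume x: "0 \<le> x" "x \<le> \<tau>"
    have "x \<le> pi / 3" using x assms pi_gt3 by simp
    then have "cos (pi / 3) \<le> cos x" using x by (intro cos_monotone_0_pi_le) auto
    then show "\<exists>y. ((\<lambda>t. sin t - t / 2) has_real_derivative y) (at x) \<and> 0 \<le> y"
      by (intro exI[of _ "cos x - 1 / 2"]) (auto intro!: derivative_eq_intros simp: cos_60)
  qed
  then show ?thesis by simp
qed

text \<open>
  With \<open>t = \<theta> - x\<close>, the squared distance \<open>|cis \<theta> - r cis x|\<^sup>2\<close> is at least both \<open>(1 - r)\<^sup>2\<close> and \<open>sin\<^sup>2 t \<ge> t\<^sup>2 / 4\<close>,
  hence at least an eighth of \<open>(1 - r)\<^sup>2 + t\<^sup>2\<close>.
\<close>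

lemma poisson_kernel_near:
  assumes r: "0 < r" "r < 1" and \<tau>: "\<bar>\<theta> - x\<bar> \<le> 1"
  shows "poisson_kernel (of_real r * cis x) (cis \<theta>) \<le> 16 * ((1 - r) / ((1 - r)\<^sup>2 + (\<theta> - x)\<^sup>2))"
proof -
  let ?t = "\<theta> - x"
  have "cis \<theta> - of_real r * cis x = cis x * (cis ?t - of_real r)"
    by (simp add: algebra_simps cis_mult)
  then have "cmod (cis \<theta> - of_real r * cis x) = cmod (cis ?t - of_real r)" by (simp add: norm_mult)
  then have n: "(cmod (cis \<theta> - of_real r * cis x))\<^sup>2 = (cos ?t - r)\<^sup>2 + (sin ?t)\<^sup>2" by (simp add: cmod_power2)
  have "\<bar>?t\<bar> / 2 \<le> sin \<bar>?t\<bar>" by (rule sin_ge_half) (use \<tau> in auto)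
  then have "(\<bar>?t\<bar> / 2)\<^sup>2 \<le> (sin \<bar>?t\<bar>)\<^sup>2" by (intro power_mono) auto
  also have "(sin \<bar>?t\<bar>)\<^sup>2 = (sin ?t)\<^sup>2"
  proof -
    have "sin \<bar>?t\<bar> = sin ?t \<or> sin \<bar>?t\<bar> = - sin ?t" by (metis abs_if sin_minus)
    then show ?thesis by auto
  qed
  finally have a: "?t\<^sup>2 / 4 \<le> (sin ?t)\<^sup>2" by (simp add: power_divide)
  have "1 - r \<le> cmod (cis ?t - of_real r)" using norm_triangle_ineq2[of "cis ?t" "of_real r"] r by simp
  then have "(1 - r)\<^sup>2 \<le> (cmod (cis ?t - of_real r))\<^sup>2" using r by (intro power_mono) auto
  then have b: "(1 - r)\<^sup>2 \<le> (cos ?t - r)\<^sup>2 + (sin ?t)\<^sup>2" by (simp add: cmod_power2)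
  have nn: "0 \<le> (cos ?t - r)\<^sup>2" "0 \<le> (1 - r)\<^sup>2" "0 \<le> (sin ?t)\<^sup>2" by auto
  have c: "((1 - r)\<^sup>2 + ?t\<^sup>2) / 8 \<le> (cmod (cis \<theta> - of_real r * cis x))\<^sup>2"
  proof -
    have "t4 / 4 \<le> S \<Longrightarrow> D \<le> C + S \<Longrightarrow> 0 \<le> C \<Longrightarrow> 0 \<le> D \<Longrightarrow> 0 \<le> S \<Longrightarrow> (D + t4) / 8 \<le> C + S" for t4 :: real and S :: real and C :: real and D :: real by (simp add: field_simps)
    from this[OF a b nn] show ?thesis unfolding n .
  qed
  have p: "0 < (1 - r)\<^sup>2 + ?t\<^sup>2" using r by (intro add_pos_nonneg) auto
  have rr: "0 \<le> 1 - r\<^sup>2" "1 - r\<^sup>2 \<le> 2 * (1 - r)"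
    using r zero_le_power2[of "1 - r"] by (simp_all add: power_le_one power2_diff)
  have "poisson_kernel (of_real r * cis x) (cis \<theta>) = (1 - r\<^sup>2) / (cmod (cis \<theta> - of_real r * cis x))\<^sup>2"
    using r by (simp add: poisson_kernel_def norm_mult)
  also have "\<dots> \<le> (2 * (1 - r)) / (((1 - r)\<^sup>2 + ?t\<^sup>2) / 8)"
    by (rule frac_le) (use rr c p r in auto)
  finally show ?thesis by simp
qed

lemma measurable_circ_comp_cis:
  fixes F :: "complex \<Rightarrow> 'b::topological_space"
  assumes "F \<in> borel_measurable circ" shows "(\<lambda>\<theta>. F (cis \<theta>)) \<in> borel_measurable borel"
proof -
  have "F \<in> borel_measurable (restrict_space borel (sphere 0 1))" using assms by (simp add: circ_def)
  moreover have "cis \<in> borel \<rightarrow>\<^sub>M restrict_space borel (sphere 0 1)"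
    by (rule measurable_restrict_space2)
       (auto intro!: borel_measurable_continuous_onI continuous_on_cis continuous_on_id)
  ultimately show ?thesis by (rule measurable_compose[rotated])
qed

lemma cis_eq_imp_eq:
  assumes "cis \<theta> = cis x" "0 \<le> \<theta>" "\<theta> \<le> 2 * pi" "0 < x" "x < 2 * pi"
  shows "\<theta> = x"
proof -
  have "sin \<theta> = sin x \<and> cos \<theta> = cos x" using assms(1) by (metis cis.sel)
  then obtain n :: int where n: "\<theta> = x + 2 * pi * of_int n" using sin_cos_eq_iff[of \<theta> x] by auto
  have "\<bar>\<theta> - x\<bar> < 2 * pi" using assms by auto
  then have "2 * pi * \<bar>of_int n :: real\<bar> < 2 * pi * 1" unfolding n by (simp add: abs_mult)
  then have "\<bar>of_int n :: real\<bar> < 1" by (subst (asm) mult_less_cancel_left_pos) auto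
  then have "n = 0" by linarith
  then show ?thesis using n by simp
qed

text \<open>
  The exceptional points are those that fail to be Lebesgue points of \<open>\<theta> \<mapsto> F (cis \<theta>)\<close> from the right or
  from the left.  Close to a Lebesgue point the kernel is dominated by the one of
  \<open>cauchy_kernel_average_bound\<close>, and away from it the kernel tends to \<open>0\<close> uniformly.
\<close>

lemma poisson_radial_average_limit:
  assumes F: "bdd_circ F"
  shows "AE \<zeta> in circ. \<forall>e>0. \<exists>r0<1. \<forall>r. r0 < r \<and> r < 1 \<longrightarrow>
           poisson (\<lambda>\<eta>. cmod (F \<eta> - F \<zeta>)) (of_real r * \<zeta>) \<le> e"
proof -
  define G where "G = (\<lambda>\<theta>. F (cis \<theta>))"
  obtain B where B: "B \<ge> 0" "\<And>\<zeta>. cmod \<zeta> = 1 \<Longrightarrow> norm (F \<zeta>) \<le> B" using bdd_circ_bound F by metis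
  have Gm [measurable]: "G \<in> borel_measurable borel"
    unfolding G_def by (rule measurable_circ_comp_cis[OF bdd_circ_measurable[OF F]])
  have G'm [measurable]: "(\<lambda>x. G (- x)) \<in> borel_measurable borel" by measurable
  have Gb: "cmod (G x) \<le> B" for x unfolding G_def by (rule B(2)) simp
  obtain N1 where N1: "negligible N1" "\<forall>x. x \<notin> N1 \<longrightarrow> (\<forall>e>0. \<exists>\<delta>>0. \<forall>t. 0 < t \<and> t \<le> \<delta> \<longrightarrow>
           (\<integral>\<^sup>+\<tau>. ennreal (cmod (G (x + \<tau>) - G x)) * indicator {0<..t} \<tau> \<partial>lborel) \<le> ennreal (e * t))"
    using lebesgue_points_right[OF Gm, of B] Gb by auto

  \<comment> \<open>the left-hand Lebesgue points of \<open>G\<close> are the right-hand ones of \<open>\<lambda>x. G (- x)\<close>, reflected\<close>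
  obtain N2 where N2: "negligible N2" "\<forall>x. x \<notin> N2 \<longrightarrow> (\<forall>e>0. \<exists>\<delta>>0. \<forall>t. 0 < t \<and> t \<le> \<delta> \<longrightarrow>
           (\<integral>\<^sup>+\<tau>. ennreal (cmod (G (- (x + \<tau>)) - G (- x))) * indicator {0<..t} \<tau> \<partial>lborel) \<le> ennreal (e * t))"
    using lebesgue_points_right[OF G'm, of B] Gb by auto

  have "negligible (uminus ` N2)"
    by (rule negligible_differentiable_image_negligible[OF order_refl N2(1)])
       (auto intro: derivative_intros simp: differentiable_on_def)
  then have neg: "negligible (N1 \<union> uminus ` N2)" using N1 by auto
  show ?thesis
  proof (rule AE_circI[OF neg], intro allI impI)
    fix x e :: real assume x: "0 < x" "x < 2 * pi" "x \<notin> N1 \<union> uminus ` N2" and e: "0 < e"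
    have xN1: "x \<notin> N1" using x(3) by blast
    have xN2: "- x \<notin> N2" using x(3) by (metis UnI2 image_eqI minus_minus)
    define e' where "e' = e / 32"
    have e': "e' > 0" using e by (simp add: e'_def)
    obtain \<delta>1 where \<delta>1: "\<delta>1 > 0" "\<And>t. 0 < t \<Longrightarrow> t \<le> \<delta>1 \<Longrightarrow>
        (\<integral>\<^sup>+\<tau>. ennreal (cmod (G (x + \<tau>) - G x)) * indicator {0<..t} \<tau> \<partial>lborel) \<le> ennreal (e' * t)"
      using N1(2)[THEN spec, of x, THEN mp, OF xN1, THEN spec, of e', THEN mp, OF e'] by (elim exE conjE) auto
    obtain \<delta>2 where \<delta>2: "\<delta>2 > 0" "\<And>t. 0 < t \<Longrightarrow> t \<le> \<delta>2 \<Longrightarrow>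
        (\<integral>\<^sup>+\<tau>. ennreal (cmod (G (- (- x + \<tau>)) - G (- (- x)))) * indicator {0<..t} \<tau> \<partial>lborel) \<le> ennreal (e' * t)"
      using N2(2)[THEN spec, of "- x", THEN mp, OF xN2, THEN spec, of e', THEN mp, OF e'] by (elim exE conjE) auto
    define \<delta> where "\<delta> = min (min \<delta>1 \<delta>2) 1"
    have \<delta>: "\<delta> > 0" "\<delta> \<le> \<delta>1" "\<delta> \<le> \<delta>2" "\<delta> \<le> 1" using \<delta>1 \<delta>2 by (auto simp: \<delta>_def)
    \<comment> \<open>a lower bound for the distance to \<open>cis x\<close> outside the \<open>\<delta>\<close>-neighbourhood of the angle\<close>
    obtain m where m: "m > 0" "\<And>\<theta>. 0 \<le> \<theta> \<Longrightarrow> \<theta> \<le> 2 * pi \<Longrightarrow> \<delta> \<le> \<bar>\<theta> - x\<bar> \<Longrightarrow> m \<le> cmod (cis \<theta> - cis x)"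
    proof -
      define K where "K = {0..2*pi} \<inter> {\<theta>. \<delta> \<le> \<bar>\<theta> - x\<bar>}"
      have "closed {\<theta>. \<delta> \<le> \<bar>\<theta> - x\<bar>}" by (intro closed_Collect_le continuous_intros)
      then have K: "compact K" unfolding K_def by (intro compact_Int_closed) auto
      show ?thesis
      proof (cases "K = {}")
        case True
        then have "\<not> (0 \<le> \<theta> \<and> \<theta> \<le> 2 * pi \<and> \<delta> \<le> \<bar>\<theta> - x\<bar>)" for \<theta> by (auto simp: K_def)
        then show ?thesis using that[of 1] by (metis zero_less_one)
      next
        case False
        have "continuous_on K (\<lambda>\<theta>. cmod (cis \<theta> - cis x))" by (intro continuous_intros continuous_on_cis)
        from continuous_attains_inf[OF K False this]
        obtain y where y: "y \<in> K" "\<And>\<theta>. \<theta> \<in> K \<Longrightarrow> cmod (cis y - cis x) \<le> cmod (cis \<theta> - cis x)" by auto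
        have "cis y \<noteq> cis x" using cis_eq_imp_eq[of y x] x y(1) \<delta> by (auto simp: K_def)
        then show ?thesis using that[of "cmod (cis y - cis x)"] y(2) by (auto simp: K_def)
      qed
    qed
    define d0 where "d0 = min (min (m / 2) (1 / 2)) (e * m\<^sup>2 / (32 * (B + 1)))"
    have d0: "d0 > 0" using m e B by (auto simp: d0_def)
    have main: "poisson (\<lambda>\<eta>. cmod (F \<eta> - F (cis x))) (of_real r * cis x) \<le> e" if r: "1 - d0 < r" "r < 1" for r
    proof -
      define d where "d = 1 - r"
      define z where "z = of_real r * cis x"
      have d: "0 < d" "d < d0" "r > 0" "d < m / 2" using r unfolding d_def d0_def by auto
      have zn: "cmod z = r" using d by (simp add: z_def norm_mult)
      have z1: "cmod z < 1" using zn r by simp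
      have zx: "cmod (z - cis x) = d"
      proof -
        have "z - cis x = of_real (r - 1) * cis x" by (simp add: z_def algebra_simps)
        then have "cmod (z - cis x) = \<bar>r - 1\<bar>" by (simp only: norm_mult norm_cis norm_of_real mult_1_right)
        then show ?thesis using r by (simp add: d_def)
      qed
      define K where "K = 4 * (1 - (cmod z)\<^sup>2) / m\<^sup>2 * (2 * B)"
      have K0: "0 \<le> K" unfolding K_def using B z1 by (simp add: power_le_one)
      have Ke: "K \<le> e / 2"
      proof -
        have "1 - (cmod z)\<^sup>2 \<le> 2 * d" using one_minus_norm_sq_le[of z "cis x"] z1 zx by simp
        then have "K \<le> 4 * (2 * d) / m\<^sup>2 * (2 * B)"
          unfolding K_def using B by (intro mult_right_mono divide_right_mono mult_left_mono) auto
        also have "\<dots> \<le> 16 * (B + 1) / m\<^sup>2 * d" using d B m by (simp add: field_simps)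
        also have "\<dots> \<le> 16 * (B + 1) / m\<^sup>2 * (e * m\<^sup>2 / (32 * (B + 1)))"
          using d(2) B by (intro mult_left_mono) (auto simp: d0_def)
        also have "\<dots> = e / 2"
        proof -
          have "16 * b / M * (e * M / (32 * b)) = e / 2" if "b \<noteq> 0" "M \<noteq> 0" for b M
            using that by simp
          then show ?thesis using B(1) m(1) by (metis add_nonneg_eq_0_iff less_numeral_extra(3) power_not_zero zero_le_one zero_neq_one)
        qed
        finally show ?thesis .
      qed
      let ?\<phi> = "\<lambda>\<theta>. cmod (G \<theta> - G x)"
      let ?k = "\<lambda>\<tau>. d / (d\<^sup>2 + \<tau>\<^sup>2)"
      let ?P = "\<lambda>\<eta>. poisson_kernel z \<eta> *\<^sub>R cmod (F \<eta> - F (cis x))"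
      have Pb: "bdd_circ ?P"
        by (intro bdd_circ_scaleR bdd_circ_norm_diff F bdd_circ_continuous continuous_poisson_kernel z1)
      obtain BP where BP: "\<And>\<zeta>. cmod \<zeta> = 1 \<Longrightarrow> norm (?P \<zeta>) \<le> BP" using bdd_circ_bound[OF Pb] by metis
      have Pm: "(\<lambda>\<theta>. ?P (cis \<theta>)) \<in> borel_measurable borel"
        by (rule measurable_circ_comp_cis[OF bdd_circ_measurable[OF Pb]])
      have Pi: "integrable lborel (\<lambda>\<theta>. indicator {0..<2*pi} \<theta> *\<^sub>R ?P (cis \<theta>))"
        by (rule integrableI_bounded_set_indicator[where B = BP]) (use Pm BP in \<open>auto\<close>)
      have P0: "0 \<le> ?P \<eta>" for \<eta> using poisson_kernel_nonneg[OF z1] by simp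
      have pt: "?P (cis \<theta>) \<le> K + 16 * (?k (\<theta> - x) * ?\<phi> \<theta>) * (indicator {0<..\<delta>} (\<theta> - x) + indicator {0<..\<delta>} (x - \<theta>))"
        if "0 \<le> \<theta>" "\<theta> < 2 * pi" for \<theta>
      proof (cases "\<bar>\<theta> - x\<bar> \<le> \<delta>")
        case True
        show ?thesis
        proof (cases "\<theta> = x")
          case True then show ?thesis using K0 by (simp add: G_def)
        next
          case False
          have "poisson_kernel z (cis \<theta>) \<le> 16 * ?k (\<theta> - x)"
            unfolding z_def d_def by (rule poisson_kernel_near) (use d r True \<delta> in auto)
          from mult_right_mono[OF this, of "?\<phi> \<theta>"]
          have "?P (cis \<theta>) \<le> 16 * ?k (\<theta> - x) * ?\<phi> \<theta>" by (simp only: G_def norm_ge_zero real_scaleR_def True_implies_equals)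
          then show ?thesis using True False K0 by (auto simp: indicator_def split: if_splits)
        qed
      next
        case False
        then have "m \<le> cmod (cis \<theta> - cis x)" using m(2) that by auto
        then have "poisson_kernel z (cis \<theta>) \<le> 4 * (1 - (cmod z)\<^sup>2) / m\<^sup>2"
          using poisson_kernel_far[OF z1 m(1), of "cis x" "cis \<theta>"] zx d by simp
        moreover have "?\<phi> \<theta> \<le> 2 * B" using norm_triangle_ineq4[of "G \<theta>" "G x"] Gb[of \<theta>] Gb[of x] by simp
        moreover have "0 \<le> 4 * (1 - (cmod z)\<^sup>2) / m\<^sup>2" using z1 by (simp add: power_le_one)
        ultimately have "poisson_kernel z (cis \<theta>) * ?\<phi> \<theta> \<le> K"
          unfolding K_def by (intro mult_mono) auto
        then have "?P (cis \<theta>) \<le> K" by (simp add: G_def)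
        moreover have "0 \<le> 16 * (?k (\<theta> - x) * ?\<phi> \<theta>) * (indicator {0<..\<delta>} (\<theta> - x) + indicator {0<..\<delta>} (x - \<theta>) :: real)"
          using d by (auto intro!: mult_nonneg_nonneg)
        ultimately show ?thesis by linarith
      qed
      have J1: "(\<integral>\<^sup>+\<theta>. ennreal (?k (\<theta> - x) * ?\<phi> \<theta>) * indicator {0<..\<delta>} (\<theta> - x) \<partial>lborel) \<le> ennreal (e' * pi)"
      proof -
        have "(\<integral>\<^sup>+\<theta>. ennreal (?k (\<theta> - x) * ?\<phi> \<theta>) * indicator {0<..\<delta>} (\<theta> - x) \<partial>lborel)
            = (\<integral>\<^sup>+\<tau>. ennreal (?k \<tau> * cmod (G (x + \<tau>) - G x)) * indicator {0<..\<delta>} \<tau> \<partial>lborel)"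
          by (subst nn_integral_real_affine[where c = 1 and t = x]) auto
        also have "\<dots> \<le> ennreal (e' * pi)"
          by (rule cauchy_kernel_local_bound[OF Gm d(1) _ \<delta>(1)]) (use \<delta>1 \<delta> e' in auto)
        finally show ?thesis .
      qed
      have J2: "(\<integral>\<^sup>+\<theta>. ennreal (?k (\<theta> - x) * ?\<phi> \<theta>) * indicator {0<..\<delta>} (x - \<theta>) \<partial>lborel) \<le> ennreal (e' * pi)"
      proof -
        have "(\<integral>\<^sup>+\<theta>. ennreal (?k (\<theta> - x) * ?\<phi> \<theta>) * indicator {0<..\<delta>} (x - \<theta>) \<partial>lborel)
            = (\<integral>\<^sup>+\<tau>. ennreal (?k \<tau> * cmod (G (- (- x + \<tau>)) - G (- (- x)))) * indicator {0<..\<delta>} \<tau> \<partial>lborel)"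
          by (subst nn_integral_real_affine[where c = "-1" and t = x]) auto
        also have "\<dots> \<le> ennreal (e' * pi)"
          by (rule cauchy_kernel_local_bound[OF G'm d(1) _ \<delta>(1)]) (use \<delta>2 \<delta> e' in auto)
        finally show ?thesis .
      qed
      have "ennreal (integral\<^sup>L circ ?P) = ennreal (LINT \<theta>:{0..<2 * pi}|lborel. ?P (cis \<theta>))"
        by (subst integral_circ[OF bdd_circ_measurable[OF Pb]]) simp
      also have "\<dots> = (\<integral>\<^sup>+\<theta>. ennreal (indicator {0..<2*pi} \<theta> *\<^sub>R ?P (cis \<theta>)) \<partial>lborel)"
        unfolding set_lebesgue_integral_def
        by (rule nn_integral_eq_integral[symmetric, OF Pi]) (use P0 in \<open>auto simp: indicator_def\<close>)
      also have "\<dots> \<le> (\<integral>\<^sup>+\<theta>. ennreal K * indicator {0..<2*pi} \<theta>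
            + (ennreal 16 * (ennreal (?k (\<theta> - x) * ?\<phi> \<theta>) * indicator {0<..\<delta>} (\<theta> - x))
             + ennreal 16 * (ennreal (?k (\<theta> - x) * ?\<phi> \<theta>) * indicator {0<..\<delta>} (x - \<theta>))) \<partial>lborel)"
      proof (rule nn_integral_mono)
        fix \<theta> :: real
        let ?R = "ennreal K * indicator {0..<2*pi} \<theta>
            + (ennreal 16 * (ennreal (?k (\<theta> - x) * ?\<phi> \<theta>) * indicator {0<..\<delta>} (\<theta> - x))
             + ennreal 16 * (ennreal (?k (\<theta> - x) * ?\<phi> \<theta>) * indicator {0<..\<delta>} (x - \<theta>)))"
        show "ennreal (indicator {0..<2*pi} \<theta> *\<^sub>R ?P (cis \<theta>)) \<le> ?R"
        proof (cases "\<theta> \<in> {0..<2*pi}")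
          case True
          define A where "A = ?k (\<theta> - x) * ?\<phi> \<theta>"
          have A0: "0 \<le> A" using d by (simp add: A_def)
          have "ennreal (?P (cis \<theta>)) \<le> ennreal (K + 16 * A * (indicator {0<..\<delta>} (\<theta> - x) + indicator {0<..\<delta>} (x - \<theta>)))"
            unfolding A_def by (rule ennreal_leI, rule pt) (use True in auto)
          also have "\<dots> = ennreal K + (ennreal 16 * (ennreal A * indicator {0<..\<delta>} (\<theta> - x)) + ennreal 16 * (ennreal A * indicator {0<..\<delta>} (x - \<theta>)))"
            using A0 K0 by (auto simp: indicator_def ennreal_mult' ennreal_plus simp del: ennreal_numeral)
          finally show ?thesis using True unfolding A_def by simp
        qed simp
      qed
      also have "\<dots> = ennreal K * ennreal (2 * pi)
            + (ennreal 16 * (\<integral>\<^sup>+\<theta>. ennreal (?k (\<theta> - x) * ?\<phi> \<theta>) * indicator {0<..\<delta>} (\<theta> - x) \<partial>lborel)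
             + ennreal 16 * (\<integral>\<^sup>+\<theta>. ennreal (?k (\<theta> - x) * ?\<phi> \<theta>) * indicator {0<..\<delta>} (x - \<theta>) \<partial>lborel))"
        by (simp add: nn_integral_add nn_integral_cmult)
      also have "\<dots> \<le> ennreal K * ennreal (2 * pi) + (ennreal 16 * ennreal (e' * pi) + ennreal 16 * ennreal (e' * pi))"
        by (intro add_mono mult_left_mono J1 J2) auto
      also have "\<dots> = ennreal (K * (2 * pi) + (16 * (e' * pi) + 16 * (e' * pi)))"
      proof -
        have a: "0 \<le> K * (2 * pi)" "0 \<le> 16 * (e' * pi)" using K0 e' by auto
        have "ennreal (K * (2 * pi)) = ennreal K * ennreal (2 * pi)" by (rule ennreal_mult'[OF K0])
        moreover have "ennreal (16 * (e' * pi)) = ennreal 16 * ennreal (e' * pi)" by (rule ennreal_mult') simp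
        ultimately show ?thesis using a by (simp only: ennreal_plus add_nonneg_nonneg)
      qed
      finally have "integral\<^sup>L circ ?P \<le> K * (2 * pi) + (16 * (e' * pi) + 16 * (e' * pi))"
        by (subst (asm) ennreal_le_iff) (use K0 e' in auto)
      then have "poisson (\<lambda>\<eta>. cmod (F \<eta> - F (cis x))) z \<le> (K * (2 * pi) + (16 * (e' * pi) + 16 * (e' * pi))) / (2 * pi)"
        unfolding poisson_def by (simp add: divide_right_mono)
      also have "\<dots> = K + 16 * e'" by (simp add: field_simps)
      also have "\<dots> \<le> e" using Ke by (simp add: e'_def)
      finally show ?thesis unfolding z_def .
    qed
    show "\<exists>r0<1. \<forall>r. r0 < r \<and> r < 1 \<longrightarrow> poisson (\<lambda>\<eta>. cmod (F \<eta> - F (cis x))) (of_real r * cis x) \<le> e"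
      by (intro exI[of _ "1 - d0"]) (use main d0 in auto)
  qed
qed

text \<open>
  In the Stolz region of aperture \<open>\<alpha>\<close> at \<open>\<zeta>\<close> the kernel at \<open>z\<close> is at most \<open>(\<alpha> + 2)\<^sup>2\<close> times the kernel at the
  point \<open>|z| \<zeta>\<close> of the radius.  Radial smallness of the Poisson integral of \<open>|F - F \<zeta>|\<close> therefore gives
  non-tangential convergence.
\<close>

theorem fatou_nontangential:
  fixes F :: "complex \<Rightarrow> complex"
  assumes F: "bdd_circ F"
  shows "AE \<zeta> in circ. \<forall>\<alpha>>1. (poisson F \<longlongrightarrow> F \<zeta>) (at \<zeta> within stolz_region \<zeta> \<alpha>)"
proof (rule AE_mp[OF poisson_radial_average_limit[OF F]], intro AE_I2 impI allI)
  fix \<zeta> and \<alpha> :: real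
  assume "\<zeta> \<in> space circ" and \<alpha>: "1 < \<alpha>"
    and rad: "\<forall>e>0. \<exists>r0<1. \<forall>r. r0 < r \<and> r < 1 \<longrightarrow> poisson (\<lambda>\<eta>. cmod (F \<eta> - F \<zeta>)) (of_real r * \<zeta>) \<le> e"
  then have \<zeta>: "cmod \<zeta> = 1" by simp
  let ?\<phi> = "\<lambda>\<eta>. cmod (F \<eta> - F \<zeta>)"
  have \<phi>b: "bdd_circ ?\<phi>" by (rule bdd_circ_norm_diff[OF F])
  have cmp: "poisson ?\<phi> z \<le> (\<alpha> + 2)\<^sup>2 * poisson ?\<phi> (of_real (cmod z) * \<zeta>)" if z: "z \<in> stolz_region \<zeta> \<alpha>" for z
  proof -
    define r where "r = cmod z"
    have z1: "cmod z < 1" and zs: "cmod (z - \<zeta>) < \<alpha> * (1 - r)" using z by (auto simp: stolz_region_def r_def)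
    have r: "0 \<le> r" "r < 1" using z1 by (auto simp: r_def)
    have rz: "cmod (of_real r * \<zeta>) = r" using \<zeta> r by (simp add: norm_mult)
    have "poisson_kernel z \<eta> \<le> (\<alpha> + 2)\<^sup>2 * poisson_kernel (of_real r * \<zeta>) \<eta>" if "cmod \<eta> = 1" for \<eta>
    proof -
      have a: "1 - r \<le> cmod (\<eta> - z)" using norm_triangle_ineq2[of \<eta> z] that by (simp add: r_def)
      have b: "cmod (\<zeta> - of_real r * \<zeta>) = 1 - r"
      proof -
        have "\<zeta> - of_real r * \<zeta> = of_real (1 - r) * \<zeta>" by (simp add: algebra_simps)
        then show ?thesis using r \<zeta> by (simp only: norm_mult norm_of_real) simp
      qed
      have "\<eta> - of_real r * \<zeta> = (\<eta> - z) + ((z - \<zeta>) + (\<zeta> - of_real r * \<zeta>))" by simp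
      then have "cmod (\<eta> - of_real r * \<zeta>) \<le> cmod (\<eta> - z) + (cmod (z - \<zeta>) + cmod (\<zeta> - of_real r * \<zeta>))"
        by (metis norm_triangle_mono norm_triangle_ineq order_refl)
      also have "\<dots> \<le> cmod (\<eta> - z) + (\<alpha> * cmod (\<eta> - z) + cmod (\<eta> - z))"
      proof -
        have "\<alpha> * (1 - r) \<le> \<alpha> * cmod (\<eta> - z)" by (rule mult_left_mono[OF a]) (use \<alpha> in simp)
        then show ?thesis using zs b a by linarith
      qed
      also have "\<dots> = (\<alpha> + 2) * cmod (\<eta> - z)" by (simp add: algebra_simps)
      finally have "(cmod (\<eta> - of_real r * \<zeta>))\<^sup>2 \<le> ((\<alpha> + 2) * cmod (\<eta> - z))\<^sup>2" by (intro power_mono) auto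
      then have c: "(cmod (\<eta> - of_real r * \<zeta>))\<^sup>2 \<le> (\<alpha> + 2)\<^sup>2 * (cmod (\<eta> - z))\<^sup>2" by (simp add: power_mult_distrib)
      have "\<eta> \<noteq> of_real r * \<zeta>" using rz r that by auto
      then have p: "0 < (cmod (\<eta> - of_real r * \<zeta>))\<^sup>2" by simp
      have p': "0 < (cmod (\<eta> - z))\<^sup>2" using a r by auto
      have r2: "0 \<le> 1 - r\<^sup>2" using r by (simp add: power_le_one)
      have "(1 - r\<^sup>2) * (cmod (\<eta> - of_real r * \<zeta>))\<^sup>2 \<le> (1 - r\<^sup>2) * ((\<alpha> + 2)\<^sup>2 * (cmod (\<eta> - z))\<^sup>2)"
        by (rule mult_left_mono[OF c r2])
      then show ?thesis using p p' unfolding poisson_kernel_def rz r_def[symmetric]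
        by (simp add: field_simps)
    qed
    then have "integral\<^sup>L circ (\<lambda>\<eta>. poisson_kernel z \<eta> *\<^sub>R ?\<phi> \<eta>)
        \<le> integral\<^sup>L circ (\<lambda>\<eta>. (\<alpha> + 2)\<^sup>2 * (poisson_kernel (of_real r * \<zeta>) \<eta> *\<^sub>R ?\<phi> \<eta>))"
      by (intro integral_mono integrable_mult_right poisson_integrable \<phi>b)
         (use z1 rz r in \<open>auto simp: mult.assoc[symmetric] intro!: mult_right_mono\<close>)
    then show ?thesis unfolding poisson_def r_def[symmetric]
      by (simp add: divide_right_mono)
  qed
  show "(poisson F \<longlongrightarrow> F \<zeta>) (at \<zeta> within stolz_region \<zeta> \<alpha>)"
    unfolding tendsto_iff eventually_at
  proof (intro allI impI)
    fix e :: real assume e: "0 < e"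
    define e1 where "e1 = e / (2 * (\<alpha> + 2)\<^sup>2)"
    have a2: "(\<alpha> + 2)\<^sup>2 > 0" using \<alpha> by auto
    have e1: "e1 > 0" using e a2 by (simp add: e1_def)
    then obtain r0 where r0: "r0 < 1" "\<And>r. r0 < r \<Longrightarrow> r < 1 \<Longrightarrow> poisson ?\<phi> (of_real r * \<zeta>) \<le> e1"
      using rad by blast
    show "\<exists>d>0. \<forall>z\<in>stolz_region \<zeta> \<alpha>. z \<noteq> \<zeta> \<and> dist z \<zeta> < d \<longrightarrow> dist (poisson F z) (F \<zeta>) < e"
    proof (intro exI[of _ "1 - r0"] conjI ballI impI)
      fix z assume z: "z \<in> stolz_region \<zeta> \<alpha>" "z \<noteq> \<zeta> \<and> dist z \<zeta> < 1 - r0"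
      have z1: "cmod z < 1" using z by (simp add: stolz_region_def)
      have "1 - cmod z \<le> dist z \<zeta>" using norm_triangle_ineq3[of z \<zeta>] \<zeta> by (simp add: dist_norm)
      then have "r0 < cmod z" using z by simp
      have "dist (poisson F z) (F \<zeta>) \<le> poisson ?\<phi> z"
        unfolding dist_norm by (rule norm_poisson_diff_le[OF F z1])
      also have "\<dots> \<le> (\<alpha> + 2)\<^sup>2 * poisson ?\<phi> (of_real (cmod z) * \<zeta>)" by (rule cmp[OF z(1)])
      also have "\<dots> \<le> (\<alpha> + 2)\<^sup>2 * e1" using r0(2)[OF \<open>r0 < cmod z\<close> z1] a2 by (intro mult_left_mono) auto
      also have "\<dots> = e / 2" unfolding e1_def using a2 by simp
      also have "\<dots> < e" using e by simp
      finally show "dist (poisson F z) (F \<zeta>) < e" .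
    qed (use r0 in auto)
  qed
qed

section \<open>The maximum principle for plurisubharmonic functions on holomorphic discs\<close>

lemma holomorphic_vec_continuous:
  fixes g :: "complex \<Rightarrow> complex ^ 'n"
  assumes "\<And>j. (\<lambda>z. g z $ j) holomorphic_on S"
  shows "continuous_on S g"
proof -
  have "continuous_on S (\<lambda>z. \<chi> j. g z $ j)"
    by (intro continuous_on_vec_lambda holomorphic_on_imp_continuous_on assms)
  then show ?thesis by simp
qed

lemma psh_circle_mean:
  fixes u :: "complex ^ 'n \<Rightarrow> real"
  assumes psh: "psh_on G u" and u: "continuous_on G u"
    and r: "0 < r" and sub: "\<And>t. cmod t \<le> r \<Longrightarrow> a + t *s b \<in> G"
  shows "2 * pi * u a \<le> integral\<^sup>L circ (\<lambda>\<eta>. u (a + (of_real r * \<eta>) *s b))"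
proof -
  have sh: "subharmonic_on {t. a + t *s b \<in> G} (\<lambda>t. u (a + t *s b))" using psh by (simp add: psh_on_def)
  have "cball 0 r \<subseteq> {t. a + t *s b \<in> G}" using sub by auto
  with sh r have "u (a + 0 *s b) \<le> 1 / (2 * pi) * (LINT \<theta>:{0..2 * pi}|lebesgue. u (a + (0 + of_real r * cis \<theta>) *s b))"
    unfolding subharmonic_on_def by blast
  moreover have "continuous_on (sphere 0 1) (\<lambda>\<eta>. u (a + (of_real r * \<eta>) *s b))"
    by (rule continuous_on_compose2[OF u])
       (use r sub in \<open>auto intro!: continuous_intros simp: vector_scalar_mult_def norm_mult\<close>)
  then have "(LINT \<theta>:{0..2 * pi}|lebesgue. u (a + (of_real r * cis \<theta>) *s b)) = integral\<^sup>L circ (\<lambda>\<eta>. u (a + (of_real r * \<eta>) *s b))"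
    by (intro lebesgue_integral_cis_eq_circ measurable_circ_continuous) auto
  ultimately show ?thesis by (simp add: field_simps)
qed

text \<open>
  The function \<open>u\<close> obeys the sub-mean value inequality only along complex lines, and \<open>g\<close> is curved, so the
  inequality does not apply to \<open>u \<circ> g\<close> directly.  The remedy is to double the variables and maximise
  \<open>u (g z + \<xi>) - H z + \<delta> |z|\<^sup>2 - A |\<xi>|\<^sup>2\<close> over \<open>z\<close> and a small vector \<open>\<xi>\<close>.  From an interior maximum \<open>(z, \<xi>)\<close> one
  moves to \<open>(z + \<zeta>, \<xi> - T \<zeta>)\<close>, where \<open>T \<zeta>\<close> is the remainder of the first-order expansion of \<open>g\<close> at \<open>z\<close>: the
  argument of \<open>u\<close> then runs along a complex line.  All other terms are real parts of holomorphic
  functions of \<open>\<zeta>\<close>, except \<open>\<delta> |\<zeta>|\<^sup>2\<close> and the smaller \<open>A |T \<zeta>|\<^sup>2\<close>, so taking the mean over a small circle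
  contradicts the sub-mean value inequality.
\<close>

lemma psh_disc_maximum_principle:
  fixes u :: "complex ^ 'n \<Rightarrow> real" and g :: "complex \<Rightarrow> complex ^ 'n" and H :: "complex \<Rightarrow> real"
  assumes psh: "psh_on G u" and u: "continuous_on G u" and G: "open G"
    and \<Omega>: "open \<Omega>" "bounded \<Omega>"
    and gc: "continuous_on (closure \<Omega>) g" and gh: "\<And>j. (\<lambda>z. g z $ j) holomorphic_on \<Omega>"
    and gG: "g ` closure \<Omega> \<subseteq> G"
    and Hc: "continuous_on (closure \<Omega>) H"
    and Hh: "\<And>z. z \<in> \<Omega> \<Longrightarrow> \<exists>r>0. \<exists>k. k holomorphic_on ball z r \<and> (\<forall>w\<in>ball z r. H w = Re (k w))"
    and bd: "\<And>z. z \<in> closure \<Omega> - \<Omega> \<Longrightarrow> u (g z) \<le> H z"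
    and z0: "z0 \<in> \<Omega>"
  shows "u (g z0) \<le> H z0"
proof (rule ccontr)
  assume neg: "\<not> u (g z0) \<le> H z0"
  \<comment> \<open>a quarter of the supposed violation; one quarter is spent below on \<open>\<xi>\<close> and another on \<open>\<delta> |z|\<^sup>2\<close>\<close>
  define \<kappa> where "\<kappa> = (u (g z0) - H z0) / 4"
  have \<kappa>: "\<kappa> > 0" using neg by (simp add: \<kappa>_def)
  have cl: "compact (closure \<Omega>)" using \<Omega> by (simp add: compact_eq_bounded_closed bounded_closure)
  define K where "K = g ` closure \<Omega>"
  have K: "compact K" unfolding K_def by (rule compact_continuous_image[OF gc cl])
  obtain d0 where d0: "d0 > 0" "(\<Union>x\<in>K. cball x d0) \<subseteq> G"
    using compact_subset_open_imp_cball_epsilon_subset[OF K G] gG unfolding K_def by auto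
  define K' where "K' = {x + y | x y. x \<in> K \<and> y \<in> cball 0 d0}"
  have K': "compact K'" unfolding K'_def by (rule compact_sums[OF K compact_cball])
  have K'G: "K' \<subseteq> G" using d0(2) by (auto simp: K'_def subset_eq dist_norm)
  have KK': "y + \<xi> \<in> K'" if "y \<in> K" "norm \<xi> \<le> d0" for y \<xi> using that by (auto simp: K'_def)
  have uK': "continuous_on K' u" using u K'G by (rule continuous_on_subset)
  have "uniformly_continuous_on K' u" by (rule compact_uniformly_continuous[OF uK' K'])
  then obtain d1 where d1: "d1 > 0" "\<And>x y. x \<in> K' \<Longrightarrow> y \<in> K' \<Longrightarrow> dist y x < d1 \<Longrightarrow> dist (u y) (u x) < \<kappa>"
    unfolding uniformly_continuous_on_def using \<kappa> by metis
  define d where "d = min d0 (d1 / 2)"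
  have d: "d > 0" "d \<le> d0" using d0 d1 by (auto simp: d_def)
  have ud: "u (y + \<xi>) \<le> u y + \<kappa>" if "y \<in> K" "norm \<xi> \<le> d" for y \<xi>
  proof -
    have "dist (u (y + \<xi>)) (u y) < \<kappa>"
    proof (rule d1(2))
      show "y \<in> K'" using KK'[of y 0] that d0 by simp
      show "y + \<xi> \<in> K'" using KK'[of y \<xi>] that d by simp
      show "dist (y + \<xi>) y < d1" using that d1(1) by (auto simp: d_def dist_norm)
    qed
    then show ?thesis by (simp add: dist_real_def)
  qed
  obtain B where B: "\<And>y. y \<in> K' \<Longrightarrow> \<bar>u y\<bar> \<le> B"
    using compact_imp_bounded[OF compact_continuous_image[OF uK' K']] by (auto simp: bounded_iff)
  obtain BH where BH: "\<And>z. z \<in> closure \<Omega> \<Longrightarrow> \<bar>H z\<bar> \<le> BH"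
    using compact_imp_bounded[OF compact_continuous_image[OF Hc cl]] by (auto simp: bounded_iff)
  obtain R where R: "R > 0" "\<And>z. z \<in> closure \<Omega> \<Longrightarrow> cmod z \<le> R"
    using compact_imp_bounded[OF cl] by (auto simp: bounded_pos)
  define \<delta> where "\<delta> = \<kappa> / R\<^sup>2"
  have \<delta>: "\<delta> > 0" using \<kappa> R by (simp add: \<delta>_def)
  have \<delta>R: "\<delta> * (cmod z)\<^sup>2 \<le> \<kappa>" if "z \<in> closure \<Omega>" for z
  proof -
    have "\<delta> * (cmod z)\<^sup>2 \<le> \<delta> * R\<^sup>2" using R that \<delta> by (intro mult_left_mono power_mono) auto
    then show ?thesis using R by (simp add: \<delta>_def)
  qed
  \<comment> \<open>the penalty is so large that no maximum has \<open>|\<xi>| = d\<close>\<close>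
  define A where "A = (\<bar>B\<bar> + \<bar>BH\<bar> + \<kappa>) / d\<^sup>2"
  have A: "A > 0" using \<kappa> d by (auto simp: A_def intro!: divide_pos_pos add_nonneg_pos)
  define M where "M = (\<lambda>(z, \<xi>). u (g z + \<xi>) - H z + \<delta> * (cmod z)\<^sup>2 - A * (norm \<xi>)\<^sup>2)"
  have "continuous_on (closure \<Omega> \<times> cball 0 d) M"
    unfolding M_def case_prod_unfold
  proof (intro continuous_intros)
    show "continuous_on (closure \<Omega> \<times> cball 0 d) (\<lambda>x. u (g (fst x) + snd x))"
    proof (rule continuous_on_compose2[OF uK'])
      show "continuous_on (closure \<Omega> \<times> cball 0 d) (\<lambda>x. g (fst x) + snd x)"
        by (intro continuous_intros continuous_on_compose2[OF gc]) auto
      show "(\<lambda>x. g (fst x) + snd x) ` (closure \<Omega> \<times> cball 0 d) \<subseteq> K'"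
        using KK' d(2) by (auto simp: K_def)
    qed
    show "continuous_on (closure \<Omega> \<times> cball 0 d) (\<lambda>x. H (fst x))"
      by (intro continuous_intros continuous_on_compose2[OF Hc]) auto
  qed
  moreover have "compact (closure \<Omega> \<times> cball (0 :: complex ^ 'n) d)" by (intro compact_Times cl compact_cball)
  moreover have m0: "(z0, 0) \<in> closure \<Omega> \<times> cball (0 :: complex ^ 'n) d"
    using z0 closure_subset d by auto
  ultimately obtain p where p: "p \<in> closure \<Omega> \<times> cball 0 d" "\<And>q. q \<in> closure \<Omega> \<times> cball 0 d \<Longrightarrow> M q \<le> M p"
    using continuous_attains_sup[of "closure \<Omega> \<times> cball 0 d" M] by blast
  obtain z \<xi> where pz: "p = (z, \<xi>)" by (cases p)
  have z: "z \<in> closure \<Omega>" and \<xi>: "norm \<xi> \<le> d" using p(1) pz by auto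
  have "4 * \<kappa> \<le> M (z0, 0)" using \<delta> by (simp add: M_def \<kappa>_def)
  then have Mp: "4 * \<kappa> \<le> M (z, \<xi>)" using p(2)[OF m0] pz by simp
  have \<xi>d: "norm \<xi> < d"
  proof (rule ccontr)
    assume "\<not> norm \<xi> < d"
    then have n: "norm \<xi> = d" using \<xi> by simp
    have "u (g z + \<xi>) \<le> \<bar>B\<bar>" using B[of "g z + \<xi>"] KK'[of "g z" \<xi>] z \<xi> d by (auto simp: K_def)
    moreover have "- H z \<le> \<bar>BH\<bar>" using BH[OF z] by simp
    moreover have "A * (norm \<xi>)\<^sup>2 = \<bar>B\<bar> + \<bar>BH\<bar> + \<kappa>" using d n by (simp add: A_def)
    ultimately have "M (z, \<xi>) \<le> 0" using \<delta>R[OF z] by (simp add: M_def)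
    then show False using Mp \<kappa> by simp
  qed
  have z\<Omega>: "z \<in> \<Omega>"
  proof (rule ccontr)
    assume "z \<notin> \<Omega>"
    then have "u (g z) \<le> H z" using bd z by auto
    moreover have "u (g z + \<xi>) \<le> u (g z) + \<kappa>" by (rule ud) (use z \<xi> in \<open>auto simp: K_def\<close>)
    moreover have "0 \<le> A * (norm \<xi>)\<^sup>2" using A by simp
    ultimately have "M (z, \<xi>) \<le> 2 * \<kappa>" using \<delta>R[OF z] by (simp add: M_def)
    then show False using Mp \<kappa> by simp
  qed
  define b where "b = (\<chi> j. deriv (\<lambda>z. g z $ j) z)"
  define T where "T = (\<lambda>\<zeta>. g (z + \<zeta>) - g z - \<zeta> *s b)"
  define a where "a = g z + \<xi>"
  obtain r1 k where r1: "r1 > 0" and k: "k holomorphic_on ball z r1" "\<And>w. w \<in> ball z r1 \<Longrightarrow> H w = Re (k w)"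
    using Hh[OF z\<Omega>] by blast
  obtain r2 where r2: "r2 > 0" "ball z r2 \<subseteq> \<Omega>" using \<Omega>(1) z\<Omega> open_contains_ball by blast
  \<comment> \<open>chosen so that \<open>A |T \<zeta>|\<^sup>2 \<le> \<delta> |\<zeta>|\<^sup>2 / 2\<close> as soon as \<open>|T \<zeta>| \<le> e |\<zeta>|\<close>\<close>
  define e where "e = sqrt (\<delta> / (2 * A))"
  have e: "e > 0" "A * e\<^sup>2 = \<delta> / 2" using \<delta> A by (auto simp: e_def)
  have "\<exists>r3>0. \<forall>\<zeta>. cmod \<zeta> < r3 \<longrightarrow> norm (T \<zeta>) \<le> e * cmod \<zeta>"
  proof -
    have "((\<lambda>z. g z) has_derivative (\<lambda>\<zeta>. \<zeta> *s b)) (at z)"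
    proof (subst has_derivative_componentwise_within, intro ballI)
      fix i :: "complex ^ 'n" assume "i \<in> Basis"
      then obtain j c where i: "i = axis j c" by (auto simp: Basis_vec_def)
      have "((\<lambda>z. g z $ j) has_field_derivative b $ j) (at z)"
        unfolding b_def by (simp add: holomorphic_derivI[OF gh \<Omega>(1) z\<Omega>])
      then have "((\<lambda>z. g z $ j) has_derivative (*) (b $ j)) (at z)" by (simp add: has_field_derivative_def)
      then have "((\<lambda>z. g z $ j \<bullet> c) has_derivative (\<lambda>\<zeta>. (b $ j * \<zeta>) \<bullet> c)) (at z)"
        by (intro derivative_intros)
      then show "((\<lambda>x. g x \<bullet> i) has_derivative (\<lambda>x. (x *s b) \<bullet> i)) (at z)"
        unfolding i by (simp add: inner_axis mult.commute)
    qed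
    from this[unfolded has_derivative_at_alt] obtain r3 where "r3 > 0"
      "\<And>y. norm (y - z) < r3 \<Longrightarrow> norm (g y - g z - (y - z) *s b) \<le> e * norm (y - z)"
      using e by blast
    note this(2)[of "z + \<zeta>" for \<zeta>]
    then have "norm (T \<zeta>) \<le> e * cmod \<zeta>" if "cmod \<zeta> < r3" for \<zeta> using that by (simp add: T_def)
    with \<open>r3 > 0\<close> show ?thesis by blast
  qed
  then obtain r3 where r3: "r3 > 0" "\<And>\<zeta>. cmod \<zeta> < r3 \<Longrightarrow> norm (T \<zeta>) \<le> e * cmod \<zeta>" by blast
  have "open ((\<lambda>t. a + t *s b) -` G)"
    by (rule open_vimage[OF G]) (auto intro!: continuous_intros simp: vector_scalar_mult_def)
  moreover have "a \<in> G" unfolding a_def using K'G KK'[of "g z" \<xi>] z \<xi> d by (auto simp: K_def)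
  then have "0 \<in> (\<lambda>t. a + t *s b) -` G" by simp
  ultimately obtain r4 where r4: "r4 > 0" "ball 0 r4 \<subseteq> (\<lambda>t. a + t *s b) -` G"
    using open_contains_ball by blast
  define r0 where "r0 = min (min r1 r2) (min r3 r4)"
  define r where "r = min (r0 / 2) ((d - norm \<xi>) / e)"
  have r0: "r0 > 0" "r0 \<le> r1" "r0 \<le> r2" "r0 \<le> r3" "r0 \<le> r4" using r1 r2 r3 r4 by (auto simp: r0_def)
  have r: "r > 0" "r < r0" "e * r \<le> d - norm \<xi>"
  proof -
    show "r > 0" using r0 e \<xi>d by (simp add: r_def)
    show "r < r0" using r0 by (auto simp: r_def)
    have "e * r \<le> e * ((d - norm \<xi>) / e)" using e by (intro mult_left_mono) (auto simp: r_def)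
    then show "e * r \<le> d - norm \<xi>" using e by simp
  qed
  \<comment> \<open>collects the terms that are real parts of holomorphic functions of \<open>\<zeta>\<close> vanishing at \<open>0\<close>\<close>
  define L where "L = (\<lambda>\<zeta>. k (z + \<zeta>) - k z - 2 * \<delta> * cnj z * \<zeta> - 2 * A * (\<Sum>j\<in>UNIV. cnj (\<xi> $ j) * T \<zeta> $ j))"
  have T0: "T 0 = 0" by (simp add: T_def)
  have L0: "L 0 = 0" by (simp add: L_def T0)
  have Lh: "L holomorphic_on ball 0 r0"
  proof -
    have 1: "(\<lambda>\<zeta>. k (z + \<zeta>)) holomorphic_on ball 0 r0"
      by (rule holomorphic_on_compose_gen[OF _ k(1), unfolded o_def])
         (use r0 in \<open>auto intro!: holomorphic_intros simp: dist_norm\<close>)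
    have 2: "(\<lambda>\<zeta>. g (z + \<zeta>) $ j) holomorphic_on ball 0 r0" for j
      by (rule holomorphic_on_compose_gen[OF _ gh[of j], unfolded o_def])
         (use r0 r2 in \<open>auto intro!: holomorphic_intros simp: dist_norm subset_eq\<close>)
    show ?thesis unfolding L_def T_def
      by (simp, intro holomorphic_intros 1 2)
  qed
  have pt: "u (a + (of_real r * \<eta>) *s b) \<le> u a - \<delta> * r\<^sup>2 / 2 + Re (L (of_real r * \<eta>))" if \<eta>: "cmod \<eta> = 1" for \<eta>
  proof -
    define \<zeta> where "\<zeta> = of_real r * \<eta>"
    have nz: "cmod \<zeta> = r" using \<eta> r by (simp add: \<zeta>_def norm_mult)
    have zb: "z + \<zeta> \<in> ball z r1" "z + \<zeta> \<in> \<Omega>"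
      using nz r r0 r2 by (auto simp: dist_norm subset_eq)
    have Tn: "norm (T \<zeta>) \<le> e * r" using r3(2)[of \<zeta>] nz r r0 by simp
    have "norm (\<xi> - T \<zeta>) \<le> d" using norm_triangle_ineq4[of \<xi> "T \<zeta>"] Tn r(3) by linarith
    then have "M (z + \<zeta>, \<xi> - T \<zeta>) \<le> M (z, \<xi>)"
      using p(2)[of "(z + \<zeta>, \<xi> - T \<zeta>)"] zb(2) closure_subset[of \<Omega>] pz by auto
    moreover have "g (z + \<zeta>) + (\<xi> - T \<zeta>) = a + \<zeta> *s b" by (simp add: T_def a_def)
    moreover have "(cmod (z + \<zeta>))\<^sup>2 = (cmod z)\<^sup>2 + 2 * Re (cnj z * \<zeta>) + r\<^sup>2"
      unfolding nz[symmetric] cmod_power2 by (simp add: power2_eq_square algebra_simps)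
    moreover have "(norm (\<xi> - T \<zeta>))\<^sup>2 = (norm \<xi>)\<^sup>2 - 2 * (\<xi> \<bullet> T \<zeta>) + (norm (T \<zeta>))\<^sup>2"
      by (simp add: power2_norm_eq_inner inner_diff inner_commute algebra_simps)
    moreover have "\<xi> \<bullet> T \<zeta> = Re (\<Sum>j\<in>UNIV. cnj (\<xi> $ j) * T \<zeta> $ j)"
      by (simp add: inner_vec_def inner_complex_def)
    moreover have "H (z + \<zeta>) - H z = Re (k (z + \<zeta>) - k z)" using k(2) zb r1 by simp
    moreover have "A * (norm (T \<zeta>))\<^sup>2 \<le> \<delta> / 2 * r\<^sup>2"
    proof -
      have "(norm (T \<zeta>))\<^sup>2 \<le> (e * r)\<^sup>2" using Tn by (intro power_mono) auto
      then have "A * (norm (T \<zeta>))\<^sup>2 \<le> A * (e * r)\<^sup>2" using A by (intro mult_left_mono) auto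
      also have "\<dots> = (A * e\<^sup>2) * r\<^sup>2" by (simp add: power_mult_distrib)
      finally show ?thesis using e by simp
    qed
    moreover have "Re (L \<zeta>) = Re (k (z + \<zeta>) - k z) - 2 * \<delta> * Re (cnj z * \<zeta>) - 2 * A * Re (\<Sum>j\<in>UNIV. cnj (\<xi> $ j) * T \<zeta> $ j)"
      unfolding L_def by (simp add: algebra_simps)
    ultimately show ?thesis unfolding \<zeta>_def[symmetric] M_def a_def
      by (simp add: algebra_simps)
  qed
  have c1: "continuous_on (sphere 0 1) (\<lambda>\<eta>. u (a + (of_real r * \<eta>) *s b))"
    by (rule continuous_on_compose2[OF u])
       (use r r4 r0 in \<open>auto intro!: continuous_intros simp: vector_scalar_mult_def norm_mult subset_eq dist_norm\<close>)
  have c2: "continuous_on (sphere 0 1) (\<lambda>\<eta>. L (of_real r * \<eta>))"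
    by (rule continuous_on_compose2[OF holomorphic_on_imp_continuous_on[OF Lh]])
       (use r in \<open>auto intro!: continuous_intros simp: norm_mult\<close>)
  have i2: "integrable circ (\<lambda>\<eta>. L (of_real r * \<eta>))" by (rule bdd_circ_integrable[OF bdd_circ_continuous[OF c2]])
  have L_int: "integral\<^sup>L circ (\<lambda>\<eta>. Re (L (of_real r * \<eta>))) = 0"
  proof -
    have "integral\<^sup>L circ (\<lambda>\<eta>. L (0 + of_real r * \<eta>)) = 2 * pi * L 0"
      by (rule holomorphic_mean_value[OF Lh]) (use r in auto)
    then have "integral\<^sup>L circ (\<lambda>\<eta>. L (of_real r * \<eta>)) = 0" by (simp add: L0)
    then show ?thesis using integral_Re[OF i2] by simp
  qed
  have "2 * pi * u a \<le> integral\<^sup>L circ (\<lambda>\<eta>. u (a + (of_real r * \<eta>) *s b))"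
    by (rule psh_circle_mean[OF psh u r(1)]) (use r r0 r4 in \<open>auto simp: subset_eq dist_norm\<close>)
  also have "\<dots> \<le> integral\<^sup>L circ (\<lambda>\<eta>. (u a - \<delta> * r\<^sup>2 / 2) + Re (L (of_real r * \<eta>)))"
    by (rule integral_mono[OF bdd_circ_integrable[OF bdd_circ_continuous[OF c1]]])
       (use pt i2 in auto)
  also have "\<dots> = 2 * pi * (u a - \<delta> * r\<^sup>2 / 2)"
    by (subst Bochner_Integration.integral_add) (use i2 L_int in \<open>auto simp: measure_circ\<close>)
  finally have "\<delta> * r\<^sup>2 \<le> 0" by simp
  then show False using \<delta> r(1) by (simp add: mult_le_0_iff)
qed

lemma closure_annulus_subset:
  "closure {z. r0 < cmod z \<and> cmod z < 1} \<subseteq> {z. r0 \<le> cmod z \<and> cmod z \<le> 1}"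
  by (rule closure_minimal) (auto intro!: closed_Collect_conj closed_Collect_le continuous_intros)

text \<open>
  The maximum principle on the annulus \<open>r0 < |z| < 1\<close>, where \<open>ln |z|\<close> is harmonic.  It is applied to the
  dilates \<open>g (r z)\<close> with the positive part of their boundary values, and \<open>r\<close> tends to \<open>1\<close> by dominated
  convergence.
\<close>

lemma psh_disc_poisson_log_bound:
  fixes u :: "complex ^ 'n \<Rightarrow> real" and g :: "complex \<Rightarrow> complex ^ 'n" and b :: "complex \<Rightarrow> real"
  assumes psh: "psh_on G u" and u: "continuous_on G u" and G: "open G"
    and gh: "\<And>j. (\<lambda>z. g z $ j) holomorphic_on ball 0 1"
    and K: "compact K" "K \<subseteq> G" and gK: "g ` ball 0 1 \<subseteq> K"
    and r0: "0 < r0" "r0 < 1" and inner: "\<And>z. cmod z \<le> r0 \<Longrightarrow> u (g z) \<le> c * ln r0"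
    and b: "bdd_circ b" "\<And>\<zeta>. cmod \<zeta> = 1 \<Longrightarrow> 0 \<le> b \<zeta>"
    and lim: "AE \<zeta> in circ. \<exists>l. ((\<lambda>r. u (g (of_real r * \<zeta>))) \<longlongrightarrow> l) (at_left 1) \<and> l \<le> b \<zeta>"
    and z: "r0 < cmod z" "cmod z < 1"
  shows "u (g z) \<le> poisson b z + c * ln (cmod z)"
proof -
  define V where "V = (\<lambda>z. u (g z))"
  have gc: "continuous_on (ball 0 1) g"
    by (rule holomorphic_vec_continuous[OF gh])
  have Vc: "continuous_on (ball 0 1) V"
    unfolding V_def by (rule continuous_on_compose2[OF u gc]) (use gK K in auto)
  have "continuous_on K u" using u K(2) by (rule continuous_on_subset)
  then obtain B where B: "\<And>y. y \<in> K \<Longrightarrow> \<bar>u y\<bar> \<le> B"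
    using compact_imp_bounded[OF compact_continuous_image[OF _ K(1)]] by (force simp: bounded_iff)
  have VB: "\<bar>V z\<bar> \<le> B" if "cmod z < 1" for z
  proof -
    have "g z \<in> K" using gK that by (auto simp: image_subset_iff)
    then show ?thesis unfolding V_def by (rule B)
  qed
  have B0: "B \<ge> 0" using VB[of 0] by auto
  define \<Omega> where "\<Omega> = {z. r0 < cmod z \<and> cmod z < 1}"
  have \<Omega>: "open \<Omega>" "bounded \<Omega>"
    unfolding \<Omega>_def by (auto intro!: open_Collect_conj open_Collect_less continuous_intros simp: bounded_iff intro: exI[of _ 1])
  have clO: "closure \<Omega> \<subseteq> {z. r0 \<le> cmod z \<and> cmod z \<le> 1}" unfolding \<Omega>_def by (rule closure_annulus_subset)
  have step: "V (of_real r * w) \<le> poisson (\<lambda>\<zeta>. max 0 (V (of_real r * \<zeta>))) w + c * ln (cmod w)"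
    if r: "0 < r" "r < 1" and w: "w \<in> \<Omega>" for r w
  proof -
    define br where "br = (\<lambda>\<zeta>. max 0 (V (of_real r * \<zeta>)))"
    have inb: "of_real r * \<zeta> \<in> ball 0 1" if "cmod \<zeta> \<le> 1" for \<zeta>
    proof -
      have "r * cmod \<zeta> \<le> r * 1" using that r by (intro mult_left_mono) auto
      then have "r * cmod \<zeta> < 1" using r by linarith
      then show ?thesis using r by (simp add: norm_mult)
    qed
    have brc: "continuous_on (sphere 0 1) br"
      unfolding br_def by (intro continuous_on_max continuous_on_const continuous_on_compose2[OF Vc] continuous_intros)
         (use inb in auto)
    have brb: "bdd_circ br" by (rule bdd_circ_continuous[OF brc])
    define P where "P = (\<lambda>z. if cmod z < 1 then poisson br z else br z)"
    have Pc: "continuous_on (cball 0 1) P" unfolding P_def by (rule continuous_poisson_extension[OF brc])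
    have P0: "0 \<le> P z" if "cmod z \<le> 1" for z
      unfolding P_def using poisson_nonneg[OF brb, of z] by (auto simp: br_def)
    have "u (g (of_real r * w)) \<le> P w + c * ln (cmod w)"
    proof (rule psh_disc_maximum_principle[OF psh u G \<Omega>])
      show "continuous_on (closure \<Omega>) (\<lambda>z. g (of_real r * z))"
        by (rule continuous_on_compose2[OF gc]) (use clO inb in \<open>auto intro!: continuous_intros\<close>)
      show "(\<lambda>z. g (of_real r * z) $ j) holomorphic_on \<Omega>" for j
        by (rule holomorphic_on_compose_gen[OF _ gh[of j], unfolded o_def])
           (use inb in \<open>auto intro!: holomorphic_intros simp: \<Omega>_def\<close>)
      show "(\<lambda>z. g (of_real r * z)) ` closure \<Omega> \<subseteq> G" using clO inb gK K by blast
      show "continuous_on (closure \<Omega>) (\<lambda>z. P z + c * ln (cmod z))"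
        by (intro continuous_intros continuous_on_subset[OF Pc]) (use clO r0 in auto)
      show "\<exists>r>0. \<exists>k. k holomorphic_on ball z r \<and> (\<forall>w\<in>ball z r. P w + c * ln (cmod w) = Re (k w))"
        if zO: "z \<in> \<Omega>" for z
      proof -
        obtain r2 where r2: "r2 > 0" "ball z r2 \<subseteq> \<Omega>" using \<Omega>(1) zO open_contains_ball by blast
        have "w \<noteq> 0" if "w \<in> ball z r2" for w
          using subsetD[OF r2(2) that] r0 by (auto simp: \<Omega>_def)
        moreover have "(\<lambda>w. w) holomorphic_on ball z r2" by (intro holomorphic_intros)
        ultimately obtain lg where lg: "lg holomorphic_on ball z r2" "\<And>w. w \<in> ball z r2 \<Longrightarrow> w = exp (lg w)"
          using contractible_imp_holomorphic_log[of "\<lambda>w. w" "ball z r2"] convex_imp_contractible[OF convex_ball] by metis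
        have "P w + c * ln (cmod w) = Re (schwarz br w + of_real c * lg w)" if w: "w \<in> ball z r2" for w
        proof -
          have "cmod w < 1" using subsetD[OF r2(2) w] by (simp add: \<Omega>_def)
          moreover have "ln (cmod w) = Re (lg w)" using lg(2)[OF w] by (metis ln_exp norm_exp_eq_Re)
          ultimately show ?thesis using Re_schwarz[OF brb] by (simp add: P_def)
        qed
        moreover have "(\<lambda>w. schwarz br w + of_real c * lg w) holomorphic_on ball z r2"
          by (intro holomorphic_intros lg holomorphic_on_subset[OF holomorphic_schwarz[OF brb]])
             (use r2 in \<open>auto simp: \<Omega>_def\<close>)
        ultimately show ?thesis using r2(1) by blast
      qed
      show "u (g (of_real r * z)) \<le> P z + c * ln (cmod z)" if "z \<in> closure \<Omega> - \<Omega>" for z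
      proof -
        have zz: "cmod z = r0 \<or> cmod z = 1" using that clO unfolding \<Omega>_def by force
        then show ?thesis
        proof
          assume z1: "cmod z = r0"
          have "r * cmod z \<le> 1 * cmod z" using r by (intro mult_right_mono) auto
          then have "r * cmod z \<le> r0" using z1 by linarith
          then have "u (g (of_real r * z)) \<le> c * ln r0" using r by (intro inner) (simp add: norm_mult)
          then show ?thesis using P0[of z] z1 r0 by simp
        next
          assume "cmod z = 1"
          then show ?thesis by (simp add: P_def br_def V_def)
        qed
      qed
    qed (use w in auto)
    moreover have "cmod w < 1" using w by (simp add: \<Omega>_def)
    ultimately show ?thesis by (simp add: P_def V_def br_def)
  qed
  define rs where "rs = (\<lambda>n::nat. 1 - 1 / (real n + 2))"
  have rs: "0 < rs n" "rs n < 1" for n by (auto simp: rs_def field_simps)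
  have "rs \<longlonglongrightarrow> 1 - 0" unfolding rs_def
    using LIMSEQ_ignore_initial_segment[OF lim_1_over_n[where 'a = real], of 2] by (intro tendsto_diff tendsto_const) (simp add: add.commute)
  then have rs_lim: "rs \<longlonglongrightarrow> 1" by simp
  have rs_left: "filterlim rs (at_left 1) sequentially"
    by (rule tendsto_imp_filterlim_at_left[OF rs_lim]) (use rs in auto)
  \<comment> \<open>taking the maximum with \<open>b\<close> forces convergence to \<open>b\<close> itself, not merely to something below it\<close>
  define bn where "bn = (\<lambda>n \<zeta>. max (max 0 (V (of_real (rs n) * \<zeta>))) (b \<zeta>))"
  have inb: "of_real (rs n) * \<zeta> \<in> ball 0 1" if "cmod \<zeta> = 1" for n \<zeta>
    using that rs[of n] by (simp add: norm_mult)
  have c0: "continuous_on (sphere 0 1) (\<lambda>\<zeta>. max 0 (V (of_real (rs n) * \<zeta>)))" for n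
    by (intro continuous_on_max continuous_on_const continuous_on_compose2[OF Vc] continuous_intros)
       (use inb in auto)
  obtain Bb where Bb: "Bb \<ge> 0" "\<And>\<zeta>. cmod \<zeta> = 1 \<Longrightarrow> norm (b \<zeta>) \<le> Bb" using bdd_circ_bound[OF b(1)] by metis
  have bnB: "norm (bn n \<zeta>) \<le> B + Bb" if "cmod \<zeta> = 1" for n \<zeta>
    using VB[of "of_real (rs n) * \<zeta>"] inb[OF that, of n] Bb(2)[OF that] B0 Bb(1) by (auto simp: bn_def)
  have bnm: "bn n \<in> borel_measurable circ" for n
    unfolding bn_def by (intro borel_measurable_max measurable_circ_continuous c0 bdd_circ_measurable b(1))
  have bnb: "bdd_circ (bn n)" for n using bnm bnB unfolding bdd_circ_def by blast
  have ev: "V (of_real (rs n) * z) \<le> poisson (bn n) z + c * ln (cmod z)" for n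
  proof -
    have "poisson (\<lambda>\<zeta>. max 0 (V (of_real (rs n) * \<zeta>))) z \<le> poisson (bn n) z"
      by (rule poisson_mono[OF bdd_circ_continuous[OF c0] bnb z(2)]) (auto simp: bn_def)
    then show ?thesis using step[OF rs, of z n] z by (simp add: \<Omega>_def)
  qed
  have "(\<lambda>n. integral\<^sup>L circ (\<lambda>\<zeta>. poisson_kernel z \<zeta> *\<^sub>R bn n \<zeta>)) \<longlonglongrightarrow> integral\<^sup>L circ (\<lambda>\<zeta>. poisson_kernel z \<zeta> *\<^sub>R b \<zeta>)"
  proof (rule integral_dominated_convergence[where w = "\<lambda>\<zeta>. poisson_kernel z \<zeta> *\<^sub>R (B + Bb)"])
    show "integrable circ (\<lambda>\<zeta>. poisson_kernel z \<zeta> *\<^sub>R (B + Bb))" by (rule poisson_integrable[OF bdd_circ_const z(2)])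
    show "AE \<zeta> in circ. (\<lambda>n. poisson_kernel z \<zeta> *\<^sub>R bn n \<zeta>) \<longlonglongrightarrow> poisson_kernel z \<zeta> *\<^sub>R b \<zeta>"
      using lim AE_space
    proof eventually_elim
      case (elim \<zeta>)
      then obtain l where l: "((\<lambda>r. V (of_real r * \<zeta>)) \<longlongrightarrow> l) (at_left 1)" "l \<le> b \<zeta>" unfolding V_def by blast
      have "(\<lambda>n. V (of_real (rs n) * \<zeta>)) \<longlonglongrightarrow> l" by (rule filterlim_compose[OF l(1) rs_left])
      then have "(\<lambda>n. bn n \<zeta>) \<longlonglongrightarrow> max (max 0 l) (b \<zeta>)" unfolding bn_def by (intro tendsto_intros)
      moreover have "max (max 0 l) (b \<zeta>) = b \<zeta>" using l(2) b(2)[of \<zeta>] elim by auto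
      ultimately show ?case by (intro tendsto_intros) simp
    qed
    show "AE \<zeta> in circ. norm (poisson_kernel z \<zeta> *\<^sub>R bn n \<zeta>) \<le> poisson_kernel z \<zeta> *\<^sub>R (B + Bb)" for n
      using bnB poisson_kernel_nonneg[OF z(2)] by (intro AE_I2) (auto simp: abs_mult intro!: mult_left_mono)
  qed (use poisson_integrable[OF bnb z(2)] poisson_integrable[OF b(1) z(2)] in auto)
  then have lim1: "(\<lambda>n. poisson (bn n) z + c * ln (cmod z)) \<longlonglongrightarrow> poisson b z + c * ln (cmod z)"
    unfolding poisson_def by (intro tendsto_intros)
  have lim2: "(\<lambda>n. V (of_real (rs n) * z)) \<longlonglongrightarrow> V (of_real 1 * z)"
  proof (rule continuous_on_tendsto_compose[OF Vc])
    show "(\<lambda>n. of_real (rs n) * z) \<longlonglongrightarrow> of_real 1 * z" by (intro tendsto_intros rs_lim)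
    show "\<forall>\<^sub>F n in sequentially. of_real (rs n) * z \<in> ball 0 1"
    proof (intro always_eventually allI)
      fix n
      have "rs n * cmod z \<le> 1 * cmod z" using rs[of n] by (intro mult_right_mono) auto
      then have "rs n * cmod z < 1" using z by linarith
      then show "of_real (rs n) * z \<in> ball 0 1" using rs[of n] by (simp add: norm_mult)
    qed
  qed (use z in auto)
  have "V (of_real 1 * z) \<le> poisson b z + c * ln (cmod z)"
    by (rule LIMSEQ_le[OF lim2 lim1]) (use ev in auto)
  then show ?thesis by (simp add: V_def)
qed

section \<open>Multipliers from a positive infimum\<close>

text \<open>
  The Huber function: a convex \<open>C\<^sup>1\<close> approximation of the positive part, with derivative \<open>clamp01\<close>.
\<close>

definition huber :: "real \<Rightarrow> real" where
  "huber r = (if r \<le> 0 then 0 else if r \<le> 1 then r\<^sup>2 / 2 else r - 1 / 2)"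

definition clamp01 :: "real \<Rightarrow> real" where
  "clamp01 r = max 0 (min 1 r)"

lemma clamp01_bounds: "0 \<le> clamp01 r" "clamp01 r \<le> 1"
  by (auto simp: clamp01_def)

text \<open>
  Convexity with a quadratic gain in the derivative, as for every convex function with 1-Lipschitz
  derivative.  The gain is what makes derivatives along a minimising sequence converge.
\<close>

lemma huber_cocoercive:
  "huber a + clamp01 a * (b - a) + (clamp01 b - clamp01 a)\<^sup>2 / 2 \<le> huber b"
proof -
  consider "a \<le> 0" "b \<le> 0" | "a \<le> 0" "0 < b" "b \<le> 1" | "a \<le> 0" "1 < b"
    | "0 < a" "a \<le> 1" "b \<le> 0" | "0 < a" "a \<le> 1" "0 < b" "b \<le> 1" | "0 < a" "a \<le> 1" "1 < b"
    | "1 < a" "b \<le> 0" | "1 < a" "0 < b" "b \<le> 1" | "1 < a" "1 < b"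
    by (cases "a \<le> 0"; cases "a \<le> 1"; cases "b \<le> 0"; cases "b \<le> 1") (auto simp: not_le)
  then show ?thesis
  proof cases
    case 4
    then have "a * b \<le> 0" by (simp add: mult_nonneg_nonpos)
    then show ?thesis using 4 by (simp add: huber_def clamp01_def power2_eq_square algebra_simps)
  next
    case 6
    then have "0 \<le> (1 - a) * (b - 1)" by simp
    then show ?thesis using 6 by (simp add: huber_def clamp01_def power2_eq_square field_simps)
  qed (simp_all add: huber_def clamp01_def power2_eq_square field_simps)
qed

text \<open>
  The upper counterpart, which comes from the same bound with the two points exchanged.
\<close>

lemma huber_upper: "huber b \<le> huber a + clamp01 a * (b - a) + (b - a)\<^sup>2 / 2"
proof -
  have "\<bar>clamp01 b - clamp01 a\<bar> \<le> \<bar>b - a\<bar>" by (auto simp: clamp01_def)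
  have "huber b \<le> huber a + clamp01 b * (b - a) - (clamp01 b - clamp01 a)\<^sup>2 / 2"
    using huber_cocoercive[of b a] by (simp add: power2_eq_square algebra_simps)
  also have "\<dots> = huber a + clamp01 a * (b - a) + ((clamp01 b - clamp01 a) * (b - a) - (clamp01 b - clamp01 a)\<^sup>2 / 2)"
    by (simp add: algebra_simps)
  also have "(clamp01 b - clamp01 a) * (b - a) - (clamp01 b - clamp01 a)\<^sup>2 / 2 \<le> (b - a)\<^sup>2 / 2"
  proof -
    have "x * y - x\<^sup>2 / 2 \<le> y\<^sup>2 / 2" for x y :: real
      using zero_le_power2[of "y - x"] by (simp add: power2_eq_square algebra_simps)
    then show ?thesis .
  qed
  finally show ?thesis by simp
qed

lemma huber_nonneg: "0 \<le> huber r"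
  by (auto simp: huber_def)

lemma huber_ge: "max 0 r - 1 / 2 \<le> huber r"
proof -
  have "0 \<le> (r - 1)\<^sup>2" by simp
  then show ?thesis by (auto simp: huber_def power2_eq_square algebra_simps max_def)
qed

lemma huber_scale: "0 \<le> s \<Longrightarrow> s \<le> 1 \<Longrightarrow> huber ((1 - s) * r) \<le> (1 - s) * huber r"
proof -
  assume s: "0 \<le> s" "s \<le> 1"
  let ?m = "(1 - s) * r"
  have 1: "huber ?m + clamp01 ?m * (r - ?m) \<le> huber r" and 2: "huber ?m + clamp01 ?m * (0 - ?m) \<le> huber 0"
    using huber_cocoercive[of ?m r] huber_cocoercive[of ?m 0] by (smt (verit) zero_le_power2 divide_nonneg_nonneg)+
  have "(1 - s) * (huber ?m + clamp01 ?m * (r - ?m)) + s * (huber ?m + clamp01 ?m * (0 - ?m)) \<le> (1 - s) * huber r + s * huber 0"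
    using s 1 2 by (intro add_mono mult_left_mono) auto
  moreover have "(1 - s) * (huber ?m + clamp01 ?m * (r - ?m)) + s * (huber ?m + clamp01 ?m * (0 - ?m)) = huber ?m"
    by (simp add: algebra_simps)
  ultimately show ?thesis by (simp add: huber_def)
qed

lemma borel_measurable_huber [measurable]: "huber \<in> borel_measurable borel"
  unfolding huber_def by measurable

lemma borel_measurable_clamp01 [measurable]: "clamp01 \<in> borel_measurable borel"
  unfolding clamp01_def by measurable

lemma huber_le_abs: "huber r \<le> \<bar>r\<bar>"
proof (cases "0 < r \<and> r \<le> 1")
  case True
  then have "r * r \<le> r * 1" by (intro mult_left_mono) auto
  then show ?thesis using True by (simp add: huber_def power2_eq_square)
qed (auto simp: huber_def)

lemma convergent_if_summable_diff:
  fixes f :: "nat \<Rightarrow> real"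
  assumes "summable (\<lambda>i. f (Suc i) - f i)" shows "convergent f"
proof -
  have "convergent (\<lambda>n. \<Sum>i<n. f (Suc i) - f i)" using assms by (simp add: summable_iff_convergent)
  then have "convergent (\<lambda>n. f n - f 0)" unfolding sum_lessThan_telescope .
  then show ?thesis by (simp add: convergent_diff_const_right_iff)
qed

text \<open>
  Take near-minimisers \<open>(r\<^sub>i, y\<^sub>i)\<close> of the functional \<open>J\<close> in the last hypothesis, within \<open>4\<^sup>-\<^sup>i\<close> of the infimum.
  Comparing \<open>J\<close> at two of them with \<open>J\<close> at their midpoint, \<open>huber_cocoercive\<close> shows that the pairs
  \<open>(clamp01 r\<^sub>i, e - y\<^sub>i)\<close>, which represent the derivatives of \<open>J\<close>, form a Cauchy sequence, fast enough for convergence almost everywhere.  Perturbing a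
  near-minimiser in a direction of \<open>V\<close> shows that the derivative in this direction is of size \<open>2\<^sup>-\<^sup>i\<close>, so
  that it vanishes in the limit.  Perturbing it towards \<open>0\<close> gives \<open>\<kappa> \<le> \<Sum> \<lambda>\<^sub>j e\<^sub>j\<close>, hence the last claim.
\<close>

theorem bounded_multiplier_exists:
  fixes M :: "'a measure" and V :: "(('a \<Rightarrow> real) \<times> (nat \<Rightarrow> real)) set" and e :: "nat \<Rightarrow> real"
  assumes M: "finite_measure M" and V0: "V \<noteq> {}"
    and Vlin: "\<And>r y r' y' c. (r, y) \<in> V \<Longrightarrow> (r', y') \<in> V \<Longrightarrow> (\<lambda>x. r x + c * r' x, \<lambda>j. y j + c * y' j) \<in> V"
    and Vm: "\<And>r y. (r, y) \<in> V \<Longrightarrow> r \<in> borel_measurable M"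
    and Vb: "\<And>r y. (r, y) \<in> V \<Longrightarrow> \<exists>B. \<forall>x\<in>space M. \<bar>r x\<bar> \<le> B"
    and \<kappa>: "0 < \<kappa>" "\<And>r y. (r, y) \<in> V \<Longrightarrow> \<kappa> \<le> integral\<^sup>L M (\<lambda>x. huber (r x)) + (\<Sum>j=1..N. (y j - e j)\<^sup>2) / 2"
  obtains \<rho> lam where "\<rho> \<in> borel_measurable M" "\<And>x. 0 \<le> \<rho> x \<and> \<rho> x \<le> 1"
    "\<And>r y. (r, y) \<in> V \<Longrightarrow> integral\<^sup>L M (\<lambda>x. \<rho> x * r x) = (\<Sum>j=1..N. lam j * y j)"
    "0 < (\<Sum>j=1..N. lam j * e j)"
proof -
  interpret finite_measure M by fact
  define J where "J = (\<lambda>(r, y). integral\<^sup>L M (\<lambda>x. huber (r x)) + (\<Sum>j=1..N. (y j - e j)\<^sup>2) / 2)"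
  have bint: "integrable M f" if "f \<in> borel_measurable M" "\<And>x. x \<in> space M \<Longrightarrow> \<bar>f x\<bar> \<le> B" for f :: "'a \<Rightarrow> real" and B
    by (rule integrable_const_bound[where B = B]) (use that in auto)
  have hint: "integrable M (\<lambda>x. huber (r x))" if V': "(r, y) \<in> V" for r y
  proof -
    obtain B where B: "\<forall>x\<in>space M. \<bar>r x\<bar> \<le> B" using Vb[OF V'] by blast
    have [measurable]: "r \<in> borel_measurable M" by (rule Vm[OF V'])
    show ?thesis
    proof (rule bint[where B = B])
      fix x assume "x \<in> space M"
      then show "\<bar>huber (r x)\<bar> \<le> B" using B huber_le_abs[of "r x"] huber_nonneg[of "r x"] by fastforce
    qed measurable
  qed
  have Jlow: "\<kappa> \<le> J v" if "v \<in> V" for v using \<kappa>(2) that by (cases v) (auto simp: J_def)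
  define m where "m = (INF v\<in>V. J v)"
  have bddb: "bdd_below (J ` V)" by (rule bdd_belowI2) (rule Jlow)
  have mJ: "m \<le> J v" if "v \<in> V" for v unfolding m_def by (rule cINF_lower[OF bddb that])
  have mk: "\<kappa> \<le> m" unfolding m_def by (rule cINF_greatest[OF V0]) (rule Jlow)
  have "\<exists>v\<in>V. J v < m + (1 / 4) ^ i" for i :: nat
    unfolding m_def by (rule cInf_lessD[of "J ` V", simplified]) (use V0 in auto)
  then obtain v where v: "\<And>i. v i \<in> V" "\<And>i. J (v i) < m + (1 / 4) ^ i" by metis
  define r where "r = (\<lambda>i. fst (v i))"
  define y where "y = (\<lambda>i. snd (v i))"
  have ry: "(r i, y i) \<in> V" for i using v(1)[of i] by (simp add: r_def y_def)
  have Jry: "J (r i, y i) < m + (1 / 4) ^ i" for i using v(2)[of i] by (simp add: r_def y_def)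
  have [measurable]: "r i \<in> borel_measurable M" for i by (rule Vm[OF ry])
  define \<rho> where "\<rho> = (\<lambda>i x. clamp01 (r i x))"
  have \<rho>m [measurable]: "\<rho> i \<in> borel_measurable M" for i unfolding \<rho>_def by measurable
  have \<rho>b: "0 \<le> \<rho> i x" "\<rho> i x \<le> 1" for i x by (auto simp: \<rho>_def clamp01_bounds)
  define lam where "lam = (\<lambda>i j. e j - y i j)"

  \<comment> \<open>near-stationarity: the perturbation by \<open>c (r', y')\<close> with \<open>c = \<plusminus> 2\<^sup>-\<^sup>i\<close> costs at most \<open>4\<^sup>-\<^sup>i\<close>\<close>
  have stat: "\<bar>integral\<^sup>L M (\<lambda>x. \<rho> i x * r' x) - (\<Sum>j=1..N. lam i j * y' j)\<bar>
      \<le> (1 / 2) ^ i * (1 + (integral\<^sup>L M (\<lambda>x. (r' x)\<^sup>2) + (\<Sum>j=1..N. (y' j)\<^sup>2)) / 2)"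
    if V': "(r', y') \<in> V" for i r' y'
  proof -
    define D where "D = integral\<^sup>L M (\<lambda>x. \<rho> i x * r' x) - (\<Sum>j=1..N. lam i j * y' j)"
    define Q where "Q = integral\<^sup>L M (\<lambda>x. (r' x)\<^sup>2) + (\<Sum>j=1..N. (y' j)\<^sup>2)"
    obtain B where B: "\<forall>x\<in>space M. \<bar>r' x\<bar> \<le> B" using Vb[OF V'] by blast
    have [measurable]: "r' \<in> borel_measurable M" by (rule Vm[OF V'])
    have i1: "integrable M (\<lambda>x. \<rho> i x * r' x)"
    proof (rule bint[where B = B])
      fix x assume x: "x \<in> space M"
      have "\<bar>\<rho> i x * r' x\<bar> \<le> 1 * \<bar>r' x\<bar>" unfolding abs_mult using \<rho>b[of i x] by (intro mult_right_mono) auto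
      then show "\<bar>\<rho> i x * r' x\<bar> \<le> B" using B x by fastforce
    qed measurable
    have i2: "integrable M (\<lambda>x. (r' x)\<^sup>2)"
    proof (rule bint[where B = "B\<^sup>2"])
      fix x assume "x \<in> space M"
      then have "\<bar>r' x\<bar>\<^sup>2 \<le> B\<^sup>2" using B by (intro power_mono) auto
      then show "\<bar>(r' x)\<^sup>2\<bar> \<le> B\<^sup>2" by simp
    qed measurable
    have main: "- ((1 / 4) ^ i) \<le> c * D + c\<^sup>2 * Q / 2" for c
    proof -
      have vc: "(\<lambda>x. r i x + c * r' x, \<lambda>j. y i j + c * y' j) \<in> V" by (rule Vlin[OF ry V'])
      have "integral\<^sup>L M (\<lambda>x. huber (r i x + c * r' x)) \<le> integral\<^sup>L M (\<lambda>x. huber (r i x) + c * (\<rho> i x * r' x) + c\<^sup>2 / 2 * (r' x)\<^sup>2)"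
      proof (rule integral_mono[OF hint[OF vc]])
        show "integrable M (\<lambda>x. huber (r i x) + c * (\<rho> i x * r' x) + c\<^sup>2 / 2 * (r' x)\<^sup>2)"
          using hint[OF ry] i1 i2 by auto
        fix x
        show "huber (r i x + c * r' x) \<le> huber (r i x) + c * (\<rho> i x * r' x) + c\<^sup>2 / 2 * (r' x)\<^sup>2"
          using huber_upper[of "r i x + c * r' x" "r i x"] by (simp add: \<rho>_def power_mult_distrib mult_ac)
      qed
      also have "\<dots> = integral\<^sup>L M (\<lambda>x. huber (r i x)) + c * integral\<^sup>L M (\<lambda>x. \<rho> i x * r' x) + c\<^sup>2 / 2 * integral\<^sup>L M (\<lambda>x. (r' x)\<^sup>2)"
        using hint[OF ry] i1 i2 by simp
      finally have a: "integral\<^sup>L M (\<lambda>x. huber (r i x + c * r' x)) \<le> \<dots>" .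
      have b: "(\<Sum>j=1..N. (y i j + c * y' j - e j)\<^sup>2) = (\<Sum>j=1..N. (y i j - e j)\<^sup>2) - 2 * c * (\<Sum>j=1..N. lam i j * y' j) + c\<^sup>2 * (\<Sum>j=1..N. (y' j)\<^sup>2)"
        unfolding sum_distrib_left sum.distrib[symmetric] sum_subtractf[symmetric]
        by (rule sum.cong[OF refl]) (simp add: lam_def power2_eq_square algebra_simps)
      have "m \<le> J (\<lambda>x. r i x + c * r' x, \<lambda>j. y i j + c * y' j)" by (rule mJ[OF vc])
      then have "m \<le> J (r i, y i) + c * D + c\<^sup>2 * Q / 2"
      proof -
        have gen: "m \<le> X + Y / 2 \<Longrightarrow> X \<le> h + c * A + c\<^sup>2 / 2 * P \<Longrightarrow> Y = E - 2 * c * L + c\<^sup>2 * T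
            \<Longrightarrow> m \<le> h + E / 2 + c * (A - L) + c\<^sup>2 * (P + T) / 2"
          for X Y h A P E L T :: real by (simp add: field_simps)
        show ?thesis using \<open>m \<le> J (\<lambda>x. r i x + c * r' x, \<lambda>j. y i j + c * y' j)\<close>
          unfolding J_def D_def Q_def prod.case by (rule gen[OF _ a b])
      qed
      then show ?thesis using Jry[of i] by linarith
    qed
    define s where "s = (1 / 2 :: real) ^ i"
    have s: "s > 0" "s\<^sup>2 = (1 / 4) ^ i" by (auto simp: s_def power_mult[symmetric] power2_eq_square power_mult_distrib[symmetric])
    have "- (s\<^sup>2) \<le> (- s) * D + s\<^sup>2 * Q / 2" using main[of "- s"] s by simp
    then have "s * D \<le> s * (s * (1 + Q / 2))" by (simp add: power2_eq_square algebra_simps)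
    then have u: "D \<le> s * (1 + Q / 2)" using s by (simp only: mult_le_cancel_left_pos)
    have "- (s\<^sup>2) \<le> s * D + s\<^sup>2 * Q / 2" using main[of s] s by simp
    then have "s * (- D) \<le> s * (s * (1 + Q / 2))" by (simp add: power2_eq_square algebra_simps)
    then have "- D \<le> s * (1 + Q / 2)" using s by (simp only: mult_le_cancel_left_pos)
    with u show ?thesis unfolding D_def[symmetric] Q_def[symmetric] s_def[symmetric] by (simp only: abs_le_iff)
  qed

  \<comment> \<open>the midpoint of two near-minimisers is no better than the infimum, so the quadratic gain is small\<close>
  have cauchy: "integral\<^sup>L M (\<lambda>x. (\<rho> i x - \<rho> (Suc i) x)\<^sup>2) + (\<Sum>j=1..N. (lam i j - lam (Suc i) j)\<^sup>2) \<le> 8 * (1 / 4) ^ i" for i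
  proof -
    let ?r = "r i" and ?r' = "r (Suc i)" and ?y = "y i" and ?y' = "y (Suc i)"
    have half: "(\<lambda>x. r k x + (- 1 / 2) * r k x, \<lambda>j. y k j + (- 1 / 2) * y k j) \<in> V" for k by (rule Vlin[OF ry ry])
    have "(\<lambda>x. (?r x + (- 1 / 2) * ?r x) + (1 / 2) * ?r' x, \<lambda>j. (?y j + (- 1 / 2) * ?y j) + (1 / 2) * ?y' j) \<in> V"
      by (rule Vlin[OF half ry])
    moreover have "(\<lambda>x. (?r x + (- 1 / 2) * ?r x) + (1 / 2) * ?r' x) = (\<lambda>x. (?r x + ?r' x) / 2)"
      "(\<lambda>j. (?y j + (- 1 / 2) * ?y j) + (1 / 2) * ?y' j) = (\<lambda>j. (?y j + ?y' j) / 2)" by (auto simp: field_simps)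
    ultimately have mid: "(\<lambda>x. (?r x + ?r' x) / 2, \<lambda>j. (?y j + ?y' j) / 2) \<in> V" by simp
    have i3: "integrable M (\<lambda>x. (\<rho> i x - \<rho> (Suc i) x)\<^sup>2)"
    proof (rule bint[where B = 1])
      fix x
      have "\<bar>\<rho> i x - \<rho> (Suc i) x\<bar> \<le> 1" using \<rho>b[of i x] \<rho>b[of "Suc i" x] by auto
      then show "\<bar>(\<rho> i x - \<rho> (Suc i) x)\<^sup>2\<bar> \<le> 1" using power_mono[of "\<bar>\<rho> i x - \<rho> (Suc i) x\<bar>" 1 2] by simp
    qed measurable
    have hp: "huber ((a + b) / 2) + (clamp01 a - clamp01 b)\<^sup>2 / 8 \<le> (huber a + huber b) / 2" for a b
    proof -
      let ?q = "(a + b) / 2"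
      have 1: "huber ?q + clamp01 ?q * (a - ?q) + (clamp01 a - clamp01 ?q)\<^sup>2 / 2 \<le> huber a" by (rule huber_cocoercive)
      have 2: "huber ?q + clamp01 ?q * (b - ?q) + (clamp01 b - clamp01 ?q)\<^sup>2 / 2 \<le> huber b" by (rule huber_cocoercive)
      have 3: "clamp01 ?q * (a - ?q) + clamp01 ?q * (b - ?q) = 0" by (simp add: distrib_left[symmetric])
      have 4: "(clamp01 a - clamp01 b)\<^sup>2 \<le> 2 * ((clamp01 a - clamp01 ?q)\<^sup>2 + (clamp01 b - clamp01 ?q)\<^sup>2)"
        using zero_le_power2[of "(clamp01 a - clamp01 ?q) + (clamp01 b - clamp01 ?q)"]
        by (simp add: power2_eq_square algebra_simps)
      have gen: "h + s + A / 2 \<le> x \<Longrightarrow> h + t + B / 2 \<le> y \<Longrightarrow> s + t = 0 \<Longrightarrow> C \<le> 2 * (A + B)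
          \<Longrightarrow> h + C / 8 \<le> (x + y) / 2" for h s t x y A B C :: real
        by (simp add: field_simps)
      show ?thesis by (rule gen[OF 1 2 3 4])
    qed
    have "integral\<^sup>L M (\<lambda>x. huber ((?r x + ?r' x) / 2) + (\<rho> i x - \<rho> (Suc i) x)\<^sup>2 / 8) \<le> integral\<^sup>L M (\<lambda>x. (huber (?r x) + huber (?r' x)) / 2)"
      by (rule integral_mono) (use hint[OF mid] i3 hint[OF ry] hp in \<open>auto simp: \<rho>_def\<close>)
    then have a: "integral\<^sup>L M (\<lambda>x. huber ((?r x + ?r' x) / 2)) + integral\<^sup>L M (\<lambda>x. (\<rho> i x - \<rho> (Suc i) x)\<^sup>2) / 8
        \<le> (integral\<^sup>L M (\<lambda>x. huber (?r x)) + integral\<^sup>L M (\<lambda>x. huber (?r' x))) / 2"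
      using hint[OF mid] i3 hint[OF ry] by simp
    have b: "(\<Sum>j=1..N. ((?y j + ?y' j) / 2 - e j)\<^sup>2) / 2 + (\<Sum>j=1..N. (lam i j - lam (Suc i) j)\<^sup>2) / 8
        = ((\<Sum>j=1..N. (?y j - e j)\<^sup>2) / 2 + (\<Sum>j=1..N. (?y' j - e j)\<^sup>2) / 2) / 2"
      unfolding sum_divide_distrib sum.distrib[symmetric]
      by (rule sum.cong[OF refl]) (simp add: lam_def power2_eq_square field_simps)
    have "m \<le> J (\<lambda>x. (?r x + ?r' x) / 2, \<lambda>j. (?y j + ?y' j) / 2)" by (rule mJ[OF mid])
    moreover have q: "(1 / 4 :: real) ^ Suc i \<le> (1 / 4) ^ i" by simp
    moreover have gen: "m \<le> X + Y / 2 \<Longrightarrow> q' \<le> q \<Longrightarrow> X + P / 8 \<le> (h + h') / 2 \<Longrightarrow> Y / 2 + T / 8 = (S / 2 + S' / 2) / 2 \<Longrightarrow>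
        h + S / 2 < m + q \<Longrightarrow> h' + S' / 2 < m + q' \<Longrightarrow> P + T \<le> 8 * q" for X Y P T h h' S S' q q' :: real
      by argo
    ultimately show ?thesis using gen[OF _ q a b] Jry[of i] Jry[of "Suc i"] unfolding J_def prod.case by blast
  qed

  \<comment> \<open>turns the \<open>L\<^sup>2\<close> bound into an \<open>L\<^sup>1\<close> bound, with \<open>s = 2\<^sup>i\<close>\<close>
  have sq: "x \<le> s / 2 * x\<^sup>2 + 1 / (2 * s)" if "s > 0" for x s :: real
  proof -
    have "0 \<le> (s * x - 1)\<^sup>2 / (2 * s)" using that by simp
    also have "\<dots> = s / 2 * x\<^sup>2 + 1 / (2 * s) - x" using that by (simp add: power2_eq_square field_simps)
    finally show ?thesis by simp
  qed
  define C where "C = 4 + measure M (space M)"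
  have C0: "C \<ge> 0" by (simp add: C_def)
  have L1: "(\<integral>\<^sup>+x. ennreal \<bar>\<rho> (Suc i) x - \<rho> i x\<bar> \<partial>M) \<le> ennreal (C * (1 / 2) ^ i)" for i
  proof -
    have i3: "integrable M (\<lambda>x. (\<rho> i x - \<rho> (Suc i) x)\<^sup>2)"
    proof (rule bint[where B = 1])
      fix x
      have "\<bar>\<rho> i x - \<rho> (Suc i) x\<bar> \<le> 1" using \<rho>b[of i x] \<rho>b[of "Suc i" x] by auto
      then show "\<bar>(\<rho> i x - \<rho> (Suc i) x)\<^sup>2\<bar> \<le> 1" using power_mono[of "\<bar>\<rho> i x - \<rho> (Suc i) x\<bar>" 1 2] by simp
    qed measurable
    have i4: "integrable M (\<lambda>x. \<bar>\<rho> (Suc i) x - \<rho> i x\<bar>)"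
    proof (rule bint[where B = 1])
      fix x
      show "\<bar>\<bar>\<rho> (Suc i) x - \<rho> i x\<bar>\<bar> \<le> 1" using \<rho>b[of i x] \<rho>b[of "Suc i" x] by auto
    qed measurable
    have "integral\<^sup>L M (\<lambda>x. \<bar>\<rho> (Suc i) x - \<rho> i x\<bar>) \<le> integral\<^sup>L M (\<lambda>x. 2 ^ i / 2 * (\<rho> i x - \<rho> (Suc i) x)\<^sup>2 + 1 / (2 * 2 ^ i))"
    proof (rule integral_mono[OF i4])
      show "integrable M (\<lambda>x. 2 ^ i / 2 * (\<rho> i x - \<rho> (Suc i) x)\<^sup>2 + 1 / (2 * 2 ^ i))" using i3 by auto
      fix x
      have "(\<rho> i x - \<rho> (Suc i) x)\<^sup>2 = \<bar>\<rho> (Suc i) x - \<rho> i x\<bar>\<^sup>2" by (simp add: power2_commute)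
      then show "\<bar>\<rho> (Suc i) x - \<rho> i x\<bar> \<le> 2 ^ i / 2 * (\<rho> i x - \<rho> (Suc i) x)\<^sup>2 + 1 / (2 * 2 ^ i)"
        using sq[of "2 ^ i" "\<bar>\<rho> (Suc i) x - \<rho> i x\<bar>"] by simp
    qed
    also have "\<dots> = 2 ^ i / 2 * integral\<^sup>L M (\<lambda>x. (\<rho> i x - \<rho> (Suc i) x)\<^sup>2) + measure M (space M) * (1 / (2 * 2 ^ i))"
      using i3 by simp
    also have "\<dots> \<le> 2 ^ i / 2 * (8 * (1 / 4) ^ i) + measure M (space M) * (1 / 2 ^ i)"
    proof (intro add_mono mult_left_mono)
      have "0 \<le> (\<Sum>j=1..N. (lam i j - lam (Suc i) j)\<^sup>2)" by (simp add: sum_nonneg)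
      then show "integral\<^sup>L M (\<lambda>x. (\<rho> i x - \<rho> (Suc i) x)\<^sup>2) \<le> 8 * (1 / 4) ^ i" using cauchy[of i] by linarith
    qed (auto simp: field_simps)
    also have "\<dots> = C * (1 / 2) ^ i"
    proof -
      have "(2::real) ^ i * (1 / 4) ^ i = (1 / 2) ^ i" by (simp add: power_mult_distrib[symmetric])
      then show ?thesis by (simp add: C_def algebra_simps power_one_over)
    qed
    finally have "integral\<^sup>L M (\<lambda>x. \<bar>\<rho> (Suc i) x - \<rho> i x\<bar>) \<le> C * (1 / 2) ^ i" .
    then show ?thesis by (subst nn_integral_eq_integral[OF i4]) (auto intro: ennreal_leI)
  qed
  have "(\<integral>\<^sup>+x. (\<Sum>i. ennreal \<bar>\<rho> (Suc i) x - \<rho> i x\<bar>) \<partial>M) = (\<Sum>i. \<integral>\<^sup>+x. ennreal \<bar>\<rho> (Suc i) x - \<rho> i x\<bar> \<partial>M)"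
    by (rule nn_integral_suminf) measurable
  also have "\<dots> \<le> (\<Sum>i. ennreal (C * (1 / 2) ^ i))"
    by (rule suminf_le[OF L1]) auto
  also have "\<dots> = ennreal (\<Sum>i. C * (1 / 2) ^ i)"
    by (rule suminf_ennreal2) (use C0 in \<open>auto intro!: summable_mult summable_geometric\<close>)
  also have "\<dots> < top" by simp
  finally have fin: "(\<integral>\<^sup>+x. (\<Sum>i. ennreal \<bar>\<rho> (Suc i) x - \<rho> i x\<bar>) \<partial>M) \<noteq> \<infinity>" by simp
  have "AE x in M. (\<Sum>i. ennreal \<bar>\<rho> (Suc i) x - \<rho> i x\<bar>) \<noteq> \<infinity>"
    by (rule nn_integral_noteq_infinite[OF _ fin]) measurable
  then have conv: "AE x in M. convergent (\<lambda>i. \<rho> i x)"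
  proof eventually_elim
    case (elim x)
    then have "summable (\<lambda>i. \<bar>\<rho> (Suc i) x - \<rho> i x\<bar>)" by (intro summable_suminf_not_top) auto
    then have "summable (\<lambda>i. \<rho> (Suc i) x - \<rho> i x)" by (rule summable_rabs_cancel)
    then show ?case by (rule convergent_if_summable_diff)
  qed
  define \<rho>' where "\<rho>' = (\<lambda>x. clamp01 (lim (\<lambda>i. \<rho> i x)))"
  have \<rho>'m [measurable]: "\<rho>' \<in> borel_measurable M" unfolding \<rho>'_def by measurable
  have \<rho>'b: "0 \<le> \<rho>' x \<and> \<rho>' x \<le> 1" for x by (simp add: \<rho>'_def clamp01_bounds)
  have lim: "AE x in M. (\<lambda>i. \<rho> i x) \<longlonglongrightarrow> \<rho>' x"
    using conv
  proof eventually_elim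
    case (elim x)
    then have l: "(\<lambda>i. \<rho> i x) \<longlonglongrightarrow> lim (\<lambda>i. \<rho> i x)" by (simp add: convergent_LIMSEQ_iff)
    have "0 \<le> lim (\<lambda>i. \<rho> i x)" "lim (\<lambda>i. \<rho> i x) \<le> 1"
      using LIMSEQ_le_const[OF l] LIMSEQ_le_const2[OF l] \<rho>b by blast+
    then show ?case using l by (simp add: \<rho>'_def clamp01_def)
  qed
  have "convergent (\<lambda>i. lam i j)" if j: "j \<in> {1..N}" for j
  proof -
    have bd: "\<bar>lam (Suc i) j - lam i j\<bar> \<le> 3 * (1 / 2) ^ i" for i
    proof -
      have "(lam i j - lam (Suc i) j)\<^sup>2 \<le> (\<Sum>j=1..N. (lam i j - lam (Suc i) j)\<^sup>2)"
        by (rule member_le_sum[OF j]) auto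
      moreover have "0 \<le> integral\<^sup>L M (\<lambda>x. (\<rho> i x - \<rho> (Suc i) x)\<^sup>2)" by simp
      ultimately have "(lam i j - lam (Suc i) j)\<^sup>2 \<le> 8 * (1 / 4) ^ i" using cauchy[of i] by linarith
      also have "\<dots> \<le> 9 * (1 / 4) ^ i" by simp
      also have "\<dots> = (3 * (1 / 2) ^ i)\<^sup>2" by (simp add: power_mult_distrib power_mult[symmetric] power2_eq_square) (simp add: power_mult_distrib[symmetric])
      finally have "\<bar>lam i j - lam (Suc i) j\<bar> \<le> \<bar>3 * (1 / 2) ^ i\<bar>" by (simp only: abs_le_square_iff)
      then show ?thesis by (simp add: abs_minus_commute)
    qed
    have "summable (\<lambda>i. 3 * (1 / 2 :: real) ^ i)" by (intro summable_mult summable_geometric) simp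
    then have "summable (\<lambda>i. lam (Suc i) j - lam i j)"
      by (rule summable_comparison_test'[where N = 0]) (simp add: bd)
    then show ?thesis by (rule convergent_if_summable_diff)
  qed
  then have lam': "(\<lambda>i. lam i j) \<longlonglongrightarrow> lim (\<lambda>i. lam i j)" if "j \<in> {1..N}" for j
    using that by (simp add: convergent_LIMSEQ_iff)
  define lam' where "lam' = (\<lambda>j. lim (\<lambda>i. lam i j))"
  have lam': "(\<lambda>i. lam i j) \<longlonglongrightarrow> lam' j" if "j \<in> {1..N}" for j unfolding lam'_def by (rule lam'[OF that])
  have pow0: "(\<lambda>i. (1 / 2 :: real) ^ i) \<longlonglongrightarrow> 0" by (rule LIMSEQ_realpow_zero) auto
  show ?thesis
  proof (rule that[OF \<rho>'m \<rho>'b])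
    fix r' y' assume V': "(r', y') \<in> V"
    obtain B where B: "\<forall>x\<in>space M. \<bar>r' x\<bar> \<le> B" using Vb[OF V'] by blast
    have [measurable]: "r' \<in> borel_measurable M" by (rule Vm[OF V'])
    have "(\<lambda>i. integral\<^sup>L M (\<lambda>x. \<rho> i x * r' x)) \<longlonglongrightarrow> integral\<^sup>L M (\<lambda>x. \<rho>' x * r' x)"
    proof (rule integral_dominated_convergence[where w = "\<lambda>x. \<bar>r' x\<bar>"])
      show "integrable M (\<lambda>x. \<bar>r' x\<bar>)" by (rule bint[where B = B]) (use B in auto)
      show "AE x in M. (\<lambda>i. \<rho> i x * r' x) \<longlonglongrightarrow> \<rho>' x * r' x" using lim by eventually_elim (intro tendsto_intros)
      show "AE x in M. norm (\<rho> i x * r' x) \<le> \<bar>r' x\<bar>" for i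
      proof (rule AE_I2)
        fix x
        have "\<bar>\<rho> i x * r' x\<bar> \<le> 1 * \<bar>r' x\<bar>" unfolding abs_mult using \<rho>b[of i x] by (intro mult_right_mono) auto
        then show "norm (\<rho> i x * r' x) \<le> \<bar>r' x\<bar>" by simp
      qed
    qed measurable
    moreover have "(\<lambda>i. \<Sum>j=1..N. lam i j * y' j) \<longlonglongrightarrow> (\<Sum>j=1..N. lam' j * y' j)"
      by (intro tendsto_sum tendsto_mult lam' tendsto_const)
    ultimately have l1: "(\<lambda>i. \<bar>integral\<^sup>L M (\<lambda>x. \<rho> i x * r' x) - (\<Sum>j=1..N. lam i j * y' j)\<bar>)
        \<longlonglongrightarrow> \<bar>integral\<^sup>L M (\<lambda>x. \<rho>' x * r' x) - (\<Sum>j=1..N. lam' j * y' j)\<bar>" by (intro tendsto_rabs tendsto_diff)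
    have l2: "(\<lambda>i. (1 / 2) ^ i * (1 + (integral\<^sup>L M (\<lambda>x. (r' x)\<^sup>2) + (\<Sum>j=1..N. (y' j)\<^sup>2)) / 2)) \<longlonglongrightarrow> 0"
      using tendsto_mult_left_zero[OF pow0] by blast
    have "\<bar>integral\<^sup>L M (\<lambda>x. \<rho>' x * r' x) - (\<Sum>j=1..N. lam' j * y' j)\<bar> \<le> 0"
      by (rule LIMSEQ_le[OF l1 l2]) (use stat[OF V'] in auto)
    then show "integral\<^sup>L M (\<lambda>x. \<rho>' x * r' x) = (\<Sum>j=1..N. lam' j * y' j)" by simp
  next
    \<comment> \<open>compares with the perturbation by the factor \<open>1 - 2\<^sup>-\<^sup>i\<close>\<close>
    have low: "\<kappa> - (1 / 2) ^ i * (1 + (\<Sum>j=1..N. (e j - lam i j)\<^sup>2) / 2) \<le> (\<Sum>j=1..N. lam i j * e j)" for i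
    proof -
      define s where "s = (1 / 2 :: real) ^ i"
      have s: "s > 0" "s \<le> 1" "s\<^sup>2 = (1 / 4) ^ i"
        by (auto simp: s_def power_mult[symmetric] power2_eq_square power_mult_distrib[symmetric] power_le_one)
      have vs: "(\<lambda>x. r i x + (- s) * r i x, \<lambda>j. y i j + (- s) * y i j) \<in> V" by (rule Vlin[OF ry ry])
      have "integral\<^sup>L M (\<lambda>x. huber (r i x + (- s) * r i x)) \<le> integral\<^sup>L M (\<lambda>x. (1 - s) * huber (r i x))"
      proof (rule integral_mono[OF hint[OF vs]])
        fix x show "huber (r i x + - s * r i x) \<le> (1 - s) * huber (r i x)"
          using huber_scale[of s "r i x"] s by (simp add: algebra_simps)
      qed (use hint[OF ry] in auto)
      then have a: "integral\<^sup>L M (\<lambda>x. huber (r i x + (- s) * r i x)) \<le> (1 - s) * integral\<^sup>L M (\<lambda>x. huber (r i x))" by simp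
      have b: "(\<Sum>j=1..N. (y i j + (- s) * y i j - e j)\<^sup>2) = (\<Sum>j=1..N. (y i j - e j)\<^sup>2) + 2 * s * (\<Sum>j=1..N. lam i j * y i j) + s\<^sup>2 * (\<Sum>j=1..N. (y i j)\<^sup>2)"
        unfolding sum_distrib_left sum.distrib[symmetric]
        by (rule sum.cong[OF refl]) (simp add: lam_def power2_eq_square algebra_simps)
      have "m \<le> J (\<lambda>x. r i x + (- s) * r i x, \<lambda>j. y i j + (- s) * y i j)" by (rule mJ[OF vs])
      then have "J (r i, y i) - s\<^sup>2 \<le> (1 - s) * integral\<^sup>L M (\<lambda>x. huber (r i x))
          + ((\<Sum>j=1..N. (y i j - e j)\<^sup>2) + 2 * s * (\<Sum>j=1..N. lam i j * y i j) + s\<^sup>2 * (\<Sum>j=1..N. (y i j)\<^sup>2)) / 2"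
        using a Jry[of i] unfolding J_def prod.case b s(3)[symmetric] by argo
      then have "s * (integral\<^sup>L M (\<lambda>x. huber (r i x)) - s * (1 + (\<Sum>j=1..N. (y i j)\<^sup>2) / 2)) \<le> s * (\<Sum>j=1..N. lam i j * y i j)"
        unfolding J_def by (simp add: power2_eq_square algebra_simps add_divide_distrib)
      then have c: "integral\<^sup>L M (\<lambda>x. huber (r i x)) - s * (1 + (\<Sum>j=1..N. (y i j)\<^sup>2) / 2) \<le> (\<Sum>j=1..N. lam i j * y i j)"
        using s by (simp only: mult_le_cancel_left_pos)
      have d: "(\<Sum>j=1..N. lam i j * e j) = (\<Sum>j=1..N. (y i j - e j)\<^sup>2) + (\<Sum>j=1..N. lam i j * y i j)"
        unfolding sum.distrib[symmetric]
        by (rule sum.cong[OF refl]) (simp add: lam_def power2_eq_square algebra_simps)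
      have "0 \<le> (\<Sum>j=1..N. (y i j - e j)\<^sup>2)" by (simp add: sum_nonneg)
      moreover have "\<kappa> \<le> J (r i, y i)" by (rule Jlow[OF ry])
      moreover have "(\<Sum>j=1..N. (e j - lam i j)\<^sup>2) = (\<Sum>j=1..N. (y i j)\<^sup>2)" by (simp add: lam_def)
      ultimately show ?thesis using c d unfolding J_def s_def[symmetric] by simp
    qed
    have l1: "(\<lambda>i. \<kappa> - (1 / 2) ^ i * (1 + (\<Sum>j=1..N. (e j - lam i j)\<^sup>2) / 2)) \<longlonglongrightarrow> \<kappa> - 0 * (1 + (\<Sum>j=1..N. (e j - lam' j)\<^sup>2) / 2)"
      by (intro tendsto_intros pow0 lam') auto
    have l2: "(\<lambda>i. \<Sum>j=1..N. lam i j * e j) \<longlonglongrightarrow> (\<Sum>j=1..N. lam' j * e j)"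
      by (intro tendsto_sum tendsto_mult lam' tendsto_const)
    have "\<kappa> - 0 * (1 + (\<Sum>j=1..N. (e j - lam' j)\<^sup>2) / 2) \<le> (\<Sum>j=1..N. lam' j * e j)"
      by (rule LIMSEQ_le[OF l1 l2]) (use low in auto)
    then show "0 < (\<Sum>j=1..N. lam' j * e j)" using \<kappa>(1) by simp
  qed
qed

section \<open>Shrinking reparametrisations of the disc\<close>

text \<open>
  Since \<open>Re q \<ge> 0\<close>, the function \<open>w exp (q w)\<close> is at least \<open>|w|\<close> in modulus.  By Rouche's theorem on a
  circle of radius between \<open>|z|\<close> and \<open>1\<close> it takes the value \<open>z\<close> as often as the value \<open>0\<close>, which is once.
\<close>

lemma exp_twisted_root_unique:
  assumes q: "q holomorphic_on ball 0 1" and Req: "\<And>w. cmod w < 1 \<Longrightarrow> 0 \<le> Re (q w)" and z: "cmod z < 1"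
  shows "\<exists>!w. cmod w < 1 \<and> w * exp (q w) = z"
proof -
  define F where "F = (\<lambda>w. w * exp (q w))"
  have Fh: "F holomorphic_on ball 0 1" unfolding F_def by (intro holomorphic_intros q)
  have Fn: "cmod w \<le> cmod (F w)" if "cmod w < 1" for w
  proof -
    have "1 \<le> exp (Re (q w))" using Req[OF that] by simp
    then have "cmod w * 1 \<le> cmod w * exp (Re (q w))" by (intro mult_left_mono) auto
    then show ?thesis by (simp add: F_def norm_mult)
  qed
  define r where "r = (1 + cmod z) / 2"
  have r: "cmod z < r" "r < 1" "0 < r" using z by (auto simp: r_def add_pos_nonneg)
  define fg where "fg = (\<lambda>w. F w + - z)"
  have fgh: "fg holomorphic_on ball 0 1" unfolding fg_def by (intro holomorphic_intros Fh)
  have F0: "F 0 = 0" by (simp add: F_def)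
  have zf: "{p \<in> ball 0 1. F p = 0} = {0}" by (auto simp: F_def)
  have nonc: "\<not> fg constant_on ball 0 1"
  proof
    assume "fg constant_on ball 0 1"
    then obtain c where c: "\<And>w. w \<in> ball 0 1 \<Longrightarrow> fg w = c" by (auto simp: constant_on_def)
    then have "fg (1 / 2) = fg 0" by (simp add: c)
    then have "F (1 / 2) = 0" by (simp add: fg_def F0)
    then show False by (simp add: F_def)
  qed
  have zsub: "{p \<in> ball 0 1. fg p = 0} = {p \<in> cball 0 (cmod z). fg p = 0}"
  proof -
    have "cmod p \<le> cmod z" if "cmod p < 1" "fg p = 0" for p
      using Fn[OF that(1)] that(2) by (simp add: fg_def add_eq_0_iff2)
    then show ?thesis using z by auto
  qed
  have fin: "finite {p \<in> ball 0 1. fg p = 0}"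
    unfolding zsub by (rule holomorphic_compact_finite_zeros[OF fgh]) (use z nonc in auto)
  have wn: "winding_number (circlepath 0 r) p = 1" if "cmod p < r" for p
    by (rule winding_number_circlepath) (use that in simp)
  have rouche: "(\<Sum>p\<in>{p \<in> ball 0 1. F p + - z = 0}. winding_number (circlepath 0 r) p * zorder (\<lambda>p. F p + - z) p)
      = (\<Sum>p\<in>{p \<in> ball 0 1. F p = 0}. winding_number (circlepath 0 r) p * zorder F p)"
  proof (rule Rouche_theorem)
    show "finite {p \<in> ball 0 1. F p + - z = 0}" using fin by (simp add: fg_def)
    show "\<forall>w\<in>path_image (circlepath 0 r). cmod (- z) < cmod (F w)"
    proof
      fix w assume "w \<in> path_image (circlepath 0 r)"
      then have "cmod w = r" using r by simp
      then show "cmod (- z) < cmod (F w)" using Fn[of w] r by simp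
    qed
    show "\<forall>w. w \<notin> ball 0 1 \<longrightarrow> winding_number (circlepath 0 r) w = 0"
    proof (intro allI impI)
      fix w :: complex assume "w \<notin> ball 0 1"
      then show "winding_number (circlepath 0 r) w = 0"
        using r by (intro winding_number_zero_outside[of _ "cball 0 r"]) auto
    qed
    show "finite {p \<in> ball 0 1. F p = 0}" unfolding zf by simp
    show "F holomorphic_on ball 0 1" by (rule Fh)
    show "(\<lambda>p. - z) holomorphic_on ball 0 1" by (rule holomorphic_on_const)
    show "path_image (circlepath 0 r) \<subseteq> ball 0 1" using r by auto
  qed auto
  have "zorder F 0 = 1"
  proof (rule zorder_eqI[of "ball 0 1" 0 "\<lambda>w. exp (q w)"])
    show "(\<lambda>w. exp (q w)) holomorphic_on ball 0 1" by (intro holomorphic_intros q)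
  qed (auto simp: F_def)
  then have rhs: "(\<Sum>p\<in>{p \<in> ball 0 1. F p = 0}. winding_number (circlepath 0 r) p * zorder F p) = 1"
    unfolding zf using wn[of 0] r by simp
  have ord: "1 \<le> zorder fg p" if p: "p \<in> {p \<in> ball 0 1. fg p = 0}" for p
  proof -
    have "\<exists>w\<in>ball 0 1. fg w \<noteq> 0"
    proof (rule ccontr)
      assume "\<not> ?thesis"
      then have "fg constant_on ball 0 1" unfolding constant_on_def by (intro exI[of _ 0]) auto
      then show False using nonc by simp
    qed
    moreover have "p \<in> ball 0 1" "fg p = 0" using p by auto
    ultimately have "zorder fg p > 0"
      using zorder_exist_zero[OF fgh open_ball connected_ball] by (simp split: if_splits)
    then show ?thesis by simp
  qed
  have "(\<Sum>p\<in>{p \<in> ball 0 1. fg p = 0}. of_int (zorder fg p)) = (\<Sum>p\<in>{p \<in> ball 0 1. fg p = 0}. winding_number (circlepath 0 r) p * zorder fg p)"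
  proof (rule sum.cong[OF refl])
    fix p assume "p \<in> {p \<in> ball 0 1. fg p = 0}"
    then have "cmod p < r" unfolding zsub using r by auto
    then show "of_int (zorder fg p) = winding_number (circlepath 0 r) p * zorder fg p" using wn by simp
  qed
  also have "\<dots> = 1" using rouche rhs unfolding fg_def[symmetric] by (simp only: fg_def)
  finally have "(of_int (\<Sum>p\<in>{p \<in> ball 0 1. fg p = 0}. zorder fg p) :: complex) = of_int 1" by simp
  then have s1: "(\<Sum>p\<in>{p \<in> ball 0 1. fg p = 0}. zorder fg p) = 1" by (simp only: of_int_eq_iff)
  have ne: "{p \<in> ball 0 1. fg p = 0} \<noteq> {}" using s1 by (metis sum.empty zero_neq_one)
  have "int (card {p \<in> ball 0 1. fg p = 0}) = (\<Sum>p\<in>{p \<in> ball 0 1. fg p = 0}. 1)" by simp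
  also have "\<dots> \<le> (\<Sum>p\<in>{p \<in> ball 0 1. fg p = 0}. zorder fg p)" by (rule sum_mono) (rule ord)
  also have "\<dots> = 1" by (rule s1)
  finally have "card {p \<in> ball 0 1. fg p = 0} \<le> 1" by simp
  moreover have "card {p \<in> ball 0 1. fg p = 0} > 0" using ne fin by (simp only: card_gt_0_iff) simp
  ultimately have "card {p \<in> ball 0 1. fg p = 0} = 1" by linarith
  then obtain w where w: "{p \<in> ball 0 1. fg p = 0} = {w}" by (rule card_1_singletonE)
  show ?thesis
  proof (rule ex1I[of _ w])
    have "w \<in> {p \<in> ball 0 1. fg p = 0}" using w by auto
    then show "cmod w < 1 \<and> w * exp (q w) = z" by (auto simp: fg_def F_def)
    fix w' assume "cmod w' < 1 \<and> w' * exp (q w') = z"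
    then have "w' \<in> {p \<in> ball 0 1. fg p = 0}" by (auto simp: fg_def F_def)
    then show "w' = w" using w by auto
  qed
qed

lemma exp_twisted_inverse:
  assumes q: "q holomorphic_on ball 0 1" and Req: "\<And>w. cmod w < 1 \<Longrightarrow> 0 \<le> Re (q w)"
  obtains \<phi> where "\<phi> holomorphic_on ball 0 1" "\<And>z. cmod z < 1 \<Longrightarrow> cmod (\<phi> z) < 1"
    "\<And>z. cmod z < 1 \<Longrightarrow> \<phi> z * exp (q (\<phi> z)) = z"
proof -
  define F where "F = (\<lambda>w. w * exp (q w))"
  have Fh: "F holomorphic_on ball 0 1" unfolding F_def by (intro holomorphic_intros q)
  define U where "U = ball 0 1 \<inter> F -` ball 0 1"
  have Uo: "open U" unfolding U_def
    by (rule continuous_open_preimage[OF holomorphic_on_imp_continuous_on[OF Fh]]) auto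
  have inj: "inj_on F U"
  proof (rule inj_onI)
    fix a b assume "a \<in> U" "b \<in> U" "F a = F b"
    then have "cmod a < 1" "cmod b < 1" "cmod (F a) < 1" "F b = F a" by (auto simp: U_def)
    then show "a = b" using exp_twisted_root_unique[OF q Req, of "F a"] unfolding F_def by blast
  qed
  have FU: "F holomorphic_on U" using Fh by (rule holomorphic_on_subset) (auto simp: U_def)
  obtain \<phi> where \<phi>: "\<phi> holomorphic_on (F ` U)" "\<And>z. z \<in> U \<Longrightarrow> deriv F z * deriv \<phi> (F z) = 1"
      "\<And>z. z \<in> U \<Longrightarrow> \<phi> (F z) = z"
  proof (rule holomorphic_has_inverse[OF FU Uo inj])
    fix g assume g: "g holomorphic_on (F ` U)" "\<And>z. z \<in> U \<Longrightarrow> deriv F z * deriv g (F z) = 1"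
      "\<And>z. z \<in> U \<Longrightarrow> g (F z) = z"
    show thesis by (rule that[OF g])
  qed
  have img: "\<exists>w\<in>U. F w = z" if z: "cmod z < 1" for z
  proof -
    obtain w where w: "cmod w < 1" "F w = z"
      using ex1_implies_ex[OF exp_twisted_root_unique[OF q Req z]] unfolding F_def by blast
    then have "w \<in> U" using z by (simp add: U_def)
    then show ?thesis using w(2) by blast
  qed
  have "F ` U = ball 0 1"
  proof
    show "F ` U \<subseteq> ball 0 1" by (auto simp: U_def)
    show "ball 0 1 \<subseteq> F ` U"
    proof
      fix z :: complex assume "z \<in> ball 0 1"
      then have "cmod z < 1" by simp
      from img[OF this] show "z \<in> F ` U" by blast
    qed
  qed
  show ?thesis
  proof (rule that[of \<phi>])
    show "\<phi> holomorphic_on ball 0 1" using \<phi>(1) \<open>F ` U = ball 0 1\<close> by simp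
    fix z :: complex assume "cmod z < 1"
    then obtain w where "w \<in> U" "F w = z" using img by blast
    then show "cmod (\<phi> z) < 1" "\<phi> z * exp (q (\<phi> z)) = z" using \<phi>(3)[of w] by (auto simp: U_def F_def)
  qed
qed

lemma norm_exp_minus_one_le:
  assumes "Re x \<le> 0" shows "cmod (exp x - 1) \<le> cmod x"
proof -
  have "cmod (exp x - exp 0) \<le> 1 * cmod (x - 0)"
  proof (rule field_differentiable_bound[where S = "{z. Re z \<le> 0}" and f' = exp])
    show "convex {z. Re z \<le> 0}" by (rule convex_halfspace_Re_le)
    show "(exp has_field_derivative exp z) (at z within {z. Re z \<le> 0})" for z
      by (rule DERIV_subset[OF DERIV_exp]) simp
  qed (use assms in auto)
  then show ?thesis by simp
qed

text \<open>
  The map solves \<open>\<phi> exp (\<tau> (S(\<phi>) + 1)) = z\<close> with \<open>S = schwarz \<beta>\<close>.  Taking moduli, \<open>ln |\<phi>|\<close> decreases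
  in proportion to the Poisson integral of \<open>\<beta>\<close> at \<open>\<phi>\<close>, which is the purpose of the construction.  The last
  estimate says that the deviation from a plain contraction is of the order of \<open>\<tau> S(\<phi>)\<close>.
\<close>

lemma shrinking_reparametrization:
  assumes \<beta>: "bdd_circ \<beta>" "\<And>\<zeta>. cmod \<zeta> = 1 \<Longrightarrow> 0 \<le> \<beta> \<zeta>" and \<tau>: "0 < \<tau>"
  obtains \<phi> where "\<phi> holomorphic_on ball 0 (exp \<tau>)"
    "\<And>z. cmod z < exp \<tau> \<Longrightarrow> cmod (\<phi> z) < 1"
    "\<And>z. cmod z \<le> 1 \<Longrightarrow> cmod (\<phi> z) \<le> exp (- \<tau>) * cmod z"
    "\<And>z. cmod z \<le> 1 \<Longrightarrow> \<phi> z \<noteq> 0 \<Longrightarrow> ln (cmod (\<phi> z)) \<le> - (\<tau> * (poisson \<beta> (\<phi> z) + 1))"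
    "\<And>z. cmod z \<le> 1 \<Longrightarrow> cmod (\<phi> z - of_real (exp (- \<tau>)) * z) \<le> \<tau> * cmod (schwarz \<beta> (\<phi> z))"
proof -
  define q where "q = (\<lambda>w. of_real \<tau> * schwarz \<beta> w)"
  have qh: "q holomorphic_on ball 0 1" unfolding q_def by (intro holomorphic_intros holomorphic_schwarz \<beta>)
  have Req: "0 \<le> Re (q w)" if "cmod w < 1" for w
    using Re_schwarz[OF \<beta>(1) that] poisson_nonneg[OF \<beta>(1) that \<beta>(2)] \<tau> by (simp add: q_def)
  obtain \<phi>0 where \<phi>0: "\<phi>0 holomorphic_on ball 0 1" "\<And>z. cmod z < 1 \<Longrightarrow> cmod (\<phi>0 z) < 1"
    "\<And>z. cmod z < 1 \<Longrightarrow> \<phi>0 z * exp (q (\<phi>0 z)) = z" using exp_twisted_inverse[OF qh Req] by metis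
  define \<phi> where "\<phi> = (\<lambda>z. \<phi>0 (of_real (exp (- \<tau>)) * z))"
  have sc: "cmod (of_real (exp (- \<tau>)) * z) < 1" if "cmod z < exp \<tau>" for z
    using that \<tau> by (simp add: norm_mult norm_divide exp_minus field_simps)
  have e1: "1 < exp \<tau>" using \<tau> by simp
  have \<phi>1: "cmod (\<phi> z) < 1" if "cmod z < exp \<tau>" for z unfolding \<phi>_def by (rule \<phi>0(2)[OF sc[OF that]])
  have eq: "\<phi> z * exp (q (\<phi> z)) = of_real (exp (- \<tau>)) * z" if "cmod z \<le> 1" for z
    unfolding \<phi>_def by (rule \<phi>0(3)[OF sc]) (use that e1 in linarith)
  have \<phi>1': "cmod (\<phi> z) < 1" if "cmod z \<le> 1" for z by (rule \<phi>1) (use that e1 in linarith)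
  have nrm: "cmod (\<phi> z) * exp (Re (q (\<phi> z))) = exp (- \<tau>) * cmod z" if "cmod z \<le> 1" for z
    using arg_cong[OF eq[OF that], of cmod] by (simp add: norm_mult)
  have small: "cmod (\<phi> z) \<le> exp (- \<tau>) * cmod z" if "cmod z \<le> 1" for z
  proof -
    have "1 \<le> exp (Re (q (\<phi> z)))" using Req[OF \<phi>1'[OF that]] by simp
    then have "cmod (\<phi> z) * 1 \<le> cmod (\<phi> z) * exp (Re (q (\<phi> z)))" by (intro mult_left_mono) auto
    then show ?thesis using nrm[OF that] by simp
  qed
  show ?thesis
  proof (rule that[of \<phi>])
    show "\<phi> holomorphic_on ball 0 (exp \<tau>)"
      unfolding \<phi>_def by (rule holomorphic_on_compose_gen[OF _ \<phi>0(1), unfolded o_def])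
        (use sc in \<open>auto intro!: holomorphic_intros\<close>)
    fix z :: complex assume z: "cmod z \<le> 1"
    show "cmod (\<phi> z) \<le> exp (- \<tau>) * cmod z" by (rule small[OF z])
    show "ln (cmod (\<phi> z)) \<le> - (\<tau> * (poisson \<beta> (\<phi> z) + 1))" if nz: "\<phi> z \<noteq> 0"
    proof -
      have "cmod (\<phi> z) * exp (Re (q (\<phi> z))) \<le> exp (- \<tau>)" using nrm[OF z] z by simp
      then have "ln (cmod (\<phi> z) * exp (Re (q (\<phi> z)))) \<le> ln (exp (- \<tau>))" using nz by (subst ln_le_cancel_iff) auto
      then have "ln (cmod (\<phi> z)) + Re (q (\<phi> z)) \<le> - \<tau>" using nz by (simp add: ln_mult)
      then show ?thesis using Re_schwarz[OF \<beta>(1) \<phi>1'[OF z]] by (simp add: q_def algebra_simps)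
    qed
    show "cmod (\<phi> z - of_real (exp (- \<tau>)) * z) \<le> \<tau> * cmod (schwarz \<beta> (\<phi> z))"
    proof -
      have "\<phi> z - of_real (exp (- \<tau>)) * z = of_real (exp (- \<tau>)) * z * (exp (- q (\<phi> z)) - 1)"
        using eq[OF z, symmetric] by (simp add: algebra_simps exp_minus)
      then have "cmod (\<phi> z - of_real (exp (- \<tau>)) * z) = exp (- \<tau>) * cmod z * cmod (exp (- q (\<phi> z)) - 1)"
        by (simp add: norm_mult)
      also have "\<dots> \<le> 1 * cmod (- q (\<phi> z))"
      proof (rule mult_mono)
        show "exp (- \<tau>) * cmod z \<le> 1" using mult_mono[of "exp (- \<tau>)" 1 "cmod z" 1] z \<tau> by simp
        show "cmod (exp (- q (\<phi> z)) - 1) \<le> cmod (- q (\<phi> z))"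
          by (rule norm_exp_minus_one_le) (use Req[OF \<phi>1'[OF z]] in simp)
      qed auto
      also have "\<dots> = \<tau> * cmod (schwarz \<beta> (\<phi> z))" using \<tau> by (simp add: q_def norm_mult)
      finally show ?thesis .
    qed
  qed (rule \<phi>1)
qed

section \<open>Non-tangential limits and means over inner circles\<close>

lemma radial_in_stolz:
  assumes "cmod \<zeta> = 1" "1 < \<alpha>"
  shows "filterlim (\<lambda>r. of_real r * \<zeta>) (at \<zeta> within stolz_region \<zeta> \<alpha>) (at_left 1)"
  unfolding filterlim_at
proof
  have "((\<lambda>r::real. of_real r * \<zeta>) \<longlongrightarrow> of_real 1 * \<zeta>) (at_left 1)" by (intro tendsto_intros)
  then show "((\<lambda>r::real. of_real r * \<zeta>) \<longlongrightarrow> \<zeta>) (at_left 1)" by simp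
  have "\<forall>\<^sub>F r::real in at_left 1. r \<in> {0<..<1}"
    by (rule eventually_at_leftI[of 0]) auto
  then show "\<forall>\<^sub>F r in at_left 1. of_real r * \<zeta> \<in> stolz_region \<zeta> \<alpha> \<and> of_real r * \<zeta> \<noteq> \<zeta>"
  proof eventually_elim
    case (elim r)
    have "of_real r * \<zeta> - \<zeta> = of_real (r - 1) * \<zeta>" by (simp add: algebra_simps)
    then have "cmod (of_real r * \<zeta> - \<zeta>) = \<bar>r - 1\<bar>" using assms(1) by (simp only: norm_mult norm_of_real mult_1_right)
    then have n: "cmod (of_real r * \<zeta> - \<zeta>) = 1 - r" using elim by simp
    have "1 * (1 - r) < \<alpha> * (1 - r)" using elim assms(2) by (intro mult_strict_right_mono) auto
    then have "of_real r * \<zeta> \<in> stolz_region \<zeta> \<alpha>"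
      unfolding stolz_region_def using n elim assms(1) by (simp add: norm_mult)
    moreover have "of_real r * \<zeta> \<noteq> \<zeta>" using n elim by auto
    ultimately show ?case by simp
  qed
qed

lemma has_nt_limit_radial:
  assumes "has_nt_limit f \<zeta> l" "cmod \<zeta> = 1"
  shows "((\<lambda>r. f (of_real r * \<zeta>)) \<longlongrightarrow> l) (at_left 1)"
proof -
  have "(f \<longlongrightarrow> l) (at \<zeta> within stolz_region \<zeta> 2)" using assms(1) by (simp add: has_nt_limit_def)
  from filterlim_compose[OF this radial_in_stolz[OF assms(2), of 2]] show ?thesis by simp
qed

lemma nt_value_eq:
  assumes "has_nt_limit f \<zeta> l" "cmod \<zeta> = 1" shows "nt_value f \<zeta> = l"
  unfolding nt_value_def
proof (rule the_equality)
  show "has_nt_limit f \<zeta> l" by (rule assms(1))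
  fix l' assume "has_nt_limit f \<zeta> l'"
  from tendsto_unique[OF _ has_nt_limit_radial[OF this assms(2)] has_nt_limit_radial[OF assms]]
  show "l' = l" by simp
qed

lemma has_nt_limit_nt_value:
  assumes "nt_defined f \<zeta>" "cmod \<zeta> = 1" shows "has_nt_limit f \<zeta> (nt_value f \<zeta>)"
  using assms nt_value_eq unfolding nt_defined_def by metis

lemma has_nt_limit_add: "has_nt_limit f \<zeta> l \<Longrightarrow> has_nt_limit g \<zeta> m \<Longrightarrow> has_nt_limit (\<lambda>z. f z + g z) \<zeta> (l + m)"
  unfolding has_nt_limit_def by (auto intro: tendsto_add)

lemma has_nt_limit_scaleR: "has_nt_limit f \<zeta> l \<Longrightarrow> has_nt_limit (\<lambda>z. c *\<^sub>R f z) \<zeta> (c *\<^sub>R l)"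
  unfolding has_nt_limit_def by (auto intro: tendsto_scaleR)

lemma tendsto_vec_mult:
  fixes f g :: "'a \<Rightarrow> complex ^ 'n"
  assumes "(f \<longlongrightarrow> l) F" "(g \<longlongrightarrow> m) F" shows "((\<lambda>z. f z * g z) \<longlongrightarrow> l * m) F"
proof (rule vec_tendstoI)
  fix i
  have "((\<lambda>z. f z $ i * g z $ i) \<longlongrightarrow> l $ i * m $ i) F"
    by (intro tendsto_mult tendsto_vec_nth assms)
  then show "((\<lambda>z. (f z * g z) $ i) \<longlongrightarrow> (l * m) $ i) F" by simp
qed

lemma has_nt_limit_mult: "has_nt_limit f \<zeta> l \<Longrightarrow> has_nt_limit g \<zeta> m \<Longrightarrow> has_nt_limit (\<lambda>z. f z * g z) \<zeta> (l * m)"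
  unfolding has_nt_limit_def by (auto intro: tendsto_vec_mult)

lemma has_nt_limit_continuous:
  assumes "continuous_on (cball 0 1) f" "cmod \<zeta> = 1" shows "has_nt_limit f \<zeta> (f \<zeta>)"
  unfolding has_nt_limit_def
proof (intro allI impI)
  fix \<alpha> :: real
  have "(f \<longlongrightarrow> f \<zeta>) (at \<zeta> within cball 0 1)" using assms by (auto simp: continuous_on_def)
  then show "(f \<longlongrightarrow> f \<zeta>) (at \<zeta> within stolz_region \<zeta> \<alpha>)"
    by (rule tendsto_within_subset) (auto simp: stolz_region_def)
qed

lemma norm_vec_le_sum: "norm (x :: complex ^ 'n) \<le> (\<Sum>j\<in>UNIV. cmod (x $ j))"
  unfolding norm_vec_def by (rule L2_set_le_sum) auto

lemma norm_vec_mult_le: "norm (x * y) \<le> norm x * norm (y :: complex ^ 'n)"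
proof -
  have "norm (x * y) \<le> L2_set (\<lambda>j. norm x * cmod (y $ j)) UNIV"
    unfolding norm_vec_def[of "x * y"]
    by (rule L2_set_mono) (auto simp: norm_mult intro!: mult_right_mono Finite_Cartesian_Product.norm_nth_le)
  also have "\<dots> = norm x * norm y" unfolding norm_vec_def[of y]
    by (simp add: L2_set_right_distrib)
  finally show ?thesis .
qed

lemma norm_scalar_product_le:
  "cmod (scalar_product x y) \<le> real CARD('n) * norm x * norm (y :: complex ^ 'n)"
proof -
  have "cmod (scalar_product x y) \<le> (\<Sum>i\<in>UNIV. cmod (x $ i * y $ i))" unfolding scalar_product_def by (rule norm_sum)
  also have "\<dots> \<le> (\<Sum>i\<in>(UNIV::'n set). norm x * norm y)"
    by (rule sum_mono) (auto simp: norm_mult intro!: mult_mono Finite_Cartesian_Product.norm_nth_le)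
  finally show ?thesis by (simp add: mult.assoc)
qed

lemma scalar_product_diff: "scalar_product (x - y) z = scalar_product x z - scalar_product y (z :: complex ^ 'n)"
  by (simp add: scalar_product_def algebra_simps sum_subtractf)

lemma scalar_product_add: "scalar_product (x + y) z = scalar_product x z + scalar_product y (z :: complex ^ 'n)"
  by (simp add: scalar_product_def algebra_simps sum.distrib)

lemma scalar_product_scaleR: "scalar_product (c *\<^sub>R x) z = c *\<^sub>R scalar_product x (z :: complex ^ 'n)"
  by (simp add: scalar_product_def scaleR_sum_right)

lemma continuous_on_scalar_product:
  fixes f g :: "'a::topological_space \<Rightarrow> complex ^ 'n"
  assumes "continuous_on S f" "continuous_on S g" shows "continuous_on S (\<lambda>z. scalar_product (f z) (g z))"
  unfolding scalar_product_def by (intro continuous_intros assms)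

lemma tendsto_scalar_product:
  fixes f g :: "'a \<Rightarrow> complex ^ 'n"
  assumes "(f \<longlongrightarrow> l) F" "(g \<longlongrightarrow> m) F" shows "((\<lambda>z. scalar_product (f z) (g z)) \<longlongrightarrow> scalar_product l m) F"
  unfolding scalar_product_def by (intro tendsto_intros tendsto_vec_nth assms)

text \<open>
  The functional \<open>\<Phi>\<close> with the unit circle replaced by the circle of radius \<open>R\<close>, where no boundary values are
  needed.
\<close>

definition mean_pairing :: "real \<Rightarrow> (complex \<Rightarrow> complex ^ 'n) \<Rightarrow> (complex \<Rightarrow> complex ^ 'n) \<Rightarrow> real" where
  "mean_pairing R w h = integral\<^sup>L circ (\<lambda>\<zeta>. Re (scalar_product (h (of_real R * \<zeta>)) (w (of_real R * \<zeta>)))) / (2 * pi)"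

lemma contour_integral_circlepath_circ:
  assumes "continuous_on (sphere 0 r) G" "0 < r"
  shows "contour_integral (circlepath 0 r) (\<lambda>z. G z / z) = \<i> * integral\<^sup>L circ (\<lambda>\<zeta>. G (of_real r * \<zeta>))"
proof -
  have c: "continuous_on (sphere 0 1) (\<lambda>\<zeta>. G (of_real r * \<zeta>))"
    by (rule continuous_on_compose2[OF assms(1)]) (use assms(2) in \<open>auto intro!: continuous_intros simp: norm_mult\<close>)
  have "contour_integral (circlepath 0 r) (\<lambda>z. G z / z)
      = integral {0..2*pi} (\<lambda>t. G (0 + of_real r * cis t) / (0 + of_real r * cis t) * of_real r * \<i> * cis t)"
    unfolding circlepath_def by (subst contour_integral_part_circlepath_eq) auto
  also have "\<dots> = integral {0..2*pi} (\<lambda>t. \<i> * G (of_real r * cis t))"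
    by (rule integral_cong) (use assms(2) in auto)
  also have "\<dots> = \<i> * integral {0..2*pi} (\<lambda>t. G (of_real r * cis t))" by simp
  also have "integral {0..2*pi} (\<lambda>t. G (of_real r * cis t)) = integral\<^sup>L circ (\<lambda>\<zeta>. G (of_real r * \<zeta>))"
    by (rule integral_circ_continuous[OF c, symmetric])
  finally show ?thesis .
qed

text \<open>
  The mean over a circle is a contour integral of \<open>G z / z\<close>, and the circles are homotopic in the annulus.
\<close>

lemma circ_mean_radius_independent:
  assumes G: "G holomorphic_on annulus \<nu>" and \<nu>: "0 < \<nu>" and r: "\<nu> < r" "r < 1" "\<nu> < r'" "r' < 1"
  shows "integral\<^sup>L circ (\<lambda>\<zeta>. G (of_real r * \<zeta>)) = integral\<^sup>L circ (\<lambda>\<zeta>. G (of_real r' * \<zeta>))"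
proof -
  have op: "open (annulus \<nu>)" unfolding annulus_def
    by (intro open_Collect_conj open_Collect_less continuous_intros)
  have hom: "homotopic_loops (annulus \<nu>) (circlepath 0 r) (circlepath 0 r')"
  proof (rule homotopic_loops_linear)
    fix t :: real assume "t \<in> {0..1}"
    define e where "e = exp (2 * of_real pi * \<i> * of_real t :: complex)"
    have e: "cmod e = 1" unfolding e_def by (simp add: norm_exp_eq_Re)
    show "closed_segment (circlepath 0 r t) (circlepath 0 r' t) \<subseteq> annulus \<nu>"
    proof
      fix x assume "x \<in> closed_segment (circlepath 0 r t) (circlepath 0 r' t)"
      then obtain v where v: "0 \<le> v" "v \<le> 1" "x = (1 - v) *\<^sub>R (of_real r * e) + v *\<^sub>R (of_real r' * e)"
        by (auto simp: closed_segment_def circlepath e_def)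
      have "x = of_real ((1 - v) * r + v * r') * e" unfolding v(3) by (simp add: scaleR_conv_of_real algebra_simps)
      then have n: "cmod x = \<bar>(1 - v) * r + v * r'\<bar>" using e by (simp only: norm_mult norm_of_real mult_1_right)
      have "(1 - v) * r + v * r' < 1" "\<nu> < (1 - v) * r + v * r'"
        using convex_bound_lt[of r 1 r' "1 - v" v] convex_bound_lt[of "- r" "- \<nu>" "- r'" "1 - v" v] v r by auto
      then show "x \<in> annulus \<nu>" unfolding annulus_def using n \<nu> by simp
    qed
  qed auto
  have hol: "(\<lambda>z. G z / z) holomorphic_on annulus \<nu>"
    by (intro holomorphic_intros G) (use \<nu> in \<open>auto simp: annulus_def\<close>)
  have c: "continuous_on (sphere 0 r) G" if "\<nu> < r" "r < 1" for r
    by (rule continuous_on_subset[OF holomorphic_on_imp_continuous_on[OF G]])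
       (use that in \<open>auto simp: annulus_def\<close>)
  have "contour_integral (circlepath 0 r) (\<lambda>z. G z / z) = contour_integral (circlepath 0 r') (\<lambda>z. G z / z)"
    by (rule Cauchy_theorem_homotopic_loops[OF hom op hol]) auto
  then show ?thesis
    using contour_integral_circlepath_circ[OF c, of r] contour_integral_circlepath_circ[OF c, of r'] r \<nu> by simp
qed

lemma sphere_subset_closure_annulus:
  assumes "\<nu> < 1" shows "sphere 0 1 \<subseteq> closure (annulus \<nu>)"
proof
  fix \<zeta> :: complex assume "\<zeta> \<in> sphere 0 1"
  then have \<zeta>: "cmod \<zeta> = 1" by simp
  show "\<zeta> \<in> closure (annulus \<nu>)"
    unfolding closure_approachable
  proof (intro allI impI)
    fix e :: real assume e: "0 < e"
    define r where "r = max (max 0 ((1 + \<nu>) / 2)) (1 - e / 2)"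
    have r: "0 \<le> r" "\<nu> < r" "r < 1" "1 - r < e" using assms e by (auto simp: r_def max_def)
    have "of_real r * \<zeta> - \<zeta> = of_real (r - 1) * \<zeta>" by (simp add: algebra_simps)
    then have "cmod (of_real r * \<zeta> - \<zeta>) = \<bar>r - 1\<bar>" using \<zeta> by (simp only: norm_mult norm_of_real mult_1_right)
    then have "dist (of_real r * \<zeta>) \<zeta> < e" using r by (simp add: dist_norm)
    moreover have "of_real r * \<zeta> \<in> annulus \<nu>" using r \<zeta> by (simp add: annulus_def norm_mult)
    ultimately show "\<exists>y\<in>annulus \<nu>. dist y \<zeta> < e" by blast
  qed
qed

lemma A_maps_annulusD:
  fixes w :: "complex \<Rightarrow> complex ^ 'n"
  assumes "w \<in> A_maps (annulus \<nu>)"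
  shows "continuous_on (closure (annulus \<nu>)) w" "\<And>j. (\<lambda>z. w z $ j) holomorphic_on annulus \<nu>"
  using assms by (auto simp: A_maps_def hol_maps_def)

lemma H_infty_bound:
  fixes H :: "complex \<Rightarrow> complex ^ 'n"
  assumes "H \<in> H_infty (ball 0 1)"
  obtains B where "0 \<le> B" "\<And>z. cmod z < 1 \<Longrightarrow> norm (H z) \<le> B"
proof -
  have "bounded (H ` ball 0 1)" using assms by (simp add: H_infty_def)
  then obtain B where B: "\<forall>x\<in>H ` ball 0 1. norm x \<le> B" unfolding bounded_iff by blast
  then have "norm (H 0) \<le> B" by simp
  then have "0 \<le> B" using norm_ge_zero order_trans by blast
  then show ?thesis using that[of B] B by simp
qed

text \<open>
  The pairing of \<open>H\<close> with \<open>w\<close> is holomorphic in the annulus, so its means do not depend on the radius,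
  and as the radius tends to \<open>1\<close> they converge to \<open>\<Phi>\<close> by dominated convergence.
\<close>

lemma Phi_eq_mean_pairing:
  fixes w H :: "complex \<Rightarrow> complex ^ 'n"
  assumes w: "w \<in> A_maps (annulus \<nu>)" and \<nu>: "0 < \<nu>" "\<nu> < 1" and R: "\<nu> < R" "R < 1"
    and H: "H \<in> H_infty (ball 0 1)" and nt: "AE \<zeta> in circ. nt_defined H \<zeta>"
  shows "Phi w H = mean_pairing R w H"
proof -
  have Hh: "(\<lambda>z. H z $ j) holomorphic_on ball 0 1" for j using H by (auto simp: H_infty_def hol_maps_def)
  obtain BH where BH0: "0 \<le> BH" and BH: "\<And>z. cmod z < 1 \<Longrightarrow> norm (H z) \<le> BH"
    using H_infty_bound[OF H] by metis
  have "bounded (annulus \<nu>)" by (rule bounded_subset[of "ball 0 1"]) (auto simp: annulus_def)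
  then have "compact (closure (annulus \<nu>))" by (simp add: compact_eq_bounded_closed bounded_closure)
  from compact_imp_bounded[OF compact_continuous_image[OF A_maps_annulusD(1)[OF w] this]]
  obtain Bw where Bw: "\<And>z. z \<in> closure (annulus \<nu>) \<Longrightarrow> norm (w z) \<le> Bw" by (auto simp: bounded_iff)
  define G where "G = (\<lambda>z. scalar_product (H z) (w z))"
  have Gh: "G holomorphic_on annulus \<nu>"
    unfolding G_def scalar_product_def
    by (intro holomorphic_intros A_maps_annulusD(2)[OF w] holomorphic_on_subset[OF Hh]) (auto simp: annulus_def)
  have GB: "cmod (G z) \<le> real CARD('n) * BH * Bw" if "z \<in> annulus \<nu>" for z
  proof -
    have a: "norm (H z) \<le> BH" using BH that by (simp add: annulus_def)
    have b: "norm (w z) \<le> Bw" using Bw closure_subset that by blast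
    have "cmod (G z) \<le> real CARD('n) * norm (H z) * norm (w z)" unfolding G_def by (rule norm_scalar_product_le)
    also have "\<dots> \<le> real CARD('n) * BH * Bw"
      by (intro mult_mono a b) (use BH0 in auto)
    finally show ?thesis .
  qed
  define rs where "rs = (\<lambda>n::nat. 1 - (1 - R) / real (n + 1))"
  have rs: "R \<le> rs n" "rs n < 1" for n
  proof -
    have "(1 - R) / real (n + 1) \<le> (1 - R) / 1" using R by (intro divide_left_mono) auto
    then show "R \<le> rs n" by (simp add: rs_def)
    show "rs n < 1" using R by (simp add: rs_def)
  qed
  have "(\<lambda>n. (1 - R) * (1 / real (n + 1))) \<longlonglongrightarrow> (1 - R) * 0"
    by (intro tendsto_intros LIMSEQ_ignore_initial_segment[OF lim_1_over_n])
  then have "rs \<longlonglongrightarrow> 1 - (1 - R) * 0" unfolding rs_def by (intro tendsto_diff tendsto_const) simp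
  then have rs_lim: "rs \<longlonglongrightarrow> 1" by simp
  have rs_left: "filterlim rs (at_left 1) sequentially"
    by (rule tendsto_imp_filterlim_at_left[OF rs_lim]) (use rs in auto)
  have inA: "of_real (rs n) * \<zeta> \<in> annulus \<nu>" if "cmod \<zeta> = 1" for n \<zeta>
    using rs[of n] R \<nu> that by (simp add: annulus_def norm_mult)
  define gn where "gn = (\<lambda>n \<zeta>. Re (G (of_real (rs n) * \<zeta>)))"
  have gc: "continuous_on (sphere 0 1) (\<lambda>\<zeta>. G (of_real (rs n) * \<zeta>))" for n
    by (rule continuous_on_compose2[OF holomorphic_on_imp_continuous_on[OF Gh]])
       (use inA in \<open>auto intro!: continuous_intros\<close>)
  have gm [measurable]: "gn n \<in> borel_measurable circ" for n
    unfolding gn_def by (intro measurable_circ_continuous continuous_intros gc)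
  define g where "g = (\<lambda>\<zeta>. lim (\<lambda>n. gn n \<zeta>))"
  have g_meas: "g \<in> borel_measurable circ" unfolding g_def by measurable
  have wc: "((\<lambda>n. w (of_real (rs n) * \<zeta>)) \<longlonglongrightarrow> w \<zeta>)" if "cmod \<zeta> = 1" for \<zeta>
  proof (rule continuous_on_tendsto_compose[OF A_maps_annulusD(1)[OF w]])
    have "(\<lambda>n. of_real (rs n) * \<zeta>) \<longlonglongrightarrow> of_real 1 * \<zeta>" by (intro tendsto_intros rs_lim)
    then show "(\<lambda>n. of_real (rs n) * \<zeta>) \<longlonglongrightarrow> \<zeta>" by simp
    show "\<zeta> \<in> closure (annulus \<nu>)" using sphere_subset_closure_annulus[OF \<nu>(2)] that by auto
    show "\<forall>\<^sub>F n in sequentially. of_real (rs n) * \<zeta> \<in> closure (annulus \<nu>)"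
      using inA[OF that] closure_subset by (intro always_eventually) blast
  qed
  have lim: "AE \<zeta> in circ. (\<lambda>n. gn n \<zeta>) \<longlonglongrightarrow> Re (scalar_product (nt_value H \<zeta>) (w \<zeta>))"
    using nt AE_space
  proof eventually_elim
    case (elim \<zeta>)
    then have z1: "cmod \<zeta> = 1" by simp
    have "((\<lambda>r. H (of_real r * \<zeta>)) \<longlongrightarrow> nt_value H \<zeta>) (at_left 1)"
      by (rule has_nt_limit_radial[OF has_nt_limit_nt_value[OF elim(1) z1] z1])
    from filterlim_compose[OF this rs_left] have "(\<lambda>n. H (of_real (rs n) * \<zeta>)) \<longlonglongrightarrow> nt_value H \<zeta>" .
    then show ?case unfolding gn_def G_def by (intro tendsto_Re tendsto_scalar_product wc z1)
  qed
  have eq: "AE \<zeta> in circ. Re (scalar_product (nt_value H \<zeta>) (w \<zeta>)) = g \<zeta>"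
    using lim by eventually_elim (simp add: g_def limI)
  have lim': "AE \<zeta> in circ. (\<lambda>n. gn n \<zeta>) \<longlonglongrightarrow> g \<zeta>"
    using lim eq by eventually_elim simp
  have Phi: "Phi w H = integral\<^sup>L circ g / (2 * pi)"
    unfolding Phi_def using lebesgue_integral_cis_eq_circ[OF g_meas eq] by simp
  have "(\<lambda>n. integral\<^sup>L circ (gn n)) \<longlonglongrightarrow> integral\<^sup>L circ g"
  proof (rule integral_dominated_convergence[OF g_meas gm, where w = "\<lambda>_. real CARD('n) * BH * Bw"])
    show "AE \<zeta> in circ. norm (gn n \<zeta>) \<le> real CARD('n) * BH * Bw" for n
    proof (rule AE_I2)
      fix \<zeta> assume "\<zeta> \<in> space circ"
      then have "cmod (G (of_real (rs n) * \<zeta>)) \<le> real CARD('n) * BH * Bw" using GB[OF inA] by simp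
      then show "norm (gn n \<zeta>) \<le> real CARD('n) * BH * Bw"
        unfolding gn_def using abs_Re_le_cmod order_trans by (metis real_norm_def)
    qed
  qed (use lim' in auto)
  moreover have "integral\<^sup>L circ (gn n) = integral\<^sup>L circ (\<lambda>\<zeta>. Re (G (of_real R * \<zeta>)))" for n
  proof -
    have gR: "continuous_on (sphere 0 1) (\<lambda>\<zeta>. G (of_real R * \<zeta>))"
      by (rule continuous_on_compose2[OF holomorphic_on_imp_continuous_on[OF Gh]])
         (use R \<nu> in \<open>auto intro!: continuous_intros simp: annulus_def norm_mult\<close>)
    have "integral\<^sup>L circ (\<lambda>\<zeta>. G (of_real (rs n) * \<zeta>)) = integral\<^sup>L circ (\<lambda>\<zeta>. G (of_real R * \<zeta>))"
      by (rule circ_mean_radius_independent[OF Gh \<nu>(1)]) (use rs[of n] R in auto)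
    then show ?thesis unfolding gn_def
      using integral_Re[OF bdd_circ_integrable[OF bdd_circ_continuous[OF gc]], of n]
        integral_Re[OF bdd_circ_integrable[OF bdd_circ_continuous[OF gR]]] by simp
  qed
  ultimately have "integral\<^sup>L circ g = integral\<^sup>L circ (\<lambda>\<zeta>. Re (G (of_real R * \<zeta>)))"
    by (simp add: LIMSEQ_const_iff)
  then show ?thesis unfolding Phi mean_pairing_def G_def by simp
qed

text \<open>
  The Neumann series: the row sums of \<open>1 - M\<close> are at most \<open>1 / 2\<close>, and \<open>r n = (1 - M)\<^sup>n y\<close>.
\<close>

lemma near_identity_solvable:
  fixes M :: "nat \<Rightarrow> nat \<Rightarrow> real"
  assumes M: "\<And>k j. k \<in> {1..N} \<Longrightarrow> j \<in> {1..N} \<Longrightarrow> \<bar>M k j - (if k = j then 1 else 0)\<bar> \<le> 1 / (2 * real N)"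
    and y: "\<And>k. k \<in> {1..N} \<Longrightarrow> \<bar>y k\<bar> \<le> Y"
  obtains c where "\<And>j. j \<in> {1..N} \<Longrightarrow> \<bar>c j\<bar> \<le> 2 * Y" "\<And>k. k \<in> {1..N} \<Longrightarrow> (\<Sum>j=1..N. M k j * c j) = y k"
proof -
  define r where "r = rec_nat y (\<lambda>_ r k. r k - (\<Sum>j=1..N. M k j * r j))"
  have r0: "r 0 = y" and rS: "r (Suc n) = (\<lambda>k. r n k - (\<Sum>j=1..N. M k j * r n j))" for n by (auto simp: r_def)
  have rb: "\<bar>r n k\<bar> \<le> Y * (1 / 2) ^ n" if "k \<in> {1..N}" for n k
    using that
  proof (induction n arbitrary: k)
    case 0 then show ?case using y by (simp add: r0)
  next
    case (Suc n)
    have N: "0 < real N" using Suc.prems by auto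
    have "r (Suc n) k = (\<Sum>j=1..N. ((if k = j then 1 else 0) - M k j) * r n j)"
    proof -
      have "(\<Sum>j=1..N. (if k = j then 1 else 0) * r n j) = (\<Sum>j=1..N. if k = j then r n j else 0)"
        by (rule sum.cong) auto
      also have "\<dots> = r n k" using Suc.prems by (subst sum.delta') auto
      finally show ?thesis by (simp add: rS left_diff_distrib sum_subtractf)
    qed
    also have "\<bar>\<dots>\<bar> \<le> (\<Sum>j=1..N. \<bar>((if k = j then 1 else 0) - M k j) * r n j\<bar>)" by (rule sum_abs)
    also have "\<dots> \<le> (\<Sum>j=1..N. 1 / (2 * real N) * (Y * (1 / 2) ^ n))"
      unfolding abs_mult
      by (intro sum_mono mult_mono) (use M Suc in \<open>auto simp: abs_minus_commute\<close>)
    also have "\<dots> = Y * (1 / 2) ^ Suc n" using N by (simp add: field_simps)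
    finally show ?case .
  qed
  have sm: "summable (\<lambda>n. r n j)" if "j \<in> {1..N}" for j
    by (rule summable_comparison_test'[where N = 0 and g = "\<lambda>n. Y * (1 / 2) ^ n"])
       (use rb[OF that] in \<open>auto intro!: summable_mult summable_geometric\<close>)
  define c where "c = (\<lambda>j. \<Sum>n. r n j)"
  show ?thesis
  proof (rule that[of c])
    fix j assume j: "j \<in> {1..N}"
    have sg: "summable (\<lambda>n. Y * (1 / 2) ^ n)" by (intro summable_mult summable_geometric) simp
    have sa: "summable (\<lambda>n. \<bar>r n j\<bar>)"
      by (rule summable_comparison_test'[where N = 0, OF sg]) (use rb[OF j] in simp)
    have "\<bar>c j\<bar> \<le> (\<Sum>n. \<bar>r n j\<bar>)" unfolding c_def by (rule summable_rabs[OF sa])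
    also have "\<dots> \<le> (\<Sum>n. Y * (1 / 2) ^ n)" by (rule suminf_le[OF _ sa sg]) (use rb[OF j] in simp)
    also have "\<dots> = 2 * Y" by (subst suminf_mult) (auto simp: suminf_geometric)
    finally show "\<bar>c j\<bar> \<le> 2 * Y" .
  next
    fix k assume k: "k \<in> {1..N}"
    have "(\<Sum>j=1..N. M k j * c j) = (\<Sum>j=1..N. \<Sum>n. M k j * r n j)"
      unfolding c_def by (rule sum.cong[OF refl]) (simp add: suminf_mult sm)
    also have "\<dots> = (\<Sum>n. \<Sum>j=1..N. M k j * r n j)"
      by (rule suminf_sum[symmetric]) (intro summable_mult sm)
    also have "\<dots> = (\<Sum>n. r n k - r (Suc n) k)" by (simp add: rS)
    also have "\<dots> = r 0 k - 0"
      by (rule sums_unique[symmetric], rule telescope_sums'[OF summable_LIMSEQ_zero[OF sm[OF k]]])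
    finally show "(\<Sum>j=1..N. M k j * c j) = y k" by (simp add: r0)
  qed
qed

section \<open>Maps of class A and expansions of the functionals\<close>

lemma continuous_on_compact_bound:
  fixes f :: "'a::topological_space \<Rightarrow> 'b::real_normed_vector"
  assumes "compact K" "continuous_on K f"
  obtains B where "0 \<le> B" "\<And>x. x \<in> K \<Longrightarrow> norm (f x) \<le> B"
proof -
  have "bounded (f ` K)" by (rule compact_imp_bounded[OF compact_continuous_image[OF assms(2,1)]])
  then obtain B where B: "\<forall>y\<in>f ` K. norm y \<le> B" unfolding bounded_iff by blast
  have "norm (f x) \<le> \<bar>B\<bar>" if "x \<in> K" for x using B that by force
  then show ?thesis using that[of "\<bar>B\<bar>"] by simp
qed

lemma A_maps_ballD:
  fixes h :: "complex \<Rightarrow> complex ^ 'n"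
  assumes "h \<in> A_maps (ball 0 1)"
  shows "continuous_on (cball 0 1) h" "\<And>j. (\<lambda>z. h z $ j) holomorphic_on ball 0 1"
  using assms by (auto simp: A_maps_def hol_maps_def)

lemma norm_le_sup_norm:
  fixes h :: "complex \<Rightarrow> complex ^ 'n"
  assumes h: "h \<in> A_maps (ball 0 1)" and z: "cmod z \<le> 1"
  shows "norm (h z) \<le> sup_norm (ball 0 1) h"
proof -
  note c = A_maps_ballD(1)[OF h]
  obtain B where "\<And>z. z \<in> cball 0 1 \<Longrightarrow> norm (h z) \<le> B"
    using continuous_on_compact_bound[OF compact_cball c] by metis
  then have bdd: "bdd_above ((\<lambda>z. norm (h z)) ` ball 0 1)" by (intro bdd_aboveI2[where M = B]) auto
  have cn: "continuous_on (closure (ball 0 1)) (\<lambda>z. norm (h z))" using c by (auto intro!: continuous_intros)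
  have le: "norm (h w) \<le> sup_norm (ball 0 1) h" if "w \<in> ball 0 1" for w
    unfolding sup_norm_def by (rule cSUP_upper[OF that bdd])
  show ?thesis by (rule continuous_le_on_closure[OF cn _ le]) (use z in auto)
qed

lemma sup_norm_le:
  assumes "\<And>z. cmod z < 1 \<Longrightarrow> norm (h z) \<le> B" shows "sup_norm (ball 0 1) h \<le> B"
  unfolding sup_norm_def by (rule cSUP_least) (use assms in auto)

lemma sup_norm_nonneg: "(h :: complex \<Rightarrow> complex ^ 'n) \<in> A_maps (ball 0 1) \<Longrightarrow> 0 \<le> sup_norm (ball 0 1) h"
  using norm_le_sup_norm[of h 0] by (simp add: order_trans[OF norm_ge_zero])

lemma A_maps_add_scaled:
  fixes h k :: "complex \<Rightarrow> complex ^ 'n"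
  assumes "h \<in> A_maps (ball 0 1)" "k \<in> A_maps (ball 0 1)"
  shows "(\<lambda>z. h z + c *\<^sub>R k z) \<in> A_maps (ball 0 1)"
proof -
  have "(\<lambda>z. (h z + c *\<^sub>R k z) $ j) holomorphic_on ball 0 1" for j
    using A_maps_ballD(2)[OF assms(1), of j] A_maps_ballD(2)[OF assms(2), of j]
    by (simp add: scaleR_conv_of_real) (intro holomorphic_intros)
  then show ?thesis using A_maps_ballD(1)[OF assms(1)] A_maps_ballD(1)[OF assms(2)]
    by (auto simp: A_maps_def hol_maps_def intro!: continuous_intros)
qed

lemma A_maps_add_sum:
  fixes h :: "complex \<Rightarrow> complex ^ 'n"
  assumes "h \<in> A_maps (ball 0 1)" "\<And>j. j \<in> {1..N::nat} \<Longrightarrow> k j \<in> A_maps (ball 0 1)"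
  shows "(\<lambda>z. h z + (\<Sum>j=1..N. c j *\<^sub>R k j z)) \<in> A_maps (ball 0 1)"
  using assms
proof (induction N)
  case (Suc N)
  have "(\<lambda>z. (h z + (\<Sum>j=1..N. c j *\<^sub>R k j z)) + c (Suc N) *\<^sub>R k (Suc N) z) \<in> A_maps (ball 0 1)"
    by (rule A_maps_add_scaled) (use Suc in auto)
  then show ?case by (simp add: add.assoc)
qed simp

lemma holomorphic_vec_mult:
  fixes f g :: "complex \<Rightarrow> complex ^ 'n"
  assumes "\<And>j. (\<lambda>z. f z $ j) holomorphic_on S" "\<And>j. (\<lambda>z. g z $ j) holomorphic_on S"
  shows "(\<lambda>z. (f z * g z) $ j) holomorphic_on S"
  using assms by (simp) (intro holomorphic_intros)

lemma H_infty_mult_A_maps: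
  fixes s h :: "complex \<Rightarrow> complex ^ 'n"
  assumes s: "s \<in> H_infty (ball 0 1)" and h: "h \<in> A_maps (ball 0 1)"
  shows "(\<lambda>z. s z * h z) \<in> H_infty (ball 0 1)"
proof -
  obtain B where B: "0 \<le> B" "\<And>z. cmod z < 1 \<Longrightarrow> norm (s z) \<le> B" using H_infty_bound[OF s] by metis
  have "norm (s z * h z) \<le> B * sup_norm (ball 0 1) h" if "cmod z < 1" for z
  proof -
    have "norm (s z * h z) \<le> norm (s z) * norm (h z)" by (rule norm_vec_mult_le)
    also have "\<dots> \<le> B * sup_norm (ball 0 1) h"
      by (intro mult_mono B norm_le_sup_norm[OF h]) (use that in auto)
    finally show ?thesis .
  qed
  then have "bounded ((\<lambda>z. s z * h z) ` ball 0 1)"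
    unfolding bounded_iff by (intro exI[of _ "B * sup_norm (ball 0 1) h"]) auto
  moreover have "(\<lambda>z. (s z * h z) $ j) holomorphic_on ball 0 1" for j
    by (rule holomorphic_vec_mult) (use s h in \<open>auto simp: H_infty_def hol_maps_def A_maps_def\<close>)
  ultimately show ?thesis by (auto simp: H_infty_def hol_maps_def)
qed

lemma holomorphic_vec_lipschitz:
  fixes H :: "complex \<Rightarrow> complex ^ 'n"
  assumes H: "\<And>j. (\<lambda>z. H z $ j) holomorphic_on ball 0 1" and R: "R < 1"
  obtains L where "0 \<le> L" "\<And>x y. cmod x \<le> R \<Longrightarrow> cmod y \<le> R \<Longrightarrow> norm (H x - H y) \<le> L * cmod (x - y)"
proof -
  have "\<exists>B. \<forall>z. cmod z \<le> R \<longrightarrow> cmod (deriv (\<lambda>z. H z $ j) z) \<le> B" for j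
  proof -
    have "deriv (\<lambda>z. H z $ j) holomorphic_on ball 0 1" by (rule holomorphic_deriv[OF H]) simp
    then have "continuous_on (cball 0 R) (deriv (\<lambda>z. H z $ j))"
      by (rule continuous_on_subset[OF holomorphic_on_imp_continuous_on]) (use R in auto)
    from continuous_on_compact_bound[OF compact_cball this]
    obtain B where "\<And>z. z \<in> cball 0 R \<Longrightarrow> cmod (deriv (\<lambda>z. H z $ j) z) \<le> B" by metis
    then show ?thesis by (intro exI[of _ B]) simp
  qed
  then obtain B where B: "\<And>j z. cmod z \<le> R \<Longrightarrow> cmod (deriv (\<lambda>z. H z $ j) z) \<le> B j" by metis
  have comp: "cmod (H x $ j - H y $ j) \<le> \<bar>B j\<bar> * cmod (x - y)" if "cmod x \<le> R" "cmod y \<le> R" for x y j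
  proof (rule field_differentiable_bound[where S = "cball 0 R" and f' = "deriv (\<lambda>z. H z $ j)"])
    fix z assume z: "z \<in> cball (0::complex) R"
    then show "((\<lambda>z. H z $ j) has_field_derivative deriv (\<lambda>z. H z $ j) z) (at z within cball 0 R)"
      by (intro DERIV_subset[OF holomorphic_derivI[OF H open_ball]]) (use R in auto)
    show "cmod (deriv (\<lambda>z. H z $ j) z) \<le> \<bar>B j\<bar>" using B[of z j] z by simp
  qed (use that in auto)
  show ?thesis
  proof (rule that[of "\<Sum>j\<in>UNIV. \<bar>B j\<bar>"])
    fix x y :: complex assume xy: "cmod x \<le> R" "cmod y \<le> R"
    have "norm (H x - H y) \<le> (\<Sum>j\<in>UNIV. cmod ((H x - H y) $ j))" by (rule norm_vec_le_sum)
    also have "\<dots> \<le> (\<Sum>j\<in>UNIV. \<bar>B j\<bar> * cmod (x - y))" by (rule sum_mono) (use comp[OF xy] in simp)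
    finally show "norm (H x - H y) \<le> (\<Sum>j\<in>UNIV. \<bar>B j\<bar>) * cmod (x - y)" by (simp add: sum_distrib_right)
  qed (simp add: sum_nonneg)
qed

lemma mean_pairing_integrable:
  assumes "continuous_on (sphere 0 R) H" "continuous_on (sphere 0 R) w" "0 < R"
  shows "integrable circ (\<lambda>\<zeta>. Re (scalar_product (H (of_real R * \<zeta>)) (w (of_real R * \<zeta>))))"
proof -
  have "continuous_on (sphere 0 1) (\<lambda>\<zeta>. scalar_product (H (of_real R * \<zeta>)) (w (of_real R * \<zeta>)))"
    by (intro continuous_on_scalar_product continuous_on_compose2[OF assms(1)] continuous_on_compose2[OF assms(2)])
       (use assms(3) in \<open>auto intro!: continuous_intros simp: norm_mult\<close>)
  then show ?thesis by (intro bdd_circ_integrable bdd_circ_continuous continuous_intros)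
qed

lemma mean_pairing_add_scaled:
  assumes "continuous_on (sphere 0 R) H" "continuous_on (sphere 0 R) K" "continuous_on (sphere 0 R) w" "0 < R"
  shows "mean_pairing R w (\<lambda>z. H z + c *\<^sub>R K z) = mean_pairing R w H + c * mean_pairing R w K"
  using mean_pairing_integrable[OF assms(1,3,4)] mean_pairing_integrable[OF assms(2,3,4)]
  by (simp add: mean_pairing_def scalar_product_add scalar_product_scaleR add_divide_distrib)

lemma mean_pairing_add_sum:
  assumes H: "continuous_on (sphere 0 R) H" and w: "continuous_on (sphere 0 R) w" "0 < R"
    and K: "\<And>j. j \<in> {1..N::nat} \<Longrightarrow> continuous_on (sphere 0 R) (K j)"
  shows "mean_pairing R w (\<lambda>z. H z + (\<Sum>j=1..N. c j *\<^sub>R K j z)) = mean_pairing R w H + (\<Sum>j=1..N. c j * mean_pairing R w (K j))"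
  using K
proof (induction N)
  case (Suc N)
  have "mean_pairing R w (\<lambda>z. (H z + (\<Sum>j=1..N. c j *\<^sub>R K j z)) + c (Suc N) *\<^sub>R K (Suc N) z)
      = mean_pairing R w (\<lambda>z. H z + (\<Sum>j=1..N. c j *\<^sub>R K j z)) + c (Suc N) * mean_pairing R w (K (Suc N))"
    by (rule mean_pairing_add_scaled) (use H w Suc.prems in \<open>auto intro!: continuous_intros\<close>)
  also have "mean_pairing R w (\<lambda>z. H z + (\<Sum>j=1..N. c j *\<^sub>R K j z)) = mean_pairing R w H + (\<Sum>j=1..N. c j * mean_pairing R w (K j))"
    by (rule Suc.IH) (use Suc.prems in auto)
  finally show ?case by (simp add: add.assoc)
qed simp

lemma mean_pairing_diff_le:
  fixes H K w :: "complex \<Rightarrow> complex ^ 'n"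
  assumes c: "continuous_on (sphere 0 R) H" "continuous_on (sphere 0 R) K" "continuous_on (sphere 0 R) w" "0 < R"
    and le: "\<And>z. cmod z = R \<Longrightarrow> norm (H z - K z) \<le> e" and w: "\<And>z. cmod z = R \<Longrightarrow> norm (w z) \<le> B"
  shows "\<bar>mean_pairing R w H - mean_pairing R w K\<bar> \<le> real CARD('n) * e * B"
proof -
  have nR: "cmod (of_real R * \<zeta>) = R" if "cmod \<zeta> = 1" for \<zeta> using that c(4) by (simp add: norm_mult)
  have i: "integrable circ (\<lambda>\<zeta>. Re (scalar_product (H (of_real R * \<zeta>)) (w (of_real R * \<zeta>))) - Re (scalar_product (K (of_real R * \<zeta>)) (w (of_real R * \<zeta>))))"
    by (intro Bochner_Integration.integrable_diff mean_pairing_integrable c)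
  have pt: "\<bar>Re (scalar_product (H (of_real R * \<zeta>)) (w (of_real R * \<zeta>))) - Re (scalar_product (K (of_real R * \<zeta>)) (w (of_real R * \<zeta>)))\<bar>
      \<le> real CARD('n) * e * B" if z: "cmod \<zeta> = 1" for \<zeta>
  proof -
    let ?x = "of_real R * \<zeta>"
    have "\<bar>Re (scalar_product (H ?x) (w ?x)) - Re (scalar_product (K ?x) (w ?x))\<bar> = \<bar>Re (scalar_product (H ?x - K ?x) (w ?x))\<bar>"
      by (simp add: scalar_product_diff)
    also have "\<dots> \<le> cmod (scalar_product (H ?x - K ?x) (w ?x))" by (rule abs_Re_le_cmod)
    also have "\<dots> \<le> real CARD('n) * norm (H ?x - K ?x) * norm (w ?x)" by (rule norm_scalar_product_le)
    also have "\<dots> \<le> real CARD('n) * e * B"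
      using le[OF nR[OF z]] w[OF nR[OF z]]
      by (intro mult_mono mult_nonneg_nonneg) (auto intro: order_trans[OF norm_ge_zero le[OF nR[OF z]]])
    finally show ?thesis .
  qed
  have "\<bar>integral\<^sup>L circ (\<lambda>\<zeta>. Re (scalar_product (H (of_real R * \<zeta>)) (w (of_real R * \<zeta>))) - Re (scalar_product (K (of_real R * \<zeta>)) (w (of_real R * \<zeta>))))\<bar>
      \<le> integral\<^sup>L circ (\<lambda>\<zeta>. \<bar>Re (scalar_product (H (of_real R * \<zeta>)) (w (of_real R * \<zeta>))) - Re (scalar_product (K (of_real R * \<zeta>)) (w (of_real R * \<zeta>)))\<bar>)"
    by (rule integral_abs_bound)
  also have "\<dots> \<le> integral\<^sup>L circ (\<lambda>\<zeta>. real CARD('n) * e * B)"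
    by (rule integral_mono[OF integrable_abs[OF i]]) (use pt in auto)
  also have "\<dots> = 2 * pi * (real CARD('n) * e * B)" by (simp add: measure_circ)
  finally have "\<bar>2 * pi * (mean_pairing R w H - mean_pairing R w K)\<bar> \<le> 2 * pi * (real CARD('n) * e * B)"
    using mean_pairing_integrable[OF c(1,3,4)] mean_pairing_integrable[OF c(2,3,4)]
    by (simp add: mean_pairing_def diff_divide_distrib[symmetric])
  then show ?thesis by (simp add: abs_mult)
qed

lemma exp_minus_second_order:
  assumes "0 \<le> (x::real)" shows "0 \<le> exp (- x) - 1 + x" "exp (- x) - 1 + x \<le> x\<^sup>2" "1 - exp (- x) \<le> x"
proof -
  show a: "0 \<le> exp (- x) - 1 + x" using exp_ge_add_one_self[of "- x"] by simp
  then show "1 - exp (- x) \<le> x" by simp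
  have "exp (- x) \<le> 1 / (1 + x)"
  proof -
    have "1 / exp x \<le> 1 / (1 + x)" using exp_ge_add_one_self[of x] assms by (intro divide_left_mono) auto
    then show ?thesis by (simp add: exp_minus field_simps)
  qed
  also have "\<dots> \<le> 1 - x + x\<^sup>2"
  proof -
    have "1 \<le> (1 - x + x\<^sup>2) * (1 + x)" using assms by (simp add: power2_eq_square algebra_simps)
    then show ?thesis using assms by (simp add: divide_le_eq)
  qed
  finally show "exp (- x) - 1 + x \<le> x\<^sup>2" by simp
qed

text \<open>
  A second-order Taylor expansion along the curve \<open>t \<mapsto> exp (- \<kappa> t) z\<close>, whose velocity at \<open>t = 0\<close> is \<open>- \<kappa> z\<close>.
\<close>

lemma radial_contraction_expansion:
  assumes F: "F holomorphic_on ball 0 1" and R: "R < 1" and \<kappa>: "0 \<le> \<kappa>"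
  shows "\<exists>C\<ge>0. \<forall>z t. cmod z \<le> R \<longrightarrow> 0 \<le> t \<longrightarrow>
    cmod (F (of_real (exp (- (\<kappa> * t))) * z) - F z + of_real t * (of_real \<kappa> * z * deriv F z)) \<le> C * t\<^sup>2"
proof -
  define D1 where "D1 = deriv F"
  define D2 where "D2 = deriv D1"
  have h1: "D1 holomorphic_on ball 0 1" unfolding D1_def by (rule holomorphic_deriv[OF F]) simp
  have h2: "D2 holomorphic_on ball 0 1" unfolding D2_def by (rule holomorphic_deriv[OF h1]) simp
  have bnd: "\<exists>B\<ge>0. \<forall>z\<in>cball 0 R. cmod (G z) \<le> B" if "G holomorphic_on ball 0 1" for G
  proof -
    have "continuous_on (cball 0 R) G"
      by (rule continuous_on_subset[OF holomorphic_on_imp_continuous_on[OF that]]) (use R in auto)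
    from continuous_on_compact_bound[OF compact_cball this]
    obtain B where "0 \<le> B" "\<And>z. z \<in> cball 0 R \<Longrightarrow> cmod (G z) \<le> B" by metis
    then show ?thesis by (intro exI[of _ B]) simp
  qed
  obtain B1 where B1: "B1 \<ge> 0" "\<And>z. z \<in> cball 0 R \<Longrightarrow> cmod (D1 z) \<le> B1" using bnd[OF h1] by blast
  obtain B2 where B2: "B2 \<ge> 0" "\<And>z. z \<in> cball 0 R \<Longrightarrow> cmod (D2 z) \<le> B2" using bnd[OF h2] by blast
  have "cmod (F (of_real (exp (- (\<kappa> * t))) * z) - F z + of_real t * (of_real \<kappa> * z * deriv F z)) \<le> (B1 + B2) * \<kappa>\<^sup>2 * t\<^sup>2"
    if z: "cmod z \<le> R" and t: "0 \<le> t" for z t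
  proof -
    define x where "x = \<kappa> * t"
    have x: "0 \<le> x" using \<kappa> t by (simp add: x_def)
    define w where "w = of_real (exp (- x)) * z"
    have z1: "cmod z \<le> 1" using z R by simp
    have "exp (- x) * cmod z \<le> 1 * cmod z" using x by (intro mult_right_mono) auto
    then have w: "cmod w \<le> R" using z by (simp add: w_def norm_mult)
    have wz: "w - z = of_real (exp (- x) - 1) * z" by (simp add: w_def algebra_simps)
    have "cmod (w - z) = \<bar>exp (- x) - 1\<bar> * cmod z" unfolding wz by (simp only: norm_mult norm_of_real)
    also have "\<dots> \<le> x * 1" using exp_minus_second_order[OF x] x z1 by (intro mult_mono) auto
    finally have n1: "cmod (w - z) \<le> x" by simp
    have "w - z + of_real x * z = of_real (exp (- x) - 1 + x) * z" unfolding wz by (simp add: algebra_simps)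
    then have "cmod (w - z + of_real x * z) = \<bar>exp (- x) - 1 + x\<bar> * cmod z" by (simp only: norm_mult norm_of_real)
    also have "\<dots> \<le> x\<^sup>2 * 1" using exp_minus_second_order[OF x] z1 by (intro mult_mono) auto
    finally have n2: "cmod (w - z + of_real x * z) \<le> x\<^sup>2" by simp
    define fs where "fs = (\<lambda>i::nat. if i = 0 then F else if i = 1 then D1 else D2)"
    have "cmod (fs 0 w - (\<Sum>i\<le>1. fs i z * (w - z) ^ i / fact i)) \<le> B2 * cmod (w - z) ^ Suc 1 / fact 1"
    proof (rule complex_Taylor[where S = "cball 0 R"])
      show "(fs i has_field_derivative fs (Suc i) y) (at y within cball 0 R)" if "y \<in> cball 0 R" "i \<le> 1" for i y
      proof -
        have y: "y \<in> ball 0 1" using that R by auto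
        have "i = 0 \<or> i = 1" using that by auto
        then show ?thesis
          using DERIV_subset[OF holomorphic_derivI[OF F open_ball y], of "cball 0 R"]
            DERIV_subset[OF holomorphic_derivI[OF h1 open_ball y], of "cball 0 R"]
          by (auto simp: fs_def D1_def D2_def)
      qed
    qed (use B2 z w in \<open>auto simp: fs_def\<close>)
    then have T: "cmod (F w - (F z + D1 z * (w - z))) \<le> B2 * (cmod (w - z))\<^sup>2"
      by (simp add: fs_def power2_eq_square)
    have "F w - F z + of_real x * z * D1 z = (F w - (F z + D1 z * (w - z))) + D1 z * (w - z + of_real x * z)"
      by (simp add: algebra_simps)
    then have "cmod (F w - F z + of_real x * z * D1 z) \<le> cmod (F w - (F z + D1 z * (w - z))) + cmod (D1 z) * cmod (w - z + of_real x * z)"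
      by (metis norm_mult norm_triangle_ineq)
    also have "\<dots> \<le> B2 * x\<^sup>2 + B1 * x\<^sup>2"
    proof (rule add_mono)
      have "B2 * (cmod (w - z))\<^sup>2 \<le> B2 * x\<^sup>2" using B2 n1 by (intro mult_left_mono power_mono) auto
      then show "cmod (F w - (F z + D1 z * (w - z))) \<le> B2 * x\<^sup>2" using T by simp
      show "cmod (D1 z) * cmod (w - z + of_real x * z) \<le> B1 * x\<^sup>2" using B1 z n2 by (intro mult_mono) auto
    qed
    also have "\<dots> = (B1 + B2) * \<kappa>\<^sup>2 * t\<^sup>2" by (simp add: x_def power_mult_distrib algebra_simps)
    finally show ?thesis unfolding w_def x_def D1_def by (simp add: mult_ac)
  qed
  moreover have "0 \<le> (B1 + B2) * \<kappa>\<^sup>2" using B1 B2 by simp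
  ultimately show ?thesis by blast
qed

text \<open>
  The number \<open>- e\<close> is the derivative of the functional along the contraction of \<open>f\<close>; the mean is taken
  over a circle inside the disc, where \<open>radial_contraction_expansion\<close> holds uniformly.
\<close>

lemma mean_pairing_contraction_derivative:
  fixes f w :: "complex \<Rightarrow> complex ^ 'n"
  assumes f: "\<And>j. (\<lambda>z. f z $ j) holomorphic_on ball 0 1" and R: "0 < R" "R < 1"
    and w: "continuous_on (sphere 0 R) w" and \<kappa>: "0 \<le> \<kappa>"
  shows "\<exists>e C. \<forall>t\<ge>0. \<bar>mean_pairing R w (\<lambda>z. f (of_real (exp (- (\<kappa> * t))) * z)) - mean_pairing R w f + t * e\<bar> \<le> C * t\<^sup>2"
proof -
  obtain C where C: "\<And>j. C j \<ge> 0" "\<And>j z t. cmod z \<le> R \<Longrightarrow> 0 \<le> t \<Longrightarrow>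
    cmod (f (of_real (exp (- (\<kappa> * t))) * z) $ j - f z $ j + of_real t * (of_real \<kappa> * z * deriv (\<lambda>z. f z $ j) z)) \<le> C j * t\<^sup>2"
    using radial_contraction_expansion[OF f R(2) \<kappa>] by metis
  define d where "d = (\<lambda>z. \<chi> j. of_real \<kappa> * z * deriv (\<lambda>z. f z $ j) z)"
  have dh: "(\<lambda>z. d z $ j) holomorphic_on ball 0 1" for j
    unfolding d_def by (simp, intro holomorphic_intros holomorphic_deriv[OF f]) simp
  have sub: "sphere 0 R \<subseteq> ball (0::complex) 1" using R by auto
  have fc: "continuous_on (sphere 0 R) f" by (rule continuous_on_subset[OF holomorphic_vec_continuous[OF f] sub])
  have dc: "continuous_on (sphere 0 R) d" by (rule continuous_on_subset[OF holomorphic_vec_continuous[OF dh] sub])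
  from continuous_on_compact_bound[OF compact_sphere w]
  obtain B where "\<And>z. z \<in> sphere 0 R \<Longrightarrow> norm (w z) \<le> B" by metis
  then have B: "\<And>z. cmod z = R \<Longrightarrow> norm (w z) \<le> B" by simp
  show ?thesis
  proof (intro exI allI impI)
    fix t :: real assume t: "0 \<le> t"
    define ft where "ft = (\<lambda>z. f (of_real (exp (- (\<kappa> * t))) * z))"
    have ex: "exp (- (\<kappa> * t)) \<le> 1" using \<kappa> t by simp
    have ftc: "continuous_on (sphere 0 R) ft"
      unfolding ft_def
    proof (rule continuous_on_compose2[OF holomorphic_vec_continuous[OF f]])
      have "exp (- (\<kappa> * t)) * R \<le> 1 * R" by (rule mult_right_mono[OF ex]) (use R in simp)
      then have "exp (- (\<kappa> * t)) * R < 1" using R by linarith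
      then show "(\<lambda>z. of_real (exp (- (\<kappa> * t))) * z) ` sphere 0 R \<subseteq> ball (0 :: complex) 1" by (auto simp: norm_mult)
    qed (auto intro!: continuous_intros)
    have "\<bar>mean_pairing R w ft - mean_pairing R w (\<lambda>z. f z + (- t) *\<^sub>R d z)\<bar> \<le> real CARD('n) * ((\<Sum>j\<in>UNIV. C j) * t\<^sup>2) * B"
    proof (rule mean_pairing_diff_le[OF ftc _ w R(1) _ B])
      show "continuous_on (sphere 0 R) (\<lambda>z. f z + (- t) *\<^sub>R d z)" by (intro continuous_intros fc dc)
      fix z :: complex assume z: "cmod z = R"
      have "norm (ft z - (f z + (- t) *\<^sub>R d z)) \<le> (\<Sum>j\<in>UNIV. cmod ((ft z - (f z + (- t) *\<^sub>R d z)) $ j))" by (rule norm_vec_le_sum)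
      also have "\<dots> \<le> (\<Sum>j\<in>UNIV. C j * t\<^sup>2)"
      proof (rule sum_mono)
        fix j
        have E: "(ft z - (f z + (- t) *\<^sub>R d z)) $ j = f (of_real (exp (- (\<kappa> * t))) * z) $ j - f z $ j + of_real t * (of_real \<kappa> * z * deriv (\<lambda>z. f z $ j) z)"
          by (simp add: ft_def d_def) (simp add: scaleR_conv_of_real)
        show "cmod ((ft z - (f z + (- t) *\<^sub>R d z)) $ j) \<le> C j * t\<^sup>2"
          unfolding E by (rule C(2)) (use z t in auto)
      qed
      finally show "norm (ft z - (f z + (- t) *\<^sub>R d z)) \<le> (\<Sum>j\<in>UNIV. C j) * t\<^sup>2" by (simp add: sum_distrib_right)
    qed
    moreover have "mean_pairing R w (\<lambda>z. f z + (- t) *\<^sub>R d z) = mean_pairing R w f + (- t) * mean_pairing R w d"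
      by (rule mean_pairing_add_scaled[OF fc dc w R(1)])
    ultimately show "\<bar>mean_pairing R w (\<lambda>z. f (of_real (exp (- (\<kappa> * t))) * z)) - mean_pairing R w f + t * mean_pairing R w d\<bar>
        \<le> (real CARD('n) * (\<Sum>j\<in>UNIV. C j) * B) * t\<^sup>2"
      unfolding ft_def by (simp add: algebra_simps)
  qed
qed

section \<open>Improving a map when all data can be approximated\<close>

lemma eventually_mult_small:
  fixes A b :: real
  assumes "0 < b" shows "\<forall>\<^sub>F t in at_right 0. t * A < b"
proof (rule order_tendstoD(2)[OF _ assms])
  have "((\<lambda>t. t * A) \<longlongrightarrow> 0 * A) (at_right 0)" by (intro tendsto_intros)
  then show "((\<lambda>t. t * A) \<longlongrightarrow> 0) (at_right 0)" by simp
qed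

lemma bdd_circ_scalar_product:
  fixes p h :: "complex \<Rightarrow> complex ^ 'n"
  assumes p: "bdd_circ p" and h: "continuous_on (sphere 0 1) h"
  shows "bdd_circ (\<lambda>\<zeta>. scalar_product (p \<zeta>) (h \<zeta>))"
proof -
  obtain A where A: "A \<ge> 0" "\<And>\<zeta>. cmod \<zeta> = 1 \<Longrightarrow> norm (p \<zeta>) \<le> A" using bdd_circ_bound p by metis
  have hb: "bdd_circ h" by (rule bdd_circ_continuous[OF h])
  obtain B where B: "B \<ge> 0" "\<And>\<zeta>. cmod \<zeta> = 1 \<Longrightarrow> norm (h \<zeta>) \<le> B" using bdd_circ_bound hb by metis
  have "cmod (scalar_product (p \<zeta>) (h \<zeta>)) \<le> real CARD('n) * A * B" if z: "cmod \<zeta> = 1" for \<zeta>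
  proof -
    have "cmod (scalar_product (p \<zeta>) (h \<zeta>)) \<le> real CARD('n) * norm (p \<zeta>) * norm (h \<zeta>)" by (rule norm_scalar_product_le)
    also have "\<dots> \<le> real CARD('n) * A * B" using A B z by (intro mult_mono mult_nonneg_nonneg) auto
    finally show ?thesis .
  qed
  moreover have "(\<lambda>\<zeta>. scalar_product (p \<zeta>) (h \<zeta>)) \<in> borel_measurable circ"
  proof -
    have m: "(\<lambda>\<zeta>. q \<zeta> $ i) \<in> borel_measurable circ" if "bdd_circ q" for q :: "complex \<Rightarrow> complex ^ 'n" and i
      using measurable_compose[OF bdd_circ_measurable[OF that] borel_measurable_continuous_onI[of "\<lambda>x. x $ i"]]
      by (simp add: continuous_intros)
    show ?thesis unfolding scalar_product_def by (intro borel_measurable_sum borel_measurable_times m p hb)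
  qed
  ultimately show ?thesis unfolding bdd_circ_def by blast
qed

text \<open>
  The competitor is \<open>F = g \<circ> \<phi>\<close> with \<open>g = f + t s \<cdot> x\<close>.  Here \<open>x\<close> is a map \<open>h\<close> with small
  \<open>\<beta> = max 0 (Re (p \<bullet> h))\<close> in the mean, plus a small combination of maps \<open>hj j\<close> whose functionals are almost the
  unit vectors, and \<open>\<phi>\<close> is the shrinking reparametrisation for \<open>\<beta>\<close>.  The functionals of \<open>h\<close> are chosen to cancel
  the effect of the contraction contained in \<open>\<phi>\<close>; the coefficients of the \<open>hj j\<close> cancel the remaining error.
  The order in which constants are fixed matters: the \<open>hj j\<close>, then \<open>\<eta>\<close>, then \<open>h\<close>, then \<open>t\<close>.
\<close>

lemma improved_competitor:
  fixes u :: "complex ^ 'n \<Rightarrow> real" and f s p :: "complex \<Rightarrow> complex ^ 'n"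
    and w :: "nat \<Rightarrow> complex \<Rightarrow> complex ^ 'n"
  assumes psh: "psh_on G u" and uc: "continuous_on G u" and Go: "open G"
    and K0: "compact K0" "K0 \<subseteq> G"
    and fh: "\<And>j. (\<lambda>z. f z $ j) holomorphic_on ball 0 1"
    and fD: "\<And>z. cmod z < 1 \<Longrightarrow> f z \<in> K0" "\<And>z. cmod z < 1 \<Longrightarrow> u (f z) < 0"
    and s: "s \<in> H_infty (ball 0 1)"
    and N: "1 \<le> N" and w: "\<And>k. k \<in> {1..N} \<Longrightarrow> w k \<in> A_maps (annulus \<nu>)" and \<nu>: "0 < \<nu>" "\<nu> < 1"
    and nt: "AE \<zeta> in circ. nt_defined f \<zeta> \<and> nt_defined s \<zeta>"
    and p: "bdd_circ p"
    and first: "\<And>\<epsilon>. 0 < \<epsilon> \<Longrightarrow> \<exists>\<delta>>0. \<forall>h\<in>A_maps (ball 0 1). sup_norm (ball 0 1) h < \<delta> \<longrightarrow>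
        (AE \<zeta> in circ. nt_value f \<zeta> + nt_value s \<zeta> * h \<zeta> \<in> G \<and>
          u (nt_value f \<zeta> + nt_value s \<zeta> * h \<zeta>) \<le> 2 * Re (scalar_product (p \<zeta>) (h \<zeta>)) + \<epsilon> * sup_norm (ball 0 1) h)"
    and approx: "\<And>e \<eta>. 0 < \<eta> \<Longrightarrow> \<exists>h\<in>A_maps (ball 0 1). (\<forall>k\<in>{1..N}. \<bar>Phi (w k) (\<lambda>z. s z * h z) - e k\<bar> < \<eta>) \<and>
        integral\<^sup>L circ (\<lambda>\<zeta>. max 0 (Re (scalar_product (p \<zeta>) (h \<zeta>)))) < \<eta>"
  shows "\<exists>F K \<delta>. compact K \<and> K \<subseteq> G \<and> 0 < \<delta> \<and> F \<in> hol_maps (ball 0 1) UNIV \<and>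
      (\<forall>z. cmod z < 1 \<longrightarrow> F z \<in> K \<and> u (F z) \<le> - \<delta>) \<and> (\<forall>k\<in>{1..N}. Phi (w k) F = Phi (w k) f)"
proof -
  let ?A = "A_maps (ball 0 1) :: (complex \<Rightarrow> complex ^ 'n) set"
  let ?B = "ball (0::complex) 1"
  define n where "n = real CARD('n)"
  have n: "n \<ge> 0" by (simp add: n_def)
  obtain d0 where d0: "d0 > 0" "(\<Union>x\<in>K0. cball x d0) \<subseteq> G"
    using compact_subset_open_imp_cball_epsilon_subset[OF K0(1) Go K0(2)] by auto
  define K where "K = {x + y | x y. x \<in> K0 \<and> y \<in> cball 0 d0}"
  have K: "compact K" unfolding K_def by (rule compact_sums[OF K0(1) compact_cball])
  have KG: "K \<subseteq> G" using d0(2) by (auto simp: K_def subset_eq dist_norm)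
  have KK: "y + \<xi> \<in> K" if "y \<in> K0" "norm \<xi> \<le> d0" for y \<xi> using that by (auto simp: K_def)
  obtain Bs where Bs: "0 \<le> Bs" "\<And>z. cmod z < 1 \<Longrightarrow> norm (s z) \<le> Bs" using H_infty_bound[OF s] by metis
  have fc: "continuous_on ?B f" by (rule holomorphic_vec_continuous[OF fh])
  have sh: "(\<lambda>z. s z $ j) holomorphic_on ?B" for j using s by (auto simp: H_infty_def hol_maps_def)
  have f_H: "f \<in> H_infty ?B"
  proof -
    have "f ` ?B \<subseteq> K0" using fD(1) by auto
    then have "bounded (f ` ?B)" using compact_imp_bounded[OF K0(1)] bounded_subset by blast
    then show ?thesis using fh by (auto simp: H_infty_def hol_maps_def)
  qed

  \<comment> \<open>\<open>u \<circ> f\<close> is at most \<open>- 3 c\<close> on the half disc, and moving \<open>f\<close> by less than \<open>d1\<close> costs at most \<open>c\<close> there\<close>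
  obtain c where c: "c > 0" "\<And>z. cmod z \<le> 1 / 2 \<Longrightarrow> u (f z) \<le> - 3 * c"
  proof -
    have "continuous_on (cball 0 (1/2)) (\<lambda>z. u (f z))"
      by (rule continuous_on_compose2[OF uc continuous_on_subset[OF fc]]) (use fD(1) K0(2) in auto)
    from continuous_attains_sup[OF compact_cball _ this]
    obtain z1 :: complex where z1: "z1 \<in> cball 0 (1/2)" "\<And>z. z \<in> cball 0 (1/2) \<Longrightarrow> u (f z) \<le> u (f z1)" by auto
    have "u (f z1) < 0" using fD(2)[of z1] z1(1) by simp
    then show ?thesis using that[of "- u (f z1) / 3"] z1(2) by auto
  qed
  have "uniformly_continuous_on K u" by (rule compact_uniformly_continuous[OF continuous_on_subset[OF uc KG] K])
  then obtain d1 where d1: "d1 > 0" "\<And>x y. x \<in> K \<Longrightarrow> y \<in> K \<Longrightarrow> dist y x < d1 \<Longrightarrow> dist (u y) (u x) < c"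
    unfolding uniformly_continuous_on_def using c(1) by metis
  \<comment> \<open>\<open>c2 ln |z|\<close> equals \<open>- c\<close> for \<open>|z| = 1 / 2\<close>; with \<open>c2 \<kappa> = 2\<close> the shrinking by \<open>\<kappa> t\<close> will cancel \<open>2 t P[\<beta>]\<close>\<close>
  define c2 where "c2 = c / ln 2"
  have c2: "c2 > 0" using c by (simp add: c2_def)
  define \<kappa> where "\<kappa> = 2 / c2"
  have \<kappa>: "\<kappa> > 0" "c2 * \<kappa> = 2" using c2 by (auto simp: \<kappa>_def)

  define R where "R = (1 + \<nu>) / 2"
  have R: "\<nu> < R" "R < 1" "0 < R" using \<nu> by (auto simp: R_def)
  define mp where "mp = (\<lambda>k. mean_pairing R (w k))"
  have sphR: "sphere 0 R \<subseteq> closure (annulus \<nu>)" using closure_subset R by (force simp: annulus_def)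
  have wc: "continuous_on (sphere 0 R) (w k)" if "k \<in> {1..N}" for k
    by (rule continuous_on_subset[OF A_maps_annulusD(1)[OF w[OF that]] sphR])
  have Phi_mp: "Phi (w k) H = mp k H" if "k \<in> {1..N}" "H \<in> H_infty ?B" "AE \<zeta> in circ. nt_defined H \<zeta>" for k H
    unfolding mp_def by (rule Phi_eq_mean_pairing[OF w[OF that(1)] \<nu> R(1,2) that(2,3)])
  have Phi_f: "Phi (w k) f = mp k f" if "k \<in> {1..N}" for k
    by (rule Phi_mp[OF that f_H]) (use nt in auto)
  have nt_sh: "AE \<zeta> in circ. nt_defined (\<lambda>z. s z * h z) \<zeta>" if h: "h \<in> ?A" for h
    using nt AE_space
  proof eventually_elim
    case (elim \<zeta>)
    then have "has_nt_limit (\<lambda>z. s z * h z) \<zeta> (nt_value s \<zeta> * h \<zeta>)"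
      by (intro has_nt_limit_mult has_nt_limit_nt_value has_nt_limit_continuous A_maps_ballD(1)[OF h]) auto
    then show ?case unfolding nt_defined_def by blast
  qed
  have Phi_sh: "Phi (w k) (\<lambda>z. s z * h z) = mp k (\<lambda>z. s z * h z)" if "k \<in> {1..N}" "h \<in> ?A" for k h
    by (rule Phi_mp[OF that(1) H_infty_mult_A_maps[OF s that(2)] nt_sh[OF that(2)]])

  have "\<exists>e C. \<forall>t\<ge>0. \<bar>mp k (\<lambda>z. f (of_real (exp (- (\<kappa> * t))) * z)) - mp k f + t * e\<bar> \<le> C * t\<^sup>2" if "k \<in> {1..N}" for k
    unfolding mp_def by (rule mean_pairing_contraction_derivative[OF fh R(3,2) wc[OF that]]) (use \<kappa> in simp)
  then obtain e0 C where e0: "\<And>k t. k \<in> {1..N} \<Longrightarrow> 0 \<le> t \<Longrightarrow>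
      \<bar>mp k (\<lambda>z. f (of_real (exp (- (\<kappa> * t))) * z)) - mp k f + t * e0 k\<bar> \<le> C k * t\<^sup>2" by metis
  define Ct where "Ct = (\<Sum>k=1..N. \<bar>C k\<bar>)"
  have Ct: "C k \<le> Ct" if "k \<in> {1..N}" for k
  proof -
    have "\<bar>C k\<bar> \<le> Ct" unfolding Ct_def by (rule member_le_sum[OF that]) auto
    then show ?thesis using abs_ge_self order_trans by blast
  qed
  have "\<exists>b\<ge>0. \<forall>z\<in>sphere 0 R. norm (w k z) \<le> b" if "k \<in> {1..N}" for k
    using continuous_on_compact_bound[OF compact_sphere wc[OF that]] by metis
  then obtain bw where bw: "\<And>k. k \<in> {1..N} \<Longrightarrow> 0 \<le> bw k" "\<And>k z. k \<in> {1..N} \<Longrightarrow> z \<in> sphere 0 R \<Longrightarrow> norm (w k z) \<le> bw k"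
    by metis
  define Bw where "Bw = (\<Sum>k=1..N. bw k)"
  have Bw0: "0 \<le> Bw" unfolding Bw_def by (rule sum_nonneg) (rule bw)
  have Bw: "norm (w k z) \<le> Bw" if "k \<in> {1..N}" "cmod z = R" for k z
  proof -
    have "bw k \<le> Bw" unfolding Bw_def by (rule member_le_sum[OF that(1)]) (use bw(1) in auto)
    then show ?thesis using bw(2)[OF that(1), of z] that(2) by simp
  qed
  obtain Lf where Lf: "0 \<le> Lf" "\<And>x y. cmod x \<le> R \<Longrightarrow> cmod y \<le> R \<Longrightarrow> norm (f x - f y) \<le> Lf * cmod (x - y)"
    using holomorphic_vec_lipschitz[OF fh R(2)] by metis

  have N0: "0 < real N" using N by simp
  have "\<exists>h\<in>?A. \<forall>k\<in>{1..N}. \<bar>Phi (w k) (\<lambda>z. s z * h z) - (if k = j then 1 else 0)\<bar> < 1 / (4 * real N)" for j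
  proof -
    have "0 < 1 / (4 * real N)" using N0 by simp
    from approx[OF this, of "\<lambda>k. if k = j then 1 else 0"] show ?thesis by blast
  qed
  then obtain hj where hj: "\<And>j. hj j \<in> ?A"
    "\<And>j k. k \<in> {1..N} \<Longrightarrow> \<bar>Phi (w k) (\<lambda>z. s z * hj j z) - (if k = j then 1 else 0)\<bar> < 1 / (4 * real N)" by metis
  define Bh where "Bh = (\<Sum>j=1..N. sup_norm ?B (hj j))"
  have Bh0: "0 \<le> Bh" unfolding Bh_def by (rule sum_nonneg) (rule sup_norm_nonneg[OF hj(1)])
  have Bh: "norm (hj j z) \<le> Bh" if "j \<in> {1..N}" "cmod z \<le> 1" for j z
  proof -
    have "sup_norm ?B (hj j) \<le> Bh" unfolding Bh_def
      by (rule member_le_sum[OF that(1)]) (use sup_norm_nonneg[OF hj(1)] in auto)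
    then show ?thesis using norm_le_sup_norm[OF hj(1) that(2), of j] by simp
  qed
  have shA: "(\<lambda>z. (s z * h z) $ i) holomorphic_on ?B" if "h \<in> ?A" for h i
    by (rule holomorphic_vec_mult[OF sh A_maps_ballD(2)[OF that]])
  have "\<exists>L\<ge>0. \<forall>x y. cmod x \<le> R \<longrightarrow> cmod y \<le> R \<longrightarrow> norm (s x * hj j x - s y * hj j y) \<le> L * cmod (x - y)" for j
    using holomorphic_vec_lipschitz[OF shA[OF hj(1)] R(2), of j] by metis
  then obtain Lj where Lj: "\<And>j. 0 \<le> Lj j" "\<And>j x y. cmod x \<le> R \<Longrightarrow> cmod y \<le> R \<Longrightarrow> norm (s x * hj j x - s y * hj j y) \<le> Lj j * cmod (x - y)"
    by metis
  define LL where "LL = (\<Sum>j=1..N. Lj j)"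
  have LL0: "0 \<le> LL" unfolding LL_def by (rule sum_nonneg) (rule Lj)
  have LL: "norm (s x * hj j x - s y * hj j y) \<le> LL * cmod (x - y)" if "j \<in> {1..N}" "cmod x \<le> R" "cmod y \<le> R" for j x y
  proof -
    have "Lj j \<le> LL" unfolding LL_def by (rule member_le_sum[OF that(1)]) (use Lj(1) in auto)
    then have "Lj j * cmod (x - y) \<le> LL * cmod (x - y)" by (rule mult_right_mono) simp
    then show ?thesis using Lj(2)[OF that(2,3), of j] by linarith
  qed
  obtain Bp where Bp: "Bp \<ge> 0" "\<And>\<zeta>. cmod \<zeta> = 1 \<Longrightarrow> norm (p \<zeta>) \<le> Bp" using bdd_circ_bound[OF p] by metis

  \<comment> \<open>the constant of \<open>norm_schwarz_le\<close>; \<open>C1\<close> bounds the correction coefficients and \<open>E\<close> their effect on \<open>Re (p \<bullet> x)\<close>, both per unit of \<open>\<eta>\<close>\<close>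
  define CR where "CR = 3 / (1 - R)"
  have CR: "0 < CR" using R by (simp add: CR_def)
  define C0 where "C0 = n * (Lf * (\<kappa> * CR)) * Bw"
  have C0: "0 \<le> C0" using n Lf \<kappa> CR Bw0 by (simp add: C0_def)
  define C1 where "C1 = 2 * (C0 + 3)"
  have C1: "0 < C1" using C0 by (simp add: C1_def)
  define E where "E = real N * C1 * (n * Bp * Bh)"
  have E0: "0 \<le> E" using n Bp Bh0 C1 by (simp add: E_def)
  define \<eta> where "\<eta> = 1 / (4 * (E + 1))"
  have \<eta>: "0 < \<eta>" "E * \<eta> \<le> 1 / 4" using E0 by (auto simp: \<eta>_def field_simps)
  obtain h where h: "h \<in> ?A" "\<And>k. k \<in> {1..N} \<Longrightarrow> \<bar>Phi (w k) (\<lambda>z. s z * h z) - e0 k\<bar> < \<eta>"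
    "integral\<^sup>L circ (\<lambda>\<zeta>. max 0 (Re (scalar_product (p \<zeta>) (h \<zeta>)))) < \<eta>"
    using approx[OF \<eta>(1), of e0] by blast
  define \<beta> where "\<beta> = (\<lambda>\<zeta>. max 0 (Re (scalar_product (p \<zeta>) (h \<zeta>))))"
  have hc: "continuous_on (sphere 0 1) h" by (rule continuous_on_subset[OF A_maps_ballD(1)[OF h(1)]]) auto
  have \<beta>b: "bdd_circ \<beta>"
    unfolding \<beta>_def
    by (rule bdd_circ_compose[OF bdd_circ_Re[OF bdd_circ_scalar_product[OF p hc]], where K = 1 and L = 0])
       (auto intro!: continuous_intros)
  have \<beta>0: "0 \<le> \<beta> \<zeta>" for \<zeta> by (simp add: \<beta>_def)
  have \<beta>m: "integral\<^sup>L circ \<beta> / (2 * pi) \<le> \<eta>"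
  proof -
    have "0 \<le> integral\<^sup>L circ \<beta>" by (rule integral_nonneg_AE) (simp add: \<beta>0)
    then have "integral\<^sup>L circ \<beta> / (2 * pi) \<le> integral\<^sup>L circ \<beta> / 1" using pi_gt3 by (intro divide_left_mono) auto
    then show ?thesis using h(3) by (simp add: \<beta>_def)
  qed
  obtain L0 where L0: "0 \<le> L0" "\<And>x y. cmod x \<le> R \<Longrightarrow> cmod y \<le> R \<Longrightarrow> norm (s x * h x - s y * h y) \<le> L0 * cmod (x - y)"
    using holomorphic_vec_lipschitz[OF shA[OF h(1)] R(2)] by metis
  define B2 where "B2 = sup_norm ?B h + real N * (C1 * \<eta> * Bh) + 1"
  have B2: "0 < B2" unfolding B2_def using sup_norm_nonneg[OF h(1)] C1 \<eta>(1) Bh0 by (intro add_nonneg_pos add_nonneg_nonneg) auto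
  obtain \<delta> where \<delta>: "\<delta> > 0" "\<And>h. h \<in> ?A \<Longrightarrow> sup_norm ?B h < \<delta> \<Longrightarrow>
        (AE \<zeta> in circ. nt_value f \<zeta> + nt_value s \<zeta> * h \<zeta> \<in> G \<and>
          u (nt_value f \<zeta> + nt_value s \<zeta> * h \<zeta>) \<le> 2 * Re (scalar_product (p \<zeta>) (h \<zeta>)) + 1 / (2 * B2) * sup_norm ?B h)"
    using first[of "1 / (2 * B2)"] B2 by auto

  define A4 where "A4 = n * (LL * (\<kappa> * (CR * \<eta> + 1))) * Bw"
  define A5 where "A5 = n * (L0 * (\<kappa> * (CR * \<eta> + 1))) * Bw"
  have "\<forall>\<^sub>F t in at_right 0. 0 < t \<and> t * B2 < \<delta> \<and> t * (Bs * B2) < min d0 d1 \<and> t * A4 < 1 / (4 * real N)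
      \<and> t * Ct < \<eta> \<and> t * A5 < \<eta>"
    by (intro eventually_conj eventually_mult_small eventually_at_right_less)
       (use \<delta> d0 d1 N0 \<eta> in auto)
  then obtain t where t: "0 < t" "t * B2 < \<delta>" "t * (Bs * B2) < min d0 d1" "t * A4 < 1 / (4 * real N)" "t * Ct < \<eta>" "t * A5 < \<eta>"
    using eventually_happens'[OF trivial_limit_at_right_real] by blast
  define \<tau> where "\<tau> = \<kappa> * t"
  have \<tau>: "0 < \<tau>" using \<kappa> t by (simp add: \<tau>_def)
  obtain \<phi> where \<phi>: "\<phi> holomorphic_on ball 0 (exp \<tau>)"
    "\<And>z. cmod z < exp \<tau> \<Longrightarrow> cmod (\<phi> z) < 1"
    "\<And>z. cmod z \<le> 1 \<Longrightarrow> cmod (\<phi> z) \<le> exp (- \<tau>) * cmod z"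
    "\<And>z. cmod z \<le> 1 \<Longrightarrow> \<phi> z \<noteq> 0 \<Longrightarrow> ln (cmod (\<phi> z)) \<le> - (\<tau> * (poisson \<beta> (\<phi> z) + 1))"
    "\<And>z. cmod z \<le> 1 \<Longrightarrow> cmod (\<phi> z - of_real (exp (- \<tau>)) * z) \<le> \<tau> * cmod (schwarz \<beta> (\<phi> z))"
    using shrinking_reparametrization[OF \<beta>b \<beta>0 \<tau>] by metis
  have e1: "1 < exp \<tau>" using \<tau> by simp
  have cb: "cball 0 1 \<subseteq> ball (0::complex) (exp \<tau>)"
  proof
    fix z :: complex assume "z \<in> cball 0 1"
    then have "cmod z \<le> 1" by simp
    then have "cmod z < exp \<tau>" using e1 by (rule le_less_trans)
    then show "z \<in> ball 0 (exp \<tau>)" by simp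
  qed
  have \<phi>1: "cmod (\<phi> z) < 1" if "cmod z \<le> 1" for z using \<phi>(2)[of z] that e1 by simp
  have \<phi>R: "cmod (\<phi> z) \<le> R" if "cmod z \<le> R" for z
  proof -
    have "exp (- \<tau>) * cmod z \<le> 1 * cmod z" using \<tau> by (intro mult_right_mono) auto
    then show ?thesis using \<phi>(3)[of z] that R by simp
  qed
  have \<phi>c: "continuous_on (ball 0 (exp \<tau>)) \<phi>" by (rule holomorphic_on_imp_continuous_on[OF \<phi>(1)])
  have dA: "cmod (\<phi> z - of_real (exp (- \<tau>)) * z) \<le> \<tau> * (CR * \<eta>)" if z: "cmod z \<le> R" for z
  proof -
    have "cmod (schwarz \<beta> (\<phi> z)) \<le> 3 / (1 - R) * (integral\<^sup>L circ \<beta> / (2 * pi))"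
      by (rule norm_schwarz_le[OF \<beta>b \<beta>0 \<phi>R[OF z] R(2)])
    also have "\<dots> \<le> CR * \<eta>" unfolding CR_def[symmetric] using CR \<beta>m by (intro mult_left_mono) auto
    finally have "\<tau> * cmod (schwarz \<beta> (\<phi> z)) \<le> \<tau> * (CR * \<eta>)" using \<tau> by (intro mult_left_mono) auto
    then show ?thesis using \<phi>(5)[of z] z R by linarith
  qed
  have dB: "cmod (\<phi> z - z) \<le> \<tau> * (CR * \<eta> + 1)" if z: "cmod z \<le> R" for z
  proof -
    have "of_real (exp (- \<tau>)) * z - z = of_real (exp (- \<tau>) - 1) * z" by (simp add: algebra_simps)
    then have "cmod (of_real (exp (- \<tau>)) * z - z) = \<bar>exp (- \<tau>) - 1\<bar> * cmod z" by (simp only: norm_mult norm_of_real)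
    also have "\<dots> \<le> \<tau> * 1" using exp_minus_second_order[of \<tau>] \<tau> z R by (intro mult_mono) auto
    finally have "cmod (of_real (exp (- \<tau>)) * z - z) \<le> \<tau>" by simp
    moreover have "cmod (\<phi> z - z) \<le> cmod (\<phi> z - of_real (exp (- \<tau>)) * z) + cmod (of_real (exp (- \<tau>)) * z - z)"
      by (metis diff_add_cancel add_diff_eq norm_triangle_ineq)
    ultimately show ?thesis using dA[OF z] by (simp add: algebra_simps)
  qed
  have cR: "continuous_on (sphere 0 R) (\<lambda>z. H (\<phi> z))" if "continuous_on ?B H" for H :: "complex \<Rightarrow> complex ^ 'n"
  proof (rule continuous_on_compose2[OF that])
    show "continuous_on (sphere 0 R) \<phi>" by (rule continuous_on_subset[OF \<phi>c], rule order_trans[OF _ cb]) (use R in auto)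
    show "\<phi> ` sphere 0 R \<subseteq> ?B" using \<phi>1 R by auto
  qed
  have cR0: "continuous_on (sphere 0 R) H" if "continuous_on ?B H" for H :: "complex \<Rightarrow> complex ^ 'n"
    by (rule continuous_on_subset[OF that]) (use R in auto)
  have shc: "continuous_on ?B (\<lambda>z. s z * k z)" if "k \<in> ?A" for k by (rule holomorphic_vec_continuous[OF shA[OF that]])

  \<comment> \<open>\<open>y\<close> is the error in the functionals per unit of \<open>t\<close> before correction, and \<open>M\<close> the effect of the maps \<open>hj j\<close>\<close>
  define y where "y = (\<lambda>k. (mp k (\<lambda>z. f (\<phi> z)) - mp k f) / t + mp k (\<lambda>z. s (\<phi> z) * h (\<phi> z)))"
  define M where "M = (\<lambda>k j. mp k (\<lambda>z. s (\<phi> z) * hj j (\<phi> z)))"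
  have yb: "\<bar>- y k\<bar> \<le> (C0 + 3) * \<eta>" if k: "k \<in> {1..N}" for k
  proof -
    have a: "\<bar>mp k (\<lambda>z. f (\<phi> z)) - mp k (\<lambda>z. f (of_real (exp (- (\<kappa> * t))) * z))\<bar> \<le> n * (Lf * (\<tau> * (CR * \<eta>))) * Bw"
      unfolding mp_def n_def
    proof (rule mean_pairing_diff_le[OF cR[OF fc] _ wc[OF k] R(3) _ Bw[OF k]])
      have "exp (- \<tau>) * R \<le> 1 * R" by (rule mult_right_mono) (use \<tau> R in auto)
      then have ex: "exp (- (\<kappa> * t)) * R < 1" using R unfolding \<tau>_def by linarith
      show "continuous_on (sphere 0 R) (\<lambda>z. f (of_real (exp (- (\<kappa> * t))) * z))"
        by (rule continuous_on_compose2[OF fc]) (use ex in \<open>auto intro!: continuous_intros simp: norm_mult\<close>)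
      fix z :: complex assume z: "cmod z = R"
      have "cmod (of_real (exp (- \<tau>)) * z) \<le> 1 * R" unfolding norm_mult z using \<tau> R by (intro mult_right_mono) auto
      then have "norm (f (\<phi> z) - f (of_real (exp (- \<tau>)) * z)) \<le> Lf * cmod (\<phi> z - of_real (exp (- \<tau>)) * z)"
        by (intro Lf(2) \<phi>R) (use z in auto)
      also have "\<dots> \<le> Lf * (\<tau> * (CR * \<eta>))" by (intro mult_left_mono dA Lf(1)) (use z in simp)
      finally show "norm (f (\<phi> z) - f (of_real (exp (- (\<kappa> * t))) * z)) \<le> Lf * (\<tau> * (CR * \<eta>))" by (simp add: \<tau>_def)
    qed
    have "n * (Lf * (\<tau> * (CR * \<eta>))) * Bw = C0 * \<eta> * t" by (simp add: C0_def \<tau>_def mult_ac)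
    with a have a': "\<bar>mp k (\<lambda>z. f (\<phi> z)) - mp k (\<lambda>z. f (of_real (exp (- (\<kappa> * t))) * z))\<bar> \<le> C0 * \<eta> * t" by simp
    have "C k * t\<^sup>2 \<le> Ct * t\<^sup>2" by (rule mult_right_mono[OF Ct[OF k]]) simp
    also have "\<dots> = (t * Ct) * t" by (simp add: power2_eq_square mult_ac)
    also have "\<dots> \<le> \<eta> * t" using t by (intro mult_right_mono) auto
    finally have b: "\<bar>mp k (\<lambda>z. f (of_real (exp (- (\<kappa> * t))) * z)) - mp k f + t * e0 k\<bar> \<le> \<eta> * t"
      using e0[OF k, of t] t by linarith
    have "\<bar>mp k (\<lambda>z. f (\<phi> z)) - mp k f + t * e0 k\<bar> \<le> (C0 * \<eta> + \<eta>) * t"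
      using a' b unfolding distrib_right by linarith
    moreover have "(mp k (\<lambda>z. f (\<phi> z)) - mp k f) / t + e0 k = (mp k (\<lambda>z. f (\<phi> z)) - mp k f + t * e0 k) / t"
      using t by (simp add: field_simps)
    ultimately have q1: "\<bar>(mp k (\<lambda>z. f (\<phi> z)) - mp k f) / t + e0 k\<bar> \<le> C0 * \<eta> + \<eta>"
      using t by (simp add: abs_divide pos_divide_le_eq)
    have q2: "\<bar>mp k (\<lambda>z. s (\<phi> z) * h (\<phi> z)) - mp k (\<lambda>z. s z * h z)\<bar> \<le> n * (L0 * (\<tau> * (CR * \<eta> + 1))) * Bw"
      unfolding mp_def n_def
    proof (rule mean_pairing_diff_le[OF cR[OF shc[OF h(1)]] cR0[OF shc[OF h(1)]] wc[OF k] R(3) _ Bw[OF k]])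
      fix z :: complex assume z: "cmod z = R"
      have "norm (s (\<phi> z) * h (\<phi> z) - s z * h z) \<le> L0 * cmod (\<phi> z - z)" by (intro L0(2) \<phi>R) (use z in auto)
      also have "\<dots> \<le> L0 * (\<tau> * (CR * \<eta> + 1))" by (intro mult_left_mono dB L0(1)) (use z in simp)
      finally show "norm (s (\<phi> z) * h (\<phi> z) - s z * h z) \<le> L0 * (\<tau> * (CR * \<eta> + 1))" .
    qed
    have "n * (L0 * (\<tau> * (CR * \<eta> + 1))) * Bw = t * A5" by (simp add: A5_def \<tau>_def mult_ac)
    with q2 t(6) have q2': "\<bar>mp k (\<lambda>z. s (\<phi> z) * h (\<phi> z)) - mp k (\<lambda>z. s z * h z)\<bar> \<le> \<eta>" by simp
    have q3: "\<bar>mp k (\<lambda>z. s z * h z) - e0 k\<bar> < \<eta>" using h(2)[OF k] Phi_sh[OF k h(1)] by simp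
    have "\<bar>- y k\<bar> \<le> C0 * \<eta> + \<eta> + \<eta> + \<eta>" unfolding y_def using q1 q2' q3 by linarith
    then show ?thesis by (simp add: algebra_simps)
  qed
  have Mb: "\<bar>M k j - (if k = j then 1 else 0)\<bar> \<le> 1 / (2 * real N)" if k: "k \<in> {1..N}" and j: "j \<in> {1..N}" for k j
  proof -
    have "\<bar>M k j - mp k (\<lambda>z. s z * hj j z)\<bar> \<le> n * (LL * (\<tau> * (CR * \<eta> + 1))) * Bw"
      unfolding M_def mp_def n_def
    proof (rule mean_pairing_diff_le[OF cR[OF shc[OF hj(1)]] cR0[OF shc[OF hj(1)]] wc[OF k] R(3) _ Bw[OF k]])
      fix z :: complex assume z: "cmod z = R"
      have "norm (s (\<phi> z) * hj j (\<phi> z) - s z * hj j z) \<le> LL * cmod (\<phi> z - z)" by (intro LL j \<phi>R) (use z in auto)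
      also have "\<dots> \<le> LL * (\<tau> * (CR * \<eta> + 1))" by (intro mult_left_mono dB LL0) (use z in simp)
      finally show "norm (s (\<phi> z) * hj j (\<phi> z) - s z * hj j z) \<le> LL * (\<tau> * (CR * \<eta> + 1))" .
    qed
    moreover have "n * (LL * (\<tau> * (CR * \<eta> + 1))) * Bw = t * A4" by (simp add: A4_def \<tau>_def mult_ac)
    ultimately have "\<bar>M k j - mp k (\<lambda>z. s z * hj j z)\<bar> \<le> 1 / (4 * real N)" using t(4) by linarith
    moreover have "\<bar>mp k (\<lambda>z. s z * hj j z) - (if k = j then 1 else 0)\<bar> < 1 / (4 * real N)"
      using hj(2)[OF k, of j] Phi_sh[OF k hj(1), of j] by simp
    moreover have "1 / (2 * real N) = 1 / (4 * real N) + 1 / (4 * real N)" using N0 by (simp add: field_simps)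
    ultimately show ?thesis by linarith
  qed
  obtain cc where cc: "\<And>j. j \<in> {1..N} \<Longrightarrow> \<bar>cc j\<bar> \<le> 2 * ((C0 + 3) * \<eta>)" "\<And>k. k \<in> {1..N} \<Longrightarrow> (\<Sum>j=1..N. M k j * cc j) = - y k"
    using near_identity_solvable[of N M "\<lambda>k. - y k" "(C0 + 3) * \<eta>", OF Mb yb] by metis
  have ccb: "\<bar>cc j\<bar> \<le> C1 * \<eta>" if "j \<in> {1..N}" for j using cc(1)[OF that] by (simp only: C1_def mult.assoc)

  define x where "x = (\<lambda>z. h z + (\<Sum>j=1..N. cc j *\<^sub>R hj j z))"
  have xA: "x \<in> ?A" unfolding x_def by (rule A_maps_add_sum[OF h(1) hj(1)])
  have xh: "norm (x z - h z) \<le> real N * (C1 * \<eta> * Bh)" if z: "cmod z \<le> 1" for z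
  proof -
    have "norm (\<Sum>j=1..N. cc j *\<^sub>R hj j z) \<le> (\<Sum>j=1..N. C1 * \<eta> * Bh)"
      by (rule sum_norm_le) (use ccb Bh z C1 \<eta> in \<open>auto intro!: mult_mono\<close>)
    then show ?thesis by (simp add: x_def)
  qed
  have xB: "norm (x z) \<le> B2" if z: "cmod z \<le> 1" for z
  proof -
    have "norm (x z) \<le> norm (h z) + norm (x z - h z)" using norm_triangle_ineq[of "h z" "x z - h z"] by simp
    then show ?thesis using norm_le_sup_norm[OF h(1) z] xh[OF z] by (simp add: B2_def)
  qed
  define tx where "tx = (\<lambda>z. t *\<^sub>R x z)"
  have zA: "(\<lambda>z. 0) \<in> ?A" by (auto simp: A_maps_def hol_maps_def)
  have txA: "tx \<in> ?A" using A_maps_add_scaled[OF zA xA, of t] by (simp add: tx_def)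
  have txB: "norm (tx z) \<le> t * B2" if "cmod z \<le> 1" for z
    using mult_left_mono[OF xB[OF that], of t] t by (simp add: tx_def)
  have tx_sup: "sup_norm ?B tx \<le> t * B2" by (rule sup_norm_le) (use txB in auto)
  define g where "g = (\<lambda>z. f z + s z * tx z)"
  have gh: "(\<lambda>z. g z $ j) holomorphic_on ?B" for j
    using fh[of j] shA[OF txA, of j] unfolding g_def vector_add_component by (intro holomorphic_on_add)
  have gf: "norm (s z * tx z) < min d0 d1" if z: "cmod z < 1" for z
  proof -
    have "norm (s z * tx z) \<le> norm (s z) * norm (tx z)" by (rule norm_vec_mult_le)
    also have "\<dots> \<le> Bs * (t * B2)" using Bs z txB[of z] by (intro mult_mono) auto
    also have "\<dots> = t * (Bs * B2)" by simp
    finally show ?thesis using t(3) by linarith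
  qed
  have gK: "g z \<in> K" if z: "cmod z < 1" for z
    unfolding g_def by (rule KK[OF fD(1)[OF z]]) (use gf[OF z] in auto)
  have g_inner: "u (g z) \<le> - 2 * c" if z: "cmod z \<le> 1 / 2" for z
  proof -
    have z1: "cmod z < 1" using z by simp
    have "dist (u (g z)) (u (f z)) < c"
    proof (rule d1(2))
      show "f z \<in> K" using KK[OF fD(1)[OF z1], of 0] d0 by simp
      show "g z \<in> K" by (rule gK[OF z1])
      show "dist (g z) (f z) < d1" using gf[OF z1] by (simp add: g_def dist_norm)
    qed
    then show ?thesis using c(2)[OF z] unfolding dist_real_def by linarith
  qed
  \<comment> \<open>of the last term \<open>t\<close>, one half pays for the correction of \<open>h\<close> and one half for the remainder of the expansion\<close>
  define b where "b = (\<lambda>\<zeta>. 2 * t * \<beta> \<zeta> + t)"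
  have bb: "bdd_circ b" unfolding b_def
    by (intro bdd_circ_add bdd_circ_mult \<beta>b bdd_circ_const)
  have b0: "0 \<le> b \<zeta>" for \<zeta> using t \<beta>0 by (simp add: b_def)
  have pois_b: "poisson b z = 2 * t * poisson \<beta> z + t" if "cmod z < 1" for z
  proof -
    have "poisson b z = poisson (\<lambda>\<zeta>. 2 * t * \<beta> \<zeta>) z + poisson (\<lambda>_. t) z"
      unfolding b_def by (rule poisson_add[OF _ bdd_circ_const that]) (intro bdd_circ_mult \<beta>b bdd_circ_const)
    then show ?thesis using poisson_cmult[of "2 * t" \<beta> z] poisson_const[OF that, of t] by simp
  qed
  have bdry: "AE \<zeta> in circ. nt_value f \<zeta> + nt_value s \<zeta> * tx \<zeta> \<in> G \<and>
          u (nt_value f \<zeta> + nt_value s \<zeta> * tx \<zeta>) \<le> 2 * Re (scalar_product (p \<zeta>) (tx \<zeta>)) + 1 / (2 * B2) * sup_norm ?B tx"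
    by (rule \<delta>(2)[OF txA]) (use tx_sup t in linarith)
  have lim: "AE \<zeta> in circ. \<exists>l. ((\<lambda>r. u (g (of_real r * \<zeta>))) \<longlongrightarrow> l) (at_left 1) \<and> l \<le> b \<zeta>"
    using bdry nt AE_space
  proof eventually_elim
    case (elim \<zeta>)
    then have z1: "cmod \<zeta> = 1" by simp
    let ?l = "nt_value f \<zeta> + nt_value s \<zeta> * tx \<zeta>"
    have "has_nt_limit g \<zeta> ?l"
      unfolding g_def using elim z1
      by (intro has_nt_limit_add has_nt_limit_mult has_nt_limit_nt_value has_nt_limit_continuous A_maps_ballD(1)[OF txA]) auto
    from has_nt_limit_radial[OF this z1] have gl: "((\<lambda>r. g (of_real r * \<zeta>)) \<longlongrightarrow> ?l) (at_left 1)" .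
    have "isCont u ?l" using uc Go elim(1) by (simp add: continuous_on_eq_continuous_at)
    then have ul: "((\<lambda>r. u (g (of_real r * \<zeta>))) \<longlongrightarrow> u ?l) (at_left 1)" by (rule isCont_tendsto_compose[OF _ gl])
    have "Re (scalar_product (p \<zeta>) (x \<zeta>)) \<le> \<beta> \<zeta> + 1 / 4"
    proof -
      have "scalar_product (p \<zeta>) (x \<zeta>) = scalar_product (p \<zeta>) (h \<zeta>) + scalar_product (p \<zeta>) (x \<zeta> - h \<zeta>)"
        by (simp add: scalar_product_def algebra_simps sum.distrib sum_subtractf)
      then have "Re (scalar_product (p \<zeta>) (x \<zeta>)) \<le> \<beta> \<zeta> + cmod (scalar_product (p \<zeta>) (x \<zeta> - h \<zeta>))"
        using complex_Re_le_cmod[of "scalar_product (p \<zeta>) (x \<zeta> - h \<zeta>)"] by (simp add: \<beta>_def)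
      also have "cmod (scalar_product (p \<zeta>) (x \<zeta> - h \<zeta>)) \<le> n * norm (p \<zeta>) * norm (x \<zeta> - h \<zeta>)"
        unfolding n_def by (rule norm_scalar_product_le)
      also have "\<dots> \<le> n * Bp * (real N * (C1 * \<eta> * Bh))"
        using n Bp z1 xh[of \<zeta>] by (intro mult_mono mult_nonneg_nonneg) auto
      also have "\<dots> = E * \<eta>" by (simp add: E_def mult_ac)
      finally show ?thesis using \<eta>(2) by linarith
    qed
    then have "t * Re (scalar_product (p \<zeta>) (x \<zeta>)) \<le> t * (\<beta> \<zeta> + 1 / 4)" using t by (intro mult_left_mono) auto
    moreover have "Re (scalar_product (p \<zeta>) (tx \<zeta>)) = t * Re (scalar_product (p \<zeta>) (x \<zeta>))"
      by (simp add: tx_def scalar_product_def sum_distrib_left)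
    ultimately have r1: "Re (scalar_product (p \<zeta>) (tx \<zeta>)) \<le> t * \<beta> \<zeta> + t / 4" by (simp add: algebra_simps)
    have "1 / (2 * B2) * sup_norm ?B tx \<le> 1 / (2 * B2) * (t * B2)" using tx_sup B2 by (intro mult_left_mono) auto
    also have "\<dots> = t / 2" using B2 by simp
    finally have "u ?l \<le> b \<zeta>" using elim(1) r1 unfolding b_def by linarith
    then show ?case using ul by blast
  qed
  have outer: "u (g z) \<le> poisson b z + c2 * ln (cmod z)" if "1 / 2 < cmod z" "cmod z < 1" for z
  proof (rule psh_disc_poisson_log_bound[OF psh uc Go gh K KG _ _ _ _ bb b0 lim that])
    show "g ` ?B \<subseteq> K" using gK by auto
    show "u (g z) \<le> c2 * ln (1 / 2)" if "cmod z \<le> 1 / 2" for z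
      using g_inner[OF that] c(1) by (simp add: c2_def ln_div)
  qed auto
  define F where "F = (\<lambda>z. g (\<phi> z))"
  have Fneg: "u (F z) \<le> - min t (2 * c)" if z: "cmod z \<le> 1" for z
  proof (cases "cmod (\<phi> z) \<le> 1 / 2")
    case True
    then show ?thesis using g_inner[OF True] by (simp add: F_def min_def)
  next
    case False
    then have nz: "\<phi> z \<noteq> 0" by auto
    have z1: "cmod (\<phi> z) < 1" by (rule \<phi>1[OF z])
    have "u (F z) \<le> 2 * t * poisson \<beta> (\<phi> z) + t + c2 * ln (cmod (\<phi> z))"
      unfolding F_def using outer[of "\<phi> z"] False z1 pois_b[OF z1] by simp
    also have "c2 * ln (cmod (\<phi> z)) \<le> c2 * (- (\<tau> * (poisson \<beta> (\<phi> z) + 1)))"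
      using \<phi>(4)[OF z nz] c2 by (intro mult_left_mono) auto
    also have "c2 * (- (\<tau> * (poisson \<beta> (\<phi> z) + 1))) = - (c2 * \<kappa>) * t * (poisson \<beta> (\<phi> z) + 1)"
      by (simp add: \<tau>_def)
    also have "2 * t * poisson \<beta> (\<phi> z) + t + - (c2 * \<kappa>) * t * (poisson \<beta> (\<phi> z) + 1) = - t"
      unfolding \<kappa>(2) by (simp add: algebra_simps)
    finally show ?thesis by simp
  qed
  have Fh: "(\<lambda>z. F z $ j) holomorphic_on ball 0 (exp \<tau>)" for j
    unfolding F_def
    by (rule holomorphic_on_compose_gen[OF \<phi>(1) gh[of j], unfolded o_def]) (use \<phi>(2) in auto)
  have FK: "F z \<in> K" if "cmod z \<le> 1" for z unfolding F_def by (rule gK[OF \<phi>1[OF that]])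
  have Fc: "continuous_on (cball 0 1) F"
    by (rule continuous_on_subset[OF holomorphic_vec_continuous[OF Fh] cb])
  have F_hol: "F \<in> hol_maps ?B UNIV"
    using holomorphic_on_subset[OF Fh order_trans[OF ball_subset_cball cb]] by (simp add: hol_maps_def)
  have F_H: "F \<in> H_infty ?B"
  proof -
    have "F ` ?B \<subseteq> K" using FK by auto
    then have "bounded (F ` ?B)" using compact_imp_bounded[OF K] bounded_subset by blast
    then show ?thesis using F_hol by (simp add: H_infty_def)
  qed
  have nt_F: "AE \<zeta> in circ. nt_defined F \<zeta>"
    by (rule AE_I2) (use has_nt_limit_continuous[OF Fc] in \<open>auto simp: nt_defined_def\<close>)
  have "Phi (w k) F = Phi (w k) f" if k: "k \<in> {1..N}" for k
  proof -
    have eq: "F = (\<lambda>z. (f (\<phi> z) + t *\<^sub>R (s (\<phi> z) * h (\<phi> z))) + (\<Sum>j=1..N. (t * cc j) *\<^sub>R (s (\<phi> z) * hj j (\<phi> z))))"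
    proof
      fix z
      show "F z = (f (\<phi> z) + t *\<^sub>R (s (\<phi> z) * h (\<phi> z))) + (\<Sum>j=1..N. (t * cc j) *\<^sub>R (s (\<phi> z) * hj j (\<phi> z)))"
        unfolding F_def g_def tx_def x_def vec_eq_iff
        by (simp add: algebra_simps sum_distrib_left scaleR_sum_right)
    qed
    have "mp k F = mp k (\<lambda>z. f (\<phi> z) + t *\<^sub>R (s (\<phi> z) * h (\<phi> z))) + (\<Sum>j=1..N. (t * cc j) * M k j)"
      unfolding eq mp_def M_def
      by (rule mean_pairing_add_sum[OF _ wc[OF k] R(3)])
         (intro continuous_intros cR[OF fc] cR[OF shc[OF h(1)]] cR[OF shc[OF hj(1)]])+
    also have "mp k (\<lambda>z. f (\<phi> z) + t *\<^sub>R (s (\<phi> z) * h (\<phi> z))) = mp k (\<lambda>z. f (\<phi> z)) + t * mp k (\<lambda>z. s (\<phi> z) * h (\<phi> z))"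
      unfolding mp_def by (rule mean_pairing_add_scaled[OF cR[OF fc] cR[OF shc[OF h(1)]] wc[OF k] R(3)])
    also have "(\<Sum>j=1..N. (t * cc j) * M k j) = t * (\<Sum>j=1..N. M k j * cc j)"
      by (simp add: sum_distrib_left mult_ac)
    also have "\<dots> = - (t * y k)" unfolding cc(2)[OF k] by simp
    also have "t * y k = mp k (\<lambda>z. f (\<phi> z)) - mp k f + t * mp k (\<lambda>z. s (\<phi> z) * h (\<phi> z))"
      unfolding y_def using t(1) by (simp add: distrib_left)
    finally have "mp k F = mp k f" by simp
    then show ?thesis using Phi_mp[OF k F_H nt_F] Phi_f[OF k] by simp
  qed
  moreover have "0 < min t (2 * c)" using t c by simp
  ultimately show ?thesis using K KG F_hol FK Fneg by (intro exI[of _ F] exI[of _ K] exI[of _ "min t (2 * c)"]) auto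
qed

section \<open>Boundary functions that annihilate the maps of class A\<close>

text \<open>
  A non-tangential limit is in particular a limit along a fixed sequence of radii.
\<close>

lemma nt_value_measurable:
  fixes H :: "complex \<Rightarrow> complex ^ 'n"
  assumes H: "continuous_on (ball 0 1) H" and T: "T \<in> sets circ" and nt: "\<And>\<zeta>. \<zeta> \<in> T \<Longrightarrow> nt_defined H \<zeta>"
  shows "(\<lambda>\<zeta>. if \<zeta> \<in> T then nt_value H \<zeta> else y) \<in> borel_measurable circ"
proof -
  have T1: "cmod \<zeta> = 1" if "\<zeta> \<in> T" for \<zeta> using sets.sets_into_space[OF T] that by auto
  define rs where "rs = (\<lambda>n::nat. 1 - 1 / real (n + 2))"
  have rs: "0 < rs n" "rs n < 1" for n by (auto simp: rs_def field_simps)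
  have "rs \<longlonglongrightarrow> 1 - 0" unfolding rs_def
    by (intro tendsto_diff tendsto_const LIMSEQ_ignore_initial_segment[OF lim_1_over_n])
  then have rs_lim: "rs \<longlonglongrightarrow> 1" by simp
  have rs_left: "filterlim rs (at_left 1) sequentially"
    by (rule tendsto_imp_filterlim_at_left[OF rs_lim]) (use rs in auto)
  have Tsp: "T \<inter> space circ \<in> sets circ" by (rule sets.Int[OF T sets.top])
  show ?thesis
  proof (rule borel_measurable_LIMSEQ_metric)
    show "(\<lambda>\<zeta>. if \<zeta> \<in> T then H (of_real (rs i) * \<zeta>) else y) \<in> borel_measurable circ" for i
    proof (rule measurable_If_set[OF _ _ Tsp])
      show "(\<lambda>\<zeta>. H (of_real (rs i) * \<zeta>)) \<in> borel_measurable circ"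
        by (intro measurable_circ_continuous continuous_on_compose2[OF H])
           (use rs[of i] in \<open>auto intro!: continuous_intros simp: norm_mult\<close>)
    qed auto
    fix \<zeta> assume "\<zeta> \<in> space circ"
    show "(\<lambda>i. if \<zeta> \<in> T then H (of_real (rs i) * \<zeta>) else y) \<longlonglongrightarrow> (if \<zeta> \<in> T then nt_value H \<zeta> else y)"
    proof (cases "\<zeta> \<in> T")
      case True
      have "((\<lambda>r. H (of_real r * \<zeta>)) \<longlongrightarrow> nt_value H \<zeta>) (at_left 1)"
        by (rule has_nt_limit_radial[OF has_nt_limit_nt_value[OF nt[OF True] T1[OF True]] T1[OF True]])
      from filterlim_compose[OF this rs_left] show ?thesis using True by simp
    qed simp
  qed
qed

text \<open>
  The derivative is a limit of difference quotients along a fixed sequence of steps.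
\<close>

lemma directional_deriv_measurable:
  fixes u :: "complex ^ 'n \<Rightarrow> real"
  assumes u: "continuous_on G u" and G: "open G" and X: "X \<in> borel_measurable circ"
    and T: "T \<in> sets circ" and XG: "\<And>\<zeta>. \<zeta> \<in> T \<Longrightarrow> X \<zeta> \<in> G"
    and d: "\<And>\<zeta>. \<zeta> \<in> T \<Longrightarrow> (\<lambda>t::real. u (X \<zeta> + t *\<^sub>R e)) field_differentiable (at 0)"
  shows "(\<lambda>\<zeta>. if \<zeta> \<in> T then deriv (\<lambda>t::real. u (X \<zeta> + t *\<^sub>R e)) 0 else 0) \<in> borel_measurable circ"
proof -
  \<comment> \<open>extended by \<open>0\<close>, since the difference quotients may leave \<open>G\<close> for large steps\<close>
  define U where "U = (\<lambda>y. if y \<in> G then u y else 0)"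
  have [measurable]: "U \<in> borel_measurable borel"
    using borel_measurable_continuous_on_if[OF _ u continuous_on_const, of 0] G unfolding U_def by auto
  have [measurable]: "X \<in> borel_measurable circ" by (rule X)
  have Tsp: "T \<inter> space circ \<in> sets circ" by (rule sets.Int[OF T sets.top])
  define a where "a = (\<lambda>n::nat. 1 / real (n + 1))"
  have a0: "a n \<noteq> 0" for n by (simp add: a_def)
  have al: "a \<longlonglongrightarrow> 0" unfolding a_def by (rule LIMSEQ_ignore_initial_segment[OF lim_1_over_n])
  show ?thesis
  proof (rule borel_measurable_LIMSEQ_metric)
    show "(\<lambda>\<zeta>. if \<zeta> \<in> T then (U (X \<zeta> + a i *\<^sub>R e) - U (X \<zeta>)) / a i else 0) \<in> borel_measurable circ" for i
      by (rule measurable_If_set[OF _ _ Tsp]) measurable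
    fix \<zeta> assume "\<zeta> \<in> space circ"
    show "(\<lambda>i. if \<zeta> \<in> T then (U (X \<zeta> + a i *\<^sub>R e) - U (X \<zeta>)) / a i else 0)
        \<longlonglongrightarrow> (if \<zeta> \<in> T then deriv (\<lambda>t::real. u (X \<zeta> + t *\<^sub>R e)) 0 else 0)"
    proof (cases "\<zeta> \<in> T")
      case True
      let ?g = "\<lambda>t::real. u (X \<zeta> + t *\<^sub>R e)"
      have "DERIV ?g 0 :> deriv ?g 0" using d[OF True] by (simp add: DERIV_deriv_iff_field_differentiable)
      then have "(\<lambda>h. (?g (0 + h) - ?g 0) / h) \<midarrow>0\<rightarrow> deriv ?g 0" by (simp add: DERIV_def)
      moreover have "filterlim a (at 0) sequentially" using al a0 by (simp add: filterlim_at)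
      ultimately have "(\<lambda>i. (?g (0 + a i) - ?g 0) / a i) \<longlonglongrightarrow> deriv ?g 0" by (rule filterlim_compose)
      moreover have "\<forall>\<^sub>F i in sequentially. X \<zeta> + a i *\<^sub>R e \<in> G"
      proof -
        have "(\<lambda>i. X \<zeta> + a i *\<^sub>R e) \<longlonglongrightarrow> X \<zeta> + 0 *\<^sub>R e" by (intro tendsto_intros al)
        then have "(\<lambda>i. X \<zeta> + a i *\<^sub>R e) \<longlonglongrightarrow> X \<zeta>" by simp
        from topological_tendstoD[OF this G XG[OF True]] show ?thesis .
      qed
      then have "\<forall>\<^sub>F i in sequentially. (?g (0 + a i) - ?g 0) / a i = (U (X \<zeta> + a i *\<^sub>R e) - U (X \<zeta>)) / a i"
        by eventually_elim (use XG[OF True] in \<open>simp add: U_def\<close>)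
      ultimately have "(\<lambda>i. (U (X \<zeta> + a i *\<^sub>R e) - U (X \<zeta>)) / a i) \<longlonglongrightarrow> deriv ?g 0"
        by (rule Lim_transform_eventually)
      then show ?thesis using True by simp
    qed simp
  qed
qed

lemma borel_measurable_vecI:
  fixes X :: "'a \<Rightarrow> complex ^ 'n"
  assumes "\<And>j. (\<lambda>x. X x $ j) \<in> borel_measurable M" shows "X \<in> borel_measurable M"
proof (subst borel_measurable_euclidean_space, rule ballI)
  fix i :: "complex ^ 'n" assume "i \<in> Basis"
  then obtain j c where i: "i = axis j c" by (auto simp: Basis_vec_def)
  show "(\<lambda>x. X x \<bullet> i) \<in> borel_measurable M"
    unfolding i inner_axis by (intro borel_measurable_inner assms borel_measurable_const)
qed

lemma borel_measurable_vec_nth: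
  fixes X :: "'a \<Rightarrow> complex ^ 'n"
  assumes "X \<in> borel_measurable M" shows "(\<lambda>x. X x $ j) \<in> borel_measurable M"
  by (rule measurable_compose[OF assms borel_measurable_continuous_onI]) (intro continuous_intros)

lemma H_infty_mult:
  fixes f g :: "complex \<Rightarrow> complex ^ 'n"
  assumes f: "f \<in> H_infty (ball 0 1)" and g: "g \<in> H_infty (ball 0 1)"
  shows "(\<lambda>z. f z * g z) \<in> H_infty (ball 0 1)"
proof -
  obtain A where A: "0 \<le> A" "\<And>z. cmod z < 1 \<Longrightarrow> norm (f z) \<le> A" using H_infty_bound[OF f] by metis
  obtain B where B: "0 \<le> B" "\<And>z. cmod z < 1 \<Longrightarrow> norm (g z) \<le> B" using H_infty_bound[OF g] by metis
  have "norm (f z * g z) \<le> A * B" if z: "cmod z < 1" for z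
    using order_trans[OF norm_vec_mult_le mult_mono[OF A(2)[OF z] B(2)[OF z] A(1) norm_ge_zero]] .
  then have "bounded ((\<lambda>z. f z * g z) ` ball 0 1)" unfolding bounded_iff by (intro exI[of _ "A * B"]) auto
  moreover have "(\<lambda>z. (f z * g z) $ j) holomorphic_on ball 0 1" for j
    by (rule holomorphic_vec_mult) (use f g in \<open>auto simp: H_infty_def hol_maps_def\<close>)
  ultimately show ?thesis by (auto simp: H_infty_def hol_maps_def)
qed

lemma H_infty_add_scaled:
  fixes f g :: "complex \<Rightarrow> complex ^ 'n"
  assumes f: "f \<in> H_infty (ball 0 1)" and g: "g \<in> H_infty (ball 0 1)"
  shows "(\<lambda>z. f z + c *\<^sub>R g z) \<in> H_infty (ball 0 1)"
proof -
  obtain A where A: "0 \<le> A" "\<And>z. cmod z < 1 \<Longrightarrow> norm (f z) \<le> A" using H_infty_bound[OF f] by metis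
  obtain B where B: "0 \<le> B" "\<And>z. cmod z < 1 \<Longrightarrow> norm (g z) \<le> B" using H_infty_bound[OF g] by metis
  have "norm (f z + c *\<^sub>R g z) \<le> A + \<bar>c\<bar> * B" if z: "cmod z < 1" for z
    by (rule norm_triangle_mono[OF A(2)[OF z]]) (use B(2)[OF z] in \<open>simp add: mult_left_mono\<close>)
  then have "bounded ((\<lambda>z. f z + c *\<^sub>R g z) ` ball 0 1)" unfolding bounded_iff by (intro exI[of _ "A + \<bar>c\<bar> * B"]) auto
  moreover have "(\<lambda>z. (f z + c *\<^sub>R g z) $ j) holomorphic_on ball 0 1" for j
  proof -
    have "(\<lambda>z. f z $ j) holomorphic_on ball 0 1" "(\<lambda>z. g z $ j) holomorphic_on ball 0 1"
      using f g by (auto simp: H_infty_def hol_maps_def)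
    then show ?thesis by (simp add: scaleR_conv_of_real) (intro holomorphic_intros)
  qed
  ultimately show ?thesis by (auto simp: H_infty_def hol_maps_def)
qed

lemma A_maps_H_infty:
  fixes h :: "complex \<Rightarrow> complex ^ 'n"
  assumes "h \<in> A_maps (ball 0 1)" shows "h \<in> H_infty (ball 0 1)"
  using assms norm_le_sup_norm[OF assms] unfolding H_infty_def A_maps_def bounded_iff
  by (auto intro!: exI[of _ "sup_norm (ball 0 1) h"])

lemma H_infty_0: "(\<lambda>z. 0 :: complex ^ 'n) \<in> H_infty (ball 0 1)"
  by (auto simp: H_infty_def hol_maps_def bounded_iff)

lemma H_infty_sum:
  fixes g :: "nat \<Rightarrow> complex \<Rightarrow> complex ^ 'n"
  assumes "\<And>k. k \<in> {1..N} \<Longrightarrow> g k \<in> H_infty (ball 0 1)"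
  shows "(\<lambda>z. \<Sum>k=1..N. c k *\<^sub>R g k z) \<in> H_infty (ball 0 1)"
  using assms
proof (induction N)
  case 0 then show ?case using H_infty_0 by simp
next
  case (Suc N)
  have "(\<lambda>z. (\<Sum>k=1..N. c k *\<^sub>R g k z) + c (Suc N) *\<^sub>R g (Suc N) z) \<in> H_infty (ball 0 1)"
    by (rule H_infty_add_scaled) (use Suc in auto)
  then show ?case by simp
qed

lemma has_nt_limit_sum:
  fixes g :: "nat \<Rightarrow> complex \<Rightarrow> complex ^ 'n"
  assumes "\<And>k. k \<in> {1..N} \<Longrightarrow> has_nt_limit (g k) \<zeta> (l k)"
  shows "has_nt_limit (\<lambda>z. \<Sum>k=1..N. c k *\<^sub>R g k z) \<zeta> (\<Sum>k=1..N. c k *\<^sub>R l k)"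
  using assms unfolding has_nt_limit_def by (auto intro!: tendsto_sum tendsto_scaleR)

text \<open>
  Testing with \<open>h = c \<zeta>\<^sup>m\<close> in the \<open>j\<close>-th component, for \<open>c = 1\<close> and \<open>c = - \<i>\<close>, shows that all moments of \<open>X\<close>
  vanish.  Hence its Poisson integral is holomorphic, and Fatou's theorem recovers \<open>X\<close> on the boundary.
\<close>

lemma annihilator_boundary_value:
  fixes X :: "complex \<Rightarrow> complex ^ 'n"
  assumes X: "bdd_circ X"
    and ann: "\<And>h. h \<in> A_maps (ball 0 1) \<Longrightarrow> integral\<^sup>L circ (\<lambda>\<zeta>. Re (scalar_product (X \<zeta>) (h \<zeta>))) = 0"
  obtains g where "g \<in> H_infty (ball 0 1)" "g 0 = 0" "AE \<zeta> in circ. has_nt_limit g \<zeta> (X \<zeta>)"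
proof -
  obtain B where B: "B \<ge> 0" "\<And>\<zeta>. cmod \<zeta> = 1 \<Longrightarrow> norm (X \<zeta>) \<le> B" using bdd_circ_bound X by metis
  have Xj: "bdd_circ (\<lambda>\<zeta>. X \<zeta> $ j)" for j
    unfolding bdd_circ_def
    using borel_measurable_vec_nth[OF bdd_circ_measurable[OF X], of j] B order_trans[OF Finite_Cartesian_Product.norm_nth_le]
    by blast
  have mom: "integral\<^sup>L circ (\<lambda>\<zeta>. X \<zeta> $ j * \<zeta> ^ m) = 0" for j m
  proof -
    have i: "integrable circ (\<lambda>\<zeta>. X \<zeta> $ j * \<zeta> ^ m)"
      by (intro bdd_circ_integrable bdd_circ_mult Xj bdd_circ_continuous continuous_intros)
    have 0: "Re (integral\<^sup>L circ (\<lambda>\<zeta>. c * (X \<zeta> $ j * \<zeta> ^ m))) = 0" for c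
    proof -
      define h where "h = (\<lambda>z. axis j (c * z ^ m) :: complex ^ 'n)"
      have hk: "h z $ k = (if k = j then c * z ^ m else 0)" for z k by (simp add: h_def axis_def)
      have hol: "(\<lambda>z. h z $ k) holomorphic_on UNIV" for k
        unfolding hk by (cases "k = j") (auto intro!: holomorphic_intros)
      have "continuous_on (closure (ball 0 1)) h"
        by (rule continuous_on_subset[OF holomorphic_vec_continuous[OF hol]]) simp
      moreover have "(\<lambda>z. h z $ k) holomorphic_on ball 0 1" for k by (rule holomorphic_on_subset[OF hol]) simp
      ultimately have "h \<in> A_maps (ball 0 1)" by (simp add: A_maps_def hol_maps_def)
      from ann[OF this] have "integral\<^sup>L circ (\<lambda>\<zeta>. Re (c * (X \<zeta> $ j * \<zeta> ^ m))) = 0"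
        by (simp add: scalar_product_def hk if_distrib mult_ac cong: if_cong)
      then show ?thesis using integral_Re[of circ "\<lambda>\<zeta>. c * (X \<zeta> $ j * \<zeta> ^ m)"] i by simp
    qed
    show ?thesis using 0[of 1] 0[of "- \<i>"] i by (simp add: complex_eq_iff)
  qed
  define g where "g = (\<lambda>z. \<chi> j. poisson (\<lambda>\<zeta>. X \<zeta> $ j) z)"
  note P = poisson_holomorphic_of_moments[OF Xj mom]
  have "\<exists>b\<ge>0. \<forall>z. cmod z < 1 \<longrightarrow> cmod (poisson (\<lambda>\<zeta>. X \<zeta> $ j) z) \<le> b" for j
  proof -
    obtain b where b: "\<forall>y\<in>poisson (\<lambda>\<zeta>. X \<zeta> $ j) ` ball 0 1. norm y \<le> b"
      using P(3)[of j] unfolding bounded_iff by blast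
    then have "\<forall>z. cmod z < 1 \<longrightarrow> cmod (poisson (\<lambda>\<zeta>. X \<zeta> $ j) z) \<le> \<bar>b\<bar>" by force
    then show ?thesis by (intro exI[of _ "\<bar>b\<bar>"]) auto
  qed
  then obtain b where b: "\<And>j z. cmod z < 1 \<Longrightarrow> cmod (poisson (\<lambda>\<zeta>. X \<zeta> $ j) z) \<le> b j" by metis
  have gb: "norm (g z) \<le> (\<Sum>j\<in>UNIV. b j)" if "cmod z < 1" for z
    by (rule order_trans[OF norm_vec_le_sum sum_mono]) (use b[OF that] in \<open>simp add: g_def\<close>)
  show ?thesis
  proof (rule that[of g])
    have "bounded (g ` ball 0 1)" unfolding bounded_iff by (intro exI[of _ "\<Sum>j\<in>UNIV. b j"]) (use gb in auto)
    then show "g \<in> H_infty (ball 0 1)" using P(1) by (simp add: H_infty_def hol_maps_def g_def)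
    show "g 0 = 0" using P(2) by (simp add: g_def vec_eq_iff)
    have "AE \<zeta> in circ. \<forall>j\<in>UNIV. \<forall>\<alpha>>1. (poisson (\<lambda>\<zeta>. X \<zeta> $ j) \<longlongrightarrow> X \<zeta> $ j) (at \<zeta> within stolz_region \<zeta> \<alpha>)"
      by (rule AE_finite_allI) (use fatou_nontangential[OF Xj] in auto)
    then show "AE \<zeta> in circ. has_nt_limit g \<zeta> (X \<zeta>)"
    proof eventually_elim
      case (elim \<zeta>)
      show ?case unfolding has_nt_limit_def
        by (intro allI impI vec_tendstoI) (use elim in \<open>simp add: g_def\<close>)
    qed
  qed
qed

text \<open>
  The limit hypothesis in terms of \<open>\<epsilon>\<close> and \<open>\<delta>\<close>; its filter sees only maps of positive norm.
\<close>

lemma remainder_uniformly_small: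
  fixes v :: "complex \<Rightarrow> (complex \<Rightarrow> complex ^ 'n) \<Rightarrow> complex"
  assumes e: "((\<lambda>h. (SUP \<zeta>\<in>S. ennreal (cmod (v \<zeta> h))) / ennreal (sup_norm (ball 0 1) h))
          \<longlongrightarrow> 0) (inf (filtercomap (sup_norm (ball 0 1)) (at_right 0)) (principal (A_maps (ball 0 1))))"
    and \<epsilon>: "0 < \<epsilon>"
  obtains \<delta> where "0 < \<delta>" "\<And>(h :: complex \<Rightarrow> complex ^ 'n) \<zeta>. h \<in> A_maps (ball 0 1) \<Longrightarrow> 0 < sup_norm (ball 0 1) h \<Longrightarrow> sup_norm (ball 0 1) h < \<delta> \<Longrightarrow> \<zeta> \<in> S
      \<Longrightarrow> cmod (v \<zeta> h) \<le> \<epsilon> * sup_norm (ball 0 1) h"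
proof -
  let ?q = "\<lambda>h. (SUP \<zeta>\<in>S. ennreal (cmod (v \<zeta> h))) / ennreal (sup_norm (ball 0 1) h)"
  have "\<forall>\<^sub>F h in inf (filtercomap (sup_norm (ball 0 1)) (at_right 0)) (principal (A_maps (ball 0 1))). ?q h < ennreal \<epsilon>"
    by (rule order_tendstoD(2)[OF e]) (use \<epsilon> in simp)
  then have "\<forall>\<^sub>F h in filtercomap (sup_norm (ball 0 1)) (at_right 0). h \<in> A_maps (ball 0 1) \<longrightarrow> ?q h < ennreal \<epsilon>"
    by (simp add: eventually_inf_principal)
  then obtain Q where Q: "eventually Q (at_right (0::real))"
    "\<And>h :: complex \<Rightarrow> complex ^ 'n. Q (sup_norm (ball 0 1) h) \<Longrightarrow> h \<in> A_maps (ball 0 1) \<Longrightarrow> ?q h < ennreal \<epsilon>"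
    unfolding eventually_filtercomap by blast
  then obtain \<delta> where \<delta>: "\<delta> > 0" "\<And>x. 0 < x \<Longrightarrow> x < \<delta> \<Longrightarrow> Q x" unfolding eventually_at_right_field by blast
  show ?thesis
  proof (rule that[OF \<delta>(1)])
    fix h :: "complex \<Rightarrow> complex ^ 'n" and \<zeta> assume h: "h \<in> A_maps (ball 0 1)" "0 < sup_norm (ball 0 1) h" "sup_norm (ball 0 1) h < \<delta>" "\<zeta> \<in> S"
    let ?x = "sup_norm (ball 0 1) h"
    have q: "?q h < ennreal \<epsilon>" by (rule Q(2)[OF \<delta>(2)[OF h(2,3)] h(1)])
    have "ennreal (cmod (v \<zeta> h) / ?x) = ennreal (cmod (v \<zeta> h)) / ennreal ?x"
      by (rule divide_ennreal[symmetric]) (use h in auto)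
    also have "\<dots> \<le> ?q h" by (rule divide_right_mono_ennreal) (rule SUP_upper[OF h(4)])
    finally have "ennreal (cmod (v \<zeta> h) / ?x) < ennreal \<epsilon>" using q by (rule le_less_trans)
    then have "cmod (v \<zeta> h) / ?x < \<epsilon>" using \<epsilon> by (simp add: ennreal_less_iff h(2) less_imp_le)
    then show "cmod (v \<zeta> h) \<le> \<epsilon> * ?x" using h(2) by (simp add: divide_less_eq)
  qed
qed

section \<open>From the multiplier to a bounded holomorphic map\<close>

lemma bdd_circ_sum:
  fixes g :: "nat \<Rightarrow> complex \<Rightarrow> 'b::{real_normed_vector, second_countable_topology}"
  assumes "\<And>k. k \<in> {1..N} \<Longrightarrow> bdd_circ (g k)" shows "bdd_circ (\<lambda>\<zeta>. \<Sum>k=1..N. g k \<zeta>)"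
  using assms
proof (induction N)
  case 0 then show ?case using bdd_circ_const by simp
next
  case (Suc N)
  have "bdd_circ (\<lambda>\<zeta>. (\<Sum>k=1..N. g k \<zeta>) + g (Suc N) \<zeta>)" by (rule bdd_circ_add) (use Suc in auto)
  then show ?case by simp
qed

lemma bdd_circ_vec_mult:
  fixes f g :: "complex \<Rightarrow> complex ^ 'n"
  assumes f: "bdd_circ f" and g: "bdd_circ g" shows "bdd_circ (\<lambda>\<zeta>. f \<zeta> * g \<zeta>)"
proof -
  obtain A where A: "A \<ge> 0" "\<And>\<zeta>. cmod \<zeta> = 1 \<Longrightarrow> norm (f \<zeta>) \<le> A" using bdd_circ_bound f by metis
  obtain B where B: "B \<ge> 0" "\<And>\<zeta>. cmod \<zeta> = 1 \<Longrightarrow> norm (g \<zeta>) \<le> B" using bdd_circ_bound g by metis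
  have "norm (f \<zeta> * g \<zeta>) \<le> A * B" if z: "cmod \<zeta> = 1" for \<zeta>
    using order_trans[OF norm_vec_mult_le mult_mono[OF A(2)[OF z] B(2)[OF z] A(1) norm_ge_zero]] .
  moreover have "(\<lambda>\<zeta>. f \<zeta> * g \<zeta>) \<in> borel_measurable circ"
  proof (rule borel_measurable_vecI)
    fix j
    show "(\<lambda>\<zeta>. (f \<zeta> * g \<zeta>) $ j) \<in> borel_measurable circ"
      unfolding vector_mult_component
      by (intro borel_measurable_times borel_measurable_vec_nth bdd_circ_measurable f g)
  qed
  ultimately show ?thesis unfolding bdd_circ_def by blast
qed

lemma norm_nt_value_le:
  fixes f :: "complex \<Rightarrow> complex ^ 'n"
  assumes nt: "nt_defined f \<zeta>" and \<zeta>: "cmod \<zeta> = 1" and B: "\<And>z. cmod z < 1 \<Longrightarrow> norm (f z) \<le> B"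
  shows "norm (nt_value f \<zeta>) \<le> B"
proof (rule tendsto_upperbound)
  show "((\<lambda>r. norm (f (of_real r * \<zeta>))) \<longlongrightarrow> norm (nt_value f \<zeta>)) (at_left 1)"
    by (intro tendsto_norm has_nt_limit_radial has_nt_limit_nt_value nt \<zeta>)
  have "\<forall>\<^sub>F r::real in at_left 1. r \<in> {0<..<1}" by (rule eventually_at_leftI[of 0]) auto
  then show "\<forall>\<^sub>F r in at_left 1. norm (f (of_real r * \<zeta>)) \<le> B"
    by eventually_elim (rule B, use \<zeta> in \<open>simp add: norm_mult\<close>)
qed simp

lemma bdd_circ_nt_value:
  fixes s :: "complex \<Rightarrow> complex ^ 'n"
  assumes s: "s \<in> H_infty (ball 0 1)" and T: "T \<in> sets circ" and nt: "\<And>\<zeta>. \<zeta> \<in> T \<Longrightarrow> nt_defined s \<zeta>"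
  shows "bdd_circ (\<lambda>\<zeta>. if \<zeta> \<in> T then nt_value s \<zeta> else 0)"
proof -
  obtain B where B: "0 \<le> B" "\<And>z. cmod z < 1 \<Longrightarrow> norm (s z) \<le> B" using H_infty_bound[OF s] by metis
  have "continuous_on (ball 0 1) s" by (rule holomorphic_vec_continuous) (use s in \<open>auto simp: H_infty_def hol_maps_def\<close>)
  from nt_value_measurable[OF this T nt] have "(\<lambda>\<zeta>. if \<zeta> \<in> T then nt_value s \<zeta> else 0) \<in> borel_measurable circ" .
  moreover have "norm (if \<zeta> \<in> T then nt_value s \<zeta> else 0) \<le> B" if "cmod \<zeta> = 1" for \<zeta>
    using norm_nt_value_le[OF nt that B(2)] B(1) by simp
  ultimately show ?thesis unfolding bdd_circ_def by blast
qed

lemma Phi_mult_eq_circ: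
  fixes s w h :: "complex \<Rightarrow> complex ^ 'n"
  assumes s: "s \<in> H_infty (ball 0 1)" and T: "T \<in> sets circ" and nt: "\<And>\<zeta>. \<zeta> \<in> T \<Longrightarrow> nt_defined s \<zeta>"
    and ae: "AE \<zeta> in circ. \<zeta> \<in> T" and h: "h \<in> A_maps (ball 0 1)" and w: "continuous_on (sphere 0 1) w"
  shows "Phi w (\<lambda>z. s z * h z) = integral\<^sup>L circ (\<lambda>\<zeta>. Re (scalar_product ((if \<zeta> \<in> T then nt_value s \<zeta> else 0) * h \<zeta>) (w \<zeta>))) / (2 * pi)"
proof -
  let ?g = "\<lambda>\<zeta>. Re (scalar_product ((if \<zeta> \<in> T then nt_value s \<zeta> else 0) * h \<zeta>) (w \<zeta>))"
  have hc: "continuous_on (sphere 0 1) h" by (rule continuous_on_subset[OF A_maps_ballD(1)[OF h]]) auto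
  have "bdd_circ ?g"
    by (intro bdd_circ_Re bdd_circ_scalar_product bdd_circ_vec_mult bdd_circ_nt_value[OF s T nt] bdd_circ_continuous hc w)
  then have gm: "?g \<in> borel_measurable circ" by (rule bdd_circ_measurable)
  have "AE \<zeta> in circ. Re (scalar_product (nt_value (\<lambda>z. s z * h z) \<zeta>) (w \<zeta>)) = ?g \<zeta>"
    using ae AE_space
  proof eventually_elim
    case (elim \<zeta>)
    then have z1: "cmod \<zeta> = 1" by simp
    have "nt_value (\<lambda>z. s z * h z) \<zeta> = nt_value s \<zeta> * h \<zeta>"
      by (intro nt_value_eq has_nt_limit_mult has_nt_limit_nt_value has_nt_limit_continuous nt elim A_maps_ballD(1)[OF h] z1)
    then show ?case using elim by simp
  qed
  from lebesgue_integral_cis_eq_circ[OF gm this] show ?thesis unfolding Phi_def by simp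
qed

lemma continuous_on_sphere_A_maps_annulus:
  fixes w :: "complex \<Rightarrow> complex ^ 'n"
  assumes "w \<in> A_maps (annulus \<nu>)" "\<nu> < 1" shows "continuous_on (sphere 0 1) w"
  by (rule continuous_on_subset[OF A_maps_annulusD(1)[OF assms(1)] sphere_subset_closure_annulus[OF assms(2)]])

text \<open>
  The map \<open>X = \<Sum> \<lambda>\<^sub>k w\<^sub>k \<cdot> s\<^sup>* - 2 \<pi> \<rho> p\<close> annihilates the maps of class \<open>\<A>(E)\<close>, so it is the boundary function
  of some \<open>g\<close> with \<open>g 0 = 0\<close>.  Where \<open>\<rho> = 0\<close> this reads \<open>\<Sum> \<lambda>\<^sub>k w\<^sub>k \<cdot> s\<^sup>* = g\<^sup>*\<close>; as the \<open>\<lambda>\<^sub>k\<close> do not all vanish, linear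
  independence makes this set null.  Finally \<open>2 \<pi> Q \<rho> p = \<Sum> \<lambda>\<^sub>k (Q w\<^sub>k) \<cdot> s\<^sup>* - Q g\<^sup>*\<close> is a boundary function, because
  the \<open>Q w\<^sub>k\<close> extend holomorphically.
\<close>

lemma multiplier_gives_boundary_value:
  fixes s p :: "complex \<Rightarrow> complex ^ 'n" and w :: "nat \<Rightarrow> complex \<Rightarrow> complex ^ 'n" and \<rho> :: "complex \<Rightarrow> real"
  assumes w: "\<And>k. k \<in> {1..N} \<Longrightarrow> w k \<in> A_maps (annulus \<nu>)" and \<nu>: "\<nu> < 1"
    and indep: "lin_indep_functionals N w" and Q: "problem_type m \<nu> N w Q"
    and s: "s \<in> H_infty (ball 0 1)" and s0: "\<And>k z. z \<in> ball 0 1 \<Longrightarrow> s z $ k \<noteq> 0"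
    and T: "T \<in> sets circ" and nt: "\<And>\<zeta>. \<zeta> \<in> T \<Longrightarrow> nt_defined s \<zeta>" and ae: "AE \<zeta> in circ. \<zeta> \<in> T"
    and p: "bdd_circ p"
    and \<rho>: "\<rho> \<in> borel_measurable circ" "\<And>\<zeta>. 0 \<le> \<rho> \<zeta> \<and> \<rho> \<zeta> \<le> 1"
    and mult: "\<And>h. h \<in> A_maps (ball 0 1) \<Longrightarrow>
        integral\<^sup>L circ (\<lambda>\<zeta>. \<rho> \<zeta> * Re (scalar_product (p \<zeta>) (h \<zeta>))) = (\<Sum>k=1..N. lam k * Phi (w k) (\<lambda>z. s z * h z))"
    and lam: "0 < (\<Sum>k=1..N. lam k * e k)"
  shows "\<exists>\<rho>' \<in> L_infty_circle. (\<forall>\<zeta> \<in> sphere 0 1. 0 < \<rho>' \<zeta>) \<and>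
           (\<exists>g \<in> H_infty (ball 0 1). AE \<zeta> in circle_measure.
              has_nt_limit g \<zeta> ((poly Q \<zeta> * complex_of_real (\<rho>' \<zeta>)) *s p \<zeta>))"
proof -
  define \<sigma> where "\<sigma> = (\<lambda>\<zeta>. if \<zeta> \<in> T then nt_value s \<zeta> else 0)"
  have \<sigma>b: "bdd_circ \<sigma>" unfolding \<sigma>_def by (rule bdd_circ_nt_value[OF s T nt])
  have wc: "continuous_on (sphere 0 1) (w k)" if "k \<in> {1..N}" for k
    by (rule continuous_on_sphere_A_maps_annulus[OF w[OF that] \<nu>])
  have \<rho>b: "bdd_circ \<rho>" unfolding bdd_circ_def using \<rho> by (auto intro!: exI[of _ 1])
  \<comment> \<open>the factor \<open>2 \<pi>\<close> compensates the normalisation of \<open>\<Phi>\<close>\<close>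
  define X where "X = (\<lambda>\<zeta>. (\<Sum>k=1..N. lam k *\<^sub>R (w k \<zeta> * \<sigma> \<zeta>)) + (- (2 * pi) * \<rho> \<zeta>) *\<^sub>R p \<zeta>)"
  have Xb: "bdd_circ X" unfolding X_def
    by (intro bdd_circ_add bdd_circ_sum bdd_circ_scaleR bdd_circ_const bdd_circ_vec_mult \<sigma>b p bdd_circ_mult \<rho>b bdd_circ_continuous wc)
  have ann: "integral\<^sup>L circ (\<lambda>\<zeta>. Re (scalar_product (X \<zeta>) (h \<zeta>))) = 0" if h: "h \<in> A_maps (ball 0 1)" for h
  proof -
    have hc: "continuous_on (sphere 0 1) h" by (rule continuous_on_subset[OF A_maps_ballD(1)[OF h]]) auto
    have i1: "integrable circ (\<lambda>\<zeta>. Re (scalar_product (\<sigma> \<zeta> * h \<zeta>) (w k \<zeta>)))" if "k \<in> {1..N}" for k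
      by (intro bdd_circ_integrable bdd_circ_Re bdd_circ_scalar_product bdd_circ_vec_mult \<sigma>b bdd_circ_continuous hc wc that)
    have i2: "integrable circ (\<lambda>\<zeta>. \<rho> \<zeta> * Re (scalar_product (p \<zeta>) (h \<zeta>)))"
      by (intro bdd_circ_integrable bdd_circ_mult \<rho>b bdd_circ_Re bdd_circ_scalar_product p hc)
    have EX: "Re (scalar_product (X \<zeta>) (h \<zeta>)) = (\<Sum>k=1..N. lam k * Re (scalar_product (\<sigma> \<zeta> * h \<zeta>) (w k \<zeta>)))
        - (2 * pi) * (\<rho> \<zeta> * Re (scalar_product (p \<zeta>) (h \<zeta>)))" for \<zeta>
    proof -
      have sps: "scalar_product (\<Sum>k\<in>I. x k) y = (\<Sum>k\<in>I. scalar_product (x k) y)" for I :: "nat set" and x and y :: "complex ^ 'n"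
        unfolding scalar_product_def sum_component sum_distrib_right by (rule sum.swap)
      have spm: "scalar_product (w k \<zeta> * \<sigma> \<zeta>) (h \<zeta>) = scalar_product (\<sigma> \<zeta> * h \<zeta>) (w k \<zeta>)" for k
        by (simp add: scalar_product_def mult_ac)
      show ?thesis unfolding X_def scalar_product_add sps scalar_product_scaleR spm by simp
    qed
    have i3: "integrable circ (\<lambda>\<zeta>. \<Sum>k=1..N. lam k * Re (scalar_product (\<sigma> \<zeta> * h \<zeta>) (w k \<zeta>)))"
      by (intro Bochner_Integration.integrable_sum integrable_mult_right i1)
    have "integral\<^sup>L circ (\<lambda>\<zeta>. Re (scalar_product (X \<zeta>) (h \<zeta>)))
        = integral\<^sup>L circ (\<lambda>\<zeta>. \<Sum>k=1..N. lam k * Re (scalar_product (\<sigma> \<zeta> * h \<zeta>) (w k \<zeta>)))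
          - integral\<^sup>L circ (\<lambda>\<zeta>. (2 * pi) * (\<rho> \<zeta> * Re (scalar_product (p \<zeta>) (h \<zeta>))))"
      unfolding EX by (rule Bochner_Integration.integral_diff[OF i3 integrable_mult_right[OF i2]])
    also have "integral\<^sup>L circ (\<lambda>\<zeta>. \<Sum>k=1..N. lam k * Re (scalar_product (\<sigma> \<zeta> * h \<zeta>) (w k \<zeta>)))
        = (\<Sum>k=1..N. lam k * integral\<^sup>L circ (\<lambda>\<zeta>. Re (scalar_product (\<sigma> \<zeta> * h \<zeta>) (w k \<zeta>))))"
      by (subst Bochner_Integration.integral_sum) (intro integrable_mult_right i1, auto)
    also have "integral\<^sup>L circ (\<lambda>\<zeta>. (2 * pi) * (\<rho> \<zeta> * Re (scalar_product (p \<zeta>) (h \<zeta>))))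
        = (2 * pi) * integral\<^sup>L circ (\<lambda>\<zeta>. \<rho> \<zeta> * Re (scalar_product (p \<zeta>) (h \<zeta>)))"
      by simp
    also have "(\<Sum>k=1..N. lam k * integral\<^sup>L circ (\<lambda>\<zeta>. Re (scalar_product (\<sigma> \<zeta> * h \<zeta>) (w k \<zeta>))))
        = (\<Sum>k=1..N. lam k * (2 * pi * Phi (w k) (\<lambda>z. s z * h z)))"
    proof (rule sum.cong[OF refl])
      fix k assume "k \<in> {1..N}"
      from Phi_mult_eq_circ[OF s T nt ae h wc[OF this]]
      show "lam k * integral\<^sup>L circ (\<lambda>\<zeta>. Re (scalar_product (\<sigma> \<zeta> * h \<zeta>) (w k \<zeta>))) = lam k * (2 * pi * Phi (w k) (\<lambda>z. s z * h z))"
        unfolding \<sigma>_def by simp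
    qed
    also have "\<dots> = 2 * pi * (\<Sum>k=1..N. lam k * Phi (w k) (\<lambda>z. s z * h z))"
      by (simp add: sum_distrib_left mult_ac)
    finally show ?thesis using mult[OF h] by simp
  qed
  obtain g where g: "g \<in> H_infty (ball 0 1)" "g 0 = 0" "AE \<zeta> in circ. has_nt_limit g \<zeta> (X \<zeta>)"
    using annihilator_boundary_value[OF Xb ann] by metis
  from g(3) ae have "AE \<zeta> in circ. has_nt_limit g \<zeta> (X \<zeta>) \<and> \<zeta> \<in> T" by eventually_elim simp
  then obtain N0 where N0: "{\<zeta> \<in> space circ. \<not> (has_nt_limit g \<zeta> (X \<zeta>) \<and> \<zeta> \<in> T)} \<subseteq> N0" "emeasure circ N0 = 0" "N0 \<in> sets circ"
    by (rule AE_E)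
  \<comment> \<open>the set on which the multiplier vanishes, up to a null set\<close>
  define A where "A = {\<zeta> \<in> space circ. \<rho> \<zeta> = 0} - N0"
  have Am: "A \<in> sets circ"
  proof -
    have "{\<zeta> \<in> space circ. \<rho> \<zeta> = 0} \<in> sets circ" using \<rho>(1) by measurable
    then show ?thesis unfolding A_def using N0(3) by auto
  qed
  have A0: "emeasure circ A = 0"
  proof (rule ccontr)
    assume "emeasure circ A \<noteq> 0"
    then have pos: "0 < emeasure circle_measure A"
      unfolding circle_measure_eq using Am by (simp add: zero_less_iff_neq_zero)
    have Ac: "A \<in> sets circle_measure" unfolding circle_measure_eq using Am by (rule sets_completionI_sets)
    have "\<forall>\<zeta>\<in>A. nt_defined s \<zeta> \<and> nt_defined g \<zeta> \<and> (\<Sum>k=1..N. lam k *\<^sub>R (w k \<zeta> * nt_value s \<zeta>)) = nt_value g \<zeta>"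
    proof
      fix \<zeta> assume "\<zeta> \<in> A"
      then have z: "cmod \<zeta> = 1" "\<rho> \<zeta> = 0" "has_nt_limit g \<zeta> (X \<zeta>)" "\<zeta> \<in> T" using N0(1) by (auto simp: A_def)
      have "nt_value g \<zeta> = X \<zeta>" by (rule nt_value_eq[OF z(3,1)])
      then show "nt_defined s \<zeta> \<and> nt_defined g \<zeta> \<and> (\<Sum>k=1..N. lam k *\<^sub>R (w k \<zeta> * nt_value s \<zeta>)) = nt_value g \<zeta>"
        using z nt[OF z(4)] by (auto simp: X_def \<sigma>_def nt_defined_def)
    qed
    with pos Ac g s s0 indep have "\<forall>k\<in>{1..N}. lam k = 0"
      unfolding lin_indep_functionals_def by blast
    then show False using lam by simp
  qed
  have \<rho>pos: "AE \<zeta> in circ. 0 < \<rho> \<zeta>"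
  proof (rule AE_I')
    show "A \<union> N0 \<in> null_sets circ" using A0 Am N0 by (intro null_sets.Un) auto
    show "{\<zeta> \<in> space circ. \<not> 0 < \<rho> \<zeta>} \<subseteq> A \<union> N0" unfolding A_def using \<rho>(2) by (auto simp: less_le)
  qed
  \<comment> \<open>the value \<open>1\<close> on a null set makes the function positive everywhere\<close>
  define \<rho>' where "\<rho>' = (\<lambda>\<zeta>. if 0 < \<rho> \<zeta> then 2 * pi * \<rho> \<zeta> else 1)"
  have \<rho>'m: "\<rho>' \<in> borel_measurable circ" unfolding \<rho>'_def using \<rho>(1) by measurable
  have \<rho>'b: "\<bar>\<rho>' \<zeta>\<bar> \<le> 2 * pi" for \<zeta>
    using \<rho>(2)[of \<zeta>] pi_gt3 mult_left_mono[of "\<rho> \<zeta>" 1 "2 * pi"] by (auto simp: \<rho>'_def)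
  have \<rho>'L: "\<rho>' \<in> L_infty_circle"
    unfolding L_infty_circle_def circle_measure_eq using measurable_completion[OF \<rho>'m] \<rho>'b by auto
  have "\<forall>k\<in>{1..N}. \<exists>F\<in>A_maps (ball 0 1). \<forall>z\<in>closure (annulus \<nu>). F z = poly Q z *s w k z"
    using Q unfolding problem_type_def by blast
  then obtain FF where FF: "\<And>k. k \<in> {1..N} \<Longrightarrow> FF k \<in> A_maps (ball 0 1)"
    "\<And>k z. k \<in> {1..N} \<Longrightarrow> z \<in> closure (annulus \<nu>) \<Longrightarrow> FF k z = poly Q z *s w k z" by metis
  define q where "q = (\<lambda>z. (\<chi> j. poly Q z) :: complex ^ 'n)"
  have qA: "q \<in> A_maps (ball 0 1)"
  proof -
    have hol: "(\<lambda>z. q z $ j) holomorphic_on UNIV" for j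
      unfolding q_def by (simp, intro holomorphic_intros)
    have "continuous_on (closure (ball 0 1)) q"
      by (rule continuous_on_subset[OF holomorphic_vec_continuous[OF hol]]) simp
    moreover have "(\<lambda>z. q z $ j) holomorphic_on ball 0 1" for j by (rule holomorphic_on_subset[OF hol]) simp
    ultimately show ?thesis by (simp add: A_maps_def hol_maps_def)
  qed
  define g' where "g' = (\<lambda>z. (\<Sum>k=1..N. lam k *\<^sub>R (s z * FF k z)) + (- 1) *\<^sub>R (q z * g z))"
  have g'H: "g' \<in> H_infty (ball 0 1)"
    unfolding g'_def
    by (intro H_infty_add_scaled H_infty_sum H_infty_mult A_maps_H_infty FF qA s g(1))
  have "AE \<zeta> in circ. has_nt_limit g' \<zeta> ((poly Q \<zeta> * complex_of_real (\<rho>' \<zeta>)) *s p \<zeta>)"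
    using g(3) ae \<rho>pos AE_space
  proof eventually_elim
    case (elim \<zeta>)
    then have z1: "cmod \<zeta> = 1" by simp
    have cl: "\<zeta> \<in> closure (annulus \<nu>)" using sphere_subset_closure_annulus[OF \<nu>] z1 by auto
    have "has_nt_limit g' \<zeta> ((\<Sum>k=1..N. lam k *\<^sub>R (nt_value s \<zeta> * FF k \<zeta>)) + (- 1) *\<^sub>R (q \<zeta> * X \<zeta>))"
      unfolding g'_def
      by (intro has_nt_limit_add has_nt_limit_scaleR has_nt_limit_sum has_nt_limit_mult has_nt_limit_nt_value[OF nt[OF elim(2)] z1]
            has_nt_limit_continuous[OF A_maps_ballD(1)] FF(1) qA z1 elim(1))
    moreover have "(\<Sum>k=1..N. lam k *\<^sub>R (nt_value s \<zeta> * FF k \<zeta>)) + (- 1) *\<^sub>R (q \<zeta> * X \<zeta>)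
        = (poly Q \<zeta> * complex_of_real (\<rho>' \<zeta>)) *s p \<zeta>"
    proof -
      let ?\<Sigma> = "\<Sum>k=1..N. lam k *\<^sub>R (w k \<zeta> * nt_value s \<zeta>)"
      have 1: "(\<Sum>k=1..N. lam k *\<^sub>R (nt_value s \<zeta> * FF k \<zeta>)) = q \<zeta> * ?\<Sigma>"
        unfolding sum_distrib_left
        by (rule sum.cong[OF refl]) (use FF(2)[OF _ cl] in \<open>simp add: vec_eq_iff q_def mult_ac\<close>)
      have 2: "X \<zeta> = ?\<Sigma> + (- (2 * pi * \<rho> \<zeta>)) *\<^sub>R p \<zeta>"
        using elim(2) by (simp add: X_def \<sigma>_def)
      have 3: "q \<zeta> * (r *\<^sub>R p \<zeta>) = (poly Q \<zeta> * complex_of_real r) *s p \<zeta>" for r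
        unfolding vec_eq_iff q_def by simp (simp add: scaleR_conv_of_real)
      have 4: "x * y + (- 1) *\<^sub>R (x * (y + (- r) *\<^sub>R z)) = x * (r *\<^sub>R z)" for x y z :: "complex ^ 'n" and r
        by (simp add: right_diff_distrib)
      have 5: "\<rho>' \<zeta> = 2 * pi * \<rho> \<zeta>" using elim(3) by (simp add: \<rho>'_def)
      show ?thesis unfolding 1 2 4 3 5 by (rule refl)
    qed
    ultimately show ?case by simp
  qed
  then show ?thesis using \<rho>'L g'H unfolding AE_circ_iff_completion
    by (intro bexI[of _ \<rho>'] conjI bexI[of _ g'] ballI) (auto simp: \<rho>'_def)
qed

section \<open>The extremality condition\<close>

lemma norm_axis_complex: "norm (axis j c :: complex ^ 'n) = cmod c"
proof -
  have "(cmod ((axis j c :: complex ^ 'n) $ i))\<^sup>2 = (if i = j then (cmod c)\<^sup>2 else 0)" for i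
    by (simp add: axis_def)
  then show ?thesis unfolding norm_vec_def L2_set_def by simp
qed

theorem corollary3:
  fixes N m :: nat and \<nu> \<epsilon> :: real
    and w :: "nat \<Rightarrow> complex \<Rightarrow> complex ^ 'n" and a :: "nat \<Rightarrow> real"
    and Q :: "complex poly"
    and D G :: "(complex ^ 'n) set" and u :: "complex ^ 'n \<Rightarrow> real"
    and f s :: "complex \<Rightarrow> complex ^ 'n" and S :: "complex set"
    and v :: "complex \<Rightarrow> (complex \<Rightarrow> complex ^ 'n) \<Rightarrow> complex"
  assumes "1 \<le> N" and "1 \<le> m" and "0 < \<nu>" and "\<nu> < 1"
    and "\<And>j. j \<in> {1..N} \<Longrightarrow> w j \<in> A_maps (annulus \<nu>)"
    and "lin_indep_functionals N w"
    and "problem_type m \<nu> N w Q"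
    and "domain_set D" and "domain_set G" and "rel_compact D G" and "rel_compact G UNIV"
    and "psh_on G u" and "continuous_on G u"
    and "D = {z \<in> G. u z < 0}" and "frontier D = {z \<in> G. u z = 0}"
    and "extremal D N w a f"
    and "S \<subseteq> sphere 0 1" and "s \<in> H_infty (ball 0 1)" and "0 < \<epsilon>"
    and a: "sphere 0 1 - S \<in> null_sets circle_measure"
    and b: "\<And>\<zeta>. \<zeta> \<in> S \<Longrightarrow>
          nt_defined f \<zeta> \<and> cgrad_defined u (nt_value f \<zeta>) \<and> nt_defined s \<zeta>"
    and c: "\<And>k z. z \<in> ball 0 1 \<Longrightarrow> s z $ k \<noteq> 0"
    and d: "\<And>\<zeta> h. \<zeta> \<in> S \<Longrightarrow> h \<in> A_maps (ball 0 1) \<Longrightarrow> sup_norm (ball 0 1) h \<le> \<epsilon> \<Longrightarrow>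
          nt_value f \<zeta> + nt_value s \<zeta> * h \<zeta> \<in> G \<and>
          complex_of_real (u (nt_value f \<zeta> + nt_value s \<zeta> * h \<zeta>)) =
            complex_of_real (u (nt_value f \<zeta>))
            + complex_of_real
                (2 * Re (scalar_product (cgrad u (nt_value f \<zeta>)) (nt_value s \<zeta> * h \<zeta>)))
            + v \<zeta> h"
    and e: "((\<lambda>h. (SUP \<zeta>\<in>S. ennreal (cmod (v \<zeta> h))) / ennreal (sup_norm (ball 0 1) h))
          \<longlongrightarrow> 0) (inf (filtercomap (sup_norm (ball 0 1)) (at_right 0)) (principal (A_maps (ball 0 1))))"
  shows "\<exists>\<rho> \<in> L_infty_circle. (\<forall>\<zeta> \<in> sphere 0 1. 0 < \<rho> \<zeta>) \<and>
           (\<exists>g \<in> H_infty (ball 0 1). AE \<zeta> in circle_measure.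
              has_nt_limit g \<zeta>
                ((poly Q \<zeta> * complex_of_real (\<rho> \<zeta>)) *s
                   (nt_value s \<zeta> * cgrad u (nt_value f \<zeta>))))"
proof -
  let ?A = "A_maps (ball 0 1) :: (complex \<Rightarrow> complex ^ 'n) set"
  define fs where "fs = nt_value f"
  define ss where "ss = nt_value s"
  have Go: "open G" using \<open>domain_set G\<close> by (simp add: domain_set_def)
  define K0 where "K0 = closure D"
  have K0: "compact K0" "K0 \<subseteq> G" using \<open>rel_compact D G\<close> by (auto simp: rel_compact_def K0_def)
  have fh: "(\<lambda>z. f z $ j) holomorphic_on ball 0 1" for j
    using \<open>extremal D N w a f\<close> by (simp add: extremal_def hol_maps_def)
  have fD: "f z \<in> D" if "cmod z < 1" for z
    using \<open>extremal D N w a f\<close> that by (auto simp: extremal_def hol_maps_def)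
  have fK0: "f z \<in> K0" if "cmod z < 1" for z using fD[OF that] closure_subset by (auto simp: K0_def)
  have fu: "u (f z) < 0" if "cmod z < 1" for z using fD[OF that] \<open>D = {z \<in> G. u z < 0}\<close> by auto
  have fc: "continuous_on (ball 0 1) f" by (rule holomorphic_vec_continuous[OF fh])
  obtain Bs where Bs: "0 \<le> Bs" "\<And>z. cmod z < 1 \<Longrightarrow> norm (s z) \<le> Bs"
    using H_infty_bound[OF \<open>s \<in> H_infty (ball 0 1)\<close>] by metis
  have wA: "w k \<in> A_maps (annulus \<nu>)" if "k \<in> {1..N}" for k using assms(5)[OF that] .
  have wc: "continuous_on (sphere 0 1) (w k)" if "k \<in> {1..N}" for k
    by (rule continuous_on_sphere_A_maps_annulus[OF wA[OF that] \<open>\<nu> < 1\<close>])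

  \<comment> \<open>a Borel subset of full measure of the given set\<close>
  have "\<exists>N'\<in>null_sets circ. sphere 0 1 - S \<subseteq> N'"
    using a unfolding circle_measure_eq null_sets_completion_iff2 .
  then obtain N' where N': "N' \<in> null_sets circ" "sphere 0 1 - S \<subseteq> N'" by blast
  define T where "T = space circ - N'"
  have T: "T \<in> sets circ" unfolding T_def by (rule sets.compl_sets) (rule null_setsD2[OF N'(1)])
  have TS: "T \<subseteq> S" using N'(2) by (auto simp: T_def)
  have aeT: "AE \<zeta> in circ. \<zeta> \<in> T"
    using AE_not_in[OF N'(1)] AE_space by eventually_elim (simp add: T_def)
  have S1: "cmod \<zeta> = 1" if "\<zeta> \<in> S" for \<zeta> using that \<open>S \<subseteq> sphere 0 1\<close> by auto
  have ntf: "has_nt_limit f \<zeta> (fs \<zeta>)" and nts: "has_nt_limit s \<zeta> (ss \<zeta>)" if "\<zeta> \<in> S" for \<zeta>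
    using b[OF that] S1[OF that] by (auto simp: fs_def ss_def intro: has_nt_limit_nt_value)
  have left1: "\<forall>\<^sub>F r::real in at_left 1. r \<in> {0<..<1}" by (rule eventually_at_leftI[of 0]) auto
  have fsK: "fs \<zeta> \<in> K0" if "\<zeta> \<in> S" for \<zeta>
  proof (rule Lim_in_closed_set[OF _ _ _ has_nt_limit_radial[OF ntf[OF that] S1[OF that]]])
    show "\<forall>\<^sub>F r in at_left 1. f (of_real r * \<zeta>) \<in> K0"
      using left1 by eventually_elim (rule fK0, use S1[OF that] in \<open>simp add: norm_mult\<close>)
  qed (simp_all add: K0_def)
  have fsu: "u (fs \<zeta>) \<le> 0" if "\<zeta> \<in> S" for \<zeta>
  proof (rule tendsto_upperbound)
    have "isCont u (fs \<zeta>)" using \<open>continuous_on G u\<close> Go fsK[OF that] K0 by (auto simp: continuous_on_eq_continuous_at)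
    then show "((\<lambda>r. u (f (of_real r * \<zeta>))) \<longlongrightarrow> u (fs \<zeta>)) (at_left 1)"
      by (rule isCont_tendsto_compose[OF _ has_nt_limit_radial[OF ntf[OF that] S1[OF that]]])
    show "\<forall>\<^sub>F r in at_left 1. u (f (of_real r * \<zeta>)) \<le> 0"
      using left1 by eventually_elim (rule less_imp_le, rule fu, use S1[OF that] in \<open>simp add: norm_mult\<close>)
  qed simp
  have ssB: "norm (ss \<zeta>) \<le> Bs" if "\<zeta> \<in> S" for \<zeta>
    unfolding ss_def by (rule norm_nt_value_le[OF _ S1[OF that] Bs(2)]) (use b[OF that] in auto)

  \<comment> \<open>maps of norm \<open>0\<close> vanish on the closed disc, so the expansion itself gives \<open>v \<zeta> h = 0\<close> for them\<close>
  have small: "\<exists>\<delta>>0. \<delta> \<le> \<epsilon> \<and> (\<forall>h\<in>?A. sup_norm (ball 0 1) h < \<delta> \<longrightarrow> (\<forall>\<zeta>\<in>S. cmod (v \<zeta> h) \<le> \<epsilon>' * sup_norm (ball 0 1) h))"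
    if \<epsilon>': "0 < \<epsilon>'" for \<epsilon>'
  proof -
    obtain \<delta> where \<delta>: "0 < \<delta>" "\<And>h \<zeta>. h \<in> ?A \<Longrightarrow> 0 < sup_norm (ball 0 1) h \<Longrightarrow> sup_norm (ball 0 1) h < \<delta> \<Longrightarrow> \<zeta> \<in> S
      \<Longrightarrow> cmod (v \<zeta> h) \<le> \<epsilon>' * sup_norm (ball 0 1) h"
      using remainder_uniformly_small[OF e \<epsilon>'] by metis
    have "cmod (v \<zeta> h) \<le> \<epsilon>' * sup_norm (ball 0 1) h" if h: "h \<in> ?A" "sup_norm (ball 0 1) h < min \<delta> \<epsilon>" "\<zeta> \<in> S" for h \<zeta>
    proof (cases "0 < sup_norm (ball 0 1) h")
      case True then show ?thesis using \<delta>(2)[OF h(1) True _ h(3)] h(2) by simp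
    next
      case False
      then have s0: "sup_norm (ball 0 1) h = 0" using sup_norm_nonneg[OF h(1)] by simp
      then have "h \<zeta> = 0" using norm_le_sup_norm[OF h(1), of \<zeta>] S1[OF h(3)] by simp
      then have "v \<zeta> h = 0" using d[OF h(3,1)] s0 \<open>0 < \<epsilon>\<close> by (simp add: scalar_product_def)
      then show ?thesis using s0 by simp
    qed
    then show ?thesis using \<delta>(1) \<open>0 < \<epsilon>\<close> by (intro exI[of _ "min \<delta> \<epsilon>"]) auto
  qed

  define p where "p = (\<lambda>\<zeta>. if \<zeta> \<in> T then ss \<zeta> * cgrad u (fs \<zeta>) else 0)"
  have expansion: "fs \<zeta> + ss \<zeta> * h \<zeta> \<in> G \<and>
      u (fs \<zeta> + ss \<zeta> * h \<zeta>) = u (fs \<zeta>) + 2 * Re (scalar_product (p \<zeta>) (h \<zeta>)) + Re (v \<zeta> h)"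
    if \<zeta>: "\<zeta> \<in> T" and h: "h \<in> ?A" "sup_norm (ball 0 1) h \<le> \<epsilon>" for \<zeta> h
  proof -
    have \<zeta>S: "\<zeta> \<in> S" using \<zeta> TS by blast
    note D = d[OF \<zeta>S h, folded fs_def ss_def]
    have "scalar_product (cgrad u (fs \<zeta>)) (ss \<zeta> * h \<zeta>) = scalar_product (p \<zeta>) (h \<zeta>)"
      using \<zeta> by (simp add: p_def scalar_product_def mult_ac)
    moreover from arg_cong[OF conjunct2[OF D], of Re]
    have "u (fs \<zeta> + ss \<zeta> * h \<zeta>) = u (fs \<zeta>) + 2 * Re (scalar_product (cgrad u (fs \<zeta>)) (ss \<zeta> * h \<zeta>)) + Re (v \<zeta> h)"
      by (simp only: plus_complex.simps Re_complex_of_real)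
    ultimately show ?thesis using conjunct1[OF D] by simp
  qed

  \<comment> \<open>the scaled gradient is bounded, because \<open>u\<close> is bounded near the closure of \<open>D\<close>\<close>
  have p_comp: "\<exists>B. \<forall>\<zeta>. cmod \<zeta> = 1 \<longrightarrow> cmod (p \<zeta> $ j) \<le> B" for j
  proof -
    obtain d0 where d0: "d0 > 0" "(\<Union>x\<in>K0. cball x d0) \<subseteq> G"
      using compact_subset_open_imp_cball_epsilon_subset[OF K0(1) Go K0(2)] by auto
    define K where "K = {x + y | x y. x \<in> K0 \<and> y \<in> cball 0 d0}"
    have K: "compact K" unfolding K_def by (rule compact_sums[OF K0(1) compact_cball])
    have KG: "K \<subseteq> G" using d0(2) by (auto simp: K_def subset_eq dist_norm)
    have KK: "y + \<xi> \<in> K" if "y \<in> K0" "norm \<xi> \<le> d0" for y \<xi> using that by (auto simp: K_def)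
    obtain Bu where Bu: "0 \<le> Bu" "\<And>y. y \<in> K \<Longrightarrow> norm (u y) \<le> Bu"
      using continuous_on_compact_bound[OF K continuous_on_subset[OF \<open>continuous_on G u\<close> KG]] by metis
    obtain \<delta> where \<delta>: "0 < \<delta>" "\<delta> \<le> \<epsilon>" "\<And>h \<zeta>. h \<in> ?A \<Longrightarrow> sup_norm (ball 0 1) h < \<delta> \<Longrightarrow> \<zeta> \<in> S \<Longrightarrow> cmod (v \<zeta> h) \<le> 1 * sup_norm (ball 0 1) h"
      using small[of 1] by auto
    \<comment> \<open>testing the expansion with the constant maps \<open>t\<close> and \<open>\<i> t\<close> in the \<open>j\<close>-th component bounds both parts of \<open>p $ j\<close>\<close>
    define t where "t = min (\<delta> / 2) (d0 / (Bs + 1))"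
    have t: "0 < t" "t < \<delta>" using \<delta> d0 Bs(1) by (auto simp: t_def)
    have tB: "Bs * t \<le> d0"
    proof -
      have "Bs * t \<le> (Bs + 1) * (d0 / (Bs + 1))" using Bs(1) t(1) by (intro mult_mono) (auto simp: t_def)
      then show ?thesis using Bs(1) by simp
    qed
    have key: "\<bar>Re (p \<zeta> $ j * (of_real t * c))\<bar> \<le> 2 * Bu + t" if \<zeta>: "\<zeta> \<in> T" and c: "cmod c = 1" for \<zeta> c
    proof -
      define h where "h = (\<lambda>_::complex. axis j (of_real t * c) :: complex ^ 'n)"
      have hA: "h \<in> ?A" by (auto simp: h_def A_maps_def hol_maps_def)
      have hn: "norm (h z) = t" for z
        using c t by (simp add: h_def norm_axis_complex norm_mult)
      have hs: "sup_norm (ball 0 1) h = t" unfolding sup_norm_def hn by simp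
      have \<zeta>S: "\<zeta> \<in> S" using \<zeta> TS by blast
      have E: "u (fs \<zeta> + ss \<zeta> * h \<zeta>) = u (fs \<zeta>) + 2 * Re (scalar_product (p \<zeta>) (h \<zeta>)) + Re (v \<zeta> h)"
        using expansion[OF \<zeta> hA] hs t \<delta> by simp
      have "norm (ss \<zeta> * h \<zeta>) \<le> norm (ss \<zeta>) * norm (h \<zeta>)" by (rule norm_vec_mult_le)
      also have "\<dots> \<le> Bs * t" using ssB[OF \<zeta>S] hn t Bs(1) by (intro mult_mono) auto
      finally have "norm (ss \<zeta> * h \<zeta>) \<le> d0" using tB by linarith
      then have 1: "\<bar>u (fs \<zeta> + ss \<zeta> * h \<zeta>)\<bar> \<le> Bu" using Bu(2)[OF KK[OF fsK[OF \<zeta>S]]] by simp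
      have 2: "\<bar>u (fs \<zeta>)\<bar> \<le> Bu" using Bu(2)[OF KK[OF fsK[OF \<zeta>S], of 0]] d0 by simp
      have 3: "\<bar>Re (v \<zeta> h)\<bar> \<le> t" using \<delta>(3)[OF hA _ \<zeta>S] hs t(2) abs_Re_le_cmod[of "v \<zeta> h"] by simp
      have "scalar_product (p \<zeta>) (h \<zeta>) = p \<zeta> $ j * (of_real t * c)"
        by (simp add: scalar_product_def h_def axis_def if_distrib cong: if_cong)
      then show ?thesis using E 1 2 3 t(1) by (smt (verit))
    qed
    have "cmod (p \<zeta> $ j) \<le> 2 * ((2 * Bu + t) / t)" if "cmod \<zeta> = 1" for \<zeta>
    proof (cases "\<zeta> \<in> T")
      case True
      have "\<bar>t * Re (p \<zeta> $ j)\<bar> \<le> 2 * Bu + t" using key[OF True, of 1] by (simp add: mult_ac)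
      then have 1: "\<bar>Re (p \<zeta> $ j)\<bar> \<le> (2 * Bu + t) / t" using t(1) by (simp add: abs_mult pos_le_divide_eq mult_ac)
      have "\<bar>t * Im (p \<zeta> $ j)\<bar> \<le> 2 * Bu + t" using key[OF True, of "\<i>"] by (simp add: mult_ac)
      then have 2: "\<bar>Im (p \<zeta> $ j)\<bar> \<le> (2 * Bu + t) / t" using t(1) by (simp add: abs_mult pos_le_divide_eq mult_ac)
      show ?thesis using cmod_le[of "p \<zeta> $ j"] 1 2 by linarith
    next
      case False
      then show ?thesis using Bu t by (simp add: p_def)
    qed
    then show ?thesis by blast
  qed
  have p_meas: "p \<in> borel_measurable circ"
  proof (rule borel_measurable_vecI)
    fix j :: 'n
    define X where "X = (\<lambda>\<zeta>. if \<zeta> \<in> T then nt_value f \<zeta> else f 0)"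
    have Xm: "X \<in> borel_measurable circ"
      unfolding X_def by (rule nt_value_measurable[OF fc T]) (use b TS in blast)
    have XG: "X \<zeta> \<in> G" if "\<zeta> \<in> T" for \<zeta> using fsK[of \<zeta>] that TS K0(2) by (auto simp: X_def fs_def)
    have ax: "axis i (complex_of_real t) = t *\<^sub>R axis i 1" "axis i (\<i> * complex_of_real t) = t *\<^sub>R axis i \<i>"
      for t :: real and i :: 'n
      by (auto simp: vec_eq_iff axis_def complex_eq_iff)
    have fd: "cgrad_defined u (X \<zeta>)" if "\<zeta> \<in> T" for \<zeta> using b[of \<zeta>] that TS by (auto simp: X_def)
    have D: "(\<lambda>\<zeta>. if \<zeta> \<in> T then deriv (\<lambda>t::real. u (X \<zeta> + t *\<^sub>R axis j c)) 0 else 0) \<in> borel_measurable circ"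
      if "c = 1 \<or> c = \<i>" for c
    proof (rule directional_deriv_measurable[OF \<open>continuous_on G u\<close> Go Xm T XG])
      fix \<zeta> assume "\<zeta> \<in> T"
      from fd[OF this] show "(\<lambda>t::real. u (X \<zeta> + t *\<^sub>R axis j c)) field_differentiable (at 0)"
        using that unfolding cgrad_defined_def by (auto simp: ax)
    qed
    have sm: "(\<lambda>\<zeta>. (if \<zeta> \<in> T then nt_value s \<zeta> else 0) $ j) \<in> borel_measurable circ"
      by (intro borel_measurable_vec_nth bdd_circ_measurable bdd_circ_nt_value \<open>s \<in> H_infty (ball 0 1)\<close> T)
         (use b TS in blast)
    have "(\<lambda>\<zeta>. p \<zeta> $ j) = (\<lambda>\<zeta>. (if \<zeta> \<in> T then nt_value s \<zeta> else 0) $ j *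
        ((of_real (if \<zeta> \<in> T then deriv (\<lambda>t::real. u (X \<zeta> + t *\<^sub>R axis j 1)) 0 else 0)
          - \<i> * of_real (if \<zeta> \<in> T then deriv (\<lambda>t::real. u (X \<zeta> + t *\<^sub>R axis j \<i>)) 0 else 0)) / 2))"
      by (auto simp: p_def cgrad_def fs_def ss_def X_def ax)
    also have "\<dots> \<in> borel_measurable circ"
      by (intro borel_measurable_times borel_measurable_divide borel_measurable_diff borel_measurable_const
            sm measurable_compose[OF D borel_measurable_of_real]) auto
    finally show "(\<lambda>\<zeta>. p \<zeta> $ j) \<in> borel_measurable circ" .
  qed
  have p_bdd: "bdd_circ p"
  proof -
    obtain Bp where Bp: "\<And>j \<zeta>. cmod \<zeta> = 1 \<Longrightarrow> cmod (p \<zeta> $ j) \<le> Bp j" using p_comp by metis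
    have "norm (p \<zeta>) \<le> (\<Sum>j\<in>UNIV. Bp j)" if "cmod \<zeta> = 1" for \<zeta>
      by (rule order_trans[OF norm_vec_le_sum sum_mono]) (rule Bp[OF that])
    then show ?thesis unfolding bdd_circ_def using p_meas by blast
  qed

  define L where "L = (\<lambda>h k. if k \<in> {1..N} then Phi (w k) (\<lambda>z. s z * h z) else 0)"
  define r where "r = (\<lambda>h \<zeta>. Re (scalar_product (p \<zeta>) (h \<zeta>)))"
  have ntT: "nt_defined s \<zeta>" if "\<zeta> \<in> T" for \<zeta> using b[of \<zeta>] that TS by blast
  have L_lin: "L (\<lambda>z. h z + c *\<^sub>R h' z) = (\<lambda>k. L h k + c * L h' k)" if h: "h \<in> ?A" "h' \<in> ?A" for h h' c
  proof
    fix k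
    show "L (\<lambda>z. h z + c *\<^sub>R h' z) k = L h k + c * L h' k"
    proof (cases "k \<in> {1..N}")
      case True
      let ?\<sigma> = "\<lambda>\<zeta>. if \<zeta> \<in> T then nt_value s \<zeta> else 0"
      have P: "Phi (w k) (\<lambda>z. s z * g z) = integral\<^sup>L circ (\<lambda>\<zeta>. Re (scalar_product (?\<sigma> \<zeta> * g \<zeta>) (w k \<zeta>))) / (2 * pi)"
        if "g \<in> ?A" for g
        by (rule Phi_mult_eq_circ[OF \<open>s \<in> H_infty (ball 0 1)\<close> T ntT aeT that wc[OF True]])
      have i: "integrable circ (\<lambda>\<zeta>. Re (scalar_product (?\<sigma> \<zeta> * g \<zeta>) (w k \<zeta>)))" if g: "g \<in> ?A" for g
      proof -
        have gc: "continuous_on (sphere 0 1) g" by (rule continuous_on_subset[OF A_maps_ballD(1)[OF g]]) auto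
        show ?thesis
          by (intro bdd_circ_integrable bdd_circ_Re bdd_circ_scalar_product bdd_circ_vec_mult
                bdd_circ_nt_value[OF \<open>s \<in> H_infty (ball 0 1)\<close> T ntT] bdd_circ_continuous gc wc True)
      qed
      have pw: "Re (scalar_product (x * (y + c *\<^sub>R z)) q) = Re (scalar_product (x * y) q) + c * Re (scalar_product (x * z) q)"
        for x y z q :: "complex ^ 'n"
        by (simp add: distrib_left scalar_product_add scalar_product_scaleR)
      have "Phi (w k) (\<lambda>z. s z * (h z + c *\<^sub>R h' z)) = Phi (w k) (\<lambda>z. s z * h z) + c * Phi (w k) (\<lambda>z. s z * h' z)"
        unfolding P[OF A_maps_add_scaled[OF h]] P[OF h(1)] P[OF h(2)] pw
        using i[OF h(1)] i[OF h(2)] by (simp add: add_divide_distrib)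
      then show ?thesis by (simp only: L_def True if_True)
    next
      case False
      then show ?thesis by (simp only: L_def if_False mult_zero_right add_0_right)
    qed
  qed
  have r_lin: "r (\<lambda>z. h z + c *\<^sub>R h' z) = (\<lambda>\<zeta>. r h \<zeta> + c * r h' \<zeta>)" for h h' c
    by (rule ext) (simp add: r_def scalar_product_def algebra_simps sum.distrib sum_subtractf sum_distrib_left)
  have r_bdd: "bdd_circ (r h)" if h: "h \<in> ?A" for h
    unfolding r_def by (intro bdd_circ_Re bdd_circ_scalar_product p_bdd continuous_on_subset[OF A_maps_ballD(1)[OF h]]) auto
  have zA: "(\<lambda>z. 0) \<in> ?A" by (auto simp: A_maps_def hol_maps_def)
  define J where "J = (\<lambda>e h. integral\<^sup>L circ (\<lambda>\<zeta>. huber (r h \<zeta>)) + (\<Sum>k=1..N. (L h k - e k)\<^sup>2) / 2)"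

  show ?thesis
  proof (cases "\<exists>e \<kappa>. 0 < \<kappa> \<and> (\<forall>h\<in>?A. \<kappa> \<le> J e h)")
    case True
    then obtain e' \<kappa> where \<kappa>: "0 < \<kappa>" "\<And>h. h \<in> ?A \<Longrightarrow> \<kappa> \<le> J e' h" by blast
    define V where "V = (\<lambda>h. (r h, L h)) ` ?A"
    obtain \<rho> lam where \<rho>: "\<rho> \<in> borel_measurable circ" "\<And>\<zeta>. 0 \<le> \<rho> \<zeta> \<and> \<rho> \<zeta> \<le> 1"
      "\<And>x y. (x, y) \<in> V \<Longrightarrow> integral\<^sup>L circ (\<lambda>\<zeta>. \<rho> \<zeta> * x \<zeta>) = (\<Sum>k=1..N. lam k * y k)"
      "0 < (\<Sum>k=1..N. lam k * e' k)"
    proof (rule bounded_multiplier_exists[OF circ.finite_measure_axioms, of V \<kappa> e' N])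
      show "V \<noteq> {}" using zA by (auto simp: V_def)
      show "(\<lambda>\<zeta>. x \<zeta> + c * x' \<zeta>, \<lambda>k. y k + c * y' k) \<in> V" if "(x, y) \<in> V" "(x', y') \<in> V" for x y x' y' c
      proof -
        from that obtain h h' where h: "h \<in> ?A" "h' \<in> ?A" "x = r h" "y = L h" "x' = r h'" "y' = L h'" by (auto simp: V_def)
        have "(\<lambda>z. h z + c *\<^sub>R h' z) \<in> ?A" by (rule A_maps_add_scaled[OF h(1,2)])
        then have "(r (\<lambda>z. h z + c *\<^sub>R h' z), L (\<lambda>z. h z + c *\<^sub>R h' z)) \<in> V" unfolding V_def by blast
        then show ?thesis unfolding r_lin L_lin[OF h(1,2)] h .
      qed
      show "x \<in> borel_measurable circ" if "(x, y) \<in> V" for x y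
        using that bdd_circ_measurable[OF r_bdd] by (auto simp: V_def)
      show "\<exists>B. \<forall>\<zeta>\<in>space circ. \<bar>x \<zeta>\<bar> \<le> B" if "(x, y) \<in> V" for x y
      proof -
        from that obtain h where "h \<in> ?A" "x = r h" by (auto simp: V_def)
        then obtain B where "\<And>\<zeta>. cmod \<zeta> = 1 \<Longrightarrow> norm (x \<zeta>) \<le> B" using bdd_circ_bound[OF r_bdd] by metis
        then show ?thesis by (intro exI[of _ B]) simp
      qed
      show "\<kappa> \<le> integral\<^sup>L circ (\<lambda>\<zeta>. huber (x \<zeta>)) + (\<Sum>k=1..N. (y k - e' k)\<^sup>2) / 2" if "(x, y) \<in> V" for x y
        using that \<kappa>(2) by (auto simp: V_def J_def)
    qed (use \<kappa>(1) that in auto)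
    have mult: "integral\<^sup>L circ (\<lambda>\<zeta>. \<rho> \<zeta> * Re (scalar_product (p \<zeta>) (h \<zeta>))) = (\<Sum>k=1..N. lam k * Phi (w k) (\<lambda>z. s z * h z))"
      if "h \<in> ?A" for h
    proof -
      have "(r h, L h) \<in> V" using that by (simp add: V_def)
      from \<rho>(3)[OF this] show ?thesis by (simp add: r_def L_def)
    qed
    have "\<exists>\<rho>' \<in> L_infty_circle. (\<forall>\<zeta> \<in> sphere 0 1. 0 < \<rho>' \<zeta>) \<and>
           (\<exists>g \<in> H_infty (ball 0 1). AE \<zeta> in circle_measure.
              has_nt_limit g \<zeta> ((poly Q \<zeta> * complex_of_real (\<rho>' \<zeta>)) *s p \<zeta>))"
      by (rule multiplier_gives_boundary_value[OF wA \<open>\<nu> < 1\<close> \<open>lin_indep_functionals N w\<close> \<open>problem_type m \<nu> N w Q\<close>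
            \<open>s \<in> H_infty (ball 0 1)\<close> c T ntT aeT p_bdd \<rho>(1,2) mult \<rho>(4)])
    then obtain \<rho>' g where g: "\<rho>' \<in> L_infty_circle" "\<forall>\<zeta> \<in> sphere 0 1. 0 < \<rho>' \<zeta>" "g \<in> H_infty (ball 0 1)"
      "AE \<zeta> in circle_measure. has_nt_limit g \<zeta> ((poly Q \<zeta> * complex_of_real (\<rho>' \<zeta>)) *s p \<zeta>)" by blast
    have "AE \<zeta> in circle_measure. \<zeta> \<in> T" using aeT unfolding AE_circ_iff_completion .
    with g(4) have "AE \<zeta> in circle_measure.
              has_nt_limit g \<zeta> ((poly Q \<zeta> * complex_of_real (\<rho>' \<zeta>)) *s (nt_value s \<zeta> * cgrad u (nt_value f \<zeta>)))"
      by eventually_elim (simp add: p_def fs_def ss_def)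
    then show ?thesis using g by blast
  next
    case False
    have approx: "\<exists>h\<in>?A. (\<forall>k\<in>{1..N}. \<bar>Phi (w k) (\<lambda>z. s z * h z) - e' k\<bar> < \<eta>) \<and>
        integral\<^sup>L circ (\<lambda>\<zeta>. max 0 (Re (scalar_product (p \<zeta>) (h \<zeta>)))) < \<eta>" if \<eta>: "0 < \<eta>" for e' \<eta>
    proof -
      \<comment> \<open>the target \<open>q e'\<close> is met up to an error less than \<open>2\<close>, and division by \<open>q\<close> makes the error small; the Huber function exceeds the positive part minus \<open>1 / 2\<close>\<close>
      define q where "q = 6 / \<eta>"
      have q: "0 < q" "6 / q = \<eta>" using \<eta> by (auto simp: q_def)
      have "\<not> (\<forall>h\<in>?A. 1 \<le> J (\<lambda>k. q * e' k) h)" using False by (metis zero_less_one)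
      then obtain h where h: "h \<in> ?A" "J (\<lambda>k. q * e' k) h < 1" by (auto simp: not_le)
      have hm: "(\<lambda>\<zeta>. huber (r h \<zeta>)) \<in> borel_measurable circ"
        using measurable_compose[OF bdd_circ_measurable[OF r_bdd[OF h(1)]] borel_measurable_huber] .
      obtain B where B: "B \<ge> 0" "\<And>\<zeta>. cmod \<zeta> = 1 \<Longrightarrow> norm (r h \<zeta>) \<le> B" using bdd_circ_bound[OF r_bdd[OF h(1)]] by metis
      have hi: "integrable circ (\<lambda>\<zeta>. huber (r h \<zeta>))"
      proof (rule integrable_circ_bounded[OF hm, where B = B])
        fix \<zeta> :: complex assume "cmod \<zeta> = 1"
        then show "norm (huber (r h \<zeta>)) \<le> B"
          using B(2)[of \<zeta>] huber_nonneg[of "r h \<zeta>"] huber_le_abs[of "r h \<zeta>"] by simp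
      qed
      have hub0: "0 \<le> integral\<^sup>L circ (\<lambda>\<zeta>. huber (r h \<zeta>))" by (rule integral_nonneg_AE) (simp add: huber_nonneg)
      have sum0: "0 \<le> (\<Sum>k=1..N. (L h k - q * e' k)\<^sup>2)" by (simp add: sum_nonneg)
      have h1: "integral\<^sup>L circ (\<lambda>\<zeta>. huber (r h \<zeta>)) < 1" and h2: "(\<Sum>k=1..N. (L h k - q * e' k)\<^sup>2) < 2"
        using h(2) hub0 sum0 unfolding J_def by linarith+
      define h' where "h' = (\<lambda>z. (1 / q) *\<^sub>R h z)"
      have h'A: "h' \<in> ?A" using A_maps_add_scaled[OF zA h(1), of "1 / q"] by (simp add: h'_def)
      have L0: "L (\<lambda>z. 0) = (\<lambda>k. 0)"
        using L_lin[OF zA zA, of "- 1"] by (simp add: fun_eq_iff)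
      have Lh': "L h' k = L h k / q" for k
        using L_lin[OF zA h(1), of "1 / q"] by (simp add: h'_def L0)
      have rh': "r h' \<zeta> = r h \<zeta> / q" for \<zeta>
        using fun_cong[OF r_lin[of "\<lambda>z. 0" "1 / q" h], of \<zeta>] by (simp add: h'_def r_def scalar_product_def)
      have "\<bar>Phi (w k) (\<lambda>z. s z * h' z) - e' k\<bar> < \<eta>" if k: "k \<in> {1..N}" for k
      proof -
        have "(L h k - q * e' k)\<^sup>2 \<le> (\<Sum>k=1..N. (L h k - q * e' k)\<^sup>2)" by (rule member_le_sum[OF k]) auto
        then have "(L h k - q * e' k)\<^sup>2 < 2\<^sup>2" using h2 by simp
        then have "\<bar>L h k - q * e' k\<bar> < 2" using power2_less_imp_less[of "\<bar>L h k - q * e' k\<bar>" 2] by simp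
        moreover have "L h' k - e' k = (L h k - q * e' k) / q" using q unfolding Lh' by (simp add: field_simps)
        ultimately have "\<bar>L h' k - e' k\<bar> < 2 / q" using q by (simp add: abs_divide divide_strict_right_mono)
        also have "\<dots> \<le> 6 / q" using q by (intro divide_right_mono) auto
        finally show ?thesis using k q by (simp add: L_def)
      qed
      moreover have "integral\<^sup>L circ (\<lambda>\<zeta>. max 0 (r h' \<zeta>)) < \<eta>"
      proof -
        have im: "integrable circ (\<lambda>\<zeta>. max 0 (r h' \<zeta>))"
          by (intro bdd_circ_integrable bdd_circ_compose[OF r_bdd[OF h'A], where K = 1 and L = 0])
             (auto intro!: continuous_intros)
        have "integral\<^sup>L circ (\<lambda>\<zeta>. max 0 (r h' \<zeta>)) \<le> integral\<^sup>L circ (\<lambda>\<zeta>. (huber (r h \<zeta>) + 1 / 2) / q)"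
        proof (rule integral_mono[OF im])
          show "integrable circ (\<lambda>\<zeta>. (huber (r h \<zeta>) + 1 / 2) / q)" using hi by simp
          fix \<zeta>
          have "max 0 (r h \<zeta>) \<le> huber (r h \<zeta>) + 1 / 2" using huber_ge[of "r h \<zeta>"] unfolding diff_le_eq .
          then have "max 0 (r h \<zeta>) / q \<le> (huber (r h \<zeta>) + 1 / 2) / q" using q by (intro divide_right_mono) auto
          moreover have "max 0 (r h' \<zeta>) = max 0 (r h \<zeta>) / q" using q unfolding rh' by (simp add: max_def divide_le_0_iff zero_le_divide_iff)
          ultimately show "max 0 (r h' \<zeta>) \<le> (huber (r h \<zeta>) + 1 / 2) / q" by simp
        qed
        also have "\<dots> = (integral\<^sup>L circ (\<lambda>\<zeta>. huber (r h \<zeta>)) + pi) / q"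
          using hi by (simp add: measure_circ)
        also have "\<dots> < 6 / q" using h1 pi_less_4 q by (intro divide_strict_right_mono) auto
        finally show ?thesis using q by simp
      qed
      ultimately show ?thesis using h'A unfolding r_def by blast
    qed
    have first: "\<exists>\<delta>>0. \<forall>h\<in>?A. sup_norm (ball 0 1) h < \<delta> \<longrightarrow>
        (AE \<zeta> in circ. nt_value f \<zeta> + nt_value s \<zeta> * h \<zeta> \<in> G \<and>
          u (nt_value f \<zeta> + nt_value s \<zeta> * h \<zeta>) \<le> 2 * Re (scalar_product (p \<zeta>) (h \<zeta>)) + \<epsilon>' * sup_norm (ball 0 1) h)"
      if "0 < \<epsilon>'" for \<epsilon>'
    proof -
      obtain \<delta> where \<delta>: "0 < \<delta>" "\<delta> \<le> \<epsilon>" "\<And>h \<zeta>. h \<in> ?A \<Longrightarrow> sup_norm (ball 0 1) h < \<delta> \<Longrightarrow> \<zeta> \<in> S \<Longrightarrow> cmod (v \<zeta> h) \<le> \<epsilon>' * sup_norm (ball 0 1) h"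
        using small[OF \<open>0 < \<epsilon>'\<close>] by blast
      have "AE \<zeta> in circ. nt_value f \<zeta> + nt_value s \<zeta> * h \<zeta> \<in> G \<and>
          u (nt_value f \<zeta> + nt_value s \<zeta> * h \<zeta>) \<le> 2 * Re (scalar_product (p \<zeta>) (h \<zeta>)) + \<epsilon>' * sup_norm (ball 0 1) h"
        if h: "h \<in> ?A" "sup_norm (ball 0 1) h < \<delta>" for h
        using aeT
      proof eventually_elim
        case (elim \<zeta>)
        then have \<zeta>S: "\<zeta> \<in> S" using TS by blast
        have E: "fs \<zeta> + ss \<zeta> * h \<zeta> \<in> G \<and>
            u (fs \<zeta> + ss \<zeta> * h \<zeta>) = u (fs \<zeta>) + 2 * Re (scalar_product (p \<zeta>) (h \<zeta>)) + Re (v \<zeta> h)"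
          by (rule expansion[OF elim h(1)]) (use h(2) \<delta>(2) in simp)
        have "Re (v \<zeta> h) \<le> \<epsilon>' * sup_norm (ball 0 1) h"
          using \<delta>(3)[OF h \<zeta>S] complex_Re_le_cmod[of "v \<zeta> h"] by linarith
        then show ?case using E fsu[OF \<zeta>S] unfolding fs_def ss_def by simp
      qed
      then show ?thesis using \<delta>(1) by blast
    qed
    have nt: "AE \<zeta> in circ. nt_defined f \<zeta> \<and> nt_defined s \<zeta>"
      using aeT by eventually_elim (use b TS in blast)
    obtain F K \<delta> where F: "compact K" "K \<subseteq> G" "0 < \<delta>" "F \<in> hol_maps (ball 0 1) UNIV"
      "\<And>z. cmod z < 1 \<Longrightarrow> F z \<in> K \<and> u (F z) \<le> - \<delta>" "\<forall>k\<in>{1..N}. Phi (w k) F = Phi (w k) f"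
      using improved_competitor[OF \<open>psh_on G u\<close> \<open>continuous_on G u\<close> Go K0 fh fK0 fu \<open>s \<in> H_infty (ball 0 1)\<close>
          \<open>1 \<le> N\<close> wA \<open>0 < \<nu>\<close> \<open>\<nu> < 1\<close> nt p_bdd first approx] by metis
    define C where "C = K \<inter> u -` {..- \<delta>}"
    have "closed C" unfolding C_def
      by (rule continuous_closed_preimage[OF continuous_on_subset[OF \<open>continuous_on G u\<close> F(2)] compact_imp_closed[OF F(1)]]) simp
    then have C: "compact C" using compact_Int_closed[OF F(1), of C] by (simp add: C_def Int_absorb1 Int_assoc[symmetric])
    have CD: "C \<subseteq> D" using F(2,3) \<open>D = {z \<in> G. u z < 0}\<close> by (auto simp: C_def)
    have FC: "F ` ball 0 1 \<subseteq> C" using F(5) by (auto simp: C_def)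
    have "F \<in> hol_maps (ball 0 1) D" using F(4) FC CD by (auto simp: hol_maps_def)
    moreover have "rel_compact (F ` ball 0 1) D"
    proof -
      have "closure (F ` ball 0 1) \<subseteq> C" by (rule closure_minimal[OF FC \<open>closed C\<close>])
      moreover have "bounded (F ` ball 0 1)" by (rule bounded_subset[OF compact_imp_bounded[OF C] FC])
      ultimately show ?thesis using CD by (auto simp: rel_compact_def)
    qed
    moreover have "\<forall>k\<in>{1..N}. Phi (w k) F = a k"
      using F(6) \<open>extremal D N w a f\<close> by (simp add: extremal_def)
    ultimately have False using \<open>extremal D N w a f\<close> unfolding extremal_def by blast
    then show ?thesis ..
  qed
qed

end
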